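(* Let $R$ be a commutative Noetherian ring with non-zero identity and $\mathfrak a$ an ideal of $R$. Let $M$ and $N$ be two non-zero finitely generated $R$-modules with $\dim M=d$ finite and $H^d_{\mathfrak a}(M)=0$. If $\mathrm{Supp}(M)=\mathrm{Supp}(N)$, then $\mathrm{Att}_R(H^{d-1}_{\mathfrak a}(N))=\mathrm{Att}_R(H^{d-1}_{\mathfrak a}(M))$.
   Context: $H^i_{\mathfrak a}(M)=\varinjlim_{n\ge 1}\mathrm{Ext}^i_R(R/\mathfrak a^n,M)$ is the $i$-th local cohomology module (zero for $i<0$). A prime $\mathfrak p$ of $R$ is attached to an $R$-module $A$ if $\mathfrak p=\mathrm{Ann}_R(A/B)$ for some submodule $B$ of $A$ (equivalently $\mathfrak p=\mathrm{Ann}_R(A/\mathfrak pA)$); $\mathrm{Att}_R A$ is the set of attached primes of $A$. *)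

theory Defs
  imports "HOL-Algebra.Module" "HOL-Algebra.Ideal_Product" "HOL-Algebra.Ring_Divisibility" "HOL-Library.Extended_Nat"
begin

text \<open>
  Modules are records of type \<open>('a, 'b) module\<close> as in HOL-Algebra. These records extend ring records;
  their fields \<open>mult\<close> and \<open>one\<close> play no role for modules and are left \<open>undefined\<close> below.
\<close>

section \<open>Modules\<close>

definition zero_module :: "'b \<Rightarrow> ('a, 'b) module" where
  "zero_module z = \<lparr>carrier = {z}, monoid.mult = undefined, one = undefined,
     zero = z, add = (\<lambda>_ _. z), smult = (\<lambda>_ _. z)\<rparr>"

definition is_zero_module :: "('a, 'b, 'm) module_scheme \<Rightarrow> bool" where
  "is_zero_module M \<longleftrightarrow> carrier M = {\<zero>\<^bsub>M\<^esub>}"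

definition regular_module :: "('a, 'r) ring_scheme \<Rightarrow> ('a, 'a) module" where
  "regular_module R = \<lparr>carrier = carrier R, monoid.mult = undefined, one = undefined,
     zero = \<zero>\<^bsub>R\<^esub>, add = (\<oplus>\<^bsub>R\<^esub>), smult = (\<otimes>\<^bsub>R\<^esub>)\<rparr>"

definition quot_module :: "('a, 'b, 'm) module_scheme \<Rightarrow> 'b set \<Rightarrow> ('a, 'b set) module" where
  "quot_module M B = \<lparr>carrier = a_rcosets\<^bsub>M\<^esub> B, monoid.mult = undefined, one = undefined,
     zero = B, add = set_add M, smult = (\<lambda>r X. \<Union>x\<in>X. B +>\<^bsub>M\<^esub> (r \<odot>\<^bsub>M\<^esub> x))\<rparr>"

definition annihilator :: "('a, 'r) ring_scheme \<Rightarrow> ('a, 'b, 'm) module_scheme \<Rightarrow> 'a set" where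
  "annihilator R M = {r \<in> carrier R. \<forall>x\<in>carrier M. r \<odot>\<^bsub>M\<^esub> x = \<zero>\<^bsub>M\<^esub>}"

definition fin_gen_module :: "('a, 'r) ring_scheme \<Rightarrow> ('a, 'b, 'm) module_scheme \<Rightarrow> bool" where
  "fin_gen_module R M \<longleftrightarrow>
     (\<exists>S. finite S \<and> S \<subseteq> carrier M \<and> \<Inter>{B. submodule B R M \<and> S \<subseteq> B} = carrier M)"

text \<open>For a free module of finite rank, vectors are functions extensional on \<open>{..<k}\<close>.\<close>

definition free_module :: "('a, 'r) ring_scheme \<Rightarrow> nat \<Rightarrow> ('a, nat \<Rightarrow> 'a) module" where
  "free_module R k = \<lparr>carrier = {..<k} \<rightarrow>\<^sub>E carrier R, monoid.mult = undefined, one = undefined,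
     zero = (\<lambda>i\<in>{..<k}. \<zero>\<^bsub>R\<^esub>),
     add = (\<lambda>v w. \<lambda>i\<in>{..<k}. v i \<oplus>\<^bsub>R\<^esub> w i),
     smult = (\<lambda>r v. \<lambda>i\<in>{..<k}. r \<otimes>\<^bsub>R\<^esub> v i)\<rparr>"

text \<open>Linear maps are taken extensional, so that equality of maps is equality on the carrier.\<close>

definition linear_maps ::
  "('a, 'r) ring_scheme \<Rightarrow> ('a, 'b, 'm) module_scheme \<Rightarrow> ('a, 'c, 'n) module_scheme \<Rightarrow> ('b \<Rightarrow> 'c) set" where
  "linear_maps R A M = {f \<in> carrier A \<rightarrow>\<^sub>E carrier M.
     (\<forall>x\<in>carrier A. \<forall>y\<in>carrier A. f (x \<oplus>\<^bsub>A\<^esub> y) = f x \<oplus>\<^bsub>M\<^esub> f y) \<and>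
     (\<forall>r\<in>carrier R. \<forall>x\<in>carrier A. f (r \<odot>\<^bsub>A\<^esub> x) = r \<odot>\<^bsub>M\<^esub> f x)}"

definition hom_module ::
  "('a, 'r) ring_scheme \<Rightarrow> ('a, 'b, 'm) module_scheme \<Rightarrow> ('a, 'c, 'n) module_scheme \<Rightarrow> ('a, 'b \<Rightarrow> 'c) module" where
  "hom_module R A M = \<lparr>carrier = linear_maps R A M, monoid.mult = undefined, one = undefined,
     zero = (\<lambda>x\<in>carrier A. \<zero>\<^bsub>M\<^esub>),
     add = (\<lambda>f g. \<lambda>x\<in>carrier A. f x \<oplus>\<^bsub>M\<^esub> g x),
     smult = (\<lambda>r f. \<lambda>x\<in>carrier A. r \<odot>\<^bsub>M\<^esub> f x)\<rparr>"


section \<open>Support, dimension, attached primes\<close>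

text \<open>
  The underlying set of the localization of \<open>M\<close> at \<open>p\<close>: fractions \<open>x/s\<close> with \<open>s \<notin> p\<close>, where
  \<open>x/s = y/t\<close> iff \<open>u(tx - sy) = 0\<close> for some \<open>u \<notin> p\<close>.
\<close>

definition localization_rel ::
  "('a, 'r) ring_scheme \<Rightarrow> ('a, 'b, 'm) module_scheme \<Rightarrow> 'a set \<Rightarrow> (('b \<times> 'a) \<times> ('b \<times> 'a)) set" where
  "localization_rel R M p = {((x, s), (y, t)).
     x \<in> carrier M \<and> y \<in> carrier M \<and> s \<in> carrier R - p \<and> t \<in> carrier R - p \<and>
     (\<exists>u\<in>carrier R - p. u \<odot>\<^bsub>M\<^esub> (t \<odot>\<^bsub>M\<^esub> x \<ominus>\<^bsub>M\<^esub> s \<odot>\<^bsub>M\<^esub> y) = \<zero>\<^bsub>M\<^esub>)}"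

definition localization_carrier ::
  "('a, 'r) ring_scheme \<Rightarrow> ('a, 'b, 'm) module_scheme \<Rightarrow> 'a set \<Rightarrow> ('b \<times> 'a) set set" where
  "localization_carrier R M p = (carrier M \<times> (carrier R - p)) // localization_rel R M p"

definition localization_zero ::
  "('a, 'r) ring_scheme \<Rightarrow> ('a, 'b, 'm) module_scheme \<Rightarrow> 'a set \<Rightarrow> ('b \<times> 'a) set" where
  "localization_zero R M p = localization_rel R M p `` {(\<zero>\<^bsub>M\<^esub>, \<one>\<^bsub>R\<^esub>)}"

definition module_supp :: "('a, 'r) ring_scheme \<Rightarrow> ('a, 'b, 'm) module_scheme \<Rightarrow> 'a set set" where
  "module_supp R M =
     {p. primeideal p R \<and> localization_carrier R M p \<noteq> {localization_zero R M p}}"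

text \<open>
  Krull dimension: the supremum of the lengths \<open>n\<close> of chains \<open>c 0 \<subset> \<dots> \<subset> c n\<close> of primes in the support.
  Only meaningful for non-zero modules: the zero module gets \<open>0\<close> here instead of \<open>-1\<close> or \<open>-\<infinity>\<close>.
\<close>

definition module_dim :: "('a, 'r) ring_scheme \<Rightarrow> ('a, 'b, 'm) module_scheme \<Rightarrow> enat" where
  "module_dim R M = Sup {enat n | n. \<exists>c :: nat \<Rightarrow> 'a set.
     (\<forall>i\<le>n. c i \<in> module_supp R M) \<and> (\<forall>i<n. c i \<subset> c (Suc i))}"

definition attached_primes :: "('a, 'r) ring_scheme \<Rightarrow> ('a, 'b, 'm) module_scheme \<Rightarrow> 'a set set" where
  "attached_primes R A =
     {p. primeideal p R \<and> (\<exists>B. submodule B R A \<and> p = annihilator R (quot_module A B))}"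


section \<open>Ext\<close>

text \<open>
  \<open>Ext(A, M)\<close> is computed from a resolution of the first argument by free modules of finite rank;
  these exist whenever \<open>R\<close> is Noetherian and \<open>A\<close> is finitely generated, and \<open>ext_module\<close> is only
  meaningful in this case. The resolution is
  \<open>\<dots> \<rightarrow> R^(res_rank P 1) \<rightarrow> R^(res_rank P 0) \<rightarrow> A \<rightarrow> 0\<close> with \<open>res_diff P i\<close> leaving degree \<open>i + 1\<close>.
\<close>

record ('a, 'b) free_resolution =
  res_rank :: "nat \<Rightarrow> nat"
  res_diff :: "nat \<Rightarrow> (nat \<Rightarrow> 'a) \<Rightarrow> (nat \<Rightarrow> 'a)"
  res_aug  :: "(nat \<Rightarrow> 'a) \<Rightarrow> 'b"

definition res_module ::
  "('a, 'r) ring_scheme \<Rightarrow> ('a, 'b) free_resolution \<Rightarrow> nat \<Rightarrow> ('a, nat \<Rightarrow> 'a) module" where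
  "res_module R P i = free_module R (res_rank P i)"

definition is_free_resolution ::
  "('a, 'r) ring_scheme \<Rightarrow> ('a, 'b, 'm) module_scheme \<Rightarrow> ('a, 'b) free_resolution \<Rightarrow> bool" where
  "is_free_resolution R A P \<longleftrightarrow>
     res_aug P \<in> linear_maps R (res_module R P 0) A \<and>
     (\<forall>i. res_diff P i \<in> linear_maps R (res_module R P (Suc i)) (res_module R P i)) \<and>
     res_aug P ` carrier (res_module R P 0) = carrier A \<and>
     a_kernel (res_module R P 0) A (res_aug P) = res_diff P 0 ` carrier (res_module R P (Suc 0)) \<and>
     (\<forall>i. a_kernel (res_module R P (Suc i)) (res_module R P i) (res_diff P i) =
        res_diff P (Suc i) ` carrier (res_module R P (Suc (Suc i))))"

definition resolution_of ::
  "('a, 'r) ring_scheme \<Rightarrow> ('a, 'b, 'm) module_scheme \<Rightarrow> ('a, 'b) free_resolution" where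
  "resolution_of R A = (SOME P. is_free_resolution R A P)"

definition cochain_module ::
  "('a, 'r) ring_scheme \<Rightarrow> ('a, 'b) free_resolution \<Rightarrow> ('a, 'c, 'n) module_scheme \<Rightarrow> nat
     \<Rightarrow> ('a, (nat \<Rightarrow> 'a) \<Rightarrow> 'c) module" where
  "cochain_module R P M i = hom_module R (res_module R P i) M"

definition cochain_diff ::
  "('a, 'r) ring_scheme \<Rightarrow> ('a, 'b) free_resolution \<Rightarrow> nat
     \<Rightarrow> ((nat \<Rightarrow> 'a) \<Rightarrow> 'c) \<Rightarrow> ((nat \<Rightarrow> 'a) \<Rightarrow> 'c)" where
  "cochain_diff R P i g = compose (carrier (res_module R P (Suc i))) g (res_diff P i)"

definition cocycles ::
  "('a, 'r) ring_scheme \<Rightarrow> ('a, 'b) free_resolution \<Rightarrow> ('a, 'c, 'n) module_scheme \<Rightarrow> nat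
     \<Rightarrow> ((nat \<Rightarrow> 'a) \<Rightarrow> 'c) set" where
  "cocycles R P M i =
     a_kernel (cochain_module R P M i) (cochain_module R P M (Suc i)) (cochain_diff R P i)"

definition coboundaries ::
  "('a, 'r) ring_scheme \<Rightarrow> ('a, 'b) free_resolution \<Rightarrow> ('a, 'c, 'n) module_scheme \<Rightarrow> nat
     \<Rightarrow> ((nat \<Rightarrow> 'a) \<Rightarrow> 'c) set" where
  "coboundaries R P M i = (case i of
       0 \<Rightarrow> {\<zero>\<^bsub>cochain_module R P M 0\<^esub>}
     | Suc j \<Rightarrow> cochain_diff R P j ` carrier (cochain_module R P M j))"

definition ext_module ::
  "('a, 'r) ring_scheme \<Rightarrow> nat \<Rightarrow> ('a, 'b, 'm) module_scheme \<Rightarrow> ('a, 'c, 'n) module_scheme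
     \<Rightarrow> ('a, ((nat \<Rightarrow> 'a) \<Rightarrow> 'c) set) module" where
  "ext_module R i A M = (let P = resolution_of R A in
     quot_module ((cochain_module R P M i)\<lparr>carrier := cocycles R P M i\<rparr>) (coboundaries R P M i))"

definition is_chain_lift ::
  "('a, 'r) ring_scheme \<Rightarrow> ('a, 'b) free_resolution \<Rightarrow> ('a, 'c) free_resolution \<Rightarrow> ('b \<Rightarrow> 'c)
     \<Rightarrow> (nat \<Rightarrow> (nat \<Rightarrow> 'a) \<Rightarrow> (nat \<Rightarrow> 'a)) \<Rightarrow> bool" where
  "is_chain_lift R P Q f \<phi> \<longleftrightarrow>
     (\<forall>i. \<phi> i \<in> linear_maps R (res_module R P i) (res_module R Q i)) \<and>
     (\<forall>x\<in>carrier (res_module R P 0). res_aug Q (\<phi> 0 x) = f (res_aug P x)) \<and>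
     (\<forall>i. \<forall>x\<in>carrier (res_module R P (Suc i)).
        res_diff Q i (\<phi> (Suc i) x) = \<phi> i (res_diff P i x))"

text \<open>
  The map \<open>Ext^i(A', M) \<rightarrow> Ext^i(A, M)\<close> induced by \<open>f : A \<rightarrow> A'\<close>: the class of a cocycle \<open>g\<close> goes to the
  class of \<open>g \<circ> \<phi> i\<close>, for a lift \<open>\<phi>\<close> of \<open>f\<close> to the chosen resolutions. It does not depend on the lift.
\<close>

definition ext_map ::
  "('a, 'r) ring_scheme \<Rightarrow> nat \<Rightarrow> ('a, 'b, 'm) module_scheme \<Rightarrow> ('a, 'd, 'k) module_scheme
     \<Rightarrow> ('b \<Rightarrow> 'd) \<Rightarrow> ('a, 'c, 'n) module_scheme
     \<Rightarrow> ((nat \<Rightarrow> 'a) \<Rightarrow> 'c) set \<Rightarrow> ((nat \<Rightarrow> 'a) \<Rightarrow> 'c) set" where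
  "ext_map R i A A' f M X = (let P = resolution_of R A; Q = resolution_of R A';
       \<phi> = (SOME \<phi>. is_chain_lift R P Q f \<phi>) in
     \<Union>g\<in>X. coboundaries R P M i +>\<^bsub>cochain_module R P M i\<^esub>
       compose (carrier (res_module R P i)) g (\<phi> i))"


section \<open>Direct limits of sequences of modules\<close>

text \<open>The system is \<open>E 0 \<rightarrow> E 1 \<rightarrow> \<dots>\<close> with transition maps \<open>t n : E n \<rightarrow> E (n + 1)\<close>.\<close>

primrec transition :: "(nat \<Rightarrow> 'x \<Rightarrow> 'x) \<Rightarrow> nat \<Rightarrow> nat \<Rightarrow> 'x \<Rightarrow> 'x" where
  "transition t n 0 x = x"
| "transition t n (Suc k) x = t (n + k) (transition t n k x)"

definition dirlim_rel ::
  "(nat \<Rightarrow> ('a, 'x, 'm) module_scheme) \<Rightarrow> (nat \<Rightarrow> 'x \<Rightarrow> 'x) \<Rightarrow> ((nat \<times> 'x) \<times> (nat \<times> 'x)) set" where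
  "dirlim_rel E t = {((m, x), (n, y)). x \<in> carrier (E m) \<and> y \<in> carrier (E n) \<and>
     (\<exists>k l. m + k = n + l \<and> transition t m k x = transition t n l y)}"

text \<open>Any two classes have representatives with a common index \<open>n\<close>, so the sum below is defined.\<close>

definition dirlim ::
  "(nat \<Rightarrow> ('a, 'x, 'm) module_scheme) \<Rightarrow> (nat \<Rightarrow> 'x \<Rightarrow> 'x) \<Rightarrow> ('a, (nat \<times> 'x) set) module" where
  "dirlim E t = \<lparr>carrier = (SIGMA n:UNIV. carrier (E n)) // dirlim_rel E t,
     monoid.mult = undefined, one = undefined,
     zero = dirlim_rel E t `` {(0, \<zero>\<^bsub>E 0\<^esub>)},
     add = (\<lambda>X Y. \<Union>{dirlim_rel E t `` {(n, x \<oplus>\<^bsub>E n\<^esub> y)} | n x y. (n, x) \<in> X \<and> (n, y) \<in> Y}),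
     smult = (\<lambda>r X. \<Union>{dirlim_rel E t `` {(n, r \<odot>\<^bsub>E n\<^esub> x)} | n x. (n, x) \<in> X})\<rparr>"


section \<open>Local cohomology\<close>

definition power_quot :: "('a, 'r) ring_scheme \<Rightarrow> 'a set \<Rightarrow> nat \<Rightarrow> ('a, 'a set) module" where
  "power_quot R \<aa> n = quot_module (regular_module R) (\<aa> [^]\<^bsub>ideals_set R\<^esub> n)"

text \<open>The canonical projection from \<open>R/\<aa>^(n+1)\<close> to \<open>R/\<aa>^n\<close>.\<close>

definition power_quot_proj :: "('a, 'r) ring_scheme \<Rightarrow> 'a set \<Rightarrow> nat \<Rightarrow> 'a set \<Rightarrow> 'a set" where
  "power_quot_proj R \<aa> n X = (\<Union>x\<in>X. (\<aa> [^]\<^bsub>ideals_set R\<^esub> n) +>\<^bsub>R\<^esub> x)"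

text \<open>
  The direct limit of \<open>Ext^i(R/\<aa>^n, M)\<close> over \<open>n \<ge> 1\<close>; the term of the system with index \<open>n\<close> is the one
  for the exponent \<open>n + 1\<close>.
\<close>

definition local_cohomology ::
  "('a, 'r) ring_scheme \<Rightarrow> 'a set \<Rightarrow> int \<Rightarrow> ('a, 'b, 'm) module_scheme
     \<Rightarrow> ('a, (nat \<times> ((nat \<Rightarrow> 'a) \<Rightarrow> 'b) set) set) module" where
  "local_cohomology R \<aa> i M =
     (if i < 0 then zero_module {}
      else dirlim
        (\<lambda>n. ext_module R (nat i) (power_quot R \<aa> (Suc n)) M)
        (\<lambda>n. ext_map R (nat i) (power_quot R \<aa> (Suc (Suc n))) (power_quot R \<aa> (Suc n))
               (power_quot_proj R \<aa> (Suc n)) M))"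

end

theory Submission
  imports Defs
begin

text \<open>
  Consider finitely generated modules \<open>L\<close> with \<open>Supp L \<subseteq> Supp M\<close>, where \<open>dim M = d\<close>, and write \<open>H^i\<close> for
  local cohomology with respect to \<open>\<aa>\<close>. By Grothendieck's vanishing theorem \<open>H^(d+1)\<close> is zero on these
  modules, so \<open>H^d\<close> is right exact on them. If \<open>H^d(M) = 0\<close>, then \<open>H^d\<close> is zero on all of them: for a prime
  \<open>p\<close> of the support there is a non-zero map \<open>M \<rightarrow> R/p\<close>, whose image \<open>b/p\<close> is a quotient of \<open>M\<close>, so that every
  \<open>c \<in> b\<close> kills \<open>H^d(R/p)\<close>; but for \<open>c \<notin> p\<close> it also acts surjectively there, because \<open>H^d(R/(p + Rc)) = 0\<close> by
  Noetherian induction. Hence \<open>T = H^(d-1)\<close> is right exact on these modules.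

  Let \<open>p\<close> be attached to \<open>T(N)\<close>. Then \<open>p \<supseteq> Ann N\<close>, so \<open>p \<in> Supp N = Supp M\<close> and there is a map \<open>M \<rightarrow> R/p\<close> as before,
  with kernel \<open>W\<close> say. The module \<open>T(M/W)\<close> is a quotient of \<open>T(M)\<close> and is killed by \<open>p\<close>. If \<open>r\<close> kills it,
  then \<open>rc\<close> kills \<open>T(R/p)\<close> for some \<open>c \<notin> p\<close>, and by right exactness \<open>rc\<close> kills \<open>T(N)/p T(N) = T(N/pN)\<close>, a quotient of
  a sum of copies of \<open>T(R/p)\<close>; so \<open>rc \<in> p\<close> and \<open>r \<in> p\<close>. Thus \<open>p\<close> is the annihilator of \<open>T(M/W)\<close> and is attached to
  \<open>T(M)\<close>. The roles of \<open>M\<close> and \<open>N\<close> can be exchanged. The results behind these steps are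
  \<open>H_quot_vanishes_above_dimension\<close>, \<open>H_quot_vanishes_from_module\<close>, \<open>nonzero_map_to_prime_quotient\<close> and
  \<open>attached_to_H_transfer\<close>.

  Grothendieck vanishing is proved by Noetherian induction for cyclic modules \<open>R/J\<close>, over a ring that need
  not be local. The case of a prime \<open>J\<close> that does not contain \<open>\<aa>\<close> follows from
  the action of an element of \<open>\<aa>\<close>. If \<open>J \<supseteq> \<aa>\<close>, then \<open>R/J\<close> is an \<open>\<aa>\<close>-torsion module, and
  \<open>torsion_H_vanishes\<close> says that such modules have no cohomology in positive degrees.

  Classes are handled through cocycles with values in a module, defined on the free modules that
  resolve \<open>R/\<aa>^n\<close>. All modules are presented as \<open>A/B\<close> with \<open>B \<subseteq> A\<close> submodules of an ambient
  module; as maps from free modules lift, cochains with values in \<open>A/B\<close> are represented by cochains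
  with values in \<open>A\<close>, and the long exact sequence becomes a statement about three submodules
  \<open>C \<subseteq> B \<subseteq> A\<close>. That a class vanishes in the direct limit means that its cocycle
  becomes a coboundary further up in the tower of resolutions.
\<close>

section \<open>Congruences, linear maps and linear relations\<close>

context module
begin

lemma minus_eq_zero_iff:
  assumes "x \<in> carrier M" "y \<in> carrier M"
  shows "x \<ominus>\<^bsub>M\<^esub> y = \<zero>\<^bsub>M\<^esub> \<longleftrightarrow> x = y"
  using assms by (metis M.minus_eq M.r_neg M.minus_equality M.minus_minus M.a_inv_closed)

lemma add_minus_cancel:
  assumes "x \<in> carrier M" "y \<in> carrier M"
  shows "y \<oplus>\<^bsub>M\<^esub> (x \<ominus>\<^bsub>M\<^esub> y) = x"
  using assms by (simp add: M.minus_eq M.add.m_lcomm M.r_neg)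

lemma smult_minus:
  assumes "r \<in> carrier R" "x \<in> carrier M" "y \<in> carrier M"
  shows "r \<odot>\<^bsub>M\<^esub> (x \<ominus>\<^bsub>M\<^esub> y) = r \<odot>\<^bsub>M\<^esub> x \<ominus>\<^bsub>M\<^esub> r \<odot>\<^bsub>M\<^esub> y"
  using assms by (simp add: M.minus_eq smult_r_distr smult_r_minus)

lemma add_diff_add:
  assumes "x \<in> carrier M" "y \<in> carrier M" "x' \<in> carrier M" "y' \<in> carrier M"
  shows "(x \<oplus>\<^bsub>M\<^esub> x') \<ominus>\<^bsub>M\<^esub> (y \<oplus>\<^bsub>M\<^esub> y') = (x \<ominus>\<^bsub>M\<^esub> y) \<oplus>\<^bsub>M\<^esub> (x' \<ominus>\<^bsub>M\<^esub> y')"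
  using assms by (simp add: M.minus_eq M.minus_add M.a_assoc M.a_comm M.a_lcomm)

lemma diff_diff_diff:
  assumes "x \<in> carrier M" "y \<in> carrier M" "x' \<in> carrier M" "y' \<in> carrier M"
  shows "(x \<ominus>\<^bsub>M\<^esub> x') \<ominus>\<^bsub>M\<^esub> (y \<ominus>\<^bsub>M\<^esub> y') = (x \<ominus>\<^bsub>M\<^esub> y) \<ominus>\<^bsub>M\<^esub> (x' \<ominus>\<^bsub>M\<^esub> y')"
  using assms by (simp add: M.minus_eq M.minus_add M.a_assoc M.a_comm M.a_lcomm)

lemma diff_add_eq_diff_diff:
  assumes "x \<in> carrier M" "y \<in> carrier M" "z \<in> carrier M"
  shows "x \<ominus>\<^bsub>M\<^esub> (y \<oplus>\<^bsub>M\<^esub> z) = (x \<ominus>\<^bsub>M\<^esub> y) \<ominus>\<^bsub>M\<^esub> z"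
  using assms by (simp add: M.minus_eq M.minus_add M.a_assoc M.a_comm M.a_lcomm)

lemma diff_telescope:
  assumes "x \<in> carrier M" "y \<in> carrier M" "z \<in> carrier M"
  shows "x \<ominus>\<^bsub>M\<^esub> z = (x \<ominus>\<^bsub>M\<^esub> y) \<oplus>\<^bsub>M\<^esub> (y \<ominus>\<^bsub>M\<^esub> z)"
  using assms by (simp add: M.minus_eq M.a_assoc M.r_neg1)

lemma neg_diff:
  assumes "x \<in> carrier M" "y \<in> carrier M"
  shows "\<ominus>\<^bsub>M\<^esub> (x \<ominus>\<^bsub>M\<^esub> y) = y \<ominus>\<^bsub>M\<^esub> x"
  using assms by (simp add: M.minus_eq M.minus_add M.a_comm)

lemma diff_zero [simp]: "x \<in> carrier M \<Longrightarrow> x \<ominus>\<^bsub>M\<^esub> \<zero>\<^bsub>M\<^esub> = x"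
  using add_minus_cancel[of x "\<zero>\<^bsub>M\<^esub>"] by simp

lemma diff_self [simp]: "x \<in> carrier M \<Longrightarrow> x \<ominus>\<^bsub>M\<^esub> x = \<zero>\<^bsub>M\<^esub>"
  by (simp add: minus_eq_zero_iff)

lemma add_diff_cancel:
  assumes "x \<in> carrier M" "y \<in> carrier M"
  shows "(x \<oplus>\<^bsub>M\<^esub> y) \<ominus>\<^bsub>M\<^esub> y = x"
  using assms by (simp add: M.minus_eq M.a_assoc M.r_neg)

lemma diff_diff_self:
  assumes "x \<in> carrier M" "y \<in> carrier M"
  shows "x \<ominus>\<^bsub>M\<^esub> (x \<ominus>\<^bsub>M\<^esub> y) = y"
  using assms by (metis add_diff_cancel add_minus_cancel M.minus_closed M.a_comm)

lemma add_diff_diff_cancel: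
  assumes "x \<in> carrier M" "y \<in> carrier M" "z \<in> carrier M"
  shows "(x \<oplus>\<^bsub>M\<^esub> y \<ominus>\<^bsub>M\<^esub> z) \<ominus>\<^bsub>M\<^esub> y = x \<ominus>\<^bsub>M\<^esub> z"
proof -
  have "x \<oplus>\<^bsub>M\<^esub> y \<ominus>\<^bsub>M\<^esub> z = (x \<ominus>\<^bsub>M\<^esub> z) \<oplus>\<^bsub>M\<^esub> y"
    using assms by (simp add: M.minus_eq M.a_ac)
  then show ?thesis
    using assms by (simp add: add_diff_cancel)
qed

lemma smult_comm:
  assumes "r \<in> carrier R" "s \<in> carrier R" "x \<in> carrier M"
  shows "r \<odot>\<^bsub>M\<^esub> (s \<odot>\<^bsub>M\<^esub> x) = s \<odot>\<^bsub>M\<^esub> (r \<odot>\<^bsub>M\<^esub> x)"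
  using assms by (metis smult_assoc1 R.m_comm)

lemma neg_eq_smult: "x \<in> carrier M \<Longrightarrow> \<ominus>\<^bsub>M\<^esub> x = (\<ominus>\<^bsub>R\<^esub> \<one>\<^bsub>R\<^esub>) \<odot>\<^bsub>M\<^esub> x"
  by (simp add: smult_l_minus)

lemma submodI:
  assumes "H \<subseteq> carrier M" "\<zero>\<^bsub>M\<^esub> \<in> H"
    and add: "\<And>a b. a \<in> H \<Longrightarrow> b \<in> H \<Longrightarrow> a \<oplus>\<^bsub>M\<^esub> b \<in> H"
    and smult: "\<And>a x. a \<in> carrier R \<Longrightarrow> x \<in> H \<Longrightarrow> a \<odot>\<^bsub>M\<^esub> x \<in> H"
  shows "submodule H R M"
proof (rule submoduleI)
  show "\<ominus>\<^bsub>M\<^esub> a \<in> H" if "a \<in> H" for a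
    using that assms(1) smult[of "\<ominus>\<^bsub>R\<^esub> \<one>\<^bsub>R\<^esub>" a] neg_eq_smult[of a] by auto
qed (use assms in auto)

lemma zero_submodule: "submodule {\<zero>\<^bsub>M\<^esub>} R M"
  by (rule submodI) auto

end

locale submod = module R M for R (structure) and M (structure) +
  fixes B
  assumes submodule_B: "submodule B R M"
begin

lemma sub_carr [simp]: "x \<in> B \<Longrightarrow> x \<in> carrier M"
  using submoduleE(1)[OF submodule_B] by blast

lemma sub_subset: "B \<subseteq> carrier M"
  using submoduleE(1)[OF submodule_B] .

lemma sub_zero [simp]: "\<zero>\<^bsub>M\<^esub> \<in> B"
  using submodule_B by (simp add: submodule_def subgroup_def)

lemma sub_add: "x \<in> B \<Longrightarrow> y \<in> B \<Longrightarrow> x \<oplus>\<^bsub>M\<^esub> y \<in> B"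
  using submoduleE(5)[OF submodule_B] by blast

lemma sub_neg: "x \<in> B \<Longrightarrow> \<ominus>\<^bsub>M\<^esub> x \<in> B"
  using submoduleE(3)[OF submodule_B] by blast

lemma sub_smult: "r \<in> carrier R \<Longrightarrow> x \<in> B \<Longrightarrow> r \<odot>\<^bsub>M\<^esub> x \<in> B"
  using submoduleE(4)[OF submodule_B] by blast

lemma sub_minus: "x \<in> B \<Longrightarrow> y \<in> B \<Longrightarrow> x \<ominus>\<^bsub>M\<^esub> y \<in> B"
  by (simp add: M.minus_eq sub_add sub_neg)

lemma cong_trans:
  "\<lbrakk>x \<ominus>\<^bsub>M\<^esub> y \<in> B; y \<ominus>\<^bsub>M\<^esub> z \<in> B; x \<in> carrier M; y \<in> carrier M; z \<in> carrier M\<rbrakk> \<Longrightarrow> x \<ominus>\<^bsub>M\<^esub> z \<in> B"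
  using diff_telescope[of x y z] sub_add by simp

lemma cong_sym:
  "\<lbrakk>x \<ominus>\<^bsub>M\<^esub> y \<in> B; x \<in> carrier M; y \<in> carrier M\<rbrakk> \<Longrightarrow> y \<ominus>\<^bsub>M\<^esub> x \<in> B"
  using neg_diff[of x y] sub_neg[of "x \<ominus>\<^bsub>M\<^esub> y"] by simp

lemma cong_refl [simp]: "x \<in> carrier M \<Longrightarrow> x \<ominus>\<^bsub>M\<^esub> x \<in> B"
  by (simp add: minus_eq_zero_iff[THEN iffD2])

lemma cong_add:
  "\<lbrakk>x \<ominus>\<^bsub>M\<^esub> y \<in> B; x' \<ominus>\<^bsub>M\<^esub> y' \<in> B; x \<in> carrier M; y \<in> carrier M; x' \<in> carrier M; y' \<in> carrier M\<rbrakk>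
    \<Longrightarrow> (x \<oplus>\<^bsub>M\<^esub> x') \<ominus>\<^bsub>M\<^esub> (y \<oplus>\<^bsub>M\<^esub> y') \<in> B"
  using add_diff_add[of x y x' y'] sub_add[of "x \<ominus>\<^bsub>M\<^esub> y" "x' \<ominus>\<^bsub>M\<^esub> y'"] by simp

lemma cong_diff:
  "\<lbrakk>x \<ominus>\<^bsub>M\<^esub> y \<in> B; x' \<ominus>\<^bsub>M\<^esub> y' \<in> B; x \<in> carrier M; y \<in> carrier M; x' \<in> carrier M; y' \<in> carrier M\<rbrakk>
    \<Longrightarrow> (x \<ominus>\<^bsub>M\<^esub> x') \<ominus>\<^bsub>M\<^esub> (y \<ominus>\<^bsub>M\<^esub> y') \<in> B"
  using diff_diff_diff[of x y x' y'] sub_minus[of "x \<ominus>\<^bsub>M\<^esub> y" "x' \<ominus>\<^bsub>M\<^esub> y'"] by simp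

lemma cong_smult:
  "\<lbrakk>x \<ominus>\<^bsub>M\<^esub> y \<in> B; r \<in> carrier R; x \<in> carrier M; y \<in> carrier M\<rbrakk>
    \<Longrightarrow> r \<odot>\<^bsub>M\<^esub> x \<ominus>\<^bsub>M\<^esub> r \<odot>\<^bsub>M\<^esub> y \<in> B"
  using smult_minus[of r x y] sub_smult[of r "x \<ominus>\<^bsub>M\<^esub> y"] by simp

lemma cong_mem:
  "\<lbrakk>x \<ominus>\<^bsub>M\<^esub> y \<in> B; y \<in> B; x \<in> carrier M\<rbrakk> \<Longrightarrow> x \<in> B"
  using add_minus_cancel[of x y] sub_add[of y "x \<ominus>\<^bsub>M\<^esub> y"] by simp

end

lemma submodI_locale: "module R M \<Longrightarrow> submodule B R M \<Longrightarrow> submod R M B"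
  by (simp add: submod_def submod_axioms_def)

text \<open>
  Linear maps without the extensionality that \<^const>\<open>linear_maps\<close> asks for, so that they can be
  composed and added pointwise.
\<close>

definition lin ::
  "('a, 'r) ring_scheme \<Rightarrow> ('a, 'b, 'm) module_scheme \<Rightarrow> ('a, 'c, 'n) module_scheme \<Rightarrow> ('b \<Rightarrow> 'c) \<Rightarrow> bool" where
  "lin R A M f \<longleftrightarrow> (\<forall>x\<in>carrier A. f x \<in> carrier M) \<and>
     (\<forall>x\<in>carrier A. \<forall>y\<in>carrier A. f (x \<oplus>\<^bsub>A\<^esub> y) = f x \<oplus>\<^bsub>M\<^esub> f y) \<and>
     (\<forall>r\<in>carrier R. \<forall>x\<in>carrier A. f (r \<odot>\<^bsub>A\<^esub> x) = r \<odot>\<^bsub>M\<^esub> f x)"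

lemma lin_closed: "lin R A M f \<Longrightarrow> x \<in> carrier A \<Longrightarrow> f x \<in> carrier M"
  and lin_add: "lin R A M f \<Longrightarrow> x \<in> carrier A \<Longrightarrow> y \<in> carrier A \<Longrightarrow> f (x \<oplus>\<^bsub>A\<^esub> y) = f x \<oplus>\<^bsub>M\<^esub> f y"
  and lin_smult: "lin R A M f \<Longrightarrow> r \<in> carrier R \<Longrightarrow> x \<in> carrier A \<Longrightarrow> f (r \<odot>\<^bsub>A\<^esub> x) = r \<odot>\<^bsub>M\<^esub> f x"
  by (auto simp: lin_def)

lemma lin_cong: "lin R A M f \<Longrightarrow> module R A \<Longrightarrow> (\<And>x. x \<in> carrier A \<Longrightarrow> g x = f x) \<Longrightarrow> lin R A M g"
  unfolding lin_def using abelian_group.axioms(1) abelian_monoid.a_closed module.axioms(2) module.smult_closed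
  by (metis (no_types, opaque_lifting))

lemma lin_zero:
  assumes "lin R A M f" "module R A" "module R M"
  shows "f \<zero>\<^bsub>A\<^esub> = \<zero>\<^bsub>M\<^esub>"
proof -
  interpret A: module R A by fact
  interpret M: module R M by fact
  have "f (\<zero>\<^bsub>R\<^esub> \<odot>\<^bsub>A\<^esub> \<zero>\<^bsub>A\<^esub>) = \<zero>\<^bsub>R\<^esub> \<odot>\<^bsub>M\<^esub> f \<zero>\<^bsub>A\<^esub>"
    using assms(1) by (intro lin_smult) auto
  then show ?thesis
    using lin_closed[OF assms(1), of "\<zero>\<^bsub>A\<^esub>"] by simp
qed

lemma lin_neg:
  assumes "lin R A M f" "module R A" "module R M" "x \<in> carrier A"
  shows "f (\<ominus>\<^bsub>A\<^esub> x) = \<ominus>\<^bsub>M\<^esub> f x"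
proof -
  interpret A: module R A by fact
  interpret M: module R M by fact
  show ?thesis
    using assms lin_smult[OF assms(1), of "\<ominus>\<^bsub>R\<^esub> \<one>\<^bsub>R\<^esub>" x] lin_closed[OF assms(1)]
    by (simp add: A.neg_eq_smult M.neg_eq_smult)
qed

lemma lin_diff:
  assumes "lin R A M f" "module R A" "module R M" "x \<in> carrier A" "y \<in> carrier A"
  shows "f (x \<ominus>\<^bsub>A\<^esub> y) = f x \<ominus>\<^bsub>M\<^esub> f y"
proof -
  interpret A: module R A by fact
  interpret M: module R M by fact
  show ?thesis
    using assms by (simp add: A.M.minus_eq M.M.minus_eq lin_add[OF assms(1)] lin_neg[OF assms(1)])
qed

lemma lin_comp: "lin R A M f \<Longrightarrow> lin R M N g \<Longrightarrow> lin R A N (\<lambda>x. g (f x))"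
  by (auto simp: lin_def)

lemma lin_pointwise_add:
  assumes "lin R A M f" "lin R A M g" "module R A" "module R M"
  shows "lin R A M (\<lambda>x. f x \<oplus>\<^bsub>M\<^esub> g x)"
proof -
  interpret M: module R M by fact
  show ?thesis
    using assms(1,2) unfolding lin_def
    by (auto simp: M.smult_r_distr M.M.a_assoc M.M.a_lcomm)
qed

lemma lin_pointwise_smult:
  assumes "lin R A M f" "module R A" "module R M" "r \<in> carrier R"
  shows "lin R A M (\<lambda>x. r \<odot>\<^bsub>M\<^esub> f x)"
proof -
  interpret M: module R M by fact
  show ?thesis
    using assms(1,4) unfolding lin_def
    by (auto simp: M.smult_r_distr M.smult_comm)
qed

lemma lin_pointwise_diff:
  assumes "lin R A M f" "lin R A M g" "module R A" "module R M"
  shows "lin R A M (\<lambda>x. f x \<ominus>\<^bsub>M\<^esub> g x)"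
proof -
  interpret M: module R M by fact
  have "lin R A M (\<lambda>x. f x \<oplus>\<^bsub>M\<^esub> (\<ominus>\<^bsub>R\<^esub> \<one>\<^bsub>R\<^esub>) \<odot>\<^bsub>M\<^esub> g x)"
    using assms by (intro lin_pointwise_add lin_pointwise_smult) auto
  then show ?thesis
    by (rule lin_cong) (use assms in \<open>auto simp: M.M.minus_eq M.neg_eq_smult lin_closed\<close>)
qed

lemma lin_const_zero: "module R M \<Longrightarrow> lin R A M (\<lambda>_. \<zero>\<^bsub>M\<^esub>)"
  unfolding lin_def
  by (metis abelian_group.axioms(1) abelian_monoid.l_zero abelian_monoid.zero_closed
      module.axioms(2) module.smult_r_null)

lemma lin_id: "lin R A A (\<lambda>x. x)"
  by (simp add: lin_def)

lemma lin_smult_self: "module R M \<Longrightarrow> r \<in> carrier R \<Longrightarrow> lin R M M (\<lambda>x. r \<odot>\<^bsub>M\<^esub> x)"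
  by (rule lin_pointwise_smult[OF lin_id])

lemma preimage_submodule:
  assumes "module R A" "module R M" "lin R A M f" "submodule B R M"
  shows "submodule {x \<in> carrier A. f x \<in> B} R A"
proof -
  interpret A: module R A by fact
  interpret B: submod R M B using assms by (simp add: submodI_locale)
  show ?thesis
    using assms(3) by (intro A.submodI)
      (auto simp: lin_zero[OF assms(3,1,2)] lin_add lin_smult B.sub_add B.sub_smult)
qed

text \<open>
  Choosing preimages along a linear map, modulo a submodule, or along a partially defined
  multivalued map are all instances of one fact about linear relations.
\<close>

definition linrel ::
  "('a, 'r) ring_scheme \<Rightarrow> ('a, 'b, 'm) module_scheme \<Rightarrow> ('a, 'c, 'n) module_scheme \<Rightarrow> ('b \<times> 'c) set \<Rightarrow> bool" where
  "linrel R X Y W \<longleftrightarrow> W \<subseteq> carrier X \<times> carrier Y \<and> (\<zero>\<^bsub>X\<^esub>, \<zero>\<^bsub>Y\<^esub>) \<in> W \<and>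
     (\<forall>x y x' y'. (x, y) \<in> W \<longrightarrow> (x', y') \<in> W \<longrightarrow> (x \<oplus>\<^bsub>X\<^esub> x', y \<oplus>\<^bsub>Y\<^esub> y') \<in> W) \<and>
     (\<forall>r\<in>carrier R. \<forall>x y. (x, y) \<in> W \<longrightarrow> (r \<odot>\<^bsub>X\<^esub> x, r \<odot>\<^bsub>Y\<^esub> y) \<in> W)"

lemma linrel_zero: "linrel R X Y W \<Longrightarrow> (\<zero>\<^bsub>X\<^esub>, \<zero>\<^bsub>Y\<^esub>) \<in> W"
  and linrel_carr: "linrel R X Y W \<Longrightarrow> (x, y) \<in> W \<Longrightarrow> x \<in> carrier X \<and> y \<in> carrier Y"
  and linrel_add: "linrel R X Y W \<Longrightarrow> (x, y) \<in> W \<Longrightarrow> (x', y') \<in> W \<Longrightarrow> (x \<oplus>\<^bsub>X\<^esub> x', y \<oplus>\<^bsub>Y\<^esub> y') \<in> W"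
  and linrel_smult: "linrel R X Y W \<Longrightarrow> r \<in> carrier R \<Longrightarrow> (x, y) \<in> W \<Longrightarrow> (r \<odot>\<^bsub>X\<^esub> x, r \<odot>\<^bsub>Y\<^esub> y) \<in> W"
  by (auto simp: linrel_def)

lemma linrel_diff:
  assumes "linrel R X Y W" "module R X" "module R Y" "(x, y) \<in> W" "(x', y') \<in> W"
  shows "(x \<ominus>\<^bsub>X\<^esub> x', y \<ominus>\<^bsub>Y\<^esub> y') \<in> W"
proof -
  interpret X: module R X by fact
  interpret Y: module R Y by fact
  have "(x', y') \<in> W \<Longrightarrow> (\<ominus>\<^bsub>X\<^esub> x', \<ominus>\<^bsub>Y\<^esub> y') \<in> W"
    using linrel_smult[OF assms(1), of "\<ominus>\<^bsub>R\<^esub> \<one>\<^bsub>R\<^esub>" x' y'] linrel_carr[OF assms(1), of x' y']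
    by (simp add: X.neg_eq_smult Y.neg_eq_smult)
  then show ?thesis
    unfolding X.M.minus_eq Y.M.minus_eq using assms by (intro linrel_add[OF assms(1)]) auto
qed


lemma linrel_Union:
  assumes "C \<noteq> {}" and chain: "\<And>V W. V \<in> C \<Longrightarrow> W \<in> C \<Longrightarrow> V \<subseteq> W \<or> W \<subseteq> V"
    and lr: "\<And>W. W \<in> C \<Longrightarrow> linrel R X Y W"
  shows "linrel R X Y (\<Union>C)"
  unfolding linrel_def
proof (intro conjI allI impI ballI)
  show "\<Union>C \<subseteq> carrier X \<times> carrier Y"
    using lr unfolding linrel_def by blast
  show "(\<zero>\<^bsub>X\<^esub>, \<zero>\<^bsub>Y\<^esub>) \<in> \<Union>C"
    using assms(1) lr linrel_zero by blast
  show "(x \<oplus>\<^bsub>X\<^esub> x', y \<oplus>\<^bsub>Y\<^esub> y') \<in> \<Union>C" if xy: "(x, y) \<in> \<Union>C" "(x', y') \<in> \<Union>C" for x y x' y'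
  proof -
    obtain V W where VW: "V \<in> C" "W \<in> C" "(x, y) \<in> V" "(x', y') \<in> W" using xy by blast
    then have "(x, y) \<in> W \<or> (x', y') \<in> V" using chain by blast
    then show ?thesis using VW linrel_add[OF lr] by blast
  qed
  show "(r \<odot>\<^bsub>X\<^esub> x, r \<odot>\<^bsub>Y\<^esub> y) \<in> \<Union>C" if "r \<in> carrier R" "(x, y) \<in> \<Union>C" for r x y
    using that linrel_smult[OF lr] by blast
qed


section \<open>Free modules of finite rank\<close>

lemma free_carrier: "carrier (free_module R k) = {..<k} \<rightarrow>\<^sub>E carrier R"
  and free_zero: "\<zero>\<^bsub>free_module R k\<^esub> = (\<lambda>i\<in>{..<k}. \<zero>\<^bsub>R\<^esub>)"
  and free_add: "v \<oplus>\<^bsub>free_module R k\<^esub> w = (\<lambda>i\<in>{..<k}. v i \<oplus>\<^bsub>R\<^esub> w i)"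
  and free_smult: "r \<odot>\<^bsub>free_module R k\<^esub> v = (\<lambda>i\<in>{..<k}. r \<otimes>\<^bsub>R\<^esub> v i)"
  by (simp_all add: free_module_def)

lemma free_module_module:
  assumes "cring R"
  shows "module R (free_module R k)"
proof -
  interpret cring R by fact
  show ?thesis
  proof (rule moduleI)
    show "abelian_group (free_module R k)"
    proof (rule abelian_groupI)
      fix x assume x: "x \<in> carrier (free_module R k)"
      have "(\<lambda>i\<in>{..<k}. \<ominus>\<^bsub>R\<^esub> x i) \<oplus>\<^bsub>free_module R k\<^esub> x = \<zero>\<^bsub>free_module R k\<^esub>"
        using x by (auto simp: free_carrier free_zero free_add PiE_iff l_neg intro!: restrict_ext)
      moreover have "(\<lambda>i\<in>{..<k}. \<ominus>\<^bsub>R\<^esub> x i) \<in> carrier (free_module R k)"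
        using x by (auto simp: free_carrier PiE_iff)
      ultimately show "\<exists>y\<in>carrier (free_module R k). y \<oplus>\<^bsub>free_module R k\<^esub> x = \<zero>\<^bsub>free_module R k\<^esub>"
        by blast
    next
      show "\<zero>\<^bsub>free_module R k\<^esub> \<oplus>\<^bsub>free_module R k\<^esub> x = x" if "x \<in> carrier (free_module R k)" for x
        using that by (auto simp: free_carrier free_zero free_add PiE_iff extensional_def fun_eq_iff)
    qed (auto simp: free_carrier free_zero free_add PiE_iff a_ac intro!: restrict_ext)
    show "\<one>\<^bsub>R\<^esub> \<odot>\<^bsub>free_module R k\<^esub> x = x" if "x \<in> carrier (free_module R k)" for x
      using that by (auto simp: free_carrier free_smult PiE_iff extensional_def fun_eq_iff)
  qed (auto simp: assms free_carrier free_zero free_add free_smult PiE_iff l_distr r_distr m_assoc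
      intro!: restrict_ext)
qed

definition unit_vec :: "('a, 'r) ring_scheme \<Rightarrow> nat \<Rightarrow> nat \<Rightarrow> nat \<Rightarrow> 'a" where
  "unit_vec R k j = (\<lambda>i\<in>{..<k}. if i = j then \<one>\<^bsub>R\<^esub> else \<zero>\<^bsub>R\<^esub>)"

text \<open>The first \<open>m\<close> coordinates of a vector; sums over basis vectors are handled by induction on \<open>m\<close>.\<close>

definition trunc_vec :: "('a, 'r) ring_scheme \<Rightarrow> nat \<Rightarrow> nat \<Rightarrow> (nat \<Rightarrow> 'a) \<Rightarrow> nat \<Rightarrow> 'a" where
  "trunc_vec R k m v = (\<lambda>i\<in>{..<k}. if i < m then v i else \<zero>\<^bsub>R\<^esub>)"

lemma unit_vec_carrier: "cring R \<Longrightarrow> unit_vec R k j \<in> carrier (free_module R k)"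
  using ring.ring_simprules(2,6)[OF cring.axioms(1)] by (fastforce simp: unit_vec_def free_carrier)

lemma trunc_vec_carrier:
  "cring R \<Longrightarrow> v \<in> carrier (free_module R k) \<Longrightarrow> trunc_vec R k m v \<in> carrier (free_module R k)"
  using ring.ring_simprules(2,6)[OF cring.axioms(1)] by (fastforce simp: trunc_vec_def free_carrier)

lemma trunc_vec_0: "trunc_vec R k 0 v = \<zero>\<^bsub>free_module R k\<^esub>"
  by (simp add: trunc_vec_def free_zero)

lemma trunc_vec_self: "v \<in> carrier (free_module R k) \<Longrightarrow> trunc_vec R k k v = v"
  by (auto simp: trunc_vec_def free_carrier PiE_iff extensional_def fun_eq_iff)

lemma trunc_vec_Suc:
  assumes "cring R" "v \<in> carrier (free_module R k)" "m < k"
  shows "trunc_vec R k (Suc m) v =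
    trunc_vec R k m v \<oplus>\<^bsub>free_module R k\<^esub> v m \<odot>\<^bsub>free_module R k\<^esub> unit_vec R k m"
proof -
  interpret cring R by fact
  show ?thesis
    using assms(2,3)
    by (auto simp: trunc_vec_def unit_vec_def free_add free_smult free_carrier PiE_iff less_Suc_eq
        intro!: restrict_ext)
qed

text \<open>
  Images of the basis vectors may be prescribed, and a linear relation that contains the prescribed
  pairs contains all pairs of values.
\<close>

lemma free_lift:
  assumes X: "module R X" and Y: "module R Y" and W: "linrel R X Y W"
    and g: "lin R (free_module R k) Y g"
    and ex: "\<And>v. v \<in> carrier (free_module R k) \<Longrightarrow> \<exists>x. (x, g v) \<in> W"
  shows "\<exists>f. lin R (free_module R k) X f \<and> (\<forall>v\<in>carrier (free_module R k). (f v, g v) \<in> W)"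
proof -
  interpret X: module R X by fact
  interpret Y: module R Y by fact
  have cr: "cring R" by (rule X.R.is_cring)
  let ?F = "free_module R k"
  interpret F: module R ?F by (rule free_module_module[OF cr])
  have "\<exists>x. \<forall>j. (x j, g (unit_vec R k j)) \<in> W"
    using ex[OF unit_vec_carrier[OF cr]] by metis
  then obtain x where xW: "\<And>j. (x j, g (unit_vec R k j)) \<in> W"
    by blast
  have xc: "x j \<in> carrier X" for j
    using xW[of j] linrel_carr[OF W] by blast
  define f where "f = (\<lambda>v. \<Oplus>\<^bsub>X\<^esub>i\<in>{..<k}. v i \<odot>\<^bsub>X\<^esub> x i)"
  have vc: "v i \<in> carrier R" if "v \<in> carrier ?F" "i < k" for v i
    using that by (auto simp: free_carrier)
  have lin: "lin R ?F X f"
    unfolding lin_def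
  proof (intro conjI ballI)
    show "f v \<in> carrier X" if "v \<in> carrier ?F" for v
      unfolding f_def using that vc xc by (intro X.M.finsum_closed) auto
    show "f (v \<oplus>\<^bsub>?F\<^esub> w) = f v \<oplus>\<^bsub>X\<^esub> f w" if "v \<in> carrier ?F" "w \<in> carrier ?F" for v w
    proof -
      have "f (v \<oplus>\<^bsub>?F\<^esub> w) = (\<Oplus>\<^bsub>X\<^esub>i\<in>{..<k}. v i \<odot>\<^bsub>X\<^esub> x i \<oplus>\<^bsub>X\<^esub> w i \<odot>\<^bsub>X\<^esub> x i)"
        unfolding f_def using that vc xc
        by (intro X.M.finsum_cong') (auto simp: free_add X.smult_l_distr)
      also have "\<dots> = f v \<oplus>\<^bsub>X\<^esub> f w"
        unfolding f_def using that vc xc by (intro X.M.finsum_addf) auto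
      finally show ?thesis .
    qed
    show "f (r \<odot>\<^bsub>?F\<^esub> v) = r \<odot>\<^bsub>X\<^esub> f v" if "r \<in> carrier R" "v \<in> carrier ?F" for r v
    proof -
      have "f (r \<odot>\<^bsub>?F\<^esub> v) = (\<Oplus>\<^bsub>X\<^esub>i\<in>{..<k}. r \<odot>\<^bsub>X\<^esub> (v i \<odot>\<^bsub>X\<^esub> x i))"
        unfolding f_def using that vc xc
        by (intro X.M.finsum_cong') (auto simp: free_smult X.smult_assoc1)
      also have "\<dots> = r \<odot>\<^bsub>X\<^esub> f v"
        unfolding f_def using that vc xc by (intro X.finsum_smult_ldistr[symmetric]) auto
      finally show ?thesis .
    qed
  qed
  have part: "m \<le> k \<Longrightarrow> ((\<Oplus>\<^bsub>X\<^esub>i\<in>{..<m}. v i \<odot>\<^bsub>X\<^esub> x i), g (trunc_vec R k m v)) \<in> W"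
    if v: "v \<in> carrier ?F" for v m
  proof (induction m)
    case 0
    then show ?case
      using lin_zero[OF g F.module_axioms Y] linrel_zero[OF W] by (simp add: trunc_vec_0)
  next
    case (Suc m)
    have "(\<Oplus>\<^bsub>X\<^esub>i\<in>{..<Suc m}. v i \<odot>\<^bsub>X\<^esub> x i) = (\<Oplus>\<^bsub>X\<^esub>i\<in>{..<m}. v i \<odot>\<^bsub>X\<^esub> x i) \<oplus>\<^bsub>X\<^esub> v m \<odot>\<^bsub>X\<^esub> x m"
      unfolding lessThan_Suc using Suc.prems v vc xc
      by (subst X.M.finsum_insert) (auto intro!: X.M.a_comm X.M.finsum_closed)
    moreover have "g (trunc_vec R k (Suc m) v) = g (trunc_vec R k m v) \<oplus>\<^bsub>Y\<^esub> v m \<odot>\<^bsub>Y\<^esub> g (unit_vec R k m)"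
      using Suc.prems v vc unit_vec_carrier[OF cr] trunc_vec_carrier[OF cr]
      by (simp add: trunc_vec_Suc[OF cr v] lin_add[OF g] lin_smult[OF g])
    ultimately show ?case
      using Suc v vc[OF v, of m] xW[of m] by (auto intro!: linrel_add[OF W] linrel_smult[OF W])
  qed
  have "(f v, g v) \<in> W" if "v \<in> carrier ?F" for v
    using part[OF that, of k] by (simp add: f_def trunc_vec_self[OF that])
  then show ?thesis
    using lin by blast
qed

lemma free_lift_mod:
  assumes X: "module R X" and Y: "module R Y" and f: "lin R X Y f"
    and A: "submodule A R X" and B: "submodule B R Y"
    and g: "lin R (free_module R k) Y g"
    and ex: "\<And>v. v \<in> carrier (free_module R k) \<Longrightarrow> \<exists>x\<in>A. f x \<ominus>\<^bsub>Y\<^esub> g v \<in> B"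
  shows "\<exists>h. lin R (free_module R k) X h \<and>
    (\<forall>v\<in>carrier (free_module R k). h v \<in> A \<and> f (h v) \<ominus>\<^bsub>Y\<^esub> g v \<in> B)"
proof -
  interpret A: submod R X A using X A by (rule submodI_locale)
  interpret B: submod R Y B using Y B by (rule submodI_locale)
  let ?W = "{(x, y). x \<in> A \<and> y \<in> carrier Y \<and> f x \<ominus>\<^bsub>Y\<^esub> y \<in> B}"
  have fc: "f x \<in> carrier Y" if "x \<in> A" for x
    using lin_closed[OF f] that by simp
  have W: "linrel R X Y ?W"
    unfolding linrel_def
    using fc by (auto simp: lin_zero[OF f X Y] lin_add[OF f] lin_smult[OF f] A.sub_add A.sub_smult
        intro!: B.cong_add B.cong_smult)
  have "\<exists>h. lin R (free_module R k) X h \<and> (\<forall>v\<in>carrier (free_module R k). (h v, g v) \<in> ?W)"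
    using ex lin_closed[OF g] by (intro free_lift[OF X Y W g]) auto
  then show ?thesis
    by auto
qed

lemma free_lift_onto:
  assumes X: "module R X" and Y: "module R Y" and f: "lin R X Y f"
    and g: "lin R (free_module R k) Y g"
    and ex: "\<And>v. v \<in> carrier (free_module R k) \<Longrightarrow> \<exists>x\<in>carrier X. f x = g v"
  shows "\<exists>h. lin R (free_module R k) X h \<and> (\<forall>v\<in>carrier (free_module R k). f (h v) = g v)"
proof -
  interpret X: module R X by fact
  interpret Y: module R Y by fact
  have "\<exists>x\<in>carrier X. f x \<ominus>\<^bsub>Y\<^esub> g v \<in> {\<zero>\<^bsub>Y\<^esub>}" if "v \<in> carrier (free_module R k)" for v
    using ex[OF that] lin_closed[OF f] lin_closed[OF g that] by (auto simp: Y.minus_eq_zero_iff)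
  from free_lift_mod[OF X Y f X.carrier_is_submodule Y.zero_submodule g this]
  obtain h where h: "lin R (free_module R k) X h"
    "\<forall>v\<in>carrier (free_module R k). h v \<in> carrier X \<and> f (h v) \<ominus>\<^bsub>Y\<^esub> g v \<in> {\<zero>\<^bsub>Y\<^esub>}"
    by blast
  have "f (h v) = g v" if "v \<in> carrier (free_module R k)" for v
    using h(2) that lin_closed[OF f, of "h v"] lin_closed[OF g that]
      Y.minus_eq_zero_iff[of "f (h v)" "g v"] by simp
  then show ?thesis
    using h(1) by blast
qed

section \<open>Finitely generated modules over a Noetherian ring\<close>

definition lin_span :: "('a, 'r) ring_scheme \<Rightarrow> ('a, 'b, 'm) module_scheme \<Rightarrow> 'b set \<Rightarrow> 'b set" where
  "lin_span R X S = \<Inter>{H. submodule H R X \<and> S \<subseteq> H}"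

definition adjoin :: "('a, 'r) ring_scheme \<Rightarrow> ('a, 'b, 'm) module_scheme \<Rightarrow> 'b set \<Rightarrow> 'b \<Rightarrow> 'b set" where
  "adjoin R X D x = {y \<oplus>\<^bsub>X\<^esub> r \<odot>\<^bsub>X\<^esub> x | y r. y \<in> D \<and> r \<in> carrier R}"

definition fg_over ::
  "('a, 'r) ring_scheme \<Rightarrow> ('a, 'b, 'm) module_scheme \<Rightarrow> 'b set \<Rightarrow> 'b set \<Rightarrow> bool" where
  "fg_over R X B A \<longleftrightarrow> (\<exists>S. finite S \<and> S \<subseteq> carrier X \<and> A = lin_span R X (B \<union> S))"

context module
begin

lemma span_submodule:
  assumes "S \<subseteq> carrier M"
  shows "submodule (lin_span R M S) R M"
proof (rule submodI)
  show "lin_span R M S \<subseteq> carrier M"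
    unfolding lin_span_def using assms carrier_is_submodule by blast
  have z: "\<zero>\<^bsub>M\<^esub> \<in> H" if "submodule H R M" for H
    using submod.sub_zero[OF submodI_locale[OF module_axioms that]] .
  show "\<zero>\<^bsub>M\<^esub> \<in> lin_span R M S"
    unfolding lin_span_def using z by blast
  show "x \<oplus>\<^bsub>M\<^esub> y \<in> lin_span R M S" if "x \<in> lin_span R M S" "y \<in> lin_span R M S" for x y
    using that unfolding lin_span_def using submoduleE(5) by blast
  show "a \<odot>\<^bsub>M\<^esub> x \<in> lin_span R M S" if "a \<in> carrier R" "x \<in> lin_span R M S" for a x
    using that unfolding lin_span_def using submoduleE(4) by blast
qed

lemma span_superset: "S \<subseteq> lin_span R M S"
  unfolding lin_span_def by blast

lemma span_least: "submodule H R M \<Longrightarrow> S \<subseteq> H \<Longrightarrow> lin_span R M S \<subseteq> H"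
  unfolding lin_span_def by blast

lemma span_eq_self: "submodule H R M \<Longrightarrow> lin_span R M H = H"
  using span_least span_superset by blast

lemma adjoin_submodule:
  assumes "submodule D R M" "x \<in> carrier M"
  shows "submodule (adjoin R M D x) R M"
proof -
  interpret D: submod R M D using assms module_axioms by (simp add: submodI_locale)
  show ?thesis
  proof (rule submodI)
    show "adjoin R M D x \<subseteq> carrier M"
      using assms unfolding adjoin_def by auto
    show "\<zero>\<^bsub>M\<^esub> \<in> adjoin R M D x"
      unfolding adjoin_def using assms
      by (auto intro!: exI[of _ "\<zero>\<^bsub>M\<^esub>"] exI[of _ "\<zero>\<^bsub>R\<^esub>"])
    fix a b assume "a \<in> adjoin R M D x" "b \<in> adjoin R M D x"
    then obtain y r y' r' where *: "a = y \<oplus>\<^bsub>M\<^esub> r \<odot>\<^bsub>M\<^esub> x" "b = y' \<oplus>\<^bsub>M\<^esub> r' \<odot>\<^bsub>M\<^esub> x"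
      "y \<in> D" "y' \<in> D" "r \<in> carrier R" "r' \<in> carrier R"
      unfolding adjoin_def by blast
    then have "a \<oplus>\<^bsub>M\<^esub> b = (y \<oplus>\<^bsub>M\<^esub> y') \<oplus>\<^bsub>M\<^esub> (r \<oplus>\<^bsub>R\<^esub> r') \<odot>\<^bsub>M\<^esub> x"
      using assms by (simp add: smult_l_distr M.a_assoc M.a_lcomm)
    then show "a \<oplus>\<^bsub>M\<^esub> b \<in> adjoin R M D x"
      unfolding adjoin_def using * D.sub_add by blast
  next
    fix s a assume s: "s \<in> carrier R" and "a \<in> adjoin R M D x"
    then obtain y r where *: "a = y \<oplus>\<^bsub>M\<^esub> r \<odot>\<^bsub>M\<^esub> x" "y \<in> D" "r \<in> carrier R"
      unfolding adjoin_def by blast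
    then have "s \<odot>\<^bsub>M\<^esub> a = s \<odot>\<^bsub>M\<^esub> y \<oplus>\<^bsub>M\<^esub> (s \<otimes>\<^bsub>R\<^esub> r) \<odot>\<^bsub>M\<^esub> x"
      using assms s by (simp add: smult_r_distr smult_assoc1)
    then show "s \<odot>\<^bsub>M\<^esub> a \<in> adjoin R M D x"
      unfolding adjoin_def using * s D.sub_smult by blast
  qed
qed

lemma adjoin_superset:
  assumes "submodule D R M" "x \<in> carrier M"
  shows "D \<subseteq> adjoin R M D x" "x \<in> adjoin R M D x"
proof -
  interpret D: submod R M D using assms module_axioms by (simp add: submodI_locale)
  show "D \<subseteq> adjoin R M D x"
  proof
    fix y assume "y \<in> D"
    then show "y \<in> adjoin R M D x"
      unfolding adjoin_def using assms by (auto intro!: exI[of _ y] exI[of _ "\<zero>\<^bsub>R\<^esub>"])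
  qed
  show "x \<in> adjoin R M D x"
    unfolding adjoin_def using assms by (auto intro!: exI[of _ "\<zero>\<^bsub>M\<^esub>"] exI[of _ "\<one>\<^bsub>R\<^esub>"])
qed

lemma adjoin_least:
  assumes "submodule H R M" "D \<subseteq> H" "x \<in> H"
  shows "adjoin R M D x \<subseteq> H"
proof -
  interpret H: submod R M H using assms module_axioms by (simp add: submodI_locale)
  show ?thesis
    using assms unfolding adjoin_def by (auto intro!: H.sub_add H.sub_smult)
qed

lemma span_insert:
  assumes "S \<subseteq> carrier M" "x \<in> carrier M"
  shows "lin_span R M (insert x S) = adjoin R M (lin_span R M S) x"
proof
  show "lin_span R M (insert x S) \<subseteq> adjoin R M (lin_span R M S) x"
    using assms adjoin_superset[OF span_submodule[OF assms(1)] assms(2)] span_superset[of S]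
    by (intro span_least adjoin_submodule span_submodule) auto
  show "adjoin R M (lin_span R M S) x \<subseteq> lin_span R M (insert x S)"
    using assms span_superset[of "insert x S"]
    by (intro adjoin_least span_submodule span_least) auto
qed

lemma fg_over_submodule: "B \<subseteq> carrier M \<Longrightarrow> fg_over R M B A \<Longrightarrow> submodule A R M"
  unfolding fg_over_def using span_submodule by auto

lemma fg_over_superset: "fg_over R M B A \<Longrightarrow> B \<subseteq> A"
  unfolding fg_over_def using span_superset by blast

lemma fg_over_mono:
  assumes "fg_over R M B A" "B \<subseteq> B'" "B' \<subseteq> A" "B \<subseteq> carrier M"
  shows "fg_over R M B' A"
proof -
  obtain S where S: "finite S" "S \<subseteq> carrier M" "A = lin_span R M (B \<union> S)"
    using assms(1) unfolding fg_over_def by blast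
  have A: "submodule A R M"
    using fg_over_submodule assms by blast
  have "B' \<subseteq> carrier M"
    using submoduleE(1)[OF A] assms(3) by blast
  then have "submodule (lin_span R M (B' \<union> S)) R M"
    using S(2) by (intro span_submodule) auto
  then have "A \<subseteq> lin_span R M (B' \<union> S)"
    unfolding S(3) using assms(2) span_superset[of "B' \<union> S"] by (intro span_least) auto
  moreover have "lin_span R M (B' \<union> S) \<subseteq> A"
    using A assms(3) S(3) span_superset[of "B \<union> S"] by (intro span_least) auto
  ultimately have "A = lin_span R M (B' \<union> S)"
    by blast
  then show ?thesis
    unfolding fg_over_def using S by blast
qed

lemma fg_over_induct [consumes 2, case_names base adjoin]:
  assumes B: "submodule B R M" and fg: "fg_over R M B A"
    and base: "P B"
    and step: "\<And>D x. \<lbrakk>submodule D R M; B \<subseteq> D; D \<subseteq> A; x \<in> A; x \<in> carrier M; P D\<rbrakk> \<Longrightarrow> P (adjoin R M D x)"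
  shows "P A"
proof -
  have BM: "B \<subseteq> carrier M" using submoduleE(1)[OF B] .
  obtain S where S: "finite S" "S \<subseteq> carrier M" "A = lin_span R M (B \<union> S)"
    using fg unfolding fg_over_def by blast
  have "T \<subseteq> S \<Longrightarrow> P (lin_span R M (B \<union> T))" if "finite T" for T
    using that
  proof (induction T)
    case empty
    then show ?case using base span_eq_self[OF B] by simp
  next
    case (insert x T)
    have "lin_span R M (B \<union> T) \<subseteq> A"
      using insert.prems S(2) BM span_superset[of "B \<union> S"] unfolding S(3)
      by (intro span_least span_submodule) auto
    moreover have "B \<subseteq> lin_span R M (B \<union> T)" "x \<in> A"
      using span_superset[of "B \<union> T"] span_superset[of "B \<union> S"] insert.prems S(3) by auto
    moreover have "submodule (lin_span R M (B \<union> T)) R M" "B \<union> T \<subseteq> carrier M" "x \<in> carrier M"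
      using insert.prems S(2) BM by (auto intro!: span_submodule)
    ultimately have "P (adjoin R M (lin_span R M (B \<union> T)) x)"
      using insert.IH insert.prems by (intro step) auto
    then show ?case
      using span_insert[of "B \<union> T" x] \<open>B \<union> T \<subseteq> carrier M\<close> \<open>x \<in> carrier M\<close> by simp
  qed
  then show ?thesis
    using S by blast
qed

lemma fg_overI:
  "finite S \<Longrightarrow> S \<subseteq> carrier M \<Longrightarrow> fg_over R M B (lin_span R M (B \<union> S))"
  unfolding fg_over_def by blast

end

lemma fin_gen_imp_fg_over:
  assumes "module R M" "fin_gen_module R M"
  shows "fg_over R M {\<zero>\<^bsub>M\<^esub>} (carrier M)"
proof -
  interpret M: module R M by fact
  obtain S where S: "finite S" "S \<subseteq> carrier M" "lin_span R M S = carrier M"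
    using assms(2) unfolding fin_gen_module_def lin_span_def by blast
  have "lin_span R M ({\<zero>\<^bsub>M\<^esub>} \<union> S) = carrier M"
    using S M.span_least[OF M.span_submodule, of "{\<zero>\<^bsub>M\<^esub>} \<union> S" S] M.span_superset[of "{\<zero>\<^bsub>M\<^esub>} \<union> S"]
      M.submoduleE(1)[OF M.span_submodule, of "{\<zero>\<^bsub>M\<^esub>} \<union> S"] by auto
  then show ?thesis
    unfolding fg_over_def using S by metis
qed

lemma regular_simps [simp]:
  "carrier (regular_module R) = carrier R" "\<zero>\<^bsub>regular_module R\<^esub> = \<zero>\<^bsub>R\<^esub>"
  "x \<oplus>\<^bsub>regular_module R\<^esub> y = x \<oplus>\<^bsub>R\<^esub> y" "x \<odot>\<^bsub>regular_module R\<^esub> y = x \<otimes>\<^bsub>R\<^esub> y"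
  by (simp_all add: regular_module_def)

lemma regular_a_inv [simp]: "\<ominus>\<^bsub>regular_module R\<^esub> x = \<ominus>\<^bsub>R\<^esub> x"
  by (simp add: a_inv_def m_inv_def)

lemma regular_minus [simp]: "x \<ominus>\<^bsub>regular_module R\<^esub> y = x \<ominus>\<^bsub>R\<^esub> y"
  by (simp add: a_minus_def)

lemma (in cring) regular_module_module: "module R (regular_module R)"
proof (rule moduleI)
  show "abelian_group (regular_module R)"
    by (rule abelian_groupI) (auto simp: a_ac intro: l_neg a_inv_closed)
qed (auto simp: is_cring l_distr r_distr m_assoc)

lemma (in cring) ideal_submodule_iff: "submodule J R (regular_module R) \<longleftrightarrow> ideal J R"
proof
  assume J: "submodule J R (regular_module R)"
  interpret J: submod R "regular_module R" J
    using J regular_module_module by (simp add: submodI_locale)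
  have "subgroup J (add_monoid R)"
    using J.sub_zero J.sub_add J.sub_neg J.sub_carr by (intro add.subgroupI) auto
  moreover have "r \<otimes> x \<in> J \<and> x \<otimes> r \<in> J" if "r \<in> carrier R" "x \<in> J" for r x
    using J.sub_smult[OF that] J.sub_carr[OF that(2)] that(1) by (simp add: m_comm)
  ultimately show "ideal J R"
    by (intro idealI ring_axioms) auto
next
  assume J: "ideal J R"
  interpret J: ideal J R by fact
  interpret X: module R "regular_module R" by (rule regular_module_module)
  show "submodule J R (regular_module R)"
    by (rule X.submodI) (use J.I_l_closed J.Icarr in auto)
qed

definition quot_ideal ::
  "('a, 'r) ring_scheme \<Rightarrow> ('a, 'b, 'm) module_scheme \<Rightarrow> 'b set \<Rightarrow> 'b \<Rightarrow> 'a set" where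
  "quot_ideal R X D x = {r \<in> carrier R. r \<odot>\<^bsub>X\<^esub> x \<in> D}"

lemma lin_scalars:
  assumes "module R X" "x \<in> carrier X"
  shows "lin R (regular_module R) X (\<lambda>r. r \<odot>\<^bsub>X\<^esub> x)"
proof -
  interpret X: module R X by fact
  show ?thesis
    using assms by (auto simp: lin_def X.smult_l_distr X.smult_assoc1)
qed

lemma quot_ideal_ideal:
  assumes "module R X" "submodule D R X" "x \<in> carrier X"
  shows "ideal (quot_ideal R X D x) R"
proof -
  interpret X: module R X by fact
  have "submodule {r \<in> carrier (regular_module R). r \<odot>\<^bsub>X\<^esub> x \<in> D} R (regular_module R)"
    using preimage_submodule[OF X.R.regular_module_module assms(1) lin_scalars[OF assms(1,3)] assms(2)] .
  then show ?thesis
    by (simp add: quot_ideal_def X.R.ideal_submodule_iff)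
qed

locale noetherian_cring = cring R + noetherian_ring R for R (structure)
begin

lemma ideal_maximal_element:
  assumes "\<S> \<noteq> {}" "\<And>J. J \<in> \<S> \<Longrightarrow> ideal J R"
  shows "\<exists>J\<in>\<S>. \<forall>K\<in>\<S>. J \<subseteq> K \<longrightarrow> K = J"
proof (rule subset_Zorn_nonempty[OF assms(1)])
  fix C assume C: "C \<noteq> {}" "subset.chain \<S> C"
  then have "subset.chain {I. ideal I R} C"
    using assms(2) unfolding pred_on.chain_def by (simp add: subset_iff)
  then have "\<Union>C \<in> C"
    by (rule ideal_chain_is_trivial[OF C(1)])
  then show "\<Union>C \<in> \<S>"
    using C(2) unfolding pred_on.chain_def by blast
qed

lemma ascending_ideals_stabilise:
  fixes N :: "nat \<Rightarrow> 'a set"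
  assumes "\<And>k. ideal (N k) R" and mono: "\<And>k e. N k \<subseteq> N (k + e)"
  obtains k where "\<And>e. N (k + e) = N k"
proof -
  obtain k where "\<forall>K\<in>range N. N k \<subseteq> K \<longrightarrow> K = N k"
    using ideal_maximal_element[of "range N"] assms(1) by auto
  then have "N (k + e) = N k" for e
    using mono by blast
  then show ?thesis
    by (rule that)
qed

lemma ideal_induct [consumes 1]:
  assumes J: "ideal J R"
    and step: "\<And>J. \<lbrakk>ideal J R; \<And>K. \<lbrakk>ideal K R; J \<subset> K\<rbrakk> \<Longrightarrow> P K\<rbrakk> \<Longrightarrow> P J"
  shows "P J"
proof (rule ccontr)
  assume "\<not> P J"
  then obtain K where K: "ideal K R" "\<not> P K" "\<forall>L\<in>{L. ideal L R \<and> \<not> P L}. K \<subseteq> L \<longrightarrow> L = K"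
    using ideal_maximal_element[of "{L. ideal L R \<and> \<not> P L}"] J by blast
  then show False
    using step[OF K(1)] by blast
qed

text \<open>
  Finite generation is used through the universal property of generators, which is what one needs to
  prove inclusions of ideals.
\<close>

lemma ideal_fg:
  assumes "ideal J R"
  shows "\<exists>S. finite S \<and> S \<subseteq> J \<and> (\<forall>K. ideal K R \<longrightarrow> S \<subseteq> K \<longrightarrow> J \<subseteq> K)"
proof -
  obtain S where S: "S \<subseteq> carrier R" "finite S" "J = Idl S"
    using finetely_gen[OF assms] by blast
  then show ?thesis
    using genideal_self[OF S(1)] genideal_minimal by (intro exI[of _ S]) auto
qed

lemma ideal_fg_over:
  assumes "ideal J R" "ideal K R" "K \<subseteq> J"
  shows "fg_over R (regular_module R) K J"
proof -
  interpret X: module R "regular_module R" by (rule regular_module_module)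
  obtain S where S: "finite S" "S \<subseteq> J" "\<And>L. ideal L R \<Longrightarrow> S \<subseteq> L \<Longrightarrow> J \<subseteq> L"
    using ideal_fg[OF assms(1)] by blast
  have JR: "J \<subseteq> carrier R"
    using assms(1) additive_subgroup.a_subset ideal.axioms(1) by blast
  have "J = lin_span R (regular_module R) (K \<union> S)"
  proof
    have "ideal (lin_span R (regular_module R) (K \<union> S)) R"
      using X.span_submodule[of "K \<union> S"] S(2) assms(3) JR by (auto simp flip: ideal_submodule_iff)
    then show "J \<subseteq> lin_span R (regular_module R) (K \<union> S)"
      using S(3) X.span_superset[of "K \<union> S"] by blast
    show "lin_span R (regular_module R) (K \<union> S) \<subseteq> J"
      using assms S(2) by (intro X.span_least) (auto simp: ideal_submodule_iff)
  qed
  then show ?thesis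
    unfolding fg_over_def using S JR by (metis regular_simps(1) subset_trans)
qed

text \<open>
  For \<open>H \<subseteq> D + Rx\<close>, combine
  generators of \<open>H \<inter> D\<close> with elements of \<open>H\<close> whose \<open>x\<close>-coefficients generate the ideal of all
  \<open>x\<close>-coefficients of \<open>H\<close>.
\<close>

lemma submodule_fg:
  assumes X: "module R X" and fg: "fg_over R X {\<zero>\<^bsub>X\<^esub>} A" and H: "submodule H R X" "H \<subseteq> A"
  shows "\<exists>S. finite S \<and> S \<subseteq> carrier X \<and> H = lin_span R X S"
proof -
  interpret X: module R X by fact
  show ?thesis
    using X.zero_submodule fg H
  proof (induction arbitrary: H rule: X.fg_over_induct)
    case base
    interpret H: submod R X H using X base by (simp add: submodI_locale)
    have "H = lin_span R X {}"
      using base H.sub_zero X.span_submodule[of "{}"] X.span_least[of H "{}"]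
        submod.sub_zero[OF submodI_locale[OF X X.span_submodule]] by auto
    then show ?case by (intro exI[of _ "{}"]) simp
  next
    case (adjoin D x)
    interpret H: submod R X H using X adjoin.prems by (simp add: submodI_locale)
    interpret D: submod R X D using X adjoin.hyps by (simp add: submodI_locale)
    have coef: "ideal {r \<in> carrier R. \<exists>h\<in>K. h \<ominus>\<^bsub>X\<^esub> r \<odot>\<^bsub>X\<^esub> x \<in> D} R" (is "ideal (?J K) R")
      if "submodule K R X" for K
    proof -
      interpret K: submod R X K using X that by (simp add: submodI_locale)
      interpret Reg: module R "regular_module R" by (rule regular_module_module)
      have "submodule (?J K) R (regular_module R)"
      proof (rule Reg.submodI)
        show "\<zero>\<^bsub>regular_module R\<^esub> \<in> ?J K"
          using adjoin.hyps by (auto intro!: bexI[of _ "\<zero>\<^bsub>X\<^esub>"])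
      next
        fix a b assume "a \<in> ?J K" "b \<in> ?J K"
        then obtain h h' where *: "a \<in> carrier R" "b \<in> carrier R" "h \<in> K" "h' \<in> K"
          "h \<ominus>\<^bsub>X\<^esub> a \<odot>\<^bsub>X\<^esub> x \<in> D" "h' \<ominus>\<^bsub>X\<^esub> b \<odot>\<^bsub>X\<^esub> x \<in> D" by blast
        then have "(h \<oplus>\<^bsub>X\<^esub> h') \<ominus>\<^bsub>X\<^esub> (a \<oplus>\<^bsub>R\<^esub> b) \<odot>\<^bsub>X\<^esub> x \<in> D"
          using D.cong_add[OF *(5,6)] adjoin.hyps by (simp add: X.smult_l_distr)
        then show "a \<oplus>\<^bsub>regular_module R\<^esub> b \<in> ?J K"
          using * K.sub_add by auto
      next
        fix s a assume s: "s \<in> carrier R" and "a \<in> ?J K"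
        then obtain h where *: "a \<in> carrier R" "h \<in> K" "h \<ominus>\<^bsub>X\<^esub> a \<odot>\<^bsub>X\<^esub> x \<in> D" by blast
        then have "s \<odot>\<^bsub>X\<^esub> h \<ominus>\<^bsub>X\<^esub> (s \<otimes>\<^bsub>R\<^esub> a) \<odot>\<^bsub>X\<^esub> x \<in> D"
          using D.cong_smult[OF *(3) s] adjoin.hyps s by (simp add: X.smult_assoc1)
        then show "s \<odot>\<^bsub>regular_module R\<^esub> a \<in> ?J K"
          using * s K.sub_smult by auto
      qed auto
      then show ?thesis by (simp add: ideal_submodule_iff)
    qed
    obtain S where S: "finite S" "S \<subseteq> ?J H" "\<And>L. ideal L R \<Longrightarrow> S \<subseteq> L \<Longrightarrow> ?J H \<subseteq> L"
      using ideal_fg[OF coef[OF adjoin.prems(1)]] by blast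
    have "\<forall>r\<in>S. \<exists>h\<in>H. h \<ominus>\<^bsub>X\<^esub> r \<odot>\<^bsub>X\<^esub> x \<in> D"
      using S(2) by blast
    then obtain h where h: "\<And>r. r \<in> S \<Longrightarrow> h r \<in> H \<and> h r \<ominus>\<^bsub>X\<^esub> r \<odot>\<^bsub>X\<^esub> x \<in> D"
      by metis
    have "submodule (H \<inter> D) R X"
      by (rule X.submodI) (auto intro: H.sub_add D.sub_add H.sub_smult D.sub_smult)
    then obtain T where T: "finite T" "T \<subseteq> carrier X" "H \<inter> D = lin_span R X T"
      using adjoin.IH by blast
    let ?K = "lin_span R X (T \<union> h ` S)"
    have TS: "T \<union> h ` S \<subseteq> carrier X"
      using T(2) h by auto
    interpret K: submod R X ?K using X X.span_submodule[OF TS] by (simp add: submodI_locale)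
    have KH: "?K \<subseteq> H"
      using T(3) X.span_superset[of T] h adjoin.prems(1) by (intro X.span_least) auto
    have "S \<subseteq> ?J ?K"
      using S(2) h X.span_superset[of "T \<union> h ` S"] by blast
    then have J: "?J H \<subseteq> ?J ?K"
      using S(3) coef[OF K.submodule_B] by blast
    have "H \<subseteq> ?K"
    proof
      fix z assume z: "z \<in> H"
      then obtain y r where yr: "z = y \<oplus>\<^bsub>X\<^esub> r \<odot>\<^bsub>X\<^esub> x" "y \<in> D" "r \<in> carrier R"
        using adjoin.prems(2) unfolding adjoin_def by blast
      then have zr: "z \<ominus>\<^bsub>X\<^esub> r \<odot>\<^bsub>X\<^esub> x \<in> D"
        using adjoin.hyps by (simp add: X.M.minus_eq X.M.a_assoc X.M.r_neg)
      then have "r \<in> ?J H" using yr z by blast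
      then obtain k where k: "k \<in> ?K" "k \<ominus>\<^bsub>X\<^esub> r \<odot>\<^bsub>X\<^esub> x \<in> D" using J by blast
      have rx: "r \<odot>\<^bsub>X\<^esub> x \<in> carrier X" using yr adjoin.hyps by simp
      have "z \<ominus>\<^bsub>X\<^esub> k \<in> D"
        using D.cong_trans[OF zr D.cong_sym[OF k(2)]] z k rx by simp
      moreover have "z \<ominus>\<^bsub>X\<^esub> k \<in> H"
        using z k KH H.sub_minus by blast
      ultimately have "z \<ominus>\<^bsub>X\<^esub> k \<in> ?K"
        using T(3) X.span_superset[of "T \<union> h ` S"] X.span_least[OF K.submodule_B, of T] by blast
      then show "z \<in> ?K"
        using K.cong_mem[of z k] k z by simp
    qed
    then show ?case
      using KH T(1) S(1) TS by (intro exI[of _ "T \<union> h ` S"]) auto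
  qed
qed

lemma submodule_fg_over:
  assumes X: "module R X" and fg: "fg_over R X {\<zero>\<^bsub>X\<^esub>} A"
    and H: "submodule H R X" "H \<subseteq> A" and B: "B \<subseteq> H" "B \<subseteq> carrier X"
  shows "fg_over R X B H"
proof -
  interpret X: module R X by fact
  obtain S where S: "finite S" "S \<subseteq> carrier X" "H = lin_span R X S"
    using submodule_fg[OF assms(1-4)] by blast
  have "fg_over R X {} H"
    using S X.fg_overI[of S "{}"] by simp
  then show ?thesis
    using X.fg_over_mono[of "{}" H B] B by simp
qed

end

section \<open>Cohomology relative to a tower of free resolutions\<close>

text \<open>
  The term \<open>n\<close> of the tower is a complex
  \<open>\<dots> \<rightarrow> R^(rk n 2) \<rightarrow> R^(rk n 1) \<rightarrow> R^(rk n 0) = 0\<close> whose part in degrees \<open>\<ge> 1\<close> is a free resolution of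
  \<open>R/I n\<close>; starting with a zero module lets degree \<open>0\<close> of the cohomology be treated like the others.
  The augmentation to \<open>R/I n\<close> is represented by a linear form \<open>\<rho> n\<close>, which lifts it to \<open>R\<close>.
\<close>

locale resolution_tower = noetherian_cring R for R (structure) +
  fixes \<aa> :: "'a set" and I :: "nat \<Rightarrow> 'a set" and rk :: "nat \<Rightarrow> nat \<Rightarrow> nat"
    and d :: "nat \<Rightarrow> nat \<Rightarrow> (nat \<Rightarrow> 'a) \<Rightarrow> (nat \<Rightarrow> 'a)"
    and \<phi> :: "nat \<Rightarrow> nat \<Rightarrow> (nat \<Rightarrow> 'a) \<Rightarrow> (nat \<Rightarrow> 'a)"
    and \<rho> :: "nat \<Rightarrow> (nat \<Rightarrow> 'a) \<Rightarrow> 'a"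
  assumes ideal_a: "ideal \<aa> R"
    and I_0: "I 0 = \<aa>"
    and I_Suc: "I (Suc n) = ideal_prod R (I n) \<aa>"
    and rk_0: "rk n 0 = 0"
    and d_lin: "lin R (free_module R (rk n (Suc i))) (free_module R (rk n i)) (d n i)"
    and \<phi>_lin: "lin R (free_module R (rk (Suc n) i)) (free_module R (rk n i)) (\<phi> n i)"
    and \<phi>_d: "z \<in> carrier (free_module R (rk (Suc n) (Suc i))) \<Longrightarrow>
      d n i (\<phi> n (Suc i) z) = \<phi> n i (d (Suc n) i z)"
    and d_d: "z \<in> carrier (free_module R (rk n (Suc (Suc i)))) \<Longrightarrow>
      d n i (d n (Suc i) z) = \<zero>\<^bsub>free_module R (rk n i)\<^esub>"
    and d_exact: "z \<in> carrier (free_module R (rk n (Suc (Suc i)))) \<Longrightarrow>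
      d n (Suc i) z = \<zero>\<^bsub>free_module R (rk n (Suc i))\<^esub> \<Longrightarrow>
      \<exists>w\<in>carrier (free_module R (rk n (Suc (Suc (Suc i))))). d n (Suc (Suc i)) w = z"
    and \<rho>_lin: "lin R (free_module R (rk n (Suc 0))) (regular_module R) (\<rho> n)"
    and \<rho>_d: "z \<in> carrier (free_module R (rk n (Suc (Suc 0)))) \<Longrightarrow> \<rho> n (d n (Suc 0) z) \<in> I n"
    and \<rho>_exact: "z \<in> carrier (free_module R (rk n (Suc 0))) \<Longrightarrow> \<rho> n z \<in> I n \<Longrightarrow>
      \<exists>w\<in>carrier (free_module R (rk n (Suc (Suc 0)))). d n (Suc 0) w = z"
    and \<rho>_one: "\<exists>z\<in>carrier (free_module R (rk n (Suc 0))). \<rho> n z \<ominus> \<one> \<in> I n"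
    and \<rho>_\<phi>: "z \<in> carrier (free_module R (rk (Suc n) (Suc 0))) \<Longrightarrow>
      \<rho> n (\<phi> n (Suc 0) z) \<ominus> \<rho> (Suc n) z \<in> I n"
begin

abbreviation F :: "nat \<Rightarrow> nat \<Rightarrow> ('a, nat \<Rightarrow> 'a) module" where
  "F n i \<equiv> free_module R (rk n i)"

lemma F_module: "module R (F n i)"
  by (rule free_module_module) (rule is_cring)

lemma I_ideal: "ideal (I n) R"
  by (induction n) (auto simp: I_0 I_Suc ideal_a ideal_prod_is_ideal)

lemma I_decseq: "I (n + k) \<subseteq> I n"
  using ideal_prod_inter[OF I_ideal ideal_a] by (induction k) (auto simp: I_Suc)

primrec tr :: "nat \<Rightarrow> nat \<Rightarrow> nat \<Rightarrow> (nat \<Rightarrow> 'a) \<Rightarrow> (nat \<Rightarrow> 'a)" where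
  "tr n 0 i z = z"
| "tr n (Suc k) i z = tr n k i (\<phi> (n + k) i z)"

lemma tr_lin: "lin R (F (n + k) i) (F n i) (tr n k i)"
proof (induction k)
  case 0
  show ?case by (simp add: lin_def)
next
  case (Suc k)
  show ?case
    using lin_comp[OF \<phi>_lin[of "n + k" i] Suc] by simp
qed

lemma tr_carrier: "z \<in> carrier (F (n + k) i) \<Longrightarrow> tr n k i z \<in> carrier (F n i)"
  using lin_closed[OF tr_lin] .

lemma d_carrier: "z \<in> carrier (F n (Suc i)) \<Longrightarrow> d n i z \<in> carrier (F n i)"
  using lin_closed[OF d_lin] .

lemma tr_d: "z \<in> carrier (F (n + k) (Suc i)) \<Longrightarrow> d n i (tr n k (Suc i) z) = tr n k i (d (n + k) i z)"
  by (induction k arbitrary: z) (auto simp: \<phi>_d lin_closed[OF \<phi>_lin])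

lemma tr_tr: "tr n (k + l) i z = tr n k i (tr (n + k) l i z)"
  by (induction l arbitrary: z) (auto simp: add.assoc)

text \<open>
  For submodules \<open>B \<subseteq> A\<close> of \<open>X\<close>, maps from a free module to \<open>A/B\<close> are represented by maps to \<open>A\<close>,
  and identities between them hold modulo \<open>B\<close>.
\<close>

definition coch :: "('a, 'x, 'm) module_scheme \<Rightarrow> 'x set \<Rightarrow> nat \<Rightarrow> nat \<Rightarrow> ((nat \<Rightarrow> 'a) \<Rightarrow> 'x) \<Rightarrow> bool" where
  "coch X A n i g \<longleftrightarrow> lin R (F n i) X g \<and> (\<forall>z\<in>carrier (F n i). g z \<in> A)"

definition cocyc :: "('a, 'x, 'm) module_scheme \<Rightarrow> 'x set \<Rightarrow> 'x set \<Rightarrow> nat \<Rightarrow> nat \<Rightarrow> ((nat \<Rightarrow> 'a) \<Rightarrow> 'x) \<Rightarrow> bool" where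
  "cocyc X A B n i g \<longleftrightarrow> coch X A n (Suc i) g \<and>
     (\<forall>z\<in>carrier (F n (Suc (Suc i))). g (d n (Suc i) z) \<in> B)"

definition cobnd :: "('a, 'x, 'm) module_scheme \<Rightarrow> 'x set \<Rightarrow> 'x set \<Rightarrow> nat \<Rightarrow> nat \<Rightarrow> ((nat \<Rightarrow> 'a) \<Rightarrow> 'x) \<Rightarrow> bool" where
  "cobnd X A B n i g \<longleftrightarrow> (\<exists>h. coch X A n i h \<and>
     (\<forall>z\<in>carrier (F n (Suc i)). g z \<ominus>\<^bsub>X\<^esub> h (d n i z) \<in> B))"

definition lim_zero :: "('a, 'x, 'm) module_scheme \<Rightarrow> 'x set \<Rightarrow> 'x set \<Rightarrow> nat \<Rightarrow> nat \<Rightarrow> ((nat \<Rightarrow> 'a) \<Rightarrow> 'x) \<Rightarrow> bool" where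
  "lim_zero X A B n i g \<longleftrightarrow> (\<exists>k. cobnd X A B (n + k) i (\<lambda>z. g (tr n k (Suc i) z)))"

definition H_vanishes :: "('a, 'x, 'm) module_scheme \<Rightarrow> 'x set \<Rightarrow> 'x set \<Rightarrow> nat \<Rightarrow> bool" where
  "H_vanishes X A B i \<longleftrightarrow> (\<forall>n g. cocyc X A B n i g \<longrightarrow> lim_zero X A B n i g)"

definition subquot :: "('a, 'x, 'm) module_scheme \<Rightarrow> 'x set \<Rightarrow> 'x set \<Rightarrow> bool" where
  "subquot X A B \<longleftrightarrow> module R X \<and> submodule A R X \<and> submodule B R X \<and> B \<subseteq> A"

lemma cochD: "coch X A n i g \<Longrightarrow> lin R (F n i) X g"
  "coch X A n i g \<Longrightarrow> z \<in> carrier (F n i) \<Longrightarrow> g z \<in> A"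
  by (auto simp: coch_def)

lemma cocycD: "cocyc X A B n i g \<Longrightarrow> coch X A n (Suc i) g"
  "cocyc X A B n i g \<Longrightarrow> z \<in> carrier (F n (Suc (Suc i))) \<Longrightarrow> g (d n (Suc i) z) \<in> B"
  by (auto simp: cocyc_def)

lemma coch_mono: "coch X A n i g \<Longrightarrow> A \<subseteq> A' \<Longrightarrow> coch X A' n i g"
  by (auto simp: coch_def)

lemma coch_add:
  assumes "module R X" "submodule A R X" "coch X A n i g" "coch X A n i h"
  shows "coch X A n i (\<lambda>z. g z \<oplus>\<^bsub>X\<^esub> h z)"
proof -
  interpret A: submod R X A using assms by (simp add: submodI_locale)
  show ?thesis
    using assms(3,4) lin_pointwise_add[OF _ _ F_module assms(1)] unfolding coch_def
    by (simp add: A.sub_add)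
qed

lemma coch_diff:
  assumes "module R X" "submodule A R X" "coch X A n i g" "coch X A n i h"
  shows "coch X A n i (\<lambda>z. g z \<ominus>\<^bsub>X\<^esub> h z)"
proof -
  interpret A: submod R X A using assms by (simp add: submodI_locale)
  show ?thesis
    using assms(3,4) lin_pointwise_diff[OF _ _ F_module assms(1)] unfolding coch_def
    by (simp add: A.sub_minus)
qed

lemma coch_smult:
  assumes "module R X" "submodule A R X" "coch X A n i g" "r \<in> carrier R"
  shows "coch X A n i (\<lambda>z. r \<odot>\<^bsub>X\<^esub> g z)"
proof -
  interpret A: submod R X A using assms by (simp add: submodI_locale)
  show ?thesis
    using assms(3,4) lin_pointwise_smult[OF _ F_module assms(1)] unfolding coch_def
    by (simp add: A.sub_smult)
qed

lemma coch_zero: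
  assumes "module R X" "submodule A R X"
  shows "coch X A n i (\<lambda>z. \<zero>\<^bsub>X\<^esub>)"
proof -
  interpret A: submod R X A using assms by (simp add: submodI_locale)
  show ?thesis
    using lin_const_zero[OF assms(1)] unfolding coch_def by auto
qed

lemma coch_tr: "coch X A n i g \<Longrightarrow> coch X A (n + k) i (\<lambda>z. g (tr n k i z))"
  using lin_comp[OF tr_lin] tr_carrier unfolding coch_def by blast

lemma coch_d: "coch X A n i g \<Longrightarrow> coch X A n (Suc i) (\<lambda>z. g (d n i z))"
  using lin_comp[OF d_lin] d_carrier unfolding coch_def by blast

lemma coch_lin:
  assumes "lin R X Y f" "\<And>x. x \<in> A \<Longrightarrow> f x \<in> A'" "coch X A n i g"
  shows "coch Y A' n i (\<lambda>z. f (g z))"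
  using assms lin_comp[OF _ assms(1)] unfolding coch_def by blast

lemma coch_carrier: "coch X A n i g \<Longrightarrow> z \<in> carrier (F n i) \<Longrightarrow> g z \<in> carrier X"
  by (rule lin_closed[OF cochD(1)])

lemma cocyc_tr:
  assumes "cocyc X A B n i g"
  shows "cocyc X A B (n + k) i (\<lambda>z. g (tr n k (Suc i) z))"
  using assms coch_tr[of X A n "Suc i" g k] tr_d[of _ n k "Suc i"] tr_carrier[of _ n k "Suc (Suc i)"]
  unfolding cocyc_def by (metis (no_types, lifting))

lemma cobnd_tr:
  assumes "cobnd X A B n i g"
  shows "cobnd X A B (n + k) i (\<lambda>z. g (tr n k (Suc i) z))"
proof -
  obtain h where h: "coch X A n i h" "\<And>z. z \<in> carrier (F n (Suc i)) \<Longrightarrow> g z \<ominus>\<^bsub>X\<^esub> h (d n i z) \<in> B"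
    using assms unfolding cobnd_def by blast
  show ?thesis
    unfolding cobnd_def using coch_tr[OF h(1), of k] h(2) tr_carrier
    by (intro exI[of _ "\<lambda>z. h (tr n k i z)"]) (auto simp flip: tr_d)
qed

lemma lim_zero_of_tr: "lim_zero X A B (n + k) i (\<lambda>z. g (tr n k (Suc i) z)) \<Longrightarrow> lim_zero X A B n i g"
  unfolding lim_zero_def tr_tr[symmetric] add.assoc by blast

lemma lim_zero_tr:
  assumes "lim_zero X A B n i g"
  shows "lim_zero X A B (n + k) i (\<lambda>z. g (tr n k (Suc i) z))"
proof -
  obtain l where "cobnd X A B (n + l) i (\<lambda>z. g (tr n l (Suc i) z))"
    using assms unfolding lim_zero_def by blast
  from cobnd_tr[OF this, of k]
  have "cobnd X A B (n + k + l) i (\<lambda>z. g (tr n k (Suc i) (tr (n + k) l (Suc i) z)))"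
    unfolding tr_tr[symmetric] by (simp add: ac_simps)
  then show ?thesis
    unfolding lim_zero_def by blast
qed

lemma cobnd_imp_lim_zero: "cobnd X A B n i g \<Longrightarrow> lim_zero X A B n i g"
  unfolding lim_zero_def by (rule exI[of _ 0]) simp

text \<open>
  A class in the limit depends on its cocycle modulo coboundaries and modulo maps with values in \<open>B\<close>. In this
  form the lemma serves for all changes of representatives.
\<close>

lemma lim_zero_mod:
  assumes X: "module R X" "submodule B R X" "submodule A R X"
    and g: "coch X A n (Suc i) g" and g': "coch X A n (Suc i) g'" and h: "coch X A n i h"
    and gg: "\<And>z. z \<in> carrier (F n (Suc i)) \<Longrightarrow> (g z \<ominus>\<^bsub>X\<^esub> h (d n i z)) \<ominus>\<^bsub>X\<^esub> g' z \<in> B"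
    and z: "lim_zero X A B n i g'"
  shows "lim_zero X A B n i g"
proof -
  interpret B: submod R X B using X by (simp add: submodI_locale)
  obtain k h' where h': "coch X A (n + k) i h'"
    "\<And>z. z \<in> carrier (F (n + k) (Suc i)) \<Longrightarrow> g' (tr n k (Suc i) z) \<ominus>\<^bsub>X\<^esub> h' (d (n + k) i z) \<in> B"
    using z unfolding lim_zero_def cobnd_def by blast
  have "g (tr n k (Suc i) z) \<ominus>\<^bsub>X\<^esub> (h (tr n k i (d (n + k) i z)) \<oplus>\<^bsub>X\<^esub> h' (d (n + k) i z)) \<in> B"
    if z: "z \<in> carrier (F (n + k) (Suc i))" for z
  proof -
    let ?w = "tr n k (Suc i) z"
    have w: "?w \<in> carrier (F n (Suc i))" and dz: "d (n + k) i z \<in> carrier (F (n + k) i)"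
      using tr_carrier d_carrier z by blast+
    note c = coch_carrier[OF g w] coch_carrier[OF g' w] coch_carrier[OF h'(1) dz]
      coch_carrier[OF h d_carrier[OF w]]
    have "((g ?w \<ominus>\<^bsub>X\<^esub> h (d n i ?w)) \<ominus>\<^bsub>X\<^esub> h' (d (n + k) i z)) \<ominus>\<^bsub>X\<^esub> (g' ?w \<ominus>\<^bsub>X\<^esub> h' (d (n + k) i z)) \<in> B"
      using gg[OF w] c by (intro B.cong_diff) auto
    then have "(g ?w \<ominus>\<^bsub>X\<^esub> h (d n i ?w)) \<ominus>\<^bsub>X\<^esub> h' (d (n + k) i z) \<in> B"
      using h'(2)[OF z] c by (elim B.cong_mem) auto
    then show ?thesis
      using c by (simp add: B.diff_add_eq_diff_diff tr_d[OF z])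
  qed
  then show ?thesis
    unfolding lim_zero_def cobnd_def
    using coch_add[OF X(1,3) coch_tr[OF h, of k] h'(1)]
    by (intro exI[of _ k] exI[of _ "\<lambda>z. h (tr n k i z) \<oplus>\<^bsub>X\<^esub> h' z"]) simp
qed

lemma lim_zero_add:
  assumes X: "module R X" "submodule B R X" "submodule A R X"
    and g: "coch X A n (Suc i) g" and g': "coch X A n (Suc i) g'"
    and z: "lim_zero X A B n i g" "lim_zero X A B n i g'"
  shows "lim_zero X A B n i (\<lambda>z. g z \<oplus>\<^bsub>X\<^esub> g' z)"
proof -
  interpret B: submod R X B using X by (simp add: submodI_locale)
  obtain k h where h: "coch X A (n + k) i h"
    "\<And>z. z \<in> carrier (F (n + k) (Suc i)) \<Longrightarrow> g (tr n k (Suc i) z) \<ominus>\<^bsub>X\<^esub> h (d (n + k) i z) \<in> B"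
    using z(1) unfolding lim_zero_def cobnd_def by blast
  have s: "coch X A (n + k) (Suc i) (\<lambda>z. g (tr n k (Suc i) z) \<oplus>\<^bsub>X\<^esub> g' (tr n k (Suc i) z))"
    using coch_add[OF X(1,3)] coch_tr g g' by blast
  have "lim_zero X A B (n + k) i (\<lambda>z. g (tr n k (Suc i) z) \<oplus>\<^bsub>X\<^esub> g' (tr n k (Suc i) z))"
  proof (rule lim_zero_mod[OF X s coch_tr[OF g'] h(1) _ lim_zero_tr[OF z(2)]])
    fix z assume z: "z \<in> carrier (F (n + k) (Suc i))"
    let ?w = "tr n k (Suc i) z"
    have w: "?w \<in> carrier (F n (Suc i))" and dz: "d (n + k) i z \<in> carrier (F (n + k) i)"
      using tr_carrier d_carrier z by blast+
    note c = coch_carrier[OF g w] coch_carrier[OF g' w] coch_carrier[OF h(1) dz]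
    have "(g ?w \<oplus>\<^bsub>X\<^esub> g' ?w \<ominus>\<^bsub>X\<^esub> h (d (n + k) i z)) \<ominus>\<^bsub>X\<^esub> g' ?w = g ?w \<ominus>\<^bsub>X\<^esub> h (d (n + k) i z)"
      using c by (simp add: B.add_diff_diff_cancel)
    then show "(g ?w \<oplus>\<^bsub>X\<^esub> g' ?w \<ominus>\<^bsub>X\<^esub> h (d (n + k) i z)) \<ominus>\<^bsub>X\<^esub> g' ?w \<in> B"
      using h(2)[OF z] by simp
  qed
  then show ?thesis
    by (rule lim_zero_of_tr)
qed

lemma lim_zero_smult:
  assumes X: "module R X" "submodule B R X" "submodule A R X"
    and g: "coch X A n (Suc i) g" and r: "r \<in> carrier R" and z: "lim_zero X A B n i g"
  shows "lim_zero X A B n i (\<lambda>z. r \<odot>\<^bsub>X\<^esub> g z)"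
proof -
  interpret B: submod R X B using X by (simp add: submodI_locale)
  obtain k h where h: "coch X A (n + k) i h"
    "\<And>z. z \<in> carrier (F (n + k) (Suc i)) \<Longrightarrow> g (tr n k (Suc i) z) \<ominus>\<^bsub>X\<^esub> h (d (n + k) i z) \<in> B"
    using z unfolding lim_zero_def cobnd_def by blast
  have "r \<odot>\<^bsub>X\<^esub> g (tr n k (Suc i) z) \<ominus>\<^bsub>X\<^esub> r \<odot>\<^bsub>X\<^esub> h (d (n + k) i z) \<in> B"
    if "z \<in> carrier (F (n + k) (Suc i))" for z
    using that h(2)[OF that] r coch_carrier[OF g tr_carrier] coch_carrier[OF h(1) d_carrier]
    by (intro B.cong_smult) auto
  then show ?thesis
    unfolding lim_zero_def cobnd_def using coch_smult[OF X(1,3) h(1) r] by blast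
qed

lemma cobnd_of_values:
  assumes X: "module R X" "submodule A R X"
    and g: "lin R (F n (Suc i)) X g" "\<And>z. z \<in> carrier (F n (Suc i)) \<Longrightarrow> g z \<in> B"
  shows "cobnd X A B n i g"
proof -
  interpret X: module R X by fact
  show ?thesis
    unfolding cobnd_def
    using coch_zero[OF X, of n i] g lin_closed[OF g(1)]
    by (intro exI[of _ "\<lambda>_. \<zero>\<^bsub>X\<^esub>"]) simp
qed

lemma cocyc_carrier: "cocyc X A B n i g \<Longrightarrow> z \<in> carrier (F n (Suc i)) \<Longrightarrow> g z \<in> carrier X"
  by (rule coch_carrier[OF cocycD(1)])

subsection \<open>The long exact sequence\<close>

text \<open>
  Exactness of \<open>H^i(B/C) \<rightarrow> H^i(A/C) \<rightarrow> H^i(A/B)\<close> in the middle.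
\<close>

lemma H_vanishes_extension:
  assumes AB: "subquot X A B" and BC: "subquot X B C"
    and v: "H_vanishes X A B i" "H_vanishes X B C i"
  shows "H_vanishes X A C i"
  unfolding H_vanishes_def
proof (intro allI impI)
  fix n g assume g: "cocyc X A C n i g"
  have X: "module R X" and C: "submodule C R X" and A: "submodule A R X" and B: "submodule B R X"
    and CB: "C \<subseteq> B" and BA: "B \<subseteq> A"
    using AB BC by (auto simp: subquot_def)
  interpret C: submod R X C using X C by (simp add: submodI_locale)
  have "cocyc X A B n i g"
    using g CB unfolding cocyc_def by blast
  then obtain k h where h: "coch X A (n + k) i h"
    "\<And>z. z \<in> carrier (F (n + k) (Suc i)) \<Longrightarrow> g (tr n k (Suc i) z) \<ominus>\<^bsub>X\<^esub> h (d (n + k) i z) \<in> B"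
    using v(1) unfolding H_vanishes_def lim_zero_def cobnd_def by blast
  let ?g = "\<lambda>z. g (tr n k (Suc i) z)"
  let ?g' = "\<lambda>z. ?g z \<ominus>\<^bsub>X\<^esub> h (d (n + k) i z)"
  have gc: "cocyc X A C (n + k) i ?g" by (rule cocyc_tr[OF g])
  have g'A: "coch X A (n + k) (Suc i) ?g'"
    by (rule coch_diff[OF X A cocycD(1)[OF gc] coch_d[OF h(1)]])
  then have g'B: "coch X B (n + k) (Suc i) ?g'"
    using h(2) unfolding coch_def by blast
  have "?g' (d (n + k) (Suc i) z) \<in> C" if z: "z \<in> carrier (F (n + k) (Suc (Suc i)))" for z
  proof -
    have "h (d (n + k) i (d (n + k) (Suc i) z)) = \<zero>\<^bsub>X\<^esub>"
      using d_d[OF z] lin_zero[OF cochD(1)[OF h(1)] F_module X] by simp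
    then show ?thesis
      using cocycD(2)[OF gc z] by simp
  qed
  then have "cocyc X B C (n + k) i ?g'"
    using g'B unfolding cocyc_def by blast
  then have "lim_zero X B C (n + k) i ?g'"
    using v(2) unfolding H_vanishes_def by blast
  then have "lim_zero X A C (n + k) i ?g'"
    unfolding lim_zero_def cobnd_def using coch_mono[OF _ BA] by blast
  then have "lim_zero X A C (n + k) i ?g"
  proof (rule lim_zero_mod[OF X C A cocycD(1)[OF gc] g'A h(1), rotated])
    fix z assume "z \<in> carrier (F (n + k) (Suc i))"
    then show "?g' z \<ominus>\<^bsub>X\<^esub> ?g' z \<in> C"
      using coch_carrier[OF g'A] by simp
  qed
  then show "lim_zero X A C n i g"
    by (rule lim_zero_of_tr)
qed

text \<open>
  The connecting map sends the class of \<open>g\<close> in \<open>H^i(A/B)\<close> to that of \<open>g \<circ> d\<close> in \<open>H^(i+1)(B/C)\<close>. If this is the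
  coboundary of \<open>h\<close>, then \<open>g - h\<close> is a cocycle for \<open>A/C\<close> with the same image in \<open>A/B\<close>.
\<close>

lemma cocyc_lift_quotient:
  assumes AB: "subquot X A B" and BC: "subquot X B C"
    and v: "H_vanishes X B C (Suc i)" and g: "cocyc X A B n i g"
  shows "\<exists>k h. coch X B (n + k) (Suc i) h \<and>
    cocyc X A C (n + k) i (\<lambda>z. g (tr n k (Suc i) z) \<ominus>\<^bsub>X\<^esub> h z)"
proof -
  have X: "module R X" and C: "submodule C R X" and A: "submodule A R X" and B: "submodule B R X"
    and CB: "C \<subseteq> B" and BA: "B \<subseteq> A"
    using AB BC by (auto simp: subquot_def)
  interpret C: submod R X C using X C by (simp add: submodI_locale)
  have "coch X B n (Suc (Suc i)) (\<lambda>z. g (d n (Suc i) z))"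
    using coch_d[OF cocycD(1)[OF g]] cocycD(2)[OF g] unfolding coch_def by blast
  moreover have "g (d n (Suc i) (d n (Suc (Suc i)) z)) = \<zero>\<^bsub>X\<^esub>"
    if "z \<in> carrier (F n (Suc (Suc (Suc i))))" for z
    using d_d[OF that] lin_zero[OF cochD(1)[OF cocycD(1)[OF g]] F_module X] by simp
  ultimately have "cocyc X B C n (Suc i) (\<lambda>z. g (d n (Suc i) z))"
    unfolding cocyc_def by simp
  then obtain k h where h: "coch X B (n + k) (Suc i) h"
    "\<And>z. z \<in> carrier (F (n + k) (Suc (Suc i))) \<Longrightarrow>
      g (d n (Suc i) (tr n k (Suc (Suc i)) z)) \<ominus>\<^bsub>X\<^esub> h (d (n + k) (Suc i) z) \<in> C"
    using v unfolding H_vanishes_def lim_zero_def cobnd_def by blast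
  have "coch X A (n + k) (Suc i) (\<lambda>z. g (tr n k (Suc i) z) \<ominus>\<^bsub>X\<^esub> h z)"
    by (rule coch_diff[OF X A coch_tr[OF cocycD(1)[OF g]] coch_mono[OF h(1) BA]])
  then have "cocyc X A C (n + k) i (\<lambda>z. g (tr n k (Suc i) z) \<ominus>\<^bsub>X\<^esub> h z)"
    using h(2) unfolding cocyc_def by (simp flip: tr_d)
  then show ?thesis
    using h(1) by blast
qed

lemma H_vanishes_quotient:
  assumes AB: "subquot X A B" and BC: "subquot X B C"
    and v: "H_vanishes X A C i" "H_vanishes X B C (Suc i)"
  shows "H_vanishes X A B i"
  unfolding H_vanishes_def
proof (intro allI impI)
  fix n g assume g: "cocyc X A B n i g"
  have X: "module R X" and C: "submodule C R X" and A: "submodule A R X" and B: "submodule B R X"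
    and CB: "C \<subseteq> B" and BA: "B \<subseteq> A"
    using AB BC by (auto simp: subquot_def)
  interpret B: submod R X B using X B by (simp add: submodI_locale)
  obtain k h where h: "coch X B (n + k) (Suc i) h"
    "cocyc X A C (n + k) i (\<lambda>z. g (tr n k (Suc i) z) \<ominus>\<^bsub>X\<^esub> h z)"
    using cocyc_lift_quotient[OF AB BC v(2) g] by blast
  let ?g = "\<lambda>z. g (tr n k (Suc i) z)"
  have gc: "coch X A (n + k) (Suc i) ?g" by (rule coch_tr[OF cocycD(1)[OF g]])
  have "lim_zero X A C (n + k) i (\<lambda>z. ?g z \<ominus>\<^bsub>X\<^esub> h z)"
    using v(1) h(2) unfolding H_vanishes_def by blast
  then have "lim_zero X A B (n + k) i (\<lambda>z. ?g z \<ominus>\<^bsub>X\<^esub> h z)"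
    unfolding lim_zero_def cobnd_def using CB by blast
  then have "lim_zero X A B (n + k) i ?g"
  proof (rule lim_zero_mod[OF X B A gc cocycD(1)[OF h(2)] coch_zero[OF X A], rotated])
    fix z assume z: "z \<in> carrier (F (n + k) (Suc i))"
    have "(?g z \<ominus>\<^bsub>X\<^esub> \<zero>\<^bsub>X\<^esub>) \<ominus>\<^bsub>X\<^esub> (?g z \<ominus>\<^bsub>X\<^esub> h z) = h z"
      using coch_carrier[OF gc z] coch_carrier[OF h(1) z]
      by (simp add: B.diff_diff_self)
    then show "(?g z \<ominus>\<^bsub>X\<^esub> \<zero>\<^bsub>X\<^esub>) \<ominus>\<^bsub>X\<^esub> (?g z \<ominus>\<^bsub>X\<^esub> h z) \<in> B"
      using cochD(2)[OF h(1) z] by simp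
  qed
  then show "lim_zero X A B n i g"
    by (rule lim_zero_of_tr)
qed

text \<open>
  Exactness of \<open>H^i(A/B) \<rightarrow> H^(i+1)(B/C) \<rightarrow> H^(i+1)(A/C)\<close>: a cochain \<open>h\<close> whose coboundary is \<open>g\<close> is a cocycle
  for \<open>A/B\<close>, and correcting it by a coboundary moves its values into \<open>B\<close>.
\<close>

lemma lim_zero_sub:
  assumes AB: "subquot X A B" and BC: "subquot X B C"
    and v: "H_vanishes X A B i" and g: "cocyc X B C n (Suc i) g" and z: "lim_zero X A C n (Suc i) g"
  shows "lim_zero X B C n (Suc i) g"
proof -
  have X: "module R X" and C: "submodule C R X" and A: "submodule A R X" and B: "submodule B R X"
    and CB: "C \<subseteq> B" and BA: "B \<subseteq> A"
    using AB BC by (auto simp: subquot_def)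
  interpret B: submod R X B using X B by (simp add: submodI_locale)
  interpret C: submod R X C using X C by (simp add: submodI_locale)
  obtain k h where h: "coch X A (n + k) (Suc i) h"
    "\<And>z. z \<in> carrier (F (n + k) (Suc (Suc i))) \<Longrightarrow>
      g (tr n k (Suc (Suc i)) z) \<ominus>\<^bsub>X\<^esub> h (d (n + k) (Suc i) z) \<in> C"
    using z unfolding lim_zero_def cobnd_def by blast
  have hB: "h (d (n + k) (Suc i) z) \<in> B" if z: "z \<in> carrier (F (n + k) (Suc (Suc i)))" for z
  proof -
    have g1: "g (tr n k (Suc (Suc i)) z) \<in> B"
      using cochD(2)[OF cocycD(1)[OF g]] tr_carrier z by blast
    have "h (d (n + k) (Suc i) z) \<ominus>\<^bsub>X\<^esub> g (tr n k (Suc (Suc i)) z) \<in> B"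
      using CB h(2)[OF z] by (intro B.cong_sym[OF _ B.sub_carr[OF g1] coch_carrier[OF h(1) d_carrier[OF z]]]) auto
    then show ?thesis
      using g1 coch_carrier[OF h(1) d_carrier[OF z]] by (elim B.cong_mem) auto
  qed
  then have "cocyc X A B (n + k) i h"
    using h(1) unfolding cocyc_def by blast
  then obtain l h' where h': "coch X A (n + k + l) i h'"
    "\<And>z. z \<in> carrier (F (n + k + l) (Suc i)) \<Longrightarrow>
       h (tr (n + k) l (Suc i) z) \<ominus>\<^bsub>X\<^esub> h' (d (n + k + l) i z) \<in> B"
    using v unfolding H_vanishes_def lim_zero_def cobnd_def by blast
  let ?h = "\<lambda>z. h (tr (n + k) l (Suc i) z) \<ominus>\<^bsub>X\<^esub> h' (d (n + k + l) i z)"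
  have "coch X A (n + k + l) (Suc i) ?h"
    by (rule coch_diff[OF X A coch_tr[OF h(1)] coch_d[OF h'(1)]])
  then have "coch X B (n + k + l) (Suc i) ?h"
    using h'(2) unfolding coch_def by blast
  moreover have "g (tr n (k + l) (Suc (Suc i)) z) \<ominus>\<^bsub>X\<^esub> ?h (d (n + k + l) (Suc i) z) \<in> C"
    if z: "z \<in> carrier (F (n + k + l) (Suc (Suc i)))" for z
  proof -
    let ?w = "tr (n + k) l (Suc (Suc i)) z"
    have w: "?w \<in> carrier (F (n + k) (Suc (Suc i)))" using tr_carrier[OF z] .
    have "h' (d (n + k + l) i (d (n + k + l) (Suc i) z)) = \<zero>\<^bsub>X\<^esub>"
      using d_d[OF z] lin_zero[OF cochD(1)[OF h'(1)] F_module X] by simp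
    moreover have "h (tr (n + k) l (Suc i) (d (n + k + l) (Suc i) z)) = h (d (n + k) (Suc i) ?w)"
      using tr_d[OF z] by simp
    ultimately show ?thesis
      using h(2)[OF w] coch_carrier[OF h(1) d_carrier[OF w]] by (simp add: tr_tr)
  qed
  ultimately have "cobnd X B C (n + (k + l)) (Suc i) (\<lambda>z. g (tr n (k + l) (Suc (Suc i)) z))"
    unfolding cobnd_def add.assoc by blast
  then show ?thesis
    unfolding lim_zero_def by blast
qed

subsection \<open>Functoriality\<close>

lemma cocyc_push:
  assumes "lin R X Y f" "\<And>x. x \<in> A \<Longrightarrow> f x \<in> A'" "\<And>x. x \<in> B \<Longrightarrow> f x \<in> B'" "cocyc X A B n i g"
  shows "cocyc Y A' B' n i (\<lambda>z. f (g z))"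
  using assms coch_lin[OF assms(1,2)] unfolding cocyc_def by blast

lemma lim_zero_push:
  assumes X: "module R X" "module R Y" and f: "lin R X Y f"
    and A: "\<And>x. x \<in> A \<Longrightarrow> f x \<in> A'" and B: "\<And>x. x \<in> B \<Longrightarrow> f x \<in> B'"
    and g: "coch X A n (Suc i) g" and z: "lim_zero X A B n i g"
  shows "lim_zero Y A' B' n i (\<lambda>z. f (g z))"
proof -
  obtain k h where h: "coch X A (n + k) i h"
    "\<And>z. z \<in> carrier (F (n + k) (Suc i)) \<Longrightarrow> g (tr n k (Suc i) z) \<ominus>\<^bsub>X\<^esub> h (d (n + k) i z) \<in> B"
    using z unfolding lim_zero_def cobnd_def by blast
  have "f (g (tr n k (Suc i) z)) \<ominus>\<^bsub>Y\<^esub> f (h (d (n + k) i z)) \<in> B'"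
    if "z \<in> carrier (F (n + k) (Suc i))" for z
    using B[OF h(2)[OF that]] that coch_carrier[OF g tr_carrier] coch_carrier[OF h(1) d_carrier]
    by (simp add: lin_diff[OF f X])
  then show ?thesis
    unfolding lim_zero_def cobnd_def using coch_lin[OF f A h(1)] by blast
qed

definition subquot_iso ::
  "('a, 'x, 'm) module_scheme \<Rightarrow> 'x set \<Rightarrow> 'x set \<Rightarrow> ('a, 'y, 'n) module_scheme \<Rightarrow> 'y set \<Rightarrow> 'y set \<Rightarrow>
    ('x \<Rightarrow> 'y) \<Rightarrow> bool" where
  "subquot_iso X A B Y A' B' f \<longleftrightarrow> lin R X Y f \<and> (\<forall>x\<in>A. f x \<in> A') \<and>
     (\<forall>y\<in>A'. \<exists>x\<in>A. f x \<ominus>\<^bsub>Y\<^esub> y \<in> B') \<and> (\<forall>x\<in>A. f x \<in> B' \<longleftrightarrow> x \<in> B)"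

lemma coch_lift:
  assumes X: "module R X" "submodule A R X" and Y: "module R Y" "submodule B' R Y"
    and f: "lin R X Y f" and onto: "\<And>y. y \<in> A' \<Longrightarrow> \<exists>x\<in>A. f x \<ominus>\<^bsub>Y\<^esub> y \<in> B'"
    and g: "coch Y A' n i g"
  shows "\<exists>h. coch X A n i h \<and> (\<forall>z\<in>carrier (F n i). f (h z) \<ominus>\<^bsub>Y\<^esub> g z \<in> B')"
proof -
  have "\<exists>x\<in>A. f x \<ominus>\<^bsub>Y\<^esub> g v \<in> B'" if "v \<in> carrier (F n i)" for v
    by (rule onto[OF cochD(2)[OF g that]])
  from free_lift_mod[OF X(1) Y(1) f X(2) Y(2) cochD(1)[OF g] this]
  obtain h where "lin R (F n i) X h" "\<forall>v\<in>carrier (F n i). h v \<in> A \<and> f (h v) \<ominus>\<^bsub>Y\<^esub> g v \<in> B'"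
    by blast
  then show ?thesis
    by (intro exI[of _ h]) (simp add: coch_def)
qed

lemma lim_zero_reflect:
  assumes X: "subquot X A B" and Y: "subquot Y A' B'" and iso: "subquot_iso X A B Y A' B' f"
    and g: "coch X A n (Suc i) g" and z: "lim_zero Y A' B' n i (\<lambda>z. f (g z))"
  shows "lim_zero X A B n i g"
proof -
  have XA: "module R X" "submodule A R X" and YB: "module R Y" "submodule B' R Y"
    using X Y by (auto simp: subquot_def)
  have f: "lin R X Y f" and onto: "\<And>y. y \<in> A' \<Longrightarrow> \<exists>x\<in>A. f x \<ominus>\<^bsub>Y\<^esub> y \<in> B'"
    and ker: "\<And>x. x \<in> A \<Longrightarrow> f x \<in> B' \<Longrightarrow> x \<in> B"
    using iso unfolding subquot_iso_def by blast+
  interpret A: submod R X A using XA by (simp add: submodI_locale)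
  interpret B': submod R Y B' using YB by (simp add: submodI_locale)
  obtain k h where h: "coch Y A' (n + k) i h"
    "\<And>z. z \<in> carrier (F (n + k) (Suc i)) \<Longrightarrow> f (g (tr n k (Suc i) z)) \<ominus>\<^bsub>Y\<^esub> h (d (n + k) i z) \<in> B'"
    using z unfolding lim_zero_def cobnd_def by blast
  obtain h' where h': "coch X A (n + k) i h'"
    "\<And>z. z \<in> carrier (F (n + k) i) \<Longrightarrow> f (h' z) \<ominus>\<^bsub>Y\<^esub> h z \<in> B'"
    using coch_lift[OF XA YB f onto h(1)] by blast
  have "g (tr n k (Suc i) z) \<ominus>\<^bsub>X\<^esub> h' (d (n + k) i z) \<in> B"
    if z: "z \<in> carrier (F (n + k) (Suc i))" for z
  proof (rule ker)
    have w: "tr n k (Suc i) z \<in> carrier (F n (Suc i))" and dz: "d (n + k) i z \<in> carrier (F (n + k) i)"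
      using z tr_carrier d_carrier by auto
    note c = coch_carrier[OF g w] coch_carrier[OF h(1) dz] coch_carrier[OF h'(1) dz]
    show "g (tr n k (Suc i) z) \<ominus>\<^bsub>X\<^esub> h' (d (n + k) i z) \<in> A"
      using cochD(2)[OF g w] cochD(2)[OF h'(1) dz] by (rule A.sub_minus)
    have "f (g (tr n k (Suc i) z)) \<ominus>\<^bsub>Y\<^esub> f (h' (d (n + k) i z)) \<in> B'"
      using B'.cong_trans[OF h(2)[OF z] B'.cong_sym[OF h'(2)[OF dz]]] c lin_closed[OF f] by simp
    then show "f (g (tr n k (Suc i) z) \<ominus>\<^bsub>X\<^esub> h' (d (n + k) i z)) \<in> B'"
      using c by (simp add: lin_diff[OF f XA(1) YB(1)])
  qed
  then show ?thesis
    unfolding lim_zero_def cobnd_def using h'(1) by blast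
qed

lemma cocyc_lift:
  assumes X: "subquot X A B" and Y: "subquot Y A' B'" and iso: "subquot_iso X A B Y A' B' f"
    and g: "cocyc Y A' B' n i g"
  shows "\<exists>h. cocyc X A B n i h \<and> (\<forall>z\<in>carrier (F n (Suc i)). f (h z) \<ominus>\<^bsub>Y\<^esub> g z \<in> B')"
proof -
  have XA: "module R X" "submodule A R X" and YB: "module R Y" "submodule B' R Y"
    using X Y by (auto simp: subquot_def)
  have f: "lin R X Y f" and onto: "\<And>y. y \<in> A' \<Longrightarrow> \<exists>x\<in>A. f x \<ominus>\<^bsub>Y\<^esub> y \<in> B'"
    and ker: "\<And>x. x \<in> A \<Longrightarrow> f x \<in> B' \<Longrightarrow> x \<in> B"
    using iso unfolding subquot_iso_def by blast+
  interpret B': submod R Y B' using YB by (simp add: submodI_locale)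
  obtain h where h: "coch X A n (Suc i) h" "\<And>z. z \<in> carrier (F n (Suc i)) \<Longrightarrow> f (h z) \<ominus>\<^bsub>Y\<^esub> g z \<in> B'"
    using coch_lift[OF XA YB f onto cocycD(1)[OF g]] by blast
  have "h (d n (Suc i) z) \<in> B" if z: "z \<in> carrier (F n (Suc (Suc i)))" for z
  proof (rule ker)
    show "h (d n (Suc i) z) \<in> A"
      using cochD(2)[OF h(1)] d_carrier z by blast
    show "f (h (d n (Suc i) z)) \<in> B'"
      using h(2)[OF d_carrier[OF z]] cocycD(2)[OF g z] lin_closed[OF f] coch_carrier[OF h(1) d_carrier[OF z]]
      by (elim B'.cong_mem) auto
  qed
  then show ?thesis
    using h unfolding cocyc_def by blast
qed

lemma H_vanishes_iso:
  assumes X: "subquot X A B" and Y: "subquot Y A' B'" and iso: "subquot_iso X A B Y A' B' f"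
  shows "H_vanishes X A B i \<longleftrightarrow> H_vanishes Y A' B' i"
proof
  have XA: "module R X" "submodule A R X" "submodule B R X" "B \<subseteq> A"
    and YB: "module R Y" "submodule A' R Y" "submodule B' R Y" "B' \<subseteq> A'"
    using X Y by (auto simp: subquot_def)
  have f: "lin R X Y f" and fA: "\<And>x. x \<in> A \<Longrightarrow> f x \<in> A'" and fB: "\<And>x. x \<in> B \<Longrightarrow> f x \<in> B'"
    using iso XA(4) unfolding subquot_iso_def by blast+
  show "H_vanishes X A B i" if v: "H_vanishes Y A' B' i"
    unfolding H_vanishes_def
  proof (intro allI impI)
    fix n g assume g: "cocyc X A B n i g"
    have "lim_zero Y A' B' n i (\<lambda>z. f (g z))"
      using v cocyc_push[OF f fA fB g] unfolding H_vanishes_def by blast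
    then show "lim_zero X A B n i g"
      using lim_zero_reflect[OF X Y iso cocycD(1)[OF g]] by blast
  qed
  show "H_vanishes Y A' B' i" if v: "H_vanishes X A B i"
    unfolding H_vanishes_def
  proof (intro allI impI)
    interpret B': submod R Y B' using YB by (simp add: submodI_locale)
    fix n g assume g: "cocyc Y A' B' n i g"
    obtain h where h: "cocyc X A B n i h" "\<And>z. z \<in> carrier (F n (Suc i)) \<Longrightarrow> f (h z) \<ominus>\<^bsub>Y\<^esub> g z \<in> B'"
      using cocyc_lift[OF X Y iso g] by blast
    have "lim_zero X A B n i h"
      using v h(1) unfolding H_vanishes_def by blast
    then have fz: "lim_zero Y A' B' n i (\<lambda>z. f (h z))"
      using lim_zero_push[OF XA(1) YB(1) f _ _ cocycD(1)[OF h(1)]] fA fB by blast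
    have fh: "coch Y A' n (Suc i) (\<lambda>z. f (h z))"
      using coch_lin[OF f _ cocycD(1)[OF h(1)]] fA by blast
    show "lim_zero Y A' B' n i g"
    proof (rule lim_zero_mod[OF YB(1,3,2) cocycD(1)[OF g] fh coch_zero[OF YB(1,2)] _ fz])
      fix z assume z: "z \<in> carrier (F n (Suc i))"
      have "g z \<ominus>\<^bsub>Y\<^esub> \<zero>\<^bsub>Y\<^esub> = g z"
        using cocyc_carrier[OF g z] by simp
      then show "(g z \<ominus>\<^bsub>Y\<^esub> \<zero>\<^bsub>Y\<^esub>) \<ominus>\<^bsub>Y\<^esub> f (h z) \<in> B'"
        using B'.cong_sym[OF h(2)[OF z]] cocyc_carrier[OF g z] lin_closed[OF f cocyc_carrier[OF h(1) z]]
        by simp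
    qed
  qed
qed

text \<open>The cyclic module \<open>(D + Rx)/D\<close> is \<open>R/(D : x)\<close>.\<close>

lemma cyclic_iso:
  assumes X: "module R X" and D: "submodule D R X" and x: "x \<in> carrier X"
  shows "subquot (regular_module R) (carrier R) (quot_ideal R X D x)"
    and "subquot X (adjoin R X D x) D"
    and "subquot_iso (regular_module R) (carrier R) (quot_ideal R X D x) X (adjoin R X D x) D
      (\<lambda>r. r \<odot>\<^bsub>X\<^esub> x)"
proof -
  interpret X: module R X by fact
  interpret D: submod R X D using X D by (simp add: submodI_locale)
  interpret Reg: module R "regular_module R" by (rule regular_module_module)
  show "subquot (regular_module R) (carrier R) (quot_ideal R X D x)"
    using quot_ideal_ideal[OF X D x] Reg.carrier_is_submodule regular_module_module
    by (auto simp: subquot_def ideal_submodule_iff quot_ideal_def)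
  show "subquot X (adjoin R X D x) D"
    using X D X.adjoin_submodule[OF D x] X.adjoin_superset[OF D x] by (simp add: subquot_def)
  have "r \<odot>\<^bsub>X\<^esub> x \<in> adjoin R X D x" if "r \<in> carrier R" for r
    unfolding adjoin_def using that x by (auto intro!: exI[of _ "\<zero>\<^bsub>X\<^esub>"] exI[of _ r])
  moreover have "\<exists>r\<in>carrier R. r \<odot>\<^bsub>X\<^esub> x \<ominus>\<^bsub>X\<^esub> y \<in> D" if y: "y \<in> adjoin R X D x" for y
  proof -
    obtain u r where ur: "y = u \<oplus>\<^bsub>X\<^esub> r \<odot>\<^bsub>X\<^esub> x" "u \<in> D" "r \<in> carrier R"
      using y unfolding adjoin_def by blast
    then have "r \<odot>\<^bsub>X\<^esub> x \<ominus>\<^bsub>X\<^esub> y = \<ominus>\<^bsub>X\<^esub> u"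
      using x by (simp add: X.M.minus_eq X.M.minus_add X.M.a_ac X.M.r_neg X.M.r_neg1 X.M.r_neg2)
    then have "r \<odot>\<^bsub>X\<^esub> x \<ominus>\<^bsub>X\<^esub> y \<in> D"
      using ur(2) D.sub_neg by simp
    then show ?thesis
      using ur(3) by blast
  qed
  ultimately show "subquot_iso (regular_module R) (carrier R) (quot_ideal R X D x) X (adjoin R X D x) D
      (\<lambda>r. r \<odot>\<^bsub>X\<^esub> x)"
    using lin_scalars[OF X x] by (auto simp: subquot_iso_def quot_ideal_def)
qed

text \<open>
  Adding generators of \<open>A\<close> to \<open>B\<close> one by one gives a filtration of \<open>A/B\<close> whose quotients are cyclic
  modules \<open>R/J\<close> with \<open>J \<supseteq> K\<close>.
\<close>

lemma H_vanishes_fg: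
  assumes X: "module R X" and B: "submodule B R X" and fg: "fg_over R X B A"
    and K: "\<And>r x. r \<in> K \<Longrightarrow> x \<in> A \<Longrightarrow> r \<odot>\<^bsub>X\<^esub> x \<in> B" "K \<subseteq> carrier R"
    and v: "\<And>J. ideal J R \<Longrightarrow> K \<subseteq> J \<Longrightarrow> H_vanishes (regular_module R) (carrier R) J i"
  shows "H_vanishes X A B i"
proof -
  interpret X: module R X by fact
  show ?thesis
    using B fg
  proof (induction rule: X.fg_over_induct)
    case base
    have "cocyc X B B n i g \<Longrightarrow> lim_zero X B B n i g" for n g
      by (rule cobnd_imp_lim_zero, rule cobnd_of_values[OF X B])
        (auto dest: cocycD(1) simp: coch_def)
    then show ?case
      unfolding H_vanishes_def by blast
  next
    case (adjoin D x)
    note iso = cyclic_iso[OF X adjoin.hyps(1,5)]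
    have "K \<subseteq> quot_ideal R X D x"
      using K adjoin.hyps unfolding quot_ideal_def by blast
    then have "H_vanishes (regular_module R) (carrier R) (quot_ideal R X D x) i"
      using v quot_ideal_ideal[OF X adjoin.hyps(1,5)] by blast
    then have "H_vanishes X (adjoin R X D x) D i"
      using H_vanishes_iso[OF iso] by blast
    then show ?case
      using H_vanishes_extension[OF iso(2) _ _ adjoin.IH] X B adjoin.hyps(1,2)
      by (auto simp: subquot_def)
  qed
qed

text \<open>
  Multiplication by \<open>r \<in> I n\<close> lifts the zero map of \<open>R/I n\<close>, so it is null-homotopic; hence \<open>I n\<close>
  kills the cohomology of the term \<open>n\<close>.
\<close>

lemma torsion_homotopy:
  assumes r: "r \<in> I n"
  shows "\<exists>h h'. lin R (F n i) (F n (Suc i)) h \<and> lin R (F n (Suc i)) (F n (Suc (Suc i))) h' \<and>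
    (\<forall>z\<in>carrier (F n (Suc i)). d n (Suc i) (h' z) \<oplus>\<^bsub>F n (Suc i)\<^esub> h (d n i z) = r \<odot>\<^bsub>F n (Suc i)\<^esub> z)"
proof (induction i)
  have rR: "r \<in> carrier R"
    using r I_ideal ideal.Icarr by metis
  case 0
  interpret F1: module R "F n (Suc 0)" by (rule F_module)
  have "\<rho> n (r \<odot>\<^bsub>F n (Suc 0)\<^esub> z) \<in> I n" if "z \<in> carrier (F n (Suc 0))" for z
    using lin_smult[OF \<rho>_lin rR that] lin_closed[OF \<rho>_lin that] ideal.I_r_closed[OF I_ideal r] by simp
  then have "\<exists>w\<in>carrier (F n (Suc (Suc 0))). d n (Suc 0) w = r \<odot>\<^bsub>F n (Suc 0)\<^esub> z"
    if "z \<in> carrier (F n (Suc 0))" for z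
    using that rR by (intro \<rho>_exact) auto
  then obtain h' where h': "lin R (F n (Suc 0)) (F n (Suc (Suc 0))) h'"
    "\<And>z. z \<in> carrier (F n (Suc 0)) \<Longrightarrow> d n (Suc 0) (h' z) = r \<odot>\<^bsub>F n (Suc 0)\<^esub> z"
    using free_lift_onto[OF F_module F_module d_lin lin_smult_self[OF F_module rR]] by metis
  show ?case
    using h' rR lin_const_zero[OF F_module]
    by (intro exI[of _ "\<lambda>_. \<zero>\<^bsub>F n (Suc 0)\<^esub>"] exI[of _ h']) auto
next
  have rR: "r \<in> carrier R"
    using r I_ideal ideal.Icarr by metis
  case (Suc i)
  then obtain h h' where h: "lin R (F n i) (F n (Suc i)) h" "lin R (F n (Suc i)) (F n (Suc (Suc i))) h'"
    "\<And>z. z \<in> carrier (F n (Suc i)) \<Longrightarrow>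
      d n (Suc i) (h' z) \<oplus>\<^bsub>F n (Suc i)\<^esub> h (d n i z) = r \<odot>\<^bsub>F n (Suc i)\<^esub> z"
    by blast
  interpret F1: module R "F n (Suc i)" by (rule F_module)
  interpret F2: module R "F n (Suc (Suc i))" by (rule F_module)
  let ?g = "\<lambda>z. r \<odot>\<^bsub>F n (Suc (Suc i))\<^esub> z \<ominus>\<^bsub>F n (Suc (Suc i))\<^esub> h' (d n (Suc i) z)"
  have g: "lin R (F n (Suc (Suc i))) (F n (Suc (Suc i))) ?g"
    by (intro lin_pointwise_diff lin_smult_self lin_comp[OF d_lin h(2)] F_module rR)
  have "d n (Suc i) (?g z) = \<zero>\<^bsub>F n (Suc i)\<^esub>" if z: "z \<in> carrier (F n (Suc (Suc i)))" for z
  proof -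
    have dz: "d n (Suc i) z \<in> carrier (F n (Suc i))" by (rule d_carrier[OF z])
    have "h (d n i (d n (Suc i) z)) = \<zero>\<^bsub>F n (Suc i)\<^esub>"
      using d_d[OF z] lin_zero[OF h(1) F_module F_module] by simp
    then have "d n (Suc i) (h' (d n (Suc i) z)) = r \<odot>\<^bsub>F n (Suc i)\<^esub> d n (Suc i) z"
      using h(3)[OF dz] d_carrier[OF lin_closed[OF h(2) dz]] by simp
    then show ?thesis
      using z rR dz lin_closed[OF h(2) dz]
      by (simp add: lin_diff[OF d_lin F_module F_module] lin_smult[OF d_lin] F1.minus_eq_zero_iff)
  qed
  then have "\<exists>w\<in>carrier (F n (Suc (Suc (Suc i)))). d n (Suc (Suc i)) w = ?g z"
    if "z \<in> carrier (F n (Suc (Suc i)))" for z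
    using that lin_closed[OF g that] by (intro d_exact) auto
  then obtain h'' where h'': "lin R (F n (Suc (Suc i))) (F n (Suc (Suc (Suc i)))) h''"
    "\<And>z. z \<in> carrier (F n (Suc (Suc i))) \<Longrightarrow> d n (Suc (Suc i)) (h'' z) = ?g z"
    using free_lift_onto[OF F_module F_module d_lin g] by metis
  have "d n (Suc (Suc i)) (h'' z) \<oplus>\<^bsub>F n (Suc (Suc i))\<^esub> h' (d n (Suc i) z) = r \<odot>\<^bsub>F n (Suc (Suc i))\<^esub> z"
    if z: "z \<in> carrier (F n (Suc (Suc i)))" for z
    using h''(2)[OF z] lin_closed[OF h(2) d_carrier[OF z]] z rR
    by (simp add: F2.add_minus_cancel F2.M.a_comm)
  then show ?case
    using h(2) h''(1) by blast
qed

lemma I_kills_cohomology: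
  assumes X: "subquot X A B" and g: "cocyc X A B n i g" and r: "r \<in> I n"
  shows "cobnd X A B n i (\<lambda>z. r \<odot>\<^bsub>X\<^esub> g z)"
proof -
  have XA: "module R X" "submodule B R X" using X by (auto simp: subquot_def)
  interpret B: submod R X B using XA by (simp add: submodI_locale)
  have rR: "r \<in> carrier R"
    using r I_ideal ideal.Icarr by metis
  interpret F1: module R "F n (Suc i)" by (rule F_module)
  obtain h h' where h: "lin R (F n i) (F n (Suc i)) h" "lin R (F n (Suc i)) (F n (Suc (Suc i))) h'"
    "\<And>z. z \<in> carrier (F n (Suc i)) \<Longrightarrow>
      d n (Suc i) (h' z) \<oplus>\<^bsub>F n (Suc i)\<^esub> h (d n i z) = r \<odot>\<^bsub>F n (Suc i)\<^esub> z"
    using torsion_homotopy[OF r, of i] by blast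
  note gl = cochD(1)[OF cocycD(1)[OF g]]
  have "coch X A n i (\<lambda>z. g (h z))"
    using lin_comp[OF h(1) gl] lin_closed[OF h(1)] cochD(2)[OF cocycD(1)[OF g]] unfolding coch_def by blast
  moreover have "r \<odot>\<^bsub>X\<^esub> g z \<ominus>\<^bsub>X\<^esub> g (h (d n i z)) \<in> B" if z: "z \<in> carrier (F n (Suc i))" for z
  proof -
    note c = lin_closed[OF h(1) d_carrier[OF z]] lin_closed[OF h(2) z]
      d_carrier[OF lin_closed[OF h(2) z]]
    have "r \<odot>\<^bsub>X\<^esub> g z = g (d n (Suc i) (h' z)) \<oplus>\<^bsub>X\<^esub> g (h (d n i z))"
      using h(3)[OF z] lin_smult[OF gl rR z] lin_add[OF gl c(3,1)] by simp
    then have "r \<odot>\<^bsub>X\<^esub> g z \<ominus>\<^bsub>X\<^esub> g (h (d n i z)) = g (d n (Suc i) (h' z))"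
      using c lin_closed[OF gl] by (simp add: B.add_diff_cancel)
    then show ?thesis
      using cocycD(2)[OF g c(2)] by simp
  qed
  ultimately show ?thesis
    unfolding cobnd_def by blast
qed


section \<open>Torsion modules have no higher cohomology\<close>

lemma I_subset: "m \<le> n \<Longrightarrow> I n \<subseteq> I m"
  using I_decseq[of m "n - m"] by simp

lemma pow_in_I: "x \<in> \<aa> \<Longrightarrow> x [^] Suc n \<in> I n"
proof (induction n)
  case 0
  then show ?case
    using ideal.Icarr[OF ideal_a] by (simp add: I_0)
next
  case (Suc n)
  then have "x [^] Suc n \<otimes> x \<in> I (Suc n)"
    unfolding I_Suc by (intro ideal_prod.prod) auto
  then show ?case by simp
qed

lemma colon_mono:
  assumes "ideal J R" "x \<in> carrier R" "w \<in> carrier R"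
  shows "quot_ideal R (regular_module R) J w \<subseteq> quot_ideal R (regular_module R) J (x \<otimes> w)"
proof
  fix r assume r: "r \<in> quot_ideal R (regular_module R) J w"
  then have "r \<otimes> (x \<otimes> w) = x \<otimes> (r \<otimes> w)"
    using assms by (simp add: quot_ideal_def m_lcomm)
  then show "r \<in> quot_ideal R (regular_module R) J (x \<otimes> w)"
    using r assms ideal.I_l_closed[OF assms(1), of "r \<otimes> w" x] by (simp add: quot_ideal_def)
qed

text \<open>
  Suppose not, and choose \<open>J : w\<close> maximal among the ideals of this form that contain no power of \<open>\<aa>\<close>.
  For \<open>x \<in> \<aa>\<close>, going down from a power of \<open>x\<close>
  in \<open>J\<close>, maximality shows that \<open>J : xw\<close> contains a power of \<open>\<aa>\<close>. As \<open>\<aa>\<close> is finitely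
  generated, one power serves for all \<open>x\<close>, so that the next power lies in \<open>J : w\<close>.
\<close>

lemma power_subset_of_radical:
  assumes J: "ideal J R" and rad: "\<And>x. x \<in> \<aa> \<Longrightarrow> \<exists>k::nat. x [^] k \<in> J"
  shows "\<exists>n. I n \<subseteq> J"
proof (rule ccontr)
  assume no: "\<not> (\<exists>n. I n \<subseteq> J)"
  let ?c = "quot_ideal R (regular_module R) J"
  let ?Bad = "{w \<in> carrier R. \<not> (\<exists>n. I n \<subseteq> ?c w)}"
  interpret J: ideal J R by fact
  have JS: "submodule J R (regular_module R)" using J by (simp add: ideal_submodule_iff)
  have ci: "ideal (?c w) R" if "w \<in> carrier R" for w
    using quot_ideal_ideal[OF regular_module_module JS] that by simp
  have "?c \<one> = J"
    unfolding quot_ideal_def using J.Icarr by auto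
  then have "?Bad \<noteq> {}" using no by auto
  then obtain w where w: "w \<in> carrier R" "\<not> (\<exists>n. I n \<subseteq> ?c w)"
    and max: "\<And>w'. w' \<in> ?Bad \<Longrightarrow> ?c w \<subseteq> ?c w' \<Longrightarrow> ?c w' = ?c w"
  proof -
    have "?c ` ?Bad \<noteq> {}" using \<open>?Bad \<noteq> {}\<close> by blast
    moreover have "ideal K R" if "K \<in> ?c ` ?Bad" for K using that ci by blast
    ultimately obtain K where K: "K \<in> ?c ` ?Bad" "\<forall>L\<in>?c ` ?Bad. K \<subseteq> L \<longrightarrow> L = K"
      using ideal_maximal_element[of "?c ` ?Bad"] by meson
    then obtain w where w: "w \<in> ?Bad" "K = ?c w" by blast
    have max: "?c w' = ?c w" if "w' \<in> ?Bad" "?c w \<subseteq> ?c w'" for w'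
      using K(2) that imageI[OF that(1), of ?c] unfolding w(2) by simp
    show ?thesis
      by (rule that[OF _ _ max]) (use w(1) in simp_all)
  qed
  have x_step: "\<exists>n. \<forall>r\<in>I n. r \<otimes> x \<in> ?c w" if x: "x \<in> \<aa>" for x
  proof -
    have xR: "x \<in> carrier R" using x ideal.Icarr[OF ideal_a] by blast
    have "(\<exists>n. I n \<subseteq> ?c (x [^] k \<otimes> w)) \<Longrightarrow> \<exists>n. \<forall>r\<in>I n. r \<otimes> x \<in> ?c w" for k :: nat
    proof (induction k)
      case 0
      then show ?case using w by simp
    next
      case (Suc k)
      show ?case
      proof (cases "\<exists>n. I n \<subseteq> ?c (x [^] k \<otimes> w)")
        case True
        then show ?thesis by (rule Suc.IH)
      next
        case False
        have kc: "?c (x [^] k \<otimes> w) = ?c w"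
          using False xR w(1) colon_mono[OF J, of "x [^] k" w] by (intro max) auto
        obtain n where n: "I n \<subseteq> ?c (x [^] Suc k \<otimes> w)" using Suc.prems by blast
        have "r \<otimes> x \<in> ?c (x [^] k \<otimes> w)" if r: "r \<in> I n" for r
        proof -
          have rR: "r \<in> carrier R" using r ideal.Icarr[OF I_ideal] by blast
          have "(r \<otimes> x) \<otimes> (x [^] k \<otimes> w) = r \<otimes> (x [^] Suc k \<otimes> w)"
            using rR xR w(1) by (simp add: m_assoc m_lcomm m_comm)
          then show ?thesis
            using n r rR xR unfolding quot_ideal_def by auto
        qed
        then show ?thesis using kc by auto
      qed
    qed
    moreover obtain k where k: "x [^] (k::nat) \<in> J" using rad[OF x] by blast
    have "I 0 \<subseteq> ?c (x [^] k \<otimes> w)"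
      unfolding quot_ideal_def using ideal.Icarr[OF I_ideal] J.I_r_closed[OF k w(1)] J.I_l_closed by auto
    ultimately show ?thesis by blast
  qed
  obtain S where S: "finite S" "S \<subseteq> \<aa>" "\<And>K. ideal K R \<Longrightarrow> S \<subseteq> K \<Longrightarrow> \<aa> \<subseteq> K"
    using ideal_fg[OF ideal_a] by blast
  obtain nn where nn: "\<And>x. x \<in> S \<Longrightarrow> \<forall>r\<in>I (nn x). r \<otimes> x \<in> ?c w"
    using x_step S(2) by (metis subsetD)
  define n where "n = Max (insert 0 (nn ` S))"
  have rx: "r \<otimes> x \<in> ?c w" if "r \<in> I n" "x \<in> S" for r x
    using that nn[OF that(2)] S(1) I_subset[of "nn x" n] by (auto simp: n_def)
  have rxa: "r \<otimes> x \<in> ?c w" if r: "r \<in> I n" and x: "x \<in> \<aa>" for r x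
  proof -
    have rR: "r \<in> carrier R" using r ideal.Icarr[OF I_ideal] by blast
    have "submodule (?c w) R (regular_module R)"
      using ci[OF w(1)] by (simp add: ideal_submodule_iff)
    then have "ideal (quot_ideal R (regular_module R) (?c w) r) R"
      using quot_ideal_ideal[OF regular_module_module] rR by simp
    moreover have "S \<subseteq> quot_ideal R (regular_module R) (?c w) r"
    proof
      fix x assume x: "x \<in> S"
      then have xR: "x \<in> carrier R" using S(2) ideal.Icarr[OF ideal_a] by blast
      have "x \<otimes> r \<in> ?c w" using rx[OF r x] m_comm[OF rR xR] by simp
      then show "x \<in> quot_ideal R (regular_module R) (?c w) r"
        using xR by (simp add: quot_ideal_def[of _ _ "?c w"])
    qed
    ultimately have "\<aa> \<subseteq> quot_ideal R (regular_module R) (?c w) r"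
      by (rule S(3))
    then have "x \<otimes> r \<in> ?c w"
      using x unfolding quot_ideal_def[of _ _ "?c w"] by auto
    then show ?thesis
      using m_comm[OF rR ideal.Icarr[OF ideal_a x]] by simp
  qed
  have "I (Suc n) \<subseteq> ?c w"
  proof
    fix s assume "s \<in> I (Suc n)"
    then show "s \<in> ?c w"
      unfolding I_Suc
      by (induction rule: ideal_prod.induct)
        (use rxa additive_subgroup.a_closed[OF ideal.axioms(1)[OF ci[OF w(1)]]] in auto)
  qed
  then show False using w(2) by blast
qed

definition torsion :: "('a, 'x, 'm) module_scheme \<Rightarrow> 'x set \<Rightarrow> 'x set \<Rightarrow> bool" where
  "torsion X A B \<longleftrightarrow> (\<forall>v\<in>A. \<exists>n. \<forall>r\<in>I n. r \<odot>\<^bsub>X\<^esub> v \<in> B)"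

text \<open>
  For a cocycle \<open>g\<close>, the rule \<open>d z \<mapsto> g z\<close> is a partial homomorphism from the free module to \<open>A/B\<close>.
  The relation \<open>W\<close> below is a maximal partial homomorphism extending it; equivalently, dividing \<open>A \<oplus> F\<close> by
  \<open>W\<close> gives an essential extension of \<open>A/B\<close>. An essential extension of a torsion module over a
  Noetherian ring is torsion: for \<open>x \<in> \<aa>\<close> and an element \<open>v\<close>, the annihilators of the elements
  \<open>x^k v\<close> become constant, and then a non-zero multiple of \<open>x^k v\<close> in \<open>A/B\<close>, being killed by a power of
  \<open>x\<close>, would have to be zero.
\<close>

lemma maximal_partial_hom:
  assumes X: "subquot X A B" and tor: "torsion X A B" and g: "cocyc X A B n (Suc i) g"
  shows "\<exists>W. linrel R X (F n (Suc i)) W \<and> W \<subseteq> A \<times> carrier (F n (Suc i)) \<and>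
    (\<forall>z\<in>carrier (F n (Suc (Suc i))). (g z, d n (Suc i) z) \<in> W) \<and>
    (\<forall>x. (x, \<zero>\<^bsub>F n (Suc i)\<^esub>) \<in> W \<longrightarrow> x \<in> B) \<and>
    (\<forall>y\<in>carrier (F n (Suc i)). \<exists>m. \<forall>r\<in>I m. (\<zero>\<^bsub>X\<^esub>, r \<odot>\<^bsub>F n (Suc i)\<^esub> y) \<in> W)"
proof -
  have XM: "module R X" and AS: "submodule A R X" and BS: "submodule B R X" and BA: "B \<subseteq> A"
    using X by (auto simp: subquot_def)
  let ?Y = "F n (Suc i)"
  let ?Z = "F n (Suc (Suc i))"
  interpret A: submod R X A using XM AS by (simp add: submodI_locale)
  interpret B: submod R X B using XM BS by (simp add: submodI_locale)
  interpret Y: module R ?Y by (rule F_module)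
  interpret Z: module R ?Z by (rule F_module)
  note gl = cochD(1)[OF cocycD(1)[OF g]]
  note gA = cochD(2)[OF cocycD(1)[OF g]]
  define W0 where "W0 = {(g z \<oplus>\<^bsub>X\<^esub> b, d n (Suc i) z) | z b. z \<in> carrier ?Z \<and> b \<in> B}"
  have W0: "linrel R X ?Y W0"
    unfolding linrel_def
  proof (intro conjI allI impI ballI)
    show "W0 \<subseteq> carrier X \<times> carrier ?Y"
      unfolding W0_def using gA d_carrier by auto
    show "(\<zero>\<^bsub>X\<^esub>, \<zero>\<^bsub>?Y\<^esub>) \<in> W0"
      unfolding W0_def using lin_zero[OF gl Z.module_axioms XM] lin_zero[OF d_lin Z.module_axioms Y.module_axioms]
      by (auto intro!: exI[of _ "\<zero>\<^bsub>?Z\<^esub>"] exI[of _ "\<zero>\<^bsub>X\<^esub>"])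
  next
    fix x y x' y' assume "(x, y) \<in> W0" "(x', y') \<in> W0"
    then obtain z b z' b' where *: "x = g z \<oplus>\<^bsub>X\<^esub> b" "y = d n (Suc i) z" "z \<in> carrier ?Z" "b \<in> B"
      "x' = g z' \<oplus>\<^bsub>X\<^esub> b'" "y' = d n (Suc i) z'" "z' \<in> carrier ?Z" "b' \<in> B"
      unfolding W0_def by blast
    have "x \<oplus>\<^bsub>X\<^esub> x' = g (z \<oplus>\<^bsub>?Z\<^esub> z') \<oplus>\<^bsub>X\<^esub> (b \<oplus>\<^bsub>X\<^esub> b')"
      using * gA by (simp add: lin_add[OF gl] A.M.a_ac)
    moreover have "y \<oplus>\<^bsub>?Y\<^esub> y' = d n (Suc i) (z \<oplus>\<^bsub>?Z\<^esub> z')"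
      using * by (simp add: lin_add[OF d_lin])
    ultimately show "(x \<oplus>\<^bsub>X\<^esub> x', y \<oplus>\<^bsub>?Y\<^esub> y') \<in> W0"
      unfolding W0_def using * B.sub_add by blast
  next
    fix r x y assume r: "r \<in> carrier R" and "(x, y) \<in> W0"
    then obtain z b where *: "x = g z \<oplus>\<^bsub>X\<^esub> b" "y = d n (Suc i) z" "z \<in> carrier ?Z" "b \<in> B"
      unfolding W0_def by blast
    have "r \<odot>\<^bsub>X\<^esub> x = g (r \<odot>\<^bsub>?Z\<^esub> z) \<oplus>\<^bsub>X\<^esub> r \<odot>\<^bsub>X\<^esub> b"
      using * r gA by (simp add: lin_smult[OF gl] A.smult_r_distr)
    moreover have "r \<odot>\<^bsub>?Y\<^esub> y = d n (Suc i) (r \<odot>\<^bsub>?Z\<^esub> z)"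
      using * r by (simp add: lin_smult[OF d_lin])
    moreover have "r \<odot>\<^bsub>?Z\<^esub> z \<in> carrier ?Z" "r \<odot>\<^bsub>X\<^esub> b \<in> B"
      using * r B.sub_smult by auto
    ultimately show "(r \<odot>\<^bsub>X\<^esub> x, r \<odot>\<^bsub>?Y\<^esub> y) \<in> W0"
      unfolding W0_def by blast
  qed
  define \<W> where "\<W> = {W. linrel R X ?Y W \<and> W \<subseteq> A \<times> carrier ?Y \<and> W0 \<subseteq> W \<and>
    (\<forall>x. (x, \<zero>\<^bsub>?Y\<^esub>) \<in> W \<longrightarrow> x \<in> B)}"
  have "W0 \<in> \<W>"
  proof -
    have "W0 \<subseteq> A \<times> carrier ?Y"
      unfolding W0_def using gA d_carrier A.sub_add BA by auto
    moreover have "x \<in> B" if x: "(x, \<zero>\<^bsub>?Y\<^esub>) \<in> W0" for x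
    proof -
      obtain z b where *: "x = g z \<oplus>\<^bsub>X\<^esub> b" "d n (Suc i) z = \<zero>\<^bsub>?Y\<^esub>" "z \<in> carrier ?Z" "b \<in> B"
        using x unfolding W0_def by auto
      obtain w where "w \<in> carrier (F n (Suc (Suc (Suc i))))" "d n (Suc (Suc i)) w = z"
        using d_exact[OF *(3,2)] by blast
      then have "g z \<in> B" using cocycD(2)[OF g] by blast
      then show ?thesis using * B.sub_add by simp
    qed
    ultimately show ?thesis
      unfolding \<W>_def using W0 by blast
  qed
  have "\<exists>W\<in>\<W>. \<forall>V\<in>\<W>. W \<subseteq> V \<longrightarrow> V = W"
  proof (rule subset_Zorn_nonempty)
    show "\<W> \<noteq> {}" using \<open>W0 \<in> \<W>\<close> by blast
    fix C assume C: "C \<noteq> {}" "subset.chain \<W> C"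
    have sub: "C \<subseteq> \<W>" and ch: "\<And>V W. V \<in> C \<Longrightarrow> W \<in> C \<Longrightarrow> V \<subseteq> W \<or> W \<subseteq> V"
      using C(2) unfolding subset_chain_def by auto
    have "linrel R X ?Y (\<Union>C)"
      using sub by (intro linrel_Union[OF C(1) ch]) (auto simp: \<W>_def)
    moreover have "\<Union>C \<subseteq> A \<times> carrier ?Y" "W0 \<subseteq> \<Union>C" "\<forall>x. (x, \<zero>\<^bsub>?Y\<^esub>) \<in> \<Union>C \<longrightarrow> x \<in> B"
      using sub C(1) unfolding \<W>_def by blast+
    ultimately show "\<Union>C \<in> \<W>" unfolding \<W>_def by simp
  qed
  then obtain W where WW: "W \<in> \<W>" and max: "\<And>V. V \<in> \<W> \<Longrightarrow> W \<subseteq> V \<Longrightarrow> V = W" by blast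
  have W: "linrel R X ?Y W" "W \<subseteq> A \<times> carrier ?Y" "W0 \<subseteq> W" "\<And>x. (x, \<zero>\<^bsub>?Y\<^esub>) \<in> W \<Longrightarrow> x \<in> B"
    using WW by (simp_all add: \<W>_def)
  have gW: "(g z, d n (Suc i) z) \<in> W" if z: "z \<in> carrier ?Z" for z
  proof -
    have "(g z \<oplus>\<^bsub>X\<^esub> \<zero>\<^bsub>X\<^esub>, d n (Suc i) z) \<in> W0"
      unfolding W0_def by (intro CollectI exI[of _ z] exI[of _ "\<zero>\<^bsub>X\<^esub>"] conjI refl z B.sub_zero)
    then have "(g z \<oplus>\<^bsub>X\<^esub> \<zero>\<^bsub>X\<^esub>, d n (Suc i) z) \<in> W" by (rule subsetD[OF W(3)])
    then show ?thesis using A.sub_carr[OF gA[OF z]] by simp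
  qed
  have BW: "(b, \<zero>\<^bsub>?Y\<^esub>) \<in> W" if b: "b \<in> B" for b
  proof -
    have "(g \<zero>\<^bsub>?Z\<^esub> \<oplus>\<^bsub>X\<^esub> b, d n (Suc i) \<zero>\<^bsub>?Z\<^esub>) \<in> W0"
      unfolding W0_def by (intro CollectI exI[of _ "\<zero>\<^bsub>?Z\<^esub>"] exI[of _ b] conjI refl b Z.M.zero_closed)
    then have "(g \<zero>\<^bsub>?Z\<^esub> \<oplus>\<^bsub>X\<^esub> b, d n (Suc i) \<zero>\<^bsub>?Z\<^esub>) \<in> W" by (rule subsetD[OF W(3)])
    then show ?thesis
      using B.sub_carr[OF b] lin_zero[OF gl Z.module_axioms XM]
        lin_zero[OF d_lin Z.module_axioms Y.module_axioms] by simp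
  qed
  have ann: "ideal {r \<in> carrier R. (\<zero>\<^bsub>X\<^esub>, r \<odot>\<^bsub>?Y\<^esub> y) \<in> W} R" if y: "y \<in> carrier ?Y" for y
  proof -
    interpret Reg: module R "regular_module R" by (rule regular_module_module)
    have "submodule {r \<in> carrier R. (\<zero>\<^bsub>X\<^esub>, r \<odot>\<^bsub>?Y\<^esub> y) \<in> W} R (regular_module R)"
    proof (rule Reg.submodI)
      show "\<zero>\<^bsub>regular_module R\<^esub> \<in> {r \<in> carrier R. (\<zero>\<^bsub>X\<^esub>, r \<odot>\<^bsub>?Y\<^esub> y) \<in> W}"
        using y linrel_zero[OF W(1)] by simp
      show "r \<oplus>\<^bsub>regular_module R\<^esub> s \<in> {r \<in> carrier R. (\<zero>\<^bsub>X\<^esub>, r \<odot>\<^bsub>?Y\<^esub> y) \<in> W}"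
        if "r \<in> {r \<in> carrier R. (\<zero>\<^bsub>X\<^esub>, r \<odot>\<^bsub>?Y\<^esub> y) \<in> W}" "s \<in> {r \<in> carrier R. (\<zero>\<^bsub>X\<^esub>, r \<odot>\<^bsub>?Y\<^esub> y) \<in> W}" for r s
        using that linrel_add[OF W(1), of "\<zero>\<^bsub>X\<^esub>" "r \<odot>\<^bsub>?Y\<^esub> y" "\<zero>\<^bsub>X\<^esub>" "s \<odot>\<^bsub>?Y\<^esub> y"] y
        by (simp add: Y.smult_l_distr)
      show "a \<odot>\<^bsub>regular_module R\<^esub> r \<in> {r \<in> carrier R. (\<zero>\<^bsub>X\<^esub>, r \<odot>\<^bsub>?Y\<^esub> y) \<in> W}"
        if "a \<in> carrier R" "r \<in> {r \<in> carrier R. (\<zero>\<^bsub>X\<^esub>, r \<odot>\<^bsub>?Y\<^esub> y) \<in> W}" for a r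
        using that linrel_smult[OF W(1), of a "\<zero>\<^bsub>X\<^esub>" "r \<odot>\<^bsub>?Y\<^esub> y"] y by (simp add: Y.smult_assoc1)
    qed auto
    then show ?thesis by (simp add: ideal_submodule_iff)
  qed
  have nilp: "\<exists>k::nat. (\<zero>\<^bsub>X\<^esub>, (x [^] k) \<odot>\<^bsub>?Y\<^esub> y) \<in> W" if x: "x \<in> \<aa>" and y: "y \<in> carrier ?Y" for x y
  proof -
    have xR: "x \<in> carrier R" using x ideal.Icarr[OF ideal_a] by blast
    let ?N = "\<lambda>k::nat. {r \<in> carrier R. (\<zero>\<^bsub>X\<^esub>, r \<odot>\<^bsub>?Y\<^esub> ((x [^] k) \<odot>\<^bsub>?Y\<^esub> y)) \<in> W}"
    have Nid: "ideal (?N k) R" for k using ann xR y by simp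
    have Nmono: "?N k \<subseteq> ?N (k + e)" for k e :: nat
    proof
      fix r assume r: "r \<in> ?N k"
      then have "((x [^] e) \<odot>\<^bsub>X\<^esub> \<zero>\<^bsub>X\<^esub>, (x [^] e) \<odot>\<^bsub>?Y\<^esub> (r \<odot>\<^bsub>?Y\<^esub> ((x [^] k) \<odot>\<^bsub>?Y\<^esub> y))) \<in> W"
        using linrel_smult[OF W(1)] xR by blast
      moreover have "(x [^] e) \<odot>\<^bsub>?Y\<^esub> (r \<odot>\<^bsub>?Y\<^esub> ((x [^] k) \<odot>\<^bsub>?Y\<^esub> y)) = r \<odot>\<^bsub>?Y\<^esub> ((x [^] (k + e)) \<odot>\<^bsub>?Y\<^esub> y)"
        using r xR y by (simp add: Y.smult_assoc1[symmetric] nat_pow_mult[symmetric] m_ac)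
      ultimately show "r \<in> ?N (k + e)" using r xR by simp
    qed
    obtain k where k: "\<And>e. ?N (k + e) = ?N k"
      by (rule ascending_ideals_stabilise[of ?N, OF Nid Nmono]) (rule that)
    let ?y = "(x [^] k) \<odot>\<^bsub>?Y\<^esub> y"
    have yc: "?y \<in> carrier ?Y" using xR y by simp
    have "(\<zero>\<^bsub>X\<^esub>, ?y) \<in> W"
    proof (rule ccontr)
      assume notin: "(\<zero>\<^bsub>X\<^esub>, ?y) \<notin> W"
      define V where "V = {(p, q \<oplus>\<^bsub>?Y\<^esub> r \<odot>\<^bsub>?Y\<^esub> ?y) | p q r. (p, q) \<in> W \<and> r \<in> carrier R}"
      have Wc: "p \<in> carrier X" "q \<in> carrier ?Y" if "(p, q) \<in> W" for p q
        using linrel_carr[OF W(1) that] by auto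
      have WV: "W \<subseteq> V"
      proof
        fix pq assume "pq \<in> W"
        moreover obtain p q where "pq = (p, q)" by fastforce
        ultimately show "pq \<in> V"
          unfolding V_def using Wc yc by (auto intro!: exI[of _ q] exI[of _ "\<zero>\<^bsub>R\<^esub>"])
      qed
      have yV: "(\<zero>\<^bsub>X\<^esub>, ?y) \<in> V"
        unfolding V_def using linrel_zero[OF W(1)] yc
        by (auto intro!: exI[of _ "\<zero>\<^bsub>?Y\<^esub>"] exI[of _ "\<one>\<^bsub>R\<^esub>"])
      have "linrel R X ?Y V"
        unfolding linrel_def
      proof (intro conjI allI impI ballI)
        show "V \<subseteq> carrier X \<times> carrier ?Y"
          unfolding V_def using Wc yc by auto
        show "(\<zero>\<^bsub>X\<^esub>, \<zero>\<^bsub>?Y\<^esub>) \<in> V" using WV linrel_zero[OF W(1)] by blast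
      next
        fix p q p' q' assume "(p, q) \<in> V" "(p', q') \<in> V"
        then obtain u r u' r' where *: "(p, u) \<in> W" "(p', u') \<in> W" "r \<in> carrier R" "r' \<in> carrier R"
          "q = u \<oplus>\<^bsub>?Y\<^esub> r \<odot>\<^bsub>?Y\<^esub> ?y" "q' = u' \<oplus>\<^bsub>?Y\<^esub> r' \<odot>\<^bsub>?Y\<^esub> ?y"
          unfolding V_def by blast
        have "q \<oplus>\<^bsub>?Y\<^esub> q' = (u \<oplus>\<^bsub>?Y\<^esub> u') \<oplus>\<^bsub>?Y\<^esub> (r \<oplus> r') \<odot>\<^bsub>?Y\<^esub> ?y"
          using * Wc(2)[OF *(1)] Wc(2)[OF *(2)] yc by (simp add: Y.smult_l_distr Y.M.a_ac)
        then show "(p \<oplus>\<^bsub>X\<^esub> p', q \<oplus>\<^bsub>?Y\<^esub> q') \<in> V"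
          unfolding V_def using linrel_add[OF W(1) *(1,2)] *(3,4) by blast
      next
        fix s p q assume s: "s \<in> carrier R" and "(p, q) \<in> V"
        then obtain u r where *: "(p, u) \<in> W" "r \<in> carrier R" "q = u \<oplus>\<^bsub>?Y\<^esub> r \<odot>\<^bsub>?Y\<^esub> ?y"
          unfolding V_def by blast
        have "s \<odot>\<^bsub>?Y\<^esub> q = s \<odot>\<^bsub>?Y\<^esub> u \<oplus>\<^bsub>?Y\<^esub> (s \<otimes> r) \<odot>\<^bsub>?Y\<^esub> ?y"
          using * s Wc(2)[OF *(1)] yc by (simp add: Y.smult_r_distr Y.smult_assoc1)
        then show "(s \<odot>\<^bsub>X\<^esub> p, s \<odot>\<^bsub>?Y\<^esub> q) \<in> V"
          unfolding V_def using linrel_smult[OF W(1) s *(1)] *(2) s by blast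
      qed
      moreover have "V \<subseteq> A \<times> carrier ?Y"
        unfolding V_def using W(2) yc by auto
      moreover have "p \<in> B" if pV: "(p, \<zero>\<^bsub>?Y\<^esub>) \<in> V" for p
      proof -
        obtain q r where *: "(p, q) \<in> W" "r \<in> carrier R" "\<zero>\<^bsub>?Y\<^esub> = q \<oplus>\<^bsub>?Y\<^esub> r \<odot>\<^bsub>?Y\<^esub> ?y"
          using pV unfolding V_def by blast
        have pq: "p \<in> A" "p \<in> carrier X" "q \<in> carrier ?Y" using *(1) W(2) Wc by auto
        obtain m where m: "\<forall>r\<in>I m. r \<odot>\<^bsub>X\<^esub> p \<in> B" using tor pq(1) unfolding torsion_def by blast
        let ?s = "x [^] Suc m"
        have sR: "?s \<in> carrier R" using xR by simp
        have sp: "?s \<odot>\<^bsub>X\<^esub> p \<in> B" using m pow_in_I[OF x] by blast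
        have "q = \<ominus>\<^bsub>?Y\<^esub> (r \<odot>\<^bsub>?Y\<^esub> ?y)"
          using *(2,3) pq(3) yc by (metis Y.M.minus_equality Y.smult_closed)
        then have ry: "r \<odot>\<^bsub>?Y\<^esub> ?y = \<ominus>\<^bsub>?Y\<^esub> q" using *(2) yc by simp
        have "(\<zero>\<^bsub>X\<^esub>, \<ominus>\<^bsub>?Y\<^esub> (?s \<odot>\<^bsub>?Y\<^esub> q)) \<in> W"
          using linrel_diff[OF W(1) XM Y.module_axioms BW[OF sp] linrel_smult[OF W(1) sR *(1)]] sp sR pq
          by (simp add: A.minus_eq_zero_iff Y.M.minus_eq)
        moreover have "\<ominus>\<^bsub>?Y\<^esub> (?s \<odot>\<^bsub>?Y\<^esub> q) = r \<odot>\<^bsub>?Y\<^esub> ((x [^] (k + Suc m)) \<odot>\<^bsub>?Y\<^esub> y)"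
        proof -
          have "\<ominus>\<^bsub>?Y\<^esub> (?s \<odot>\<^bsub>?Y\<^esub> q) = ?s \<odot>\<^bsub>?Y\<^esub> (r \<odot>\<^bsub>?Y\<^esub> ?y)"
            unfolding ry using sR pq(3) by (simp add: Y.smult_r_minus del: nat_pow_Suc)
          also have "\<dots> = r \<odot>\<^bsub>?Y\<^esub> ((x [^] (k + Suc m)) \<odot>\<^bsub>?Y\<^esub> y)"
            using *(2) xR y sR
            by (simp add: Y.smult_assoc1[symmetric] nat_pow_mult[symmetric] m_ac del: nat_pow_Suc add_Suc_right)
          finally show ?thesis .
        qed
        ultimately have "r \<in> ?N (k + Suc m)" using *(2) by simp
        then have "r \<in> ?N k" by (rule subsetD[OF equalityD1[OF k[of "Suc m"]]])
        then have "(\<zero>\<^bsub>X\<^esub>, r \<odot>\<^bsub>?Y\<^esub> ?y) \<in> W" by simp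
        from linrel_add[OF W(1) *(1) this] have "(p, \<zero>\<^bsub>?Y\<^esub>) \<in> W"
          using *(3) pq by simp
        then show ?thesis by (rule W(4))
      qed
      ultimately have "V \<in> \<W>" unfolding \<W>_def using W(3) WV by blast
      then show False using max[OF _ WV] yV notin by blast
    qed
    then show ?thesis by blast
  qed
  have "\<exists>m. \<forall>r\<in>I m. (\<zero>\<^bsub>X\<^esub>, r \<odot>\<^bsub>?Y\<^esub> y) \<in> W" if y: "y \<in> carrier ?Y" for y
  proof -
    have "\<exists>k::nat. x [^] k \<in> {r \<in> carrier R. (\<zero>\<^bsub>X\<^esub>, r \<odot>\<^bsub>?Y\<^esub> y) \<in> W}" if "x \<in> \<aa>" for x
      using nilp[OF that y] ideal.Icarr[OF ideal_a that] by auto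
    then show ?thesis
      using power_subset_of_radical[OF ann[OF y]] by blast
  qed
  then show ?thesis
    using W gW by blast
qed

text \<open>
  It remains to subtract from the transition map \<open>tr\<close> a map that is zero modulo \<open>W\<close> on boundaries, so that
  the difference \<open>q\<close> has values in the domain of \<open>W\<close>. Following \<open>q\<close> by the partial homomorphism \<open>W\<close> then gives
  a cochain whose coboundary is \<open>g \<circ> tr\<close>.
\<close>

lemma cobnd_of_partial_hom:
  assumes X: "subquot X A B" and W: "linrel R X (F n (Suc i)) W" "W \<subseteq> A \<times> carrier (F n (Suc i))"
    and gW: "\<And>z. z \<in> carrier (F n (Suc (Suc i))) \<Longrightarrow> (g z, d n (Suc i) z) \<in> W"
    and WB: "\<And>x. (x, \<zero>\<^bsub>F n (Suc i)\<^esub>) \<in> W \<Longrightarrow> x \<in> B"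
    and q: "lin R (F (n + k) (Suc i)) (F n (Suc i)) q"
    and qW: "\<And>w. w \<in> carrier (F (n + k) (Suc i)) \<Longrightarrow> \<exists>x. (x, q w) \<in> W"
    and qd: "\<And>z. z \<in> carrier (F (n + k) (Suc (Suc i))) \<Longrightarrow>
      (\<zero>\<^bsub>X\<^esub>, tr n k (Suc i) (d (n + k) (Suc i) z) \<ominus>\<^bsub>F n (Suc i)\<^esub> q (d (n + k) (Suc i) z)) \<in> W"
  shows "cobnd X A B (n + k) (Suc i) (\<lambda>z. g (tr n k (Suc (Suc i)) z))"
proof -
  have XM: "module R X" using X by (simp add: subquot_def)
  interpret X: module R X by fact
  interpret Y: module R "F n (Suc i)" by (rule F_module)
  obtain h where h: "lin R (F (n + k) (Suc i)) X h" "\<And>w. w \<in> carrier (F (n + k) (Suc i)) \<Longrightarrow> (h w, q w) \<in> W"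
    using free_lift[OF XM F_module W(1) q qW] by blast
  have "coch X A (n + k) (Suc i) h"
    unfolding coch_def using h W(2) by blast
  moreover have "g (tr n k (Suc (Suc i)) z) \<ominus>\<^bsub>X\<^esub> h (d (n + k) (Suc i) z) \<in> B"
    if z: "z \<in> carrier (F (n + k) (Suc (Suc i)))" for z
  proof (rule WB)
    let ?t = "tr n k (Suc (Suc i)) z"
    let ?dz = "d (n + k) (Suc i) z"
    have t: "?t \<in> carrier (F n (Suc (Suc i)))" and dz: "?dz \<in> carrier (F (n + k) (Suc i))"
      using z tr_carrier d_carrier by auto
    have c: "d n (Suc i) ?t \<in> carrier (F n (Suc i))" "q ?dz \<in> carrier (F n (Suc i))"
      using d_carrier[OF t] lin_closed[OF q dz] by auto
    have e: "tr n k (Suc i) ?dz = d n (Suc i) ?t" using tr_d[OF z] by simp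
    have 1: "(g ?t \<ominus>\<^bsub>X\<^esub> h ?dz, d n (Suc i) ?t \<ominus>\<^bsub>F n (Suc i)\<^esub> q ?dz) \<in> W"
      by (rule linrel_diff[OF W(1) XM F_module gW[OF t] h(2)[OF dz]])
    have 2: "(\<zero>\<^bsub>X\<^esub>, d n (Suc i) ?t \<ominus>\<^bsub>F n (Suc i)\<^esub> q ?dz) \<in> W"
      using qd[OF z] unfolding e .
    show "(g ?t \<ominus>\<^bsub>X\<^esub> h ?dz, \<zero>\<^bsub>F n (Suc i)\<^esub>) \<in> W"
      using linrel_diff[OF W(1) XM F_module 1 2] linrel_carr[OF W(1) 1] by simp
  qed
  ultimately show ?thesis
    unfolding cobnd_def by blast
qed

lemma \<rho>_tr: "z \<in> carrier (F (n + k) (Suc 0)) \<Longrightarrow> \<rho> n (tr n k (Suc 0) z) \<ominus> \<rho> (n + k) z \<in> I n"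
proof (induction k arbitrary: z)
  case 0
  then show ?case
    using lin_closed[OF \<rho>_lin] additive_subgroup.zero_closed[OF ideal.axioms(1)[OF I_ideal]]
    by (simp add: minus_eq r_neg)
next
  case (Suc k)
  interpret S: submod R "regular_module R" "I n"
    using regular_module_module I_ideal by (simp add: submodI_locale ideal_submodule_iff)
  let ?w = "\<phi> (n + k) (Suc 0) z"
  have zc: "z \<in> carrier (F (Suc (n + k)) (Suc 0))" using Suc.prems by simp
  have w: "?w \<in> carrier (F (n + k) (Suc 0))" using lin_closed[OF \<phi>_lin zc] .
  have "\<rho> (n + k) ?w \<ominus> \<rho> (Suc (n + k)) z \<in> I n"
    using \<rho>_\<phi>[OF zc] I_decseq by blast
  then have "\<rho> n (tr n k (Suc 0) ?w) \<ominus> \<rho> (Suc (n + k)) z \<in> I n"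
    using S.cong_trans[of "\<rho> n (tr n k (Suc 0) ?w)" "\<rho> (n + k) ?w" "\<rho> (Suc (n + k)) z"] Suc.IH[OF w]
      lin_closed[OF \<rho>_lin tr_carrier[OF w]] lin_closed[OF \<rho>_lin w] lin_closed[OF \<rho>_lin zc] by simp
  then show ?case by simp
qed

text \<open>
  In degree \<open>1\<close>, let \<open>u\<close> be a lift of \<open>1 \<in> R/I n\<close> to the free module. The map \<open>w \<mapsto> tr w - \<rho>(w) u\<close> has values in the
  boundaries, on which the partial homomorphism is defined. On boundaries \<open>\<rho>\<close> has values in \<open>I (n + k)\<close>, and this ideal
  kills \<open>u\<close> modulo \<open>W\<close> for large \<open>k\<close>.
\<close>

lemma torsion_lim_zero_1:
  assumes X: "subquot X A B" and tor: "torsion X A B" and g: "cocyc X A B n (Suc 0) g"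
  shows "lim_zero X A B n (Suc 0) g"
proof -
  have XM: "module R X" using X by (simp add: subquot_def)
  let ?Y = "F n (Suc 0)"
  interpret X: module R X by fact
  interpret Y: module R ?Y by (rule F_module)
  obtain W where W: "linrel R X ?Y W" "W \<subseteq> A \<times> carrier ?Y"
    and gW: "\<And>z. z \<in> carrier (F n (Suc (Suc 0))) \<Longrightarrow> (g z, d n (Suc 0) z) \<in> W"
    and WB: "\<And>x. (x, \<zero>\<^bsub>?Y\<^esub>) \<in> W \<Longrightarrow> x \<in> B"
    and Wt: "\<And>y. y \<in> carrier ?Y \<Longrightarrow> \<exists>m. \<forall>r\<in>I m. (\<zero>\<^bsub>X\<^esub>, r \<odot>\<^bsub>?Y\<^esub> y) \<in> W"
    using maximal_partial_hom[OF X tor g] by blast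
  interpret S: submod R "regular_module R" "I n"
    using regular_module_module I_ideal by (simp add: submodI_locale ideal_submodule_iff)
  obtain u where u: "u \<in> carrier ?Y" "\<rho> n u \<ominus> \<one> \<in> I n" using \<rho>_one by blast
  obtain k where k: "\<forall>r\<in>I k. (\<zero>\<^bsub>X\<^esub>, r \<odot>\<^bsub>?Y\<^esub> u) \<in> W" using Wt[OF u(1)] by blast
  let ?q = "\<lambda>w. tr n k (Suc 0) w \<ominus>\<^bsub>?Y\<^esub> \<rho> (n + k) w \<odot>\<^bsub>?Y\<^esub> u"
  have ru: "lin R (F (n + k) (Suc 0)) ?Y (\<lambda>w. \<rho> (n + k) w \<odot>\<^bsub>?Y\<^esub> u)"
    by (rule lin_comp[OF \<rho>_lin lin_scalars[OF F_module u(1)]])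
  have q: "lin R (F (n + k) (Suc 0)) ?Y ?q"
    by (rule lin_pointwise_diff[OF tr_lin ru F_module F_module])
  have "cobnd X A B (n + k) (Suc 0) (\<lambda>z. g (tr n k (Suc (Suc 0)) z))"
  proof (rule cobnd_of_partial_hom[OF X W gW WB q])
    fix w assume w: "w \<in> carrier (F (n + k) (Suc 0))"
    have c: "\<rho> (n + k) w \<in> carrier R" "\<rho> n u \<in> carrier R" "\<rho> n (tr n k (Suc 0) w) \<in> carrier R"
      "tr n k (Suc 0) w \<in> carrier ?Y"
      using lin_closed[OF \<rho>_lin w] lin_closed[OF \<rho>_lin u(1)] lin_closed[OF \<rho>_lin tr_carrier[OF w]] tr_carrier[OF w]
      by simp_all
    have "\<rho> n (?q w) = \<rho> n (tr n k (Suc 0) w) \<ominus> \<rho> (n + k) w \<otimes> \<rho> n u"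
      using lin_diff[OF \<rho>_lin F_module regular_module_module c(4) lin_closed[OF ru w]]
        lin_smult[OF \<rho>_lin c(1) u(1)] by simp
    moreover have "\<rho> (n + k) w \<otimes> \<rho> n u \<ominus> \<rho> (n + k) w \<in> I n"
      using S.cong_smult[of "\<rho> n u" \<one> "\<rho> (n + k) w"] u(2) c by simp
    then have "\<rho> (n + k) w \<ominus> \<rho> (n + k) w \<otimes> \<rho> n u \<in> I n"
      using S.cong_sym[of "\<rho> (n + k) w \<otimes> \<rho> n u" "\<rho> (n + k) w"] c by simp
    then have "\<rho> n (tr n k (Suc 0) w) \<ominus> \<rho> (n + k) w \<otimes> \<rho> n u \<in> I n"
      using S.cong_trans[of "\<rho> n (tr n k (Suc 0) w)" "\<rho> (n + k) w" "\<rho> (n + k) w \<otimes> \<rho> n u"] \<rho>_tr[OF w] c by simp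
    ultimately have "\<rho> n (?q w) \<in> I n" by simp
    then obtain z where "z \<in> carrier (F n (Suc (Suc 0)))" "d n (Suc 0) z = ?q w"
      using \<rho>_exact[OF lin_closed[OF q w]] by blast
    then show "\<exists>x. (x, ?q w) \<in> W" using gW by metis
  next
    fix z assume z: "z \<in> carrier (F (n + k) (Suc (Suc 0)))"
    let ?dz = "d (n + k) (Suc 0) z"
    have dz: "?dz \<in> carrier (F (n + k) (Suc 0))" by (rule d_carrier[OF z])
    have "\<rho> (n + k) ?dz \<in> I k"
      using \<rho>_d[OF z] I_subset[of k "n + k"] by auto
    then have "(\<zero>\<^bsub>X\<^esub>, \<rho> (n + k) ?dz \<odot>\<^bsub>?Y\<^esub> u) \<in> W" using k by blast
    then show "(\<zero>\<^bsub>X\<^esub>, tr n k (Suc 0) ?dz \<ominus>\<^bsub>?Y\<^esub> ?q ?dz) \<in> W"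
      using Y.diff_diff_self[OF tr_carrier[OF dz] lin_closed[OF ru dz]] by simp
  qed
  then show ?thesis
    unfolding lim_zero_def by blast
qed

text \<open>
  In higher degrees, the identity of the free module is a cocycle with values in \<open>F/D\<close>, where \<open>D\<close> is the domain of the
  partial homomorphism. As \<open>F/D\<close> is torsion, this cocycle becomes a coboundary, by induction on the degree; subtracting
  the coboundary from \<open>tr\<close> gives a map into \<open>D\<close> that agrees with \<open>tr\<close> on boundaries.
\<close>

lemma torsion_lim_zero_step:
  assumes X: "subquot X A B" and tor: "torsion X A B" and g: "cocyc X A B n (Suc i) g"
    and IH: "\<And>D. \<lbrakk>subquot (F n (Suc i)) (carrier (F n (Suc i))) D; torsion (F n (Suc i)) (carrier (F n (Suc i))) D\<rbrakk>
      \<Longrightarrow> H_vanishes (F n (Suc i)) (carrier (F n (Suc i))) D i"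
  shows "lim_zero X A B n (Suc i) g"
proof -
  have XM: "module R X" using X by (simp add: subquot_def)
  let ?Y = "F n (Suc i)"
  interpret X: module R X by fact
  interpret Y: module R ?Y by (rule F_module)
  obtain W where W: "linrel R X ?Y W" "W \<subseteq> A \<times> carrier ?Y"
    and gW: "\<And>z. z \<in> carrier (F n (Suc (Suc i))) \<Longrightarrow> (g z, d n (Suc i) z) \<in> W"
    and WB: "\<And>x. (x, \<zero>\<^bsub>?Y\<^esub>) \<in> W \<Longrightarrow> x \<in> B"
    and Wt: "\<And>y. y \<in> carrier ?Y \<Longrightarrow> \<exists>m. \<forall>r\<in>I m. (\<zero>\<^bsub>X\<^esub>, r \<odot>\<^bsub>?Y\<^esub> y) \<in> W"
    using maximal_partial_hom[OF X tor g] by blast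
  define D where "D = snd ` W"
  have D: "submodule D R ?Y"
  proof (rule Y.submodI)
    show "D \<subseteq> carrier ?Y" unfolding D_def using W(2) by auto
    show "\<zero>\<^bsub>?Y\<^esub> \<in> D" unfolding D_def using linrel_zero[OF W(1)] by force
    show "a \<oplus>\<^bsub>?Y\<^esub> b \<in> D" if "a \<in> D" "b \<in> D" for a b
      using that linrel_add[OF W(1)] unfolding D_def by force
    show "r \<odot>\<^bsub>?Y\<^esub> a \<in> D" if "r \<in> carrier R" "a \<in> D" for r a
      using that linrel_smult[OF W(1)] unfolding D_def by force
  qed
  have sq: "subquot ?Y (carrier ?Y) D"
    using D Y.carrier_is_submodule F_module Y.submoduleE(1)[OF D] by (simp add: subquot_def)
  have "torsion ?Y (carrier ?Y) D"
    unfolding torsion_def D_def using Wt by force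
  then have v: "H_vanishes ?Y (carrier ?Y) D i" using IH sq by blast
  have "cocyc ?Y (carrier ?Y) D n i (\<lambda>z. z)"
    unfolding cocyc_def coch_def D_def using gW lin_id by force
  then obtain k h where h: "coch ?Y (carrier ?Y) (n + k) i h"
    "\<And>z. z \<in> carrier (F (n + k) (Suc i)) \<Longrightarrow> tr n k (Suc i) z \<ominus>\<^bsub>?Y\<^esub> h (d (n + k) i z) \<in> D"
    using v unfolding H_vanishes_def lim_zero_def cobnd_def by blast
  let ?q = "\<lambda>w. tr n k (Suc i) w \<ominus>\<^bsub>?Y\<^esub> h (d (n + k) i w)"
  have q: "lin R (F (n + k) (Suc i)) ?Y ?q"
    using cochD(1)[OF coch_d[OF h(1)]] by (intro lin_pointwise_diff tr_lin F_module)
  have "cobnd X A B (n + k) (Suc i) (\<lambda>z. g (tr n k (Suc (Suc i)) z))"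
  proof (rule cobnd_of_partial_hom[OF X W gW WB q])
    show "\<exists>x. (x, ?q w) \<in> W" if "w \<in> carrier (F (n + k) (Suc i))" for w
      using h(2)[OF that] unfolding D_def by force
    fix z assume z: "z \<in> carrier (F (n + k) (Suc (Suc i)))"
    have dz: "d (n + k) (Suc i) z \<in> carrier (F (n + k) (Suc i))" by (rule d_carrier[OF z])
    have "h (d (n + k) i (d (n + k) (Suc i) z)) = \<zero>\<^bsub>?Y\<^esub>"
      using d_d[OF z] lin_zero[OF cochD(1)[OF h(1)] F_module F_module] by simp
    then show "(\<zero>\<^bsub>X\<^esub>, tr n k (Suc i) (d (n + k) (Suc i) z) \<ominus>\<^bsub>?Y\<^esub> ?q (d (n + k) (Suc i) z)) \<in> W"
      using tr_carrier[OF dz] linrel_zero[OF W(1)] by simp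
  qed
  then show ?thesis
    unfolding lim_zero_def by blast
qed

text \<open>
  The induction step leads from an arbitrary module to quotients of free modules, so the induction is carried out for
  the latter.
\<close>

lemma torsion_H_vanishes:
  assumes X: "subquot X A B" and tor: "torsion X A B"
  shows "H_vanishes X A B (Suc i)"
proof -
  have free: "subquot (free_module R k) (carrier (free_module R k)) D \<Longrightarrow>
      torsion (free_module R k) (carrier (free_module R k)) D \<Longrightarrow>
      H_vanishes (free_module R k) (carrier (free_module R k)) D (Suc i)" for k D i
  proof (induction i arbitrary: k D)
    case 0
    then show ?case
      using torsion_lim_zero_1 unfolding H_vanishes_def by blast
  next
    case (Suc i)
    show ?case
      unfolding H_vanishes_def using torsion_lim_zero_step[OF Suc.prems] Suc.IH by blast
  qed
  show ?thesis
  proof (cases i)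
    case 0
    then show ?thesis
      using torsion_lim_zero_1[OF assms] unfolding H_vanishes_def by blast
  next
    case (Suc j)
    show ?thesis
      unfolding H_vanishes_def Suc using torsion_lim_zero_step[OF assms] free by blast
  qed
qed


section \<open>Grothendieck vanishing\<close>

abbreviation Reg :: "('a, 'a) module" where
  "Reg \<equiv> regular_module R"

abbreviation H_quot_vanishes :: "'a set \<Rightarrow> nat \<Rightarrow> bool" where
  "H_quot_vanishes J i \<equiv> H_vanishes Reg (carrier R) J i"

lemma subquot_ideals: "ideal J R \<Longrightarrow> ideal K R \<Longrightarrow> K \<subseteq> J \<Longrightarrow> subquot Reg J K"
  using regular_module_module by (simp add: subquot_def ideal_submodule_iff)

lemma subquot_ring: "ideal J R \<Longrightarrow> subquot Reg (carrier R) J"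
  using subquot_ideals[OF oneideal] additive_subgroup.a_subset[OF ideal.axioms(1)] by blast

lemma H_vanishes_trivial:
  assumes "module R X" "submodule B R X"
  shows "H_vanishes X B B i"
  unfolding H_vanishes_def
proof (intro allI impI)
  fix n g assume "cocyc X B B n i g"
  then show "lim_zero X B B n i g"
    using cobnd_of_values[OF assms, of n i g B] by (simp add: cocyc_def coch_def cobnd_imp_lim_zero)
qed

lemma adjoin_ideal:
  assumes "ideal J R" "x \<in> carrier R"
  shows "ideal (adjoin R Reg J x) R" "J \<subseteq> adjoin R Reg J x" "x \<in> adjoin R Reg J x"
proof -
  interpret Reg: module R Reg by (rule regular_module_module)
  have J: "submodule J R Reg" using assms(1) by (simp add: ideal_submodule_iff)
  show "ideal (adjoin R Reg J x) R"
    using Reg.adjoin_submodule[OF J] assms(2) by (simp add: ideal_submodule_iff)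
  show "J \<subseteq> adjoin R Reg J x" "x \<in> adjoin R Reg J x"
    using Reg.adjoin_superset[OF J] assms(2) by simp_all
qed

lemma cyclic_ideal_iso:
  assumes "ideal J R" "x \<in> carrier R"
  shows "subquot_iso Reg (carrier R) (quot_ideal R Reg J x) Reg (adjoin R Reg J x) J (\<lambda>r. r \<otimes> x)"
  using cyclic_iso(3)[OF regular_module_module, of J x] assms by (simp add: ideal_submodule_iff)

lemma quot_ideal_regular: "quot_ideal R Reg J x = {r \<in> carrier R. r \<otimes> x \<in> J}"
  by (simp add: quot_ideal_def)

lemma quot_ideal_Reg_ideal: "ideal J R \<Longrightarrow> x \<in> carrier R \<Longrightarrow> ideal (quot_ideal R Reg J x) R"
  using quot_ideal_ideal[OF regular_module_module, of J x] by (simp add: ideal_submodule_iff)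

lemma quot_ideal_prime:
  assumes "primeideal p R" "x \<in> carrier R" "x \<notin> p"
  shows "quot_ideal R Reg p x = p"
proof -
  interpret p: primeideal p R by fact
  show ?thesis
    unfolding quot_ideal_regular using p.I_prime p.I_r_closed p.Icarr assms(2,3) by auto
qed

text \<open>
  If \<open>xy \<in> J\<close> with \<open>x, y \<notin> J\<close>, then \<open>R/J\<close> is an extension of \<open>R/(J + Rx)\<close> by \<open>R/(J : x)\<close>, and both
  ideals are larger than \<open>J\<close>. So in a Noetherian induction only prime ideals need an argument.
\<close>

lemma H_quot_vanishes_devissage:
  assumes J: "ideal J R"
    and larger: "\<And>K. ideal K R \<Longrightarrow> J \<subset> K \<Longrightarrow> H_quot_vanishes K i"
    and prime: "primeideal J R \<Longrightarrow> H_quot_vanishes J i"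
  shows "H_quot_vanishes J i"
proof -
  consider "J = carrier R" | "primeideal J R" | "J \<noteq> carrier R" "\<not> primeideal J R" by blast
  then show ?thesis
  proof cases
    case 1
    then show ?thesis
      using H_vanishes_trivial[OF regular_module_module, of J] J by (simp add: ideal_submodule_iff)
  next
    case 2
    then show ?thesis by (rule prime)
  next
    case 3
    interpret J: ideal J R by fact
    obtain x y where xy: "x \<in> carrier R" "y \<in> carrier R" "x \<otimes> y \<in> J" "x \<notin> J" "y \<notin> J"
      using primeidealI[OF J is_cring] 3 by blast
    let ?A = "adjoin R Reg J x"
    note A = adjoin_ideal[OF J xy(1)]
    have "H_quot_vanishes ?A i"
      using A xy(4) by (intro larger) auto
    moreover have "H_vanishes Reg ?A J i"
    proof -
      let ?C = "quot_ideal R Reg J x"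
      have C: "ideal ?C R" by (rule quot_ideal_Reg_ideal[OF J xy(1)])
      have "y \<otimes> x \<in> J" using xy(3) m_comm[OF xy(1,2)] by simp
      then have "y \<in> ?C" using xy(2) by (simp add: quot_ideal_regular)
      moreover have "J \<subseteq> ?C"
        unfolding quot_ideal_regular using J.Icarr J.I_r_closed xy(1) by auto
      ultimately have "H_quot_vanishes ?C i"
        using xy(5) by (intro larger[OF C]) blast
      then show ?thesis
        using H_vanishes_iso[OF subquot_ring[OF C] subquot_ideals[OF A(1) J A(2)] cyclic_ideal_iso[OF J xy(1)]]
        by simp
    qed
    ultimately show ?thesis
      using H_vanishes_extension[OF subquot_ring[OF A(1)] subquot_ideals[OF A(1) J A(2)]] by blast
  qed
qed

definition prime_chain :: "'a set \<Rightarrow> nat \<Rightarrow> bool" where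
  "prime_chain J i \<longleftrightarrow> (\<exists>c :: nat \<Rightarrow> 'a set. (\<forall>j\<le>i. primeideal (c j) R \<and> J \<subseteq> c j) \<and> (\<forall>j<i. c j \<subset> c (Suc j)))"

lemma prime_chain_mono: "prime_chain K i \<Longrightarrow> J \<subseteq> K \<Longrightarrow> prime_chain J i"
  unfolding prime_chain_def by (meson subset_trans)

lemma prime_chain_Suc:
  assumes p: "primeideal p R" and K: "p \<subset> K" and c: "prime_chain K i"
  shows "prime_chain p (Suc i)"
proof -
  obtain c where c: "\<And>j. j \<le> i \<Longrightarrow> primeideal (c j) R \<and> K \<subseteq> c j" "\<And>j. j < i \<Longrightarrow> c j \<subset> c (Suc j)"
    using c unfolding prime_chain_def by blast
  let ?c = "case_nat p c"
  have "primeideal (?c j) R \<and> p \<subseteq> ?c j" if "j \<le> Suc i" for j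
    using that p c(1)[of "j - 1"] K by (cases j) auto
  moreover have "?c j \<subset> ?c (Suc j)" if "j < Suc i" for j
    using that c(1)[of 0] c(2)[of "j - 1"] K by (cases j) auto
  ultimately show ?thesis
    unfolding prime_chain_def by blast
qed

text \<open>
  Multiplication by \<open>x\<close> is injective on \<open>H^(i+1)(R/p)\<close>, because its kernel is a quotient of
  \<open>H^i(R/(p + Rx))\<close>; but every class is killed by a power of \<open>x \<in> \<aa>\<close>.
\<close>

lemma H_quot_vanishes_prime_step:
  assumes p: "primeideal p R" and x: "x \<in> \<aa>" "x \<notin> p" and v: "H_quot_vanishes (adjoin R Reg p x) i"
  shows "H_quot_vanishes p (Suc i)"
  unfolding H_vanishes_def
proof (intro allI impI)
  interpret p: primeideal p R by fact
  have xR: "x \<in> carrier R" using ideal.Icarr[OF ideal_a x(1)] .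
  note pI = p.is_ideal
  let ?Q = "adjoin R Reg p x"
  note Q = adjoin_ideal[OF pI xR]
  note sqs = subquot_ring[OF Q(1)] subquot_ideals[OF Q(1) pI Q(2)] subquot_ring[OF pI]
  have iso: "subquot_iso Reg (carrier R) p Reg ?Q p (\<lambda>r. r \<otimes> x)"
    using cyclic_ideal_iso[OF pI xR] quot_ideal_prime[OF p xR x(2)] by simp
  fix n t assume t: "cocyc Reg (carrier R) p n (Suc i) t"
  have tR: "t z \<in> carrier R" if "z \<in> carrier (F n (Suc (Suc i)))" for z
    using cocyc_carrier[OF t that] by simp
  have xt: "cocyc Reg (carrier R) p n (Suc i) (\<lambda>z. r \<otimes> t z)" if r: "r \<in> carrier R" for r
    using cocyc_push[OF lin_smult_self[OF regular_module_module r] _ _ t, of "carrier R" p] r p.I_l_closed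
    by simp
  have inj: "lim_zero Reg (carrier R) p n (Suc i) u"
    if u: "cocyc Reg (carrier R) p n (Suc i) u" and z: "lim_zero Reg (carrier R) p n (Suc i) (\<lambda>z. u z \<otimes> x)" for u
  proof -
    have "cocyc Reg ?Q p n (Suc i) (\<lambda>z. u z \<otimes> x)"
      using cocyc_push[of Reg Reg "\<lambda>r. r \<otimes> x" "carrier R" ?Q p p, OF _ _ _ u] iso
      unfolding subquot_iso_def using p.I_r_closed[OF _ xR] by blast
    then have "lim_zero Reg ?Q p n (Suc i) (\<lambda>z. u z \<otimes> x)"
      using lim_zero_sub[OF sqs(1,2) v _ z] by blast
    then show ?thesis
      using lim_zero_reflect[OF sqs(3,2) iso cocycD(1)[OF u]] by blast
  qed
  have "lim_zero Reg (carrier R) p n (Suc i) (\<lambda>z. x [^] k \<otimes> t z) \<Longrightarrow> lim_zero Reg (carrier R) p n (Suc i) (\<lambda>z. \<one> \<otimes> t z)"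
    for k :: nat
  proof (induction k)
    case 0
    then show ?case by simp
  next
    case (Suc k)
    have c: "cocyc Reg (carrier R) p n (Suc i) (\<lambda>z. x [^] k \<otimes> t z)" using xt xR by simp
    have cx: "cocyc Reg (carrier R) p n (Suc i) (\<lambda>z. x [^] Suc k \<otimes> t z)" using xt xR by simp
    have cx': "coch Reg (carrier R) n (Suc (Suc i)) (\<lambda>z. x [^] k \<otimes> t z \<otimes> x)"
      using coch_lin[OF lin_scalars[OF regular_module_module, of x] _ cocycD(1)[OF c], of "carrier R"] xR by simp
    interpret P: submod R Reg p
      using regular_module_module pI by (simp add: submodI_locale ideal_submodule_iff)
    have "lim_zero Reg (carrier R) p n (Suc i) (\<lambda>z. x [^] k \<otimes> t z \<otimes> x)"
    proof (rule lim_zero_mod[OF regular_module_module P.submodule_B _ cx' cocycD(1)[OF cx] coch_zero _ Suc.prems])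
      show "submodule (carrier R) R Reg" "submodule (carrier R) R Reg" "module R Reg"
        using P.carrier_is_submodule P.module_axioms by simp_all
      fix z assume z: "z \<in> carrier (F n (Suc (Suc i)))"
      have "x [^] k \<otimes> t z \<otimes> x = x [^] Suc k \<otimes> t z"
        using xR tR[OF z] by (simp add: m_ac)
      then show "x [^] k \<otimes> t z \<otimes> x \<ominus>\<^bsub>Reg\<^esub> \<zero>\<^bsub>Reg\<^esub> \<ominus>\<^bsub>Reg\<^esub> x [^] Suc k \<otimes> t z \<in> p"
        using P.diff_zero[of "x [^] Suc k \<otimes> t z"] P.cong_refl[of "x [^] Suc k \<otimes> t z"] xR tR[OF z] by simp
    qed
    then have "lim_zero Reg (carrier R) p n (Suc i) (\<lambda>z. x [^] k \<otimes> t z)"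
      by (rule inj[OF c])
    then show ?case by (rule Suc.IH)
  qed
  moreover have "lim_zero Reg (carrier R) p n (Suc i) (\<lambda>z. x [^] Suc n \<otimes> t z)"
    using cobnd_imp_lim_zero[OF I_kills_cohomology[OF sqs(3) t pow_in_I[OF x(1)]]] by simp
  ultimately have one: "lim_zero Reg (carrier R) p n (Suc i) (\<lambda>z. \<one> \<otimes> t z)" by blast
  interpret P: submod R Reg p
    using regular_module_module pI by (simp add: submodI_locale ideal_submodule_iff)
  show "lim_zero Reg (carrier R) p n (Suc i) t"
  proof (rule lim_zero_mod[OF regular_module_module P.submodule_B _ cocycD(1)[OF t] cocycD(1)[OF xt[OF one_closed]] coch_zero _ one])
    show "submodule (carrier R) R Reg" "submodule (carrier R) R Reg" "module R Reg"
      using P.carrier_is_submodule P.module_axioms by simp_all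
    fix z assume z: "z \<in> carrier (F n (Suc (Suc i)))"
    show "t z \<ominus>\<^bsub>Reg\<^esub> \<zero>\<^bsub>Reg\<^esub> \<ominus>\<^bsub>Reg\<^esub> \<one> \<otimes> t z \<in> p"
      using P.diff_zero[of "t z"] P.cong_refl[of "t z"] tR[OF z] by simp
  qed
qed

text \<open>
  Grothendieck's theorem for \<open>R/J\<close>. Passing from a prime \<open>J\<close> to \<open>J + Rx\<close> with \<open>x \<notin> J\<close> lowers the dimension, since \<open>J\<close> can be
  put in front of every chain of primes above \<open>J + Rx\<close>.
\<close>

theorem H_quot_vanishes_above_dimension:
  assumes J: "ideal J R" and "\<not> prime_chain J i"
  shows "H_quot_vanishes J i"
proof -
  have "\<forall>i. \<not> prime_chain J i \<longrightarrow> H_quot_vanishes J i"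
    using J
  proof (induction rule: ideal_induct)
    fix J assume J: "ideal J R"
      and IH: "\<And>K. ideal K R \<Longrightarrow> J \<subset> K \<Longrightarrow> \<forall>i. \<not> prime_chain K i \<longrightarrow> H_quot_vanishes K i"
    show "\<forall>i. \<not> prime_chain J i \<longrightarrow> H_quot_vanishes J i"
    proof (intro allI impI)
      fix i assume nc: "\<not> prime_chain J i"
      show "H_quot_vanishes J i"
      proof (rule H_quot_vanishes_devissage[OF J])
        show "H_quot_vanishes K i" if "ideal K R" "J \<subset> K" for K
          using IH[OF that] nc prime_chain_mono[of K i J] that(2) by blast
        assume p: "primeideal J R"
        show "H_quot_vanishes J i"
        proof (cases i)
          case 0
          have "prime_chain J 0"
            unfolding prime_chain_def using p by (intro exI[of _ "\<lambda>_. J"]) simp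
          then show ?thesis using nc 0 by simp
        next
          case (Suc k)
          show ?thesis
          proof (cases "\<aa> \<subseteq> J")
            case True
            have "torsion Reg (carrier R) J"
              unfolding torsion_def using True ideal.I_r_closed[OF J] by (auto intro!: exI[of _ 0] simp: I_0)
            then show ?thesis
              unfolding Suc by (rule torsion_H_vanishes[OF subquot_ring[OF J]])
          next
            case False
            then obtain x where x: "x \<in> \<aa>" "x \<notin> J" by blast
            note A = adjoin_ideal[OF J ideal.Icarr[OF ideal_a x(1)]]
            have JA: "J \<subset> adjoin R Reg J x" using A(2,3) x(2) by blast
            have "\<not> prime_chain (adjoin R Reg J x) k"
              using prime_chain_Suc[OF p JA] nc Suc by blast
            then have "H_quot_vanishes (adjoin R Reg J x) k"
              using IH[OF A(1) JA] by blast
            then show ?thesis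
              unfolding Suc by (rule H_quot_vanishes_prime_step[OF p x])
          qed
        qed
      qed
    qed
  qed
  then show ?thesis using assms(2) by blast
qed


section \<open>From a finitely generated module to the primes of its support\<close>

text \<open>
  A finitely generated module \<open>A\<close> with \<open>Ann A \<subseteq> p\<close> has a non-zero map to \<open>R/p\<close>. In the lemma, \<open>W\<close> is the
  kernel of such a map and \<open>c\<close> represents the image of \<open>m\<close>, so that \<open>R/p \<rightarrow> A/W \<rightarrow> R/p\<close>, with the first map
  given by \<open>m\<close>, is multiplication by \<open>c\<close>; the last clause expresses this for cohomology classes. For \<open>A = D + Rx\<close>
  there are two cases: if \<open>D : x \<subseteq> p\<close>, then \<open>A/D\<close> maps onto \<open>R/p\<close>; and if \<open>ux \<in> D\<close> with \<open>u \<notin> p\<close>, one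
  composes multiplication by \<open>u\<close> with a map \<open>D \<rightarrow> R/p\<close>.
\<close>

lemma nonzero_map_to_prime_quotient:
  assumes X: "module R X" and fg: "fg_over R X {\<zero>\<^bsub>X\<^esub>} A" and p: "primeideal p R"
    and ann: "\<And>r. r \<in> carrier R \<Longrightarrow> (\<And>a. a \<in> A \<Longrightarrow> r \<odot>\<^bsub>X\<^esub> a = \<zero>\<^bsub>X\<^esub>) \<Longrightarrow> r \<in> p"
  shows "\<exists>W m c. submodule W R X \<and> W \<subseteq> A \<and> m \<in> A \<and> c \<in> carrier R \<and> c \<notin> p \<and>
    (\<forall>r\<in>p. \<forall>a\<in>A. r \<odot>\<^bsub>X\<^esub> a \<in> W) \<and>
    (\<forall>n i t. coch Reg (carrier R) n (Suc i) t \<longrightarrow> lim_zero X A W n i (\<lambda>z. t z \<odot>\<^bsub>X\<^esub> m) \<longrightarrow>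
      lim_zero Reg (carrier R) p n i (\<lambda>z. c \<otimes> t z))"
proof -
  interpret X: module R X by fact
  interpret p: primeideal p R by fact
  interpret Reg: module R Reg by (rule regular_module_module)
  note pI = p.is_ideal
  show ?thesis
    using X.zero_submodule fg ann
  proof (induction rule: X.fg_over_induct)
    case base
    have "\<one> \<in> p" by (rule base) auto
    then show ?case using p.I_notcarr p.one_imp_carrier by simp
  next
    case (adjoin D x)
    let ?A = "adjoin R X D x"
    note D = adjoin.hyps(1) and x = adjoin.hyps(5)
    have A: "submodule ?A R X" "D \<subseteq> ?A" "x \<in> ?A"
      using X.adjoin_submodule[OF D x] X.adjoin_superset[OF D x] by auto
    interpret D: submod R X D using X D by (rule submodI_locale)
    interpret A: submod R X ?A using X A(1) by (rule submodI_locale)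
    show ?case
    proof (cases "quot_ideal R X D x \<subseteq> p")
      case True
      define W where "W = {y \<oplus>\<^bsub>X\<^esub> r \<odot>\<^bsub>X\<^esub> x | y r. y \<in> D \<and> r \<in> p}"
      have WI: "y \<oplus>\<^bsub>X\<^esub> r \<odot>\<^bsub>X\<^esub> x \<in> W" if "y \<in> D" "r \<in> p" for y r
        unfolding W_def using that by blast
      have W: "submodule W R X"
      proof (rule X.submodI)
        show "W \<subseteq> carrier X" unfolding W_def using x p.Icarr by auto
        show "\<zero>\<^bsub>X\<^esub> \<in> W"
          unfolding W_def using x p.zero_closed
          by (auto intro!: exI[of _ "\<zero>\<^bsub>X\<^esub>"] exI[of _ "\<zero>"])
      next
        fix a b assume "a \<in> W" "b \<in> W"
        then obtain y r y' r' where *: "a = y \<oplus>\<^bsub>X\<^esub> r \<odot>\<^bsub>X\<^esub> x" "b = y' \<oplus>\<^bsub>X\<^esub> r' \<odot>\<^bsub>X\<^esub> x"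
          "y \<in> D" "y' \<in> D" "r \<in> p" "r' \<in> p"
          unfolding W_def by blast
        then have "a \<oplus>\<^bsub>X\<^esub> b = (y \<oplus>\<^bsub>X\<^esub> y') \<oplus>\<^bsub>X\<^esub> (r \<oplus> r') \<odot>\<^bsub>X\<^esub> x"
          using x p.Icarr by (simp add: X.smult_l_distr X.M.a_ac)
        then show "a \<oplus>\<^bsub>X\<^esub> b \<in> W"
          using WI[OF D.sub_add[OF *(3,4)] p.a_closed[OF *(5,6)]] by simp
      next
        fix s a assume s: "s \<in> carrier R" and "a \<in> W"
        then obtain y r where *: "a = y \<oplus>\<^bsub>X\<^esub> r \<odot>\<^bsub>X\<^esub> x" "y \<in> D" "r \<in> p"
          unfolding W_def by blast
        then have "s \<odot>\<^bsub>X\<^esub> a = s \<odot>\<^bsub>X\<^esub> y \<oplus>\<^bsub>X\<^esub> (s \<otimes> r) \<odot>\<^bsub>X\<^esub> x"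
          using x s p.Icarr by (simp add: X.smult_r_distr X.smult_assoc1)
        then show "s \<odot>\<^bsub>X\<^esub> a \<in> W"
          using WI[OF D.sub_smult[OF s *(2)] p.I_l_closed[OF *(3) s]] by simp
      qed
      interpret W: submod R X W using X W by (rule submodI_locale)
      have WA: "W \<subseteq> ?A" unfolding W_def adjoin_def using p.Icarr by blast
      have DW: "y \<in> W" if "y \<in> D" for y
      proof -
        show ?thesis using WI[OF that p.zero_closed] that x by simp
      qed
      have pxW: "r \<odot>\<^bsub>X\<^esub> x \<in> W" if "r \<in> p" for r
      proof -
        show ?thesis using WI[OF D.sub_zero that] that x p.Icarr by simp
      qed
      have pW: "r \<odot>\<^bsub>X\<^esub> a \<in> W" if r: "r \<in> p" and a: "a \<in> ?A" for r a
      proof -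
        obtain y s where *: "a = y \<oplus>\<^bsub>X\<^esub> s \<odot>\<^bsub>X\<^esub> x" "y \<in> D" "s \<in> carrier R"
          using a unfolding adjoin_def by blast
        have "r \<odot>\<^bsub>X\<^esub> a = r \<odot>\<^bsub>X\<^esub> y \<oplus>\<^bsub>X\<^esub> (r \<otimes> s) \<odot>\<^bsub>X\<^esub> x"
          using * x r p.Icarr by (simp add: X.smult_r_distr X.smult_assoc1)
        then show ?thesis
          using WI[OF D.sub_smult[OF p.Icarr[OF r] *(2)] p.I_r_closed[OF r *(3)]] by simp
      qed
      have xA: "r \<odot>\<^bsub>X\<^esub> x \<in> ?A" if "r \<in> carrier R" for r
        using A.sub_smult[OF that A(3)] .
      have onto: "\<exists>r\<in>carrier R. r \<odot>\<^bsub>X\<^esub> x \<ominus>\<^bsub>X\<^esub> y \<in> W" if y: "y \<in> ?A" for y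
        using cyclic_iso(3)[OF X D x] y DW unfolding subquot_iso_def by blast
      have ker: "r \<in> p" if r: "r \<in> carrier R" "r \<odot>\<^bsub>X\<^esub> x \<in> W" for r
      proof -
        obtain y s where *: "r \<odot>\<^bsub>X\<^esub> x = y \<oplus>\<^bsub>X\<^esub> s \<odot>\<^bsub>X\<^esub> x" "y \<in> D" "s \<in> p"
          using r(2) unfolding W_def by blast
        have sR: "s \<in> carrier R" using *(3) p.Icarr by blast
        have "(r \<ominus> s) \<odot>\<^bsub>X\<^esub> x = y"
          using r(1) sR x *(1) D.sub_carr[OF *(2)]
          by (simp add: minus_eq X.smult_l_distr X.smult_l_minus X.M.a_assoc X.M.r_neg)
        then have "r \<ominus> s \<in> p"
          using True *(2) r(1) sR by (auto simp: quot_ideal_def)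
        moreover have "r = s \<oplus> (r \<ominus> s)"
          using Reg.add_minus_cancel[of r s] r(1) sR by simp
        ultimately show ?thesis using p.a_closed[OF *(3)] by metis
      qed
      have sq: "subquot X ?A W" using X A(1) W WA by (simp add: subquot_def)
      have iso: "subquot_iso Reg (carrier R) p X ?A W (\<lambda>r. r \<odot>\<^bsub>X\<^esub> x)"
        unfolding subquot_iso_def using lin_scalars[OF X x] xA onto ker pxW by blast
      have "lim_zero Reg (carrier R) p n i (\<lambda>z. \<one> \<otimes> t z)"
        if t: "coch Reg (carrier R) n (Suc i) t" and z: "lim_zero X ?A W n i (\<lambda>z. t z \<odot>\<^bsub>X\<^esub> x)" for n i t
      proof -
        have "lim_zero Reg (carrier R) p n i t"
          by (rule lim_zero_reflect[OF subquot_ring[OF pI] sq iso t z])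
        then show ?thesis
          using lim_zero_smult[OF regular_module_module _ _ t one_closed] pI Reg.carrier_is_submodule
          by (simp add: ideal_submodule_iff)
      qed
      moreover have "\<one> \<notin> p" using p.I_notcarr p.one_imp_carrier by auto
      ultimately show ?thesis
        using W WA A(3) pW by (intro exI[of _ W] exI[of _ x] exI[of _ \<one>]) simp
    next
      case False
      then obtain u where u: "u \<in> carrier R" "u \<odot>\<^bsub>X\<^esub> x \<in> D" "u \<notin> p"
        unfolding quot_ideal_def by blast
      have uA: "u \<odot>\<^bsub>X\<^esub> a \<in> D" if a: "a \<in> ?A" for a
      proof -
        obtain y s where *: "a = y \<oplus>\<^bsub>X\<^esub> s \<odot>\<^bsub>X\<^esub> x" "y \<in> D" "s \<in> carrier R"
          using a unfolding adjoin_def by blast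
        have "u \<odot>\<^bsub>X\<^esub> a = u \<odot>\<^bsub>X\<^esub> y \<oplus>\<^bsub>X\<^esub> s \<odot>\<^bsub>X\<^esub> (u \<odot>\<^bsub>X\<^esub> x)"
          using * x u by (simp add: X.smult_r_distr X.smult_comm)
        then show ?thesis
          using *(2,3) u D.sub_add D.sub_smult by simp
      qed
      have annD: "r \<in> p" if r: "r \<in> carrier R" "\<And>a. a \<in> D \<Longrightarrow> r \<odot>\<^bsub>X\<^esub> a = \<zero>\<^bsub>X\<^esub>" for r
      proof -
        have "r \<otimes> u \<in> p"
        proof (rule adjoin.prems)
          show "r \<otimes> u \<in> carrier R" using r u by simp
          show "(r \<otimes> u) \<odot>\<^bsub>X\<^esub> a = \<zero>\<^bsub>X\<^esub>" if "a \<in> ?A" for a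
            using r(2)[OF uA[OF that]] r(1) u(1) that by (simp add: X.smult_assoc1)
        qed
        then show ?thesis using p.I_prime[OF r(1) u(1)] u(3) by blast
      qed
      obtain W m c where W: "submodule W R X" "W \<subseteq> D" "m \<in> D" "c \<in> carrier R" "c \<notin> p"
        and pW: "\<And>r a. r \<in> p \<Longrightarrow> a \<in> D \<Longrightarrow> r \<odot>\<^bsub>X\<^esub> a \<in> W"
        and H: "\<And>n i t. coch Reg (carrier R) n (Suc i) t \<Longrightarrow> lim_zero X D W n i (\<lambda>z. t z \<odot>\<^bsub>X\<^esub> m) \<Longrightarrow>
          lim_zero Reg (carrier R) p n i (\<lambda>z. c \<otimes> t z)"
        using adjoin.IH[OF annD] by auto
      interpret W: submod R X W using X W(1) by (rule submodI_locale)
      define V where "V = {a \<in> ?A. u \<odot>\<^bsub>X\<^esub> a \<in> W}"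
      have V: "submodule V R X"
        unfolding V_def using u(1)
        by (intro X.submodI)
          (auto intro: A.sub_add A.sub_smult W.sub_add simp: X.smult_r_distr X.smult_comm[of u] W.sub_smult)
      have uV: "u \<odot>\<^bsub>X\<^esub> a \<in> W" if "a \<in> V" for a using that unfolding V_def by blast
      have "r \<odot>\<^bsub>X\<^esub> a \<in> V" if r: "r \<in> p" and a: "a \<in> ?A" for r a
        unfolding V_def using pW[OF r uA[OF a]] A.sub_smult[OF _ a] p.Icarr[OF r] u(1) a
        by (simp add: X.smult_comm[of u])
      moreover have "lim_zero Reg (carrier R) p n i (\<lambda>z. (c \<otimes> u) \<otimes> t z)"
        if t: "coch Reg (carrier R) n (Suc i) t" and z: "lim_zero X ?A V n i (\<lambda>z. t z \<odot>\<^bsub>X\<^esub> m)" for n i t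
      proof -
        have mX: "m \<in> carrier X" using W(3) by simp
        have tm: "coch X ?A n (Suc i) (\<lambda>z. t z \<odot>\<^bsub>X\<^esub> m)"
          using coch_lin[OF lin_scalars[OF X mX] _ t, of ?A] A.sub_smult A(2) W(3) by blast
        have ut: "coch Reg (carrier R) n (Suc i) (\<lambda>z. u \<otimes> t z)"
          using coch_smult[OF regular_module_module _ t u(1)] Reg.carrier_is_submodule by simp
        have tR: "t z \<in> carrier R" if "z \<in> carrier (F n (Suc i))" for z
          using coch_carrier[OF t that] by simp
        have 1: "lim_zero X D W n i (\<lambda>z. u \<odot>\<^bsub>X\<^esub> (t z \<odot>\<^bsub>X\<^esub> m))"
          using lim_zero_push[OF X X lin_smult_self[OF X u(1)] _ _ tm z, of D W] uA uV by blast
        have um: "coch X D n (Suc i) (\<lambda>z. u \<odot>\<^bsub>X\<^esub> (t z \<odot>\<^bsub>X\<^esub> m))"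
          using coch_lin[OF lin_smult_self[OF X u(1)] _ tm, of D] uA by blast
        have um': "coch X D n (Suc i) (\<lambda>z. (u \<otimes> t z) \<odot>\<^bsub>X\<^esub> m)"
          using coch_lin[OF lin_scalars[OF X mX] _ ut, of D] D.sub_smult W(3) by blast
        have "lim_zero X D W n i (\<lambda>z. (u \<otimes> t z) \<odot>\<^bsub>X\<^esub> m)"
        proof (rule lim_zero_mod[OF X W(1) D um' um coch_zero[OF X D] _ 1])
          fix z assume "z \<in> carrier (F n (Suc i))"
          then show "(u \<otimes> t z) \<odot>\<^bsub>X\<^esub> m \<ominus>\<^bsub>X\<^esub> \<zero>\<^bsub>X\<^esub> \<ominus>\<^bsub>X\<^esub> u \<odot>\<^bsub>X\<^esub> (t z \<odot>\<^bsub>X\<^esub> m) \<in> W"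
            using u(1) tR mX by (simp add: X.smult_assoc1)
        qed
        then have 2: "lim_zero Reg (carrier R) p n i (\<lambda>z. c \<otimes> (u \<otimes> t z))"
          by (rule H[OF ut])
        have cut: "coch Reg (carrier R) n (Suc i) (\<lambda>z. c \<otimes> (u \<otimes> t z))"
          using coch_smult[OF regular_module_module _ ut W(4)] Reg.carrier_is_submodule by simp
        have cut': "coch Reg (carrier R) n (Suc i) (\<lambda>z. (c \<otimes> u) \<otimes> t z)"
          using coch_smult[OF regular_module_module _ t, of "c \<otimes> u"] Reg.carrier_is_submodule W(4) u(1) by simp
        interpret P: submod R Reg p
          using regular_module_module pI by (simp add: submodI_locale ideal_submodule_iff)
        show ?thesis
        proof (rule lim_zero_mod[OF regular_module_module P.submodule_B _ cut' cut coch_zero _ 2])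
          show "submodule (carrier R) R Reg" "submodule (carrier R) R Reg" "module R Reg"
            using Reg.carrier_is_submodule Reg.module_axioms by simp_all
          fix z assume z: "z \<in> carrier (F n (Suc i))"
          show "(c \<otimes> u) \<otimes> t z \<ominus>\<^bsub>Reg\<^esub> \<zero>\<^bsub>Reg\<^esub> \<ominus>\<^bsub>Reg\<^esub> c \<otimes> (u \<otimes> t z) \<in> p"
            using Reg.diff_zero[of "c \<otimes> (u \<otimes> t z)"] P.cong_refl[of "c \<otimes> (u \<otimes> t z)"] W(4) u(1) tR[OF z]
            by (simp add: m_assoc)
        qed
      qed
      moreover have "c \<otimes> u \<notin> p" using p.I_prime[OF W(4) u(1)] W(5) u(3) by blast
      ultimately show ?thesis
        using V W(3,4) A(2) u(1)
        by (intro exI[of _ V] exI[of _ m] exI[of _ "c \<otimes> u"]) (auto simp: V_def)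
    qed
  qed
qed


section \<open>Vanishing in the top degree depends only on the support\<close>

text \<open>
  For a class \<open>\<G>\<close> of ideals on which the cohomology in degree \<open>i + 1\<close> vanishes, the functor \<open>H^i\<close> is
  right exact. If it vanishes on \<open>A\<close>, then on the quotient \<open>A/W\<close> as well, so that for a prime \<open>p\<close> some
  \<open>c \<notin> p\<close> kills \<open>H^i(R/p)\<close>. But \<open>H^i(R/(p + Rc)) = 0\<close> by Noetherian induction, so that multiplication
  by \<open>c\<close> is also surjective.
\<close>

lemma H_quot_vanishes_from_module:
  assumes X: "module R X" and fg: "fg_over R X {\<zero>\<^bsub>X\<^esub>} A"
    and K: "K \<subseteq> carrier R" "\<And>r a. r \<in> K \<Longrightarrow> a \<in> A \<Longrightarrow> r \<odot>\<^bsub>X\<^esub> a = \<zero>\<^bsub>X\<^esub>"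
    and up: "\<And>J L. \<G> J \<Longrightarrow> ideal L R \<Longrightarrow> J \<subseteq> L \<Longrightarrow> \<G> L"
    and GK: "\<And>J. ideal J R \<Longrightarrow> K \<subseteq> J \<Longrightarrow> \<G> J"
    and annp: "\<And>p r. primeideal p R \<Longrightarrow> \<G> p \<Longrightarrow> r \<in> carrier R \<Longrightarrow>
      (\<And>a. a \<in> A \<Longrightarrow> r \<odot>\<^bsub>X\<^esub> a = \<zero>\<^bsub>X\<^esub>) \<Longrightarrow> r \<in> p"
    and v1: "\<And>J. ideal J R \<Longrightarrow> \<G> J \<Longrightarrow> H_quot_vanishes J (Suc i)"
    and vA: "H_vanishes X A {\<zero>\<^bsub>X\<^esub>} i"
    and J: "ideal J R" "\<G> J"
  shows "H_quot_vanishes J i"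
proof -
  interpret X: module R X by fact
  interpret Reg: module R Reg by (rule regular_module_module)
  have AS: "submodule A R X" using X.fg_over_submodule[OF _ fg] by simp
  have A0: "subquot X A {\<zero>\<^bsub>X\<^esub>}"
    using X AS X.zero_submodule X.fg_over_superset[OF fg] by (simp add: subquot_def)
  have "\<G> J \<longrightarrow> H_quot_vanishes J i"
    using J(1)
  proof (induction rule: ideal_induct)
    fix J assume J: "ideal J R"
      and IH: "\<And>K. ideal K R \<Longrightarrow> J \<subset> K \<Longrightarrow> \<G> K \<longrightarrow> H_quot_vanishes K i"
    show "\<G> J \<longrightarrow> H_quot_vanishes J i"
    proof
      assume GJ: "\<G> J"
      have larger: "H_quot_vanishes K i" if "ideal K R" "J \<subset> K" for K
        using IH[OF that] up[OF GJ that(1)] that(2) by blast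
      show "H_quot_vanishes J i"
      proof (rule H_quot_vanishes_devissage[OF J larger])
        assume p: "primeideal J R"
        interpret J: primeideal J R by fact
        obtain W m c where W: "submodule W R X" "W \<subseteq> A" "m \<in> A" "c \<in> carrier R" "c \<notin> J"
          and pW: "\<And>r a. r \<in> J \<Longrightarrow> a \<in> A \<Longrightarrow> r \<odot>\<^bsub>X\<^esub> a \<in> W"
          and H: "\<And>n i t. coch Reg (carrier R) n (Suc i) t \<Longrightarrow> lim_zero X A W n i (\<lambda>z. t z \<odot>\<^bsub>X\<^esub> m) \<Longrightarrow>
            lim_zero Reg (carrier R) J n i (\<lambda>z. c \<otimes> t z)"
          using nonzero_map_to_prime_quotient[OF X fg p annp[OF p GJ]] by auto
        interpret W: submod R X W using X W(1) by (rule submodI_locale)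
        have mX: "m \<in> carrier X" using X.submoduleE(1)[OF AS] W(3) by blast
        have AW: "subquot X A W" and W0: "subquot X W {\<zero>\<^bsub>X\<^esub>}"
          using X AS W(1,2) X.zero_submodule W.sub_zero by (simp_all add: subquot_def)
        have "H_vanishes X W {\<zero>\<^bsub>X\<^esub>} (Suc i)"
        proof (rule H_vanishes_fg[OF X X.zero_submodule _ _ K(1)])
          show "fg_over R X {\<zero>\<^bsub>X\<^esub>} W"
            using submodule_fg_over[OF X fg W(1,2)] W.sub_zero by simp
          show "r \<odot>\<^bsub>X\<^esub> x \<in> {\<zero>\<^bsub>X\<^esub>}" if "r \<in> K" "x \<in> W" for r x
            using K(2)[OF that(1)] W(2) that(2) by blast
          show "H_quot_vanishes J (Suc i)" if "ideal J R" "K \<subseteq> J" for J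
            using v1[OF that(1) GK[OF that]] .
        qed
        then have vAW: "H_vanishes X A W i"
          using H_vanishes_quotient[OF AW W0 vA] by blast
        have c_kills: "lim_zero Reg (carrier R) J n i (\<lambda>z. c \<otimes> t z)" if t: "cocyc Reg (carrier R) J n i t" for n t
        proof (rule H[OF cocycD(1)[OF t]])
          have rA: "r \<odot>\<^bsub>X\<^esub> m \<in> A" if "r \<in> carrier R" for r
            using X.submoduleE(4)[OF AS that W(3)] .
          have "cocyc X A W n i (\<lambda>z. t z \<odot>\<^bsub>X\<^esub> m)"
            using cocyc_push[OF lin_scalars[OF X mX] _ _ t, of A W] rA pW W(3) by blast
          then show "lim_zero X A W n i (\<lambda>z. t z \<odot>\<^bsub>X\<^esub> m)"
            using vAW unfolding H_vanishes_def by blast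
        qed
        let ?Q = "adjoin R Reg J c"
        note Q = adjoin_ideal[OF J W(4)]
        note sqs = subquot_ring[OF Q(1)] subquot_ideals[OF Q(1) J Q(2)] subquot_ring[OF J]
        have iso: "subquot_iso Reg (carrier R) J Reg ?Q J (\<lambda>r. r \<otimes> c)"
          using cyclic_ideal_iso[OF J W(4)] quot_ideal_prime[OF p W(4,5)] by simp
        have vQ: "H_quot_vanishes ?Q i"
          using Q(2,3) W(5) by (intro larger[OF Q(1)]) blast
        interpret P: submod R Reg J
          using regular_module_module J by (simp add: submodI_locale ideal_submodule_iff)
        show "H_quot_vanishes J i"
          unfolding H_vanishes_def
        proof (intro allI impI)
          fix n t assume t: "cocyc Reg (carrier R) J n i t"
          have "cocyc Reg (carrier R) ?Q n i t"
            using t Q(2) unfolding cocyc_def by blast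
          then obtain k h where h: "coch Reg (carrier R) (n + k) i h"
            "\<And>z. z \<in> carrier (F (n + k) (Suc i)) \<Longrightarrow> t (tr n k (Suc i) z) \<ominus>\<^bsub>Reg\<^esub> h (d (n + k) i z) \<in> ?Q"
            using vQ unfolding H_vanishes_def lim_zero_def cobnd_def by blast
          let ?t = "\<lambda>z. t (tr n k (Suc i) z)"
          let ?u = "\<lambda>z. ?t z \<ominus>\<^bsub>Reg\<^esub> h (d (n + k) i z)"
          have tc: "cocyc Reg (carrier R) J (n + k) i ?t" by (rule cocyc_tr[OF t])
          have uR: "coch Reg (carrier R) (n + k) (Suc i) ?u"
            using coch_diff[OF regular_module_module _ cocycD(1)[OF tc] coch_d[OF h(1)]] Reg.carrier_is_submodule
            by simp
          have uQ: "coch Reg ?Q (n + k) (Suc i) ?u"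
            using uR h(2) unfolding coch_def by blast
          have "?u (d (n + k) (Suc i) z) \<in> J" if z: "z \<in> carrier (F (n + k) (Suc (Suc i)))" for z
          proof -
            have "h (d (n + k) i (d (n + k) (Suc i) z)) = \<zero>\<^bsub>Reg\<^esub>"
              using d_d[OF z] lin_zero[OF cochD(1)[OF h(1)] F_module regular_module_module] by simp
            then show ?thesis
              using cocycD(2)[OF tc z] cocyc_carrier[OF tc d_carrier[OF z]] Reg.diff_zero by simp
          qed
          then have "cocyc Reg ?Q J (n + k) i ?u"
            using uQ unfolding cocyc_def by blast
          then obtain s where s: "cocyc Reg (carrier R) J (n + k) i s"
            "\<And>z. z \<in> carrier (F (n + k) (Suc i)) \<Longrightarrow> s z \<otimes> c \<ominus>\<^bsub>Reg\<^esub> ?u z \<in> J"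
            using cocyc_lift[OF sqs(3,2) iso] by blast
          have cs: "coch Reg (carrier R) (n + k) (Suc i) (\<lambda>z. c \<otimes> s z)"
            using coch_smult[OF regular_module_module _ cocycD(1)[OF s(1)] W(4)] Reg.carrier_is_submodule by simp
          have "lim_zero Reg (carrier R) J (n + k) i ?t"
          proof (rule lim_zero_mod[OF regular_module_module P.submodule_B _ cocycD(1)[OF tc] cs h(1) _ c_kills[OF s(1)]])
            show "submodule (carrier R) R Reg" using Reg.carrier_is_submodule by simp
            fix z assume z: "z \<in> carrier (F (n + k) (Suc i))"
            have sR: "s z \<in> carrier R" and uz: "?u z \<in> carrier R"
              using cocyc_carrier[OF s(1) z] coch_carrier[OF uR z] by simp_all
            show "?u z \<ominus>\<^bsub>Reg\<^esub> c \<otimes> s z \<in> J"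
              using P.cong_sym[OF s(2)[OF z]] sR uz W(4) by (simp add: m_comm)
          qed
          then show "lim_zero Reg (carrier R) J n i t"
            by (rule lim_zero_of_tr)
        qed
      qed
    qed
  qed
  then show ?thesis using J(2) by blast
qed


section \<open>Submodules of the limit, and attached primes\<close>

text \<open>
  A submodule of \<open>H^i(X)\<close> is represented by the set of cocycles, at all terms of the tower, whose classes
  lie in it.
\<close>

abbreviation Z :: "('a, 'x, 'm) module_scheme \<Rightarrow> nat \<Rightarrow> nat \<Rightarrow> ((nat \<Rightarrow> 'a) \<Rightarrow> 'x) \<Rightarrow> bool" where
  "Z X n i g \<equiv> cocyc X (carrier X) {\<zero>\<^bsub>X\<^esub>} n i g"

definition limit_submodule ::
  "('a, 'x, 'm) module_scheme \<Rightarrow> nat \<Rightarrow> (nat \<Rightarrow> ((nat \<Rightarrow> 'a) \<Rightarrow> 'x) \<Rightarrow> bool) \<Rightarrow> bool" where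
  "limit_submodule X i Q \<longleftrightarrow>
     (\<forall>n g h. Z X n i g \<longrightarrow> Z X n i h \<longrightarrow> Q n g \<longrightarrow> Q n h \<longrightarrow> Q n (\<lambda>z. g z \<oplus>\<^bsub>X\<^esub> h z)) \<and>
     (\<forall>n g r. Z X n i g \<longrightarrow> r \<in> carrier R \<longrightarrow> Q n g \<longrightarrow> Q n (\<lambda>z. r \<odot>\<^bsub>X\<^esub> g z)) \<and>
     (\<forall>n g. Z X n i g \<longrightarrow> (Q (Suc n) (\<lambda>z. g (\<phi> n (Suc i) z)) \<longleftrightarrow> Q n g)) \<and>
     (\<forall>n g. Z X n i g \<longrightarrow> cobnd X (carrier X) {\<zero>\<^bsub>X\<^esub>} n i g \<longrightarrow> Q n g) \<and>
     (\<forall>n g h. Z X n i g \<longrightarrow> Z X n i h \<longrightarrow> (\<forall>z\<in>carrier (F n (Suc i)). g z = h z) \<longrightarrow> Q n g \<longrightarrow> Q n h)"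

definition attached_to_H :: "('a, 'x, 'm) module_scheme \<Rightarrow> nat \<Rightarrow> 'a set \<Rightarrow> bool" where
  "attached_to_H X i p \<longleftrightarrow> primeideal p R \<and> (\<exists>Q. limit_submodule X i Q \<and>
     p = {r \<in> carrier R. \<forall>n g. Z X n i g \<longrightarrow> Q n (\<lambda>z. r \<odot>\<^bsub>X\<^esub> g z)})"

lemma limit_submoduleD:
  assumes "limit_submodule X i Q"
  shows "Z X n i g \<Longrightarrow> Z X n i h \<Longrightarrow> Q n g \<Longrightarrow> Q n h \<Longrightarrow> Q n (\<lambda>z. g z \<oplus>\<^bsub>X\<^esub> h z)"
    and "Z X n i g \<Longrightarrow> r \<in> carrier R \<Longrightarrow> Q n g \<Longrightarrow> Q n (\<lambda>z. r \<odot>\<^bsub>X\<^esub> g z)"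
    and "Z X n i g \<Longrightarrow> Q (Suc n) (\<lambda>z. g (\<phi> n (Suc i) z)) \<longleftrightarrow> Q n g"
    and "Z X n i g \<Longrightarrow> cobnd X (carrier X) {\<zero>\<^bsub>X\<^esub>} n i g \<Longrightarrow> Q n g"
    and "Z X n i g \<Longrightarrow> Z X n i h \<Longrightarrow> (\<And>z. z \<in> carrier (F n (Suc i)) \<Longrightarrow> g z = h z) \<Longrightarrow> Q n g \<Longrightarrow> Q n h"
proof -
  note parts = assms[unfolded limit_submodule_def]
  show "Z X n i g \<Longrightarrow> Z X n i h \<Longrightarrow> Q n g \<Longrightarrow> Q n h \<Longrightarrow> Q n (\<lambda>z. g z \<oplus>\<^bsub>X\<^esub> h z)"
    using conjunct1[OF parts] by simp
  show "Z X n i g \<Longrightarrow> r \<in> carrier R \<Longrightarrow> Q n g \<Longrightarrow> Q n (\<lambda>z. r \<odot>\<^bsub>X\<^esub> g z)"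
    using conjunct1[OF conjunct2[OF parts]] by simp
  show "Z X n i g \<Longrightarrow> Q (Suc n) (\<lambda>z. g (\<phi> n (Suc i) z)) \<longleftrightarrow> Q n g"
    using conjunct1[OF conjunct2[OF conjunct2[OF parts]]] by simp
  show "Z X n i g \<Longrightarrow> cobnd X (carrier X) {\<zero>\<^bsub>X\<^esub>} n i g \<Longrightarrow> Q n g"
    using conjunct1[OF conjunct2[OF conjunct2[OF conjunct2[OF parts]]]] by simp
  show "Z X n i g \<Longrightarrow> Z X n i h \<Longrightarrow> (\<And>z. z \<in> carrier (F n (Suc i)) \<Longrightarrow> g z = h z) \<Longrightarrow> Q n g \<Longrightarrow> Q n h"
    using conjunct2[OF conjunct2[OF conjunct2[OF conjunct2[OF parts]]]] by metis
qed

lemma limit_submodule_tr: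
  assumes Q: "limit_submodule X i Q" and g: "Z X n i g"
  shows "Q (n + k) (\<lambda>z. g (tr n k (Suc i) z)) \<longleftrightarrow> Q n g"
proof (induction k)
  case (Suc k)
  show ?case
    using limit_submoduleD(3)[OF Q cocyc_tr[OF g, of k]] Suc by simp
qed simp

text \<open>
  When the cohomology in degree \<open>i + 1\<close> vanishes on \<open>J/K\<close> for the relevant ideals \<open>J\<close>, the classes of
  \<open>H^i(A/C)\<close> are generated by the images of \<open>H^i(R/K)\<close> under the maps \<open>R/K \<rightarrow> A/C\<close>: one adds generators
  of \<open>A\<close> one by one, using that \<open>H^i(R/K) \<rightarrow> H^i(R/J)\<close> is surjective. The predicate \<open>Q\<close> stands for membership in
  a submodule of \<open>H^i(A/C)\<close>.
\<close>

lemma cocycles_from_generators: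
  assumes X: "module R X" and C: "submodule C R X" and fg: "fg_over R X C A"
    and K: "ideal K R" "\<And>r x. r \<in> K \<Longrightarrow> x \<in> A \<Longrightarrow> r \<odot>\<^bsub>X\<^esub> x \<in> C"
    and v: "\<And>J. ideal J R \<Longrightarrow> K \<subseteq> J \<Longrightarrow> H_quot_vanishes J (Suc i)"
    and Qadd: "\<And>n g h f. \<lbrakk>cocyc X A C n i g; cocyc X A C n i h; cocyc X A C n i f; Q n g; Q n h;
      \<And>z. z \<in> carrier (F n (Suc i)) \<Longrightarrow> f z = g z \<oplus>\<^bsub>X\<^esub> h z\<rbrakk> \<Longrightarrow> Q n f"
    and Qtr: "\<And>n k g. cocyc X A C n i g \<Longrightarrow> Q (n + k) (\<lambda>z. g (tr n k (Suc i) z)) \<Longrightarrow> Q n g"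
    and QC: "\<And>n g. cocyc X A C n i g \<Longrightarrow> (\<And>z. z \<in> carrier (F n (Suc i)) \<Longrightarrow> g z \<in> C) \<Longrightarrow> Q n g"
    and Qgen: "\<And>n t x. x \<in> A \<Longrightarrow> cocyc Reg (carrier R) K n i t \<Longrightarrow> Q n (\<lambda>z. t z \<odot>\<^bsub>X\<^esub> x)"
    and g: "cocyc X A C n i g"
  shows "Q n g"
proof -
  interpret X: module R X by fact
  interpret Reg: module R Reg by (rule regular_module_module)
  have CX: "C \<subseteq> carrier X" using X.submoduleE(1)[OF C] .
  have A: "submodule A R X" by (rule X.fg_over_submodule[OF CX fg])
  interpret A: submod R X A using X A by (rule submodI_locale)
  let ?P = "\<lambda>D. \<forall>n g. cocyc X A C n i g \<longrightarrow> (\<forall>z\<in>carrier (F n (Suc i)). g z \<in> D) \<longrightarrow> Q n g"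
  have "?P A"
  proof (rule X.fg_over_induct[where P = ?P, OF C fg])
    show "?P C" using QC by blast
    fix D x
    assume hyps: "submodule D R X" "C \<subseteq> D" "D \<subseteq> A" "x \<in> A" "x \<in> carrier X" and IH: "?P D"
    interpret D: submod R X D using X hyps(1) by (rule submodI_locale)
    note x = hyps(5)
    show "?P (adjoin R X D x)"
    proof (intro allI impI)
      fix n g assume g: "cocyc X A C n i g" and gD: "\<forall>z\<in>carrier (F n (Suc i)). g z \<in> adjoin R X D x"
      let ?J = "quot_ideal R X D x"
      have J: "ideal ?J R" by (rule quot_ideal_ideal[OF X hyps(1) x])
      have KJ: "K \<subseteq> ?J"
        using K(2)[OF _ hyps(4)] hyps(2) ideal.Icarr[OF K(1)] unfolding quot_ideal_def by blast
      note iso = cyclic_iso[OF X hyps(1) x]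
      have gX: "g z \<in> carrier X" if "z \<in> carrier (F n (Suc i))" for z using cocyc_carrier[OF g that] .
      have "cocyc X (adjoin R X D x) D n i g"
        using g gD hyps(2) unfolding cocyc_def coch_def by blast
      then obtain t where t: "cocyc Reg (carrier R) ?J n i t"
        "\<And>z. z \<in> carrier (F n (Suc i)) \<Longrightarrow> t z \<odot>\<^bsub>X\<^esub> x \<ominus>\<^bsub>X\<^esub> g z \<in> D"
        using cocyc_lift[OF iso] by blast
      have "H_vanishes Reg ?J K (Suc i)"
      proof (rule H_vanishes_fg[OF regular_module_module])
        show "submodule K R Reg" using K(1) by (simp add: ideal_submodule_iff)
        show "fg_over R Reg K ?J" by (rule ideal_fg_over[OF J K(1) KJ])
        show "K \<subseteq> carrier R" using ideal.Icarr[OF K(1)] by blast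
        show "r \<odot>\<^bsub>Reg\<^esub> y \<in> K" if "r \<in> K" "y \<in> ?J" for r y
          using ideal.I_r_closed[OF K(1) that(1)] ideal.Icarr[OF J that(2)] by simp
      qed (rule v)
      then obtain k h where h: "coch Reg ?J (n + k) (Suc i) h"
        "cocyc Reg (carrier R) K (n + k) i (\<lambda>z. t (tr n k (Suc i) z) \<ominus>\<^bsub>Reg\<^esub> h z)"
        using cocyc_lift_quotient[OF subquot_ring[OF J] subquot_ideals[OF J K(1) KJ] _ t(1)] by blast
      let ?s = "\<lambda>z. t (tr n k (Suc i) z) \<ominus>\<^bsub>Reg\<^esub> h z"
      let ?g = "\<lambda>z. g (tr n k (Suc i) z)"
      let ?f = "\<lambda>z. ?g z \<ominus>\<^bsub>X\<^esub> ?s z \<odot>\<^bsub>X\<^esub> x"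
      have gc: "cocyc X A C (n + k) i ?g" by (rule cocyc_tr[OF g])
      have sxA: "r \<odot>\<^bsub>X\<^esub> x \<in> A" if "r \<in> carrier R" for r
        using A.sub_smult[OF that hyps(4)] .
      have sx: "cocyc X A C (n + k) i (\<lambda>z. ?s z \<odot>\<^bsub>X\<^esub> x)"
        using cocyc_push[OF lin_scalars[OF X x] _ _ h(2), of A C] sxA K(2)[OF _ hyps(4)] by blast
      have fA: "coch X A (n + k) (Suc i) ?f"
        by (rule coch_diff[OF X A cocycD(1)[OF gc] cocycD(1)[OF sx]])
      interpret C: submod R X C using X C by (rule submodI_locale)
      have f: "cocyc X A C (n + k) i ?f"
        using fA C.sub_minus[OF cocycD(2)[OF gc] cocycD(2)[OF sx]] unfolding cocyc_def by blast
      have "?f z \<in> D" if z: "z \<in> carrier (F (n + k) (Suc i))" for z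
      proof -
        let ?w = "tr n k (Suc i) z"
        have w: "?w \<in> carrier (F n (Suc i))" using tr_carrier[OF z] .
        have c: "t ?w \<in> carrier R" "h z \<in> carrier R" "h z \<odot>\<^bsub>X\<^esub> x \<in> D"
          using cocyc_carrier[OF t(1) w] coch_carrier[OF h(1) z] cochD(2)[OF h(1) z]
          by (simp_all add: quot_ideal_def)
        have "?s z \<odot>\<^bsub>X\<^esub> x = t ?w \<odot>\<^bsub>X\<^esub> x \<ominus>\<^bsub>X\<^esub> h z \<odot>\<^bsub>X\<^esub> x"
          using c(1,2) x by (simp add: minus_eq X.M.minus_eq X.smult_l_distr X.smult_l_minus)
        then have "?s z \<odot>\<^bsub>X\<^esub> x \<ominus>\<^bsub>X\<^esub> t ?w \<odot>\<^bsub>X\<^esub> x = \<ominus>\<^bsub>X\<^esub> (h z \<odot>\<^bsub>X\<^esub> x)"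
          using X.diff_diff_self[of "t ?w \<odot>\<^bsub>X\<^esub> x" "h z \<odot>\<^bsub>X\<^esub> x"] X.neg_diff[of "t ?w \<odot>\<^bsub>X\<^esub> x" "?s z \<odot>\<^bsub>X\<^esub> x"] c x
          by simp
        then have "?s z \<odot>\<^bsub>X\<^esub> x \<ominus>\<^bsub>X\<^esub> t ?w \<odot>\<^bsub>X\<^esub> x \<in> D" using D.sub_neg[OF c(3)] by simp
        then have "?s z \<odot>\<^bsub>X\<^esub> x \<ominus>\<^bsub>X\<^esub> g ?w \<in> D"
          using D.cong_trans[OF _ t(2)[OF w]] c x gX[OF w] by simp
        then show ?thesis
          using D.cong_sym[of "?s z \<odot>\<^bsub>X\<^esub> x" "g ?w"] c x gX[OF w] by simp
      qed
      then have Qf: "Q (n + k) ?f" using IH f by blast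
      have Qs: "Q (n + k) (\<lambda>z. ?s z \<odot>\<^bsub>X\<^esub> x)"
        by (rule Qgen[OF hyps(4) h(2)])
      have "Q (n + k) ?g"
      proof (rule Qadd[OF sx f gc Qs Qf])
        fix z assume z: "z \<in> carrier (F (n + k) (Suc i))"
        show "?g z = ?s z \<odot>\<^bsub>X\<^esub> x \<oplus>\<^bsub>X\<^esub> ?f z"
          using X.add_minus_cancel[OF cocyc_carrier[OF gc z] cocyc_carrier[OF sx z]] by simp
      qed
      then show "Q n g" by (rule Qtr[OF g])
    qed
  qed
  then show ?thesis using g cochD(2)[OF cocycD(1)[OF g]] by blast
qed

text \<open>
  Let \<open>p = Ann (H^i(N)/Q)\<close>. For \<open>W\<close>, \<open>m\<close> and \<open>c\<close> as in
  \<open>nonzero_map_to_prime_quotient\<close>, the kernel of \<open>H^i(M) \<rightarrow> H^i(M/W)\<close> is a submodule of \<open>H^i(M)\<close>, and the quotient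
  is killed by \<open>p\<close>. If \<open>r\<close> kills it, then \<open>r\<close> kills \<open>H^i(M/W)\<close>, so \<open>s = cr\<close> kills \<open>H^i(R/p)\<close>. Then \<open>s\<close> maps
  \<open>H^i(R/KN)\<close> into the image of \<open>H^i(p/KN)\<close>, which is \<open>p H^i(R/KN)\<close>, and hence \<open>H^i(N)\<close> into \<open>p H^i(N) \<subseteq> Q\<close>; so
  \<open>s \<in> p\<close> and \<open>r \<in> p\<close>.
\<close>

theorem attached_to_H_transfer:
  assumes M: "module R M" "fg_over R M {\<zero>\<^bsub>M\<^esub>} (carrier M)" and N: "module R N" "fg_over R N {\<zero>\<^bsub>N\<^esub>} (carrier N)"
    and KM: "ideal KM R" "\<And>r x. r \<in> KM \<Longrightarrow> x \<in> carrier M \<Longrightarrow> r \<odot>\<^bsub>M\<^esub> x = \<zero>\<^bsub>M\<^esub>"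
    and KN: "ideal KN R" "\<And>r x. r \<in> KN \<Longrightarrow> x \<in> carrier N \<Longrightarrow> r \<odot>\<^bsub>N\<^esub> x = \<zero>\<^bsub>N\<^esub>"
    and vM: "\<And>J. ideal J R \<Longrightarrow> KM \<subseteq> J \<Longrightarrow> H_quot_vanishes J (Suc i)"
    and vN: "\<And>J. ideal J R \<Longrightarrow> KN \<subseteq> J \<Longrightarrow> H_quot_vanishes J (Suc i)"
    and annp: "\<And>p r. primeideal p R \<Longrightarrow> KN \<subseteq> p \<Longrightarrow> r \<in> carrier R \<Longrightarrow>
      (\<And>x. x \<in> carrier M \<Longrightarrow> r \<odot>\<^bsub>M\<^esub> x = \<zero>\<^bsub>M\<^esub>) \<Longrightarrow> r \<in> p"
    and att: "attached_to_H N i p"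
  shows "attached_to_H M i p"
proof -
  interpret M: module R M by fact
  interpret N: module R N by fact
  interpret Reg: module R Reg by (rule regular_module_module)
  obtain Q where p: "primeideal p R" and Q: "limit_submodule N i Q"
    and pQ: "p = {r \<in> carrier R. \<forall>n g. Z N n i g \<longrightarrow> Q n (\<lambda>z. r \<odot>\<^bsub>N\<^esub> g z)}"
    using att unfolding attached_to_H_def by blast
  note QD = limit_submoduleD[OF Q]
  interpret p: primeideal p R by fact
  note pI = p.is_ideal
  have NS: "submodule (carrier N) R N" and N0: "submodule {\<zero>\<^bsub>N\<^esub>} R N"
    and MS: "submodule (carrier M) R M" and M0: "submodule {\<zero>\<^bsub>M\<^esub>} R M" and RS: "submodule (carrier R) R Reg"
    using N.carrier_is_submodule N.zero_submodule M.carrier_is_submodule M.zero_submodule Reg.carrier_is_submodule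
    by simp_all
  have Zr: "Z N n i (\<lambda>z. r \<odot>\<^bsub>N\<^esub> g z)" if "r \<in> carrier R" "Z N n i g" for r n g
    using cocyc_push[OF lin_smult_self[OF N(1) that(1)] _ _ that(2), of "carrier N" "{\<zero>\<^bsub>N\<^esub>}"] that(1) by simp
  have Q0: "Q n g" if g: "Z N n i g" "\<And>z. z \<in> carrier (F n (Suc i)) \<Longrightarrow> g z = \<zero>\<^bsub>N\<^esub>" for n g
  proof (rule QD(4)[OF g(1)])
    show "cobnd N (carrier N) {\<zero>\<^bsub>N\<^esub>} n i g"
      by (rule cobnd_of_values[OF N(1) NS cochD(1)[OF cocycD(1)[OF g(1)]]]) (use g(2) in simp)
  qed
  have KNp: "KN \<subseteq> p"
  proof
    fix r assume r: "r \<in> KN"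
    have rR: "r \<in> carrier R" using ideal.Icarr[OF KN(1) r] .
    have "Q n (\<lambda>z. r \<odot>\<^bsub>N\<^esub> g z)" if g: "Z N n i g" for n g
      by (rule Q0[OF Zr[OF rR g]]) (use KN(2)[OF r] cocyc_carrier[OF g] in simp)
    then show "r \<in> p" unfolding pQ using rR by blast
  qed
  obtain W m c where W: "submodule W R M" "m \<in> carrier M" "c \<in> carrier R" "c \<notin> p"
    and pW: "\<And>r a. r \<in> p \<Longrightarrow> a \<in> carrier M \<Longrightarrow> r \<odot>\<^bsub>M\<^esub> a \<in> W"
    and H: "\<And>n i t. coch Reg (carrier R) n (Suc i) t \<Longrightarrow> lim_zero M (carrier M) W n i (\<lambda>z. t z \<odot>\<^bsub>M\<^esub> m) \<Longrightarrow>
      lim_zero Reg (carrier R) p n i (\<lambda>z. c \<otimes> t z)"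
    using nonzero_map_to_prime_quotient[OF M p annp[OF p KNp]] by auto
  interpret W: submod R M W using M(1) W(1) by (rule submodI_locale)
  have MW: "subquot M (carrier M) W" and W0: "subquot M W {\<zero>\<^bsub>M\<^esub>}"
    using M(1) MS W(1) M0 W.sub_zero W.sub_subset by (simp_all add: subquot_def)
  define Q' where "Q' n g \<longleftrightarrow> lim_zero M (carrier M) W n i g" for n g
  have Q': "limit_submodule M i Q'"
    unfolding limit_submodule_def
  proof (intro conjI allI impI)
    fix n g h assume g: "Z M n i g" and h: "Z M n i h"
    show "Q' n (\<lambda>z. g z \<oplus>\<^bsub>M\<^esub> h z)" if "Q' n g" "Q' n h"
      using lim_zero_add[OF M(1) W(1) MS cocycD(1)[OF g] cocycD(1)[OF h]] that unfolding Q'_def by blast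
    show "Q' n h" if "\<forall>z\<in>carrier (F n (Suc i)). g z = h z" "Q' n g"
      unfolding Q'_def
    proof (rule lim_zero_mod[OF M(1) W(1) MS cocycD(1)[OF h] cocycD(1)[OF g] coch_zero[OF M(1) MS]])
      show "h z \<ominus>\<^bsub>M\<^esub> \<zero>\<^bsub>M\<^esub> \<ominus>\<^bsub>M\<^esub> g z \<in> W" if "z \<in> carrier (F n (Suc i))" for z
        using \<open>\<forall>z\<in>carrier (F n (Suc i)). g z = h z\<close> that cocyc_carrier[OF h that] by simp
      show "lim_zero M (carrier M) W n i g" using \<open>Q' n g\<close> unfolding Q'_def .
    qed
  next
    fix n g r assume "Z M n i g" "r \<in> carrier R" "Q' n g"
    then show "Q' n (\<lambda>z. r \<odot>\<^bsub>M\<^esub> g z)"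
      using lim_zero_smult[OF M(1) W(1) MS cocycD(1)] unfolding Q'_def by blast
  next
    fix n g assume g: "Z M n i g"
    show "Q' (Suc n) (\<lambda>z. g (\<phi> n (Suc i) z)) \<longleftrightarrow> Q' n g"
      using lim_zero_tr[of M "carrier M" W n i g "Suc 0"] lim_zero_of_tr[of M "carrier M" W n "Suc 0" i g]
      unfolding Q'_def by auto
    show "Q' n g" if "cobnd M (carrier M) {\<zero>\<^bsub>M\<^esub>} n i g"
    proof -
      have "cobnd M (carrier M) W n i g"
        using that W.sub_zero unfolding cobnd_def by (metis singletonD)
      then show ?thesis unfolding Q'_def by (rule cobnd_imp_lim_zero)
    qed
  qed
  have "r \<in> p" if r: "r \<in> carrier R" and rQ': "\<And>n g. Z M n i g \<Longrightarrow> Q' n (\<lambda>z. r \<odot>\<^bsub>M\<^esub> g z)" for r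
  proof -
    have vW: "H_vanishes M W {\<zero>\<^bsub>M\<^esub>} (Suc i)"
    proof (rule H_vanishes_fg[OF M(1) M0])
      show "fg_over R M {\<zero>\<^bsub>M\<^esub>} W"
        using submodule_fg_over[OF M W(1) W.sub_subset] W.sub_zero by simp
      show "a \<odot>\<^bsub>M\<^esub> x \<in> {\<zero>\<^bsub>M\<^esub>}" if "a \<in> KM" "x \<in> W" for a x
        using KM(2)[OF that(1)] that(2) by simp
      show "KM \<subseteq> carrier R" using ideal.Icarr[OF KM(1)] by blast
    qed (rule vM)
    \<comment> \<open>Right exactness: every class of \<open>H^i(M/W)\<close> comes from \<open>H^i(M)\<close>.\<close>
    have r_kills: "lim_zero M (carrier M) W n i (\<lambda>z. r \<odot>\<^bsub>M\<^esub> g z)" if g: "cocyc M (carrier M) W n i g" for n g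
    proof -
      obtain k h where h: "coch M W (n + k) (Suc i) h" "Z M (n + k) i (\<lambda>z. g (tr n k (Suc i) z) \<ominus>\<^bsub>M\<^esub> h z)"
        using cocyc_lift_quotient[OF MW W0 vW g] by blast
      let ?g = "\<lambda>z. g (tr n k (Suc i) z)"
      have gc: "coch M (carrier M) (n + k) (Suc i) ?g" by (rule coch_tr[OF cocycD(1)[OF g]])
      have 1: "lim_zero M (carrier M) W (n + k) i (\<lambda>z. r \<odot>\<^bsub>M\<^esub> (?g z \<ominus>\<^bsub>M\<^esub> h z))"
        using rQ'[OF h(2)] unfolding Q'_def .
      have "lim_zero M (carrier M) W (n + k) i (\<lambda>z. r \<odot>\<^bsub>M\<^esub> ?g z)"
      proof (rule lim_zero_mod[OF M(1) W(1) MS coch_smult[OF M(1) MS gc r]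
            coch_smult[OF M(1) MS cocycD(1)[OF h(2)] r] coch_zero[OF M(1) MS] _ 1])
        fix z assume z: "z \<in> carrier (F (n + k) (Suc i))"
        have c: "?g z \<in> carrier M" "h z \<in> W" using coch_carrier[OF gc z] cochD(2)[OF h(1) z] by auto
        have "r \<odot>\<^bsub>M\<^esub> ?g z \<ominus>\<^bsub>M\<^esub> r \<odot>\<^bsub>M\<^esub> (?g z \<ominus>\<^bsub>M\<^esub> h z) = r \<odot>\<^bsub>M\<^esub> h z"
          using c r by (simp add: M.smult_minus M.diff_diff_self)
        then show "r \<odot>\<^bsub>M\<^esub> ?g z \<ominus>\<^bsub>M\<^esub> \<zero>\<^bsub>M\<^esub> \<ominus>\<^bsub>M\<^esub> r \<odot>\<^bsub>M\<^esub> (?g z \<ominus>\<^bsub>M\<^esub> h z) \<in> W"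
          using c r W.sub_smult by simp
      qed
      then show ?thesis by (rule lim_zero_of_tr)
    qed
    define s where "s = c \<otimes> r"
    have sR: "s \<in> carrier R" unfolding s_def using W(3) r by simp
    interpret P: submod R Reg p
      using regular_module_module pI by (simp add: submodI_locale ideal_submodule_iff)
    \<comment> \<open>The maps \<open>R/p \<rightarrow> M/W \<rightarrow> R/p\<close> compose to multiplication by \<open>c\<close>, and \<open>r\<close> kills the middle term.\<close>
    have s_kills: "lim_zero Reg (carrier R) p n i (\<lambda>z. s \<otimes> t z)" if t: "cocyc Reg (carrier R) p n i t" for n t
    proof -
      have tR: "t z \<in> carrier R" if "z \<in> carrier (F n (Suc i))" for z using cocyc_carrier[OF t that] by simp
      have tm: "cocyc M (carrier M) W n i (\<lambda>z. t z \<odot>\<^bsub>M\<^esub> m)"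
        using cocyc_push[OF lin_scalars[OF M(1) W(2)] _ _ t, of "carrier M" W] pW W(2) by simp
      have rt: "coch Reg (carrier R) n (Suc i) (\<lambda>z. r \<otimes> t z)"
        using coch_smult[OF regular_module_module RS cocycD(1)[OF t] r] by simp
      have rtm: "coch M (carrier M) n (Suc i) (\<lambda>z. (r \<otimes> t z) \<odot>\<^bsub>M\<^esub> m)"
        using coch_lin[OF lin_scalars[OF M(1) W(2)] _ rt, of "carrier M"] W(2) by simp
      have "lim_zero M (carrier M) W n i (\<lambda>z. (r \<otimes> t z) \<odot>\<^bsub>M\<^esub> m)"
      proof (rule lim_zero_mod[OF M(1) W(1) MS rtm coch_smult[OF M(1) MS cocycD(1)[OF tm] r]
            coch_zero[OF M(1) MS] _ r_kills[OF tm]])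
        fix z assume "z \<in> carrier (F n (Suc i))"
        then show "(r \<otimes> t z) \<odot>\<^bsub>M\<^esub> m \<ominus>\<^bsub>M\<^esub> \<zero>\<^bsub>M\<^esub> \<ominus>\<^bsub>M\<^esub> r \<odot>\<^bsub>M\<^esub> (t z \<odot>\<^bsub>M\<^esub> m) \<in> W"
          using r tR W(2) by (simp add: M.smult_assoc1)
      qed
      then have 1: "lim_zero Reg (carrier R) p n i (\<lambda>z. c \<otimes> (r \<otimes> t z))" by (rule H[OF rt])
      have crt: "coch Reg (carrier R) n (Suc i) (\<lambda>z. c \<otimes> (r \<otimes> t z))"
        using coch_smult[OF regular_module_module RS rt W(3)] by simp
      have st: "coch Reg (carrier R) n (Suc i) (\<lambda>z. s \<otimes> t z)"
        using coch_smult[OF regular_module_module RS cocycD(1)[OF t] sR] by simp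
      show ?thesis
      proof (rule lim_zero_mod[OF regular_module_module P.submodule_B RS st crt coch_zero[OF regular_module_module RS] _ 1])
        fix z assume z: "z \<in> carrier (F n (Suc i))"
        show "s \<otimes> t z \<ominus>\<^bsub>Reg\<^esub> \<zero>\<^bsub>Reg\<^esub> \<ominus>\<^bsub>Reg\<^esub> c \<otimes> (r \<otimes> t z) \<in> p"
          using Reg.diff_zero[of "c \<otimes> (r \<otimes> t z)"] P.cong_refl[of "c \<otimes> (r \<otimes> t z)"] W(3) r tR[OF z]
          by (simp add: s_def m_assoc)
      qed
    qed
    have KNS: "submodule KN R Reg" using KN(1) by (simp add: ideal_submodule_iff)
    have tx: "Z N n i (\<lambda>z. t z \<odot>\<^bsub>N\<^esub> x)" if "x \<in> carrier N" "cocyc Reg (carrier R) KN n i t" for n t x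
      using cocyc_push[OF lin_scalars[OF N(1) that(1)] _ _ that(2), of "carrier N" "{\<zero>\<^bsub>N\<^esub>}"] KN(2) that(1) by simp
    have txp: "Z N n i (\<lambda>z. t z \<odot>\<^bsub>N\<^esub> x)" if "x \<in> carrier N" "cocyc Reg p KN n i t" for n t x
      using cocyc_push[OF lin_scalars[OF N(1) that(1)] _ _ that(2), of "carrier N" "{\<zero>\<^bsub>N\<^esub>}"] KN(2) that(1) p.Icarr
      by simp
    \<comment> \<open>The image of \<open>H^i(p/KN)\<close> under any map \<open>R/KN \<rightarrow> N\<close> lies in \<open>p H^i(N) \<subseteq> Q\<close>.\<close>
    have Q_p: "Q n (\<lambda>z. u z \<odot>\<^bsub>N\<^esub> x)" if x: "x \<in> carrier N" and u: "cocyc Reg p KN n i u" for n u x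
    proof -
      define Qx where "Qx n u \<longleftrightarrow> Q n (\<lambda>z. u z \<odot>\<^bsub>N\<^esub> x)" for n and u :: "(nat \<Rightarrow> 'a) \<Rightarrow> 'a"
      have "Qx n u"
      proof (rule cocycles_from_generators[where Q = Qx and X = Reg and C = KN and A = p and K = KN])
        show "module R Reg" "submodule KN R Reg" "fg_over R Reg KN p" "ideal KN R"
          using regular_module_module KNS ideal_fg_over[OF pI KN(1) KNp] KN(1) by simp_all
        show "a \<odot>\<^bsub>Reg\<^esub> b \<in> KN" if "a \<in> KN" "b \<in> p" for a b
          using ideal.I_r_closed[OF KN(1) that(1)] p.Icarr[OF that(2)] by simp
        show "cocyc Reg p KN n i u" by (rule u)
      next
        fix n g h f assume *: "cocyc Reg p KN n i g" "cocyc Reg p KN n i h" "cocyc Reg p KN n i f"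
          "Qx n g" "Qx n h"
          "\<And>z. z \<in> carrier (F n (Suc i)) \<Longrightarrow> f z = g z \<oplus>\<^bsub>Reg\<^esub> h z"
        have s: "Q n (\<lambda>z. g z \<odot>\<^bsub>N\<^esub> x \<oplus>\<^bsub>N\<^esub> h z \<odot>\<^bsub>N\<^esub> x)"
          by (rule QD(1)[OF txp[OF x *(1)] txp[OF x *(2)] *(4,5)[unfolded Qx_def]])
        have e: "g z \<odot>\<^bsub>N\<^esub> x \<oplus>\<^bsub>N\<^esub> h z \<odot>\<^bsub>N\<^esub> x = f z \<odot>\<^bsub>N\<^esub> x" if "z \<in> carrier (F n (Suc i))" for z
          using *(6)[OF that] cocyc_carrier[OF *(1) that] cocyc_carrier[OF *(2) that] x by (simp add: N.smult_l_distr)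
        have "coch N (carrier N) n (Suc i) (\<lambda>z. g z \<odot>\<^bsub>N\<^esub> x \<oplus>\<^bsub>N\<^esub> h z \<odot>\<^bsub>N\<^esub> x)"
          by (rule coch_add[OF N(1) NS cocycD(1)[OF txp[OF x *(1)]] cocycD(1)[OF txp[OF x *(2)]]])
        then have "Z N n i (\<lambda>z. g z \<odot>\<^bsub>N\<^esub> x \<oplus>\<^bsub>N\<^esub> h z \<odot>\<^bsub>N\<^esub> x)"
          using cocycD(2)[OF txp[OF x *(1)]] cocycD(2)[OF txp[OF x *(2)]] unfolding cocyc_def by simp
        then show "Qx n f"
          unfolding Qx_def using QD(5)[OF _ txp[OF x *(3)] e s] by blast
      next
        fix n k g assume "cocyc Reg p KN n i g" "Qx (n + k) (\<lambda>z. g (tr n k (Suc i) z))"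
        then show "Qx n g"
          unfolding Qx_def using limit_submodule_tr[OF Q txp[OF x], of n g k] by simp
      next
        fix n g assume g: "cocyc Reg p KN n i g" "\<And>z. z \<in> carrier (F n (Suc i)) \<Longrightarrow> g z \<in> KN"
        show "Qx n g"
          unfolding Qx_def by (rule Q0[OF txp[OF x g(1)]]) (use KN(2)[OF g(2) x] in simp)
      next
        fix n t a assume a: "a \<in> p" and t: "cocyc Reg (carrier R) KN n i t"
        have aR: "a \<in> carrier R" using p.Icarr[OF a] .
        note Ztx = tx[OF x t]
        have "Q n (\<lambda>z. a \<odot>\<^bsub>N\<^esub> (t z \<odot>\<^bsub>N\<^esub> x))"
          using a Ztx unfolding pQ by blast
        moreover have "a \<odot>\<^bsub>N\<^esub> (t z \<odot>\<^bsub>N\<^esub> x) = (t z \<odot>\<^bsub>Reg\<^esub> a) \<odot>\<^bsub>N\<^esub> x" if "z \<in> carrier (F n (Suc i))" for z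
          using cocyc_carrier[OF t that] aR x by (simp add: N.smult_assoc1 N.smult_comm)
        moreover have "cocyc Reg p KN n i (\<lambda>z. t z \<odot>\<^bsub>Reg\<^esub> a)"
          using cocyc_push[OF lin_scalars[OF regular_module_module, of a] _ _ t, of p KN] aR
            p.I_l_closed[OF a] ideal.I_r_closed[OF KN(1)] by simp
        ultimately show "Qx n (\<lambda>z. t z \<odot>\<^bsub>Reg\<^esub> a)"
          unfolding Qx_def using QD(5)[OF Zr[OF aR Ztx] txp[OF x]] by blast
      qed (rule vN)
      then show ?thesis unfolding Qx_def .
    qed
    \<comment> \<open>As \<open>s\<close> kills \<open>H^i(R/p)\<close>, the class \<open>s t\<close> comes from \<open>H^i(p/KN)\<close>.\<close>
    have Q_gen: "Q n (\<lambda>z. s \<odot>\<^bsub>N\<^esub> (t z \<odot>\<^bsub>N\<^esub> x))" if x: "x \<in> carrier N" and t: "cocyc Reg (carrier R) KN n i t" for n t x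
    proof -
      have "cocyc Reg (carrier R) p n i t" using t KNp unfolding cocyc_def by blast
      then obtain k h where h: "coch Reg (carrier R) (n + k) i h"
        "\<And>z. z \<in> carrier (F (n + k) (Suc i)) \<Longrightarrow> s \<otimes> t (tr n k (Suc i) z) \<ominus>\<^bsub>Reg\<^esub> h (d (n + k) i z) \<in> p"
        using s_kills unfolding lim_zero_def cobnd_def by blast
      let ?t = "\<lambda>z. t (tr n k (Suc i) z)"
      let ?u = "\<lambda>z. s \<otimes> ?t z \<ominus>\<^bsub>Reg\<^esub> h (d (n + k) i z)"
      have tc: "cocyc Reg (carrier R) KN (n + k) i ?t" by (rule cocyc_tr[OF t])
      have stc: "cocyc Reg (carrier R) KN (n + k) i (\<lambda>z. s \<otimes> ?t z)"
        using cocyc_push[OF lin_smult_self[OF regular_module_module sR] _ _ tc, of "carrier R" KN] sR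
          ideal.I_l_closed[OF KN(1)] by simp
      have "coch Reg (carrier R) (n + k) (Suc i) ?u"
        by (rule coch_diff[OF regular_module_module RS cocycD(1)[OF stc] coch_d[OF h(1)]])
      then have up: "coch Reg p (n + k) (Suc i) ?u"
        using h(2) unfolding coch_def by blast
      have "?u (d (n + k) (Suc i) z) \<in> KN" if z: "z \<in> carrier (F (n + k) (Suc (Suc i)))" for z
      proof -
        have "h (d (n + k) i (d (n + k) (Suc i) z)) = \<zero>\<^bsub>Reg\<^esub>"
          using d_d[OF z] lin_zero[OF cochD(1)[OF h(1)] F_module regular_module_module] by simp
        then show ?thesis
          using cocycD(2)[OF stc z] cocyc_carrier[OF stc d_carrier[OF z]]
            Reg.diff_zero[of "s \<otimes> ?t (d (n + k) (Suc i) z)"] by simp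
      qed
      then have u: "cocyc Reg p KN (n + k) i ?u" using up unfolding cocyc_def by blast
      have Qu: "Q (n + k) (\<lambda>z. ?u z \<odot>\<^bsub>N\<^esub> x)" by (rule Q_p[OF x u])
      let ?hx = "\<lambda>z. h (d (n + k) i z) \<odot>\<^bsub>N\<^esub> x"
      have hx0: "coch N (carrier N) (n + k) i (\<lambda>z. h z \<odot>\<^bsub>N\<^esub> x)"
        using coch_lin[OF lin_scalars[OF N(1) x] _ h(1), of "carrier N"] x by simp
      have hx: "Z N (n + k) i ?hx"
        using coch_d[OF hx0] d_d lin_zero[OF cochD(1)[OF hx0] F_module N(1)] unfolding cocyc_def by simp
      have Qh: "Q (n + k) ?hx"
      proof (rule QD(4)[OF hx])
        show "cobnd N (carrier N) {\<zero>\<^bsub>N\<^esub>} (n + k) i ?hx"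
          unfolding cobnd_def using hx0 cocyc_carrier[OF hx] by (intro exI[of _ "\<lambda>z. h z \<odot>\<^bsub>N\<^esub> x"]) simp
      qed
      have sum: "Q (n + k) (\<lambda>z. ?u z \<odot>\<^bsub>N\<^esub> x \<oplus>\<^bsub>N\<^esub> ?hx z)"
        by (rule QD(1)[OF txp[OF x u] hx Qu Qh])
      have "coch N (carrier N) (n + k) (Suc i) (\<lambda>z. ?u z \<odot>\<^bsub>N\<^esub> x \<oplus>\<^bsub>N\<^esub> ?hx z)"
        by (rule coch_add[OF N(1) NS cocycD(1)[OF txp[OF x u]] cocycD(1)[OF hx]])
      then have Zsum: "Z N (n + k) i (\<lambda>z. ?u z \<odot>\<^bsub>N\<^esub> x \<oplus>\<^bsub>N\<^esub> ?hx z)"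
        using cocycD(2)[OF txp[OF x u]] cocycD(2)[OF hx] unfolding cocyc_def by simp
      have "?u z \<odot>\<^bsub>N\<^esub> x \<oplus>\<^bsub>N\<^esub> ?hx z = s \<odot>\<^bsub>N\<^esub> (?t z \<odot>\<^bsub>N\<^esub> x)" if z: "z \<in> carrier (F (n + k) (Suc i))" for z
      proof -
        have c: "?t z \<in> carrier R" "h (d (n + k) i z) \<in> carrier R" "?u z \<in> carrier R"
          using cocyc_carrier[OF tc z] coch_carrier[OF h(1) d_carrier[OF z]] cocyc_carrier[OF u z] by simp_all
        have "?u z \<odot>\<^bsub>N\<^esub> x \<oplus>\<^bsub>N\<^esub> ?hx z = (h (d (n + k) i z) \<oplus> ?u z) \<odot>\<^bsub>N\<^esub> x"
          using c x by (simp add: N.smult_l_distr N.M.a_comm)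
        also have "h (d (n + k) i z) \<oplus> ?u z = s \<otimes> ?t z"
          using Reg.add_minus_cancel[of "s \<otimes> ?t z" "h (d (n + k) i z)"] c sR by simp
        finally show ?thesis using c sR x by (simp add: N.smult_assoc1)
      qed
      then have "Q (n + k) (\<lambda>z. s \<odot>\<^bsub>N\<^esub> (?t z \<odot>\<^bsub>N\<^esub> x))"
        using QD(5)[OF Zsum Zr[OF sR tx[OF x tc]] _ sum] by blast
      then show ?thesis
        using limit_submodule_tr[OF Q Zr[OF sR tx[OF x t]], of k] by simp
    qed
    have "Q n (\<lambda>z. s \<odot>\<^bsub>N\<^esub> g z)" if g: "Z N n i g" for n g
    proof -
      define Qs where "Qs n g \<longleftrightarrow> Q n (\<lambda>z. s \<odot>\<^bsub>N\<^esub> g z)" for n g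
      have "Qs n g"
      proof (rule cocycles_from_generators[where Q = Qs and X = N and C = "{\<zero>\<^bsub>N\<^esub>}"
            and A = "carrier N" and K = KN])
        show "module R N" "submodule {\<zero>\<^bsub>N\<^esub>} R N" "fg_over R N {\<zero>\<^bsub>N\<^esub>} (carrier N)" "ideal KN R" "Z N n i g"
          using N N0 KN(1) g by simp_all
        show "a \<odot>\<^bsub>N\<^esub> b \<in> {\<zero>\<^bsub>N\<^esub>}" if "a \<in> KN" "b \<in> carrier N" for a b
          using KN(2)[OF that] by simp
      next
        fix n g h f assume *: "Z N n i g" "Z N n i h" "Z N n i f"
          "Qs n g" "Qs n h"
          "\<And>z. z \<in> carrier (F n (Suc i)) \<Longrightarrow> f z = g z \<oplus>\<^bsub>N\<^esub> h z"
        have sm: "Q n (\<lambda>z. s \<odot>\<^bsub>N\<^esub> g z \<oplus>\<^bsub>N\<^esub> s \<odot>\<^bsub>N\<^esub> h z)"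
          by (rule QD(1)[OF Zr[OF sR *(1)] Zr[OF sR *(2)] *(4,5)[unfolded Qs_def]])
        have "coch N (carrier N) n (Suc i) (\<lambda>z. s \<odot>\<^bsub>N\<^esub> g z \<oplus>\<^bsub>N\<^esub> s \<odot>\<^bsub>N\<^esub> h z)"
          by (rule coch_add[OF N(1) NS cocycD(1)[OF Zr[OF sR *(1)]] cocycD(1)[OF Zr[OF sR *(2)]]])
        then have "Z N n i (\<lambda>z. s \<odot>\<^bsub>N\<^esub> g z \<oplus>\<^bsub>N\<^esub> s \<odot>\<^bsub>N\<^esub> h z)"
          using cocycD(2)[OF Zr[OF sR *(1)]] cocycD(2)[OF Zr[OF sR *(2)]] unfolding cocyc_def by simp
        moreover have "s \<odot>\<^bsub>N\<^esub> g z \<oplus>\<^bsub>N\<^esub> s \<odot>\<^bsub>N\<^esub> h z = s \<odot>\<^bsub>N\<^esub> f z" if "z \<in> carrier (F n (Suc i))" for z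
          using *(6)[OF that] cocyc_carrier[OF *(1) that] cocyc_carrier[OF *(2) that] sR by (simp add: N.smult_r_distr)
        ultimately show "Qs n f"
          unfolding Qs_def using QD(5)[OF _ Zr[OF sR *(3)] _ sm] by blast
      next
        fix n k g assume "Z N n i g" "Qs (n + k) (\<lambda>z. g (tr n k (Suc i) z))"
        then show "Qs n g"
          unfolding Qs_def using limit_submodule_tr[OF Q Zr[OF sR], of n g k] by simp
      next
        fix n g assume g: "Z N n i g" "\<And>z. z \<in> carrier (F n (Suc i)) \<Longrightarrow> g z \<in> {\<zero>\<^bsub>N\<^esub>}"
        show "Qs n g"
          unfolding Qs_def by (rule Q0[OF Zr[OF sR g(1)]]) (use g(2) sR in simp)
      next
          fix n t x assume "x \<in> carrier N" "cocyc Reg (carrier R) KN n i t"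
          then show "Qs n (\<lambda>z. t z \<odot>\<^bsub>N\<^esub> x)"
            unfolding Qs_def by (rule Q_gen)
      qed (rule vN)
      then show ?thesis unfolding Qs_def .
    qed
    then have "s \<in> p" unfolding pQ using sR by blast
    then show "r \<in> p" using p.I_prime[OF W(3) r] W(4) unfolding s_def by blast
  qed
  moreover have "Q' n (\<lambda>z. r \<odot>\<^bsub>M\<^esub> g z)" if r: "r \<in> p" and g: "Z M n i g" for r n g
  proof -
    have "cobnd M (carrier M) W n i (\<lambda>z. r \<odot>\<^bsub>M\<^esub> g z)"
    proof (rule cobnd_of_values[OF M(1) MS])
      show "lin R (F n (Suc i)) M (\<lambda>z. r \<odot>\<^bsub>M\<^esub> g z)"
        by (rule lin_pointwise_smult[OF cochD(1)[OF cocycD(1)[OF g]] F_module M(1) p.Icarr[OF r]])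
    qed (rule pW[OF r cocyc_carrier[OF g]])
    then show ?thesis unfolding Q'_def by (rule cobnd_imp_lim_zero)
  qed
  ultimately have "p = {r \<in> carrier R. \<forall>n g. Z M n i g \<longrightarrow> Q' n (\<lambda>z. r \<odot>\<^bsub>M\<^esub> g z)}"
    using p.Icarr by blast
  then show ?thesis
    unfolding attached_to_H_def using p Q' by blast
qed

end

section \<open>Quotient modules\<close>

lemma UN_const_on: "X \<noteq> {} \<Longrightarrow> (\<And>x. x \<in> X \<Longrightarrow> f x = c) \<Longrightarrow> (\<Union>x\<in>X. f x) = c"
  by auto

context submod
begin

lemma abelian_subgroup_B: "abelian_subgroup B M"
proof (rule abelian_subgroupI3)
  show "additive_subgroup B M"
    using submodule_B unfolding submodule_def by (intro additive_subgroupI) simp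
  show "abelian_group M" by (rule M.abelian_group_axioms)
qed

lemma coset_eq_iff:
  assumes "x \<in> carrier M" "y \<in> carrier M"
  shows "B +>\<^bsub>M\<^esub> x = B +>\<^bsub>M\<^esub> y \<longleftrightarrow> x \<ominus>\<^bsub>M\<^esub> y \<in> B"
proof -
  interpret B: abelian_subgroup B M by (rule abelian_subgroup_B)
  have "x \<in> B +>\<^bsub>M\<^esub> y \<longleftrightarrow> x \<ominus>\<^bsub>M\<^esub> y \<in> B"
    using B.a_rcos_module[OF assms(2,1)] by (simp add: M.minus_eq)
  moreover have "B +>\<^bsub>M\<^esub> x = B +>\<^bsub>M\<^esub> y \<longleftrightarrow> x \<in> B +>\<^bsub>M\<^esub> y"
    using assms by (metis B.a_rcos_self B.a_repr_independence')
  ultimately show ?thesis by blast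
qed

lemma coset_mem: "x \<in> carrier M \<Longrightarrow> x \<in> B +>\<^bsub>M\<^esub> x"
  by (rule abelian_subgroup.a_rcos_self[OF abelian_subgroup_B])

lemma coset_elem: "x \<in> carrier M \<Longrightarrow> y \<in> B +>\<^bsub>M\<^esub> x \<Longrightarrow> y \<in> carrier M \<and> y \<ominus>\<^bsub>M\<^esub> x \<in> B"
  using abelian_subgroup.a_elemrcos_carrier[OF abelian_subgroup_B]
    abelian_subgroup.a_rcos_module_imp[OF abelian_subgroup_B] by (auto simp: M.minus_eq)

lemma coset_eq_B_iff: "x \<in> carrier M \<Longrightarrow> B +>\<^bsub>M\<^esub> x = B \<longleftrightarrow> x \<in> B"
  using coset_eq_iff[of x "\<zero>\<^bsub>M\<^esub>"] M.a_coset_add_zero[OF sub_subset] by simp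

lemma quot_carrier: "carrier (quot_module M B) = (\<lambda>x. B +>\<^bsub>M\<^esub> x) ` carrier M"
  by (auto simp: quot_module_def A_RCOSETS_def')

lemma quot_zero: "\<zero>\<^bsub>quot_module M B\<^esub> = B"
  by (simp add: quot_module_def)

lemma quot_add:
  "x \<in> carrier M \<Longrightarrow> y \<in> carrier M \<Longrightarrow>
    (B +>\<^bsub>M\<^esub> x) \<oplus>\<^bsub>quot_module M B\<^esub> (B +>\<^bsub>M\<^esub> y) = B +>\<^bsub>M\<^esub> (x \<oplus>\<^bsub>M\<^esub> y)"
  by (simp add: quot_module_def abelian_subgroup.a_rcos_sum[OF abelian_subgroup_B])

lemma quot_smult:
  assumes "r \<in> carrier R" "x \<in> carrier M"
  shows "r \<odot>\<^bsub>quot_module M B\<^esub> (B +>\<^bsub>M\<^esub> x) = B +>\<^bsub>M\<^esub> (r \<odot>\<^bsub>M\<^esub> x)"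
proof -
  have "B +>\<^bsub>M\<^esub> (r \<odot>\<^bsub>M\<^esub> y) = B +>\<^bsub>M\<^esub> (r \<odot>\<^bsub>M\<^esub> x)" if "y \<in> B +>\<^bsub>M\<^esub> x" for y
    using coset_elem[OF assms(2) that] assms by (simp add: coset_eq_iff cong_smult)
  moreover have "B +>\<^bsub>M\<^esub> x \<noteq> {}" using coset_mem[OF assms(2)] by blast
  ultimately have "(\<Union>y\<in>B +>\<^bsub>M\<^esub> x. B +>\<^bsub>M\<^esub> (r \<odot>\<^bsub>M\<^esub> y)) = B +>\<^bsub>M\<^esub> (r \<odot>\<^bsub>M\<^esub> x)"
    by (intro UN_const_on)
  then show ?thesis by (simp add: quot_module_def)
qed

lemma quot_lin: "lin R M (quot_module M B) (\<lambda>x. B +>\<^bsub>M\<^esub> x)"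
  unfolding lin_def by (auto simp: quot_carrier quot_add quot_smult)

lemma quot_zero_coset: "B = B +>\<^bsub>M\<^esub> \<zero>\<^bsub>M\<^esub>"
  using coset_eq_B_iff[of "\<zero>\<^bsub>M\<^esub>"] by simp

lemma quot_module_module: "module R (quot_module M B)"
proof (rule moduleI)
  let ?Q = "quot_module M B"
  have zero: "\<zero>\<^bsub>?Q\<^esub> = B +>\<^bsub>M\<^esub> \<zero>\<^bsub>M\<^esub>" using quot_zero quot_zero_coset by simp
  show "cring R" by (rule R.is_cring)
  show "abelian_group ?Q"
  proof (rule abelian_groupI)
    show "\<zero>\<^bsub>?Q\<^esub> \<in> carrier ?Q" unfolding zero quot_carrier by blast
    fix x y assume "x \<in> carrier ?Q" "y \<in> carrier ?Q"
    then obtain a b where ab: "a \<in> carrier M" "b \<in> carrier M" "x = B +>\<^bsub>M\<^esub> a" "y = B +>\<^bsub>M\<^esub> b"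
      unfolding quot_carrier by blast
    then show "x \<oplus>\<^bsub>?Q\<^esub> y \<in> carrier ?Q" by (simp add: quot_add quot_carrier)
    show "x \<oplus>\<^bsub>?Q\<^esub> y = y \<oplus>\<^bsub>?Q\<^esub> x" using ab by (simp add: quot_add M.a_comm)
    show "\<zero>\<^bsub>?Q\<^esub> \<oplus>\<^bsub>?Q\<^esub> x = x" unfolding zero using ab by (simp add: quot_add)
    have "(B +>\<^bsub>M\<^esub> (\<ominus>\<^bsub>M\<^esub> a)) \<oplus>\<^bsub>?Q\<^esub> x = \<zero>\<^bsub>?Q\<^esub>" unfolding zero using ab by (simp add: quot_add M.l_neg)
    moreover have "B +>\<^bsub>M\<^esub> (\<ominus>\<^bsub>M\<^esub> a) \<in> carrier ?Q" unfolding quot_carrier using ab by simp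
    ultimately show "\<exists>y\<in>carrier ?Q. y \<oplus>\<^bsub>?Q\<^esub> x = \<zero>\<^bsub>?Q\<^esub>" by blast
    fix z assume "z \<in> carrier ?Q"
    then obtain c where "c \<in> carrier M" "z = B +>\<^bsub>M\<^esub> c" unfolding quot_carrier by blast
    then show "x \<oplus>\<^bsub>?Q\<^esub> y \<oplus>\<^bsub>?Q\<^esub> z = x \<oplus>\<^bsub>?Q\<^esub> (y \<oplus>\<^bsub>?Q\<^esub> z)" using ab by (simp add: quot_add M.a_assoc)
  qed
  fix r x assume r: "r \<in> carrier R" and "x \<in> carrier ?Q"
  then obtain a where a: "a \<in> carrier M" "x = B +>\<^bsub>M\<^esub> a" unfolding quot_carrier by blast
  then show "r \<odot>\<^bsub>?Q\<^esub> x \<in> carrier ?Q" using r by (simp add: quot_smult quot_carrier)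
  show "(r \<oplus>\<^bsub>R\<^esub> s) \<odot>\<^bsub>?Q\<^esub> x = r \<odot>\<^bsub>?Q\<^esub> x \<oplus>\<^bsub>?Q\<^esub> s \<odot>\<^bsub>?Q\<^esub> x" if "s \<in> carrier R" for s
    using r a that by (simp add: quot_smult quot_add smult_l_distr)
  show "r \<otimes>\<^bsub>R\<^esub> s \<odot>\<^bsub>?Q\<^esub> x = r \<odot>\<^bsub>?Q\<^esub> (s \<odot>\<^bsub>?Q\<^esub> x)" if "s \<in> carrier R" for s
    using r a that by (simp add: quot_smult smult_assoc1)
  show "r \<odot>\<^bsub>?Q\<^esub> (x \<oplus>\<^bsub>?Q\<^esub> y) = r \<odot>\<^bsub>?Q\<^esub> x \<oplus>\<^bsub>?Q\<^esub> r \<odot>\<^bsub>?Q\<^esub> y" if y: "y \<in> carrier ?Q" for y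
  proof -
    obtain b where "b \<in> carrier M" "y = B +>\<^bsub>M\<^esub> b" using y unfolding quot_carrier by blast
    then show ?thesis using r a by (simp add: quot_smult quot_add smult_r_distr)
  qed
next
  fix x assume "x \<in> carrier (quot_module M B)"
  then obtain a where "a \<in> carrier M" "x = B +>\<^bsub>M\<^esub> a" unfolding quot_carrier by blast
  then show "\<one>\<^bsub>R\<^esub> \<odot>\<^bsub>quot_module M B\<^esub> x = x" by (simp add: quot_smult)
qed

lemma annihilator_quot: "annihilator R (quot_module M B) = {r \<in> carrier R. \<forall>x\<in>carrier M. r \<odot>\<^bsub>M\<^esub> x \<in> B}"
proof -
  have "r \<odot>\<^bsub>quot_module M B\<^esub> (B +>\<^bsub>M\<^esub> x) = B \<longleftrightarrow> r \<odot>\<^bsub>M\<^esub> x \<in> B" if "r \<in> carrier R" "x \<in> carrier M" for r x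
    using quot_smult[OF that] coset_eq_B_iff[of "r \<odot>\<^bsub>M\<^esub> x"] that by simp
  then show ?thesis
    unfolding annihilator_def quot_carrier quot_zero by auto
qed

end


section \<open>Free resolutions and their lifts exist\<close>

lemma a_kernel_eq: "a_kernel A M f = {x \<in> carrier A. f x = \<zero>\<^bsub>M\<^esub>}"
  by (simp add: a_kernel_def kernel_def)

lemma linear_maps_iff: "f \<in> linear_maps R A M \<longleftrightarrow> lin R A M f \<and> f \<in> extensional (carrier A)"
  by (auto simp: linear_maps_def lin_def PiE_def)

lemma restrict_linear_maps:
  assumes "lin R A M f" "module R A"
  shows "restrict f (carrier A) \<in> linear_maps R A M"
  using lin_cong[OF assms, of "restrict f (carrier A)"] by (simp add: linear_maps_iff)

lemma free_fg_over:
  assumes "cring R"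
  shows "fg_over R (free_module R k) {\<zero>\<^bsub>free_module R k\<^esub>} (carrier (free_module R k))"
proof -
  let ?F = "free_module R k"
  interpret F: module R ?F by (rule free_module_module[OF assms])
  let ?S = "unit_vec R k ` {..<k}"
  have S: "?S \<subseteq> carrier ?F" using unit_vec_carrier[OF assms] by blast
  have sub: "submodule (lin_span R ?F ({\<zero>\<^bsub>?F\<^esub>} \<union> ?S)) R ?F" (is "submodule ?H R ?F")
    using S by (intro F.span_submodule) simp
  interpret H: submod R ?F ?H using F.module_axioms sub by (rule submodI_locale)
  have "v \<in> ?H" if v: "v \<in> carrier ?F" for v
  proof -
    have "m \<le> k \<Longrightarrow> trunc_vec R k m v \<in> ?H" for m
    proof (induction m)
      case 0
      show ?case using H.sub_zero by (simp add: trunc_vec_0)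
    next
      case (Suc m)
      have m: "m < k" using Suc.prems by simp
      then have "unit_vec R k m \<in> ?H"
        using F.span_superset[of "{\<zero>\<^bsub>?F\<^esub>} \<union> ?S"] by auto
      moreover have "v m \<in> carrier R"
        using v m PiE_mem[of v "{..<k}" "\<lambda>_. carrier R" m] by (simp add: free_carrier)
      ultimately show ?case
        unfolding trunc_vec_Suc[OF assms v m] using m by (intro H.sub_add H.sub_smult Suc.IH) simp
    qed
    then show ?thesis using trunc_vec_self[OF v] by (metis order_refl)
  qed
  then have "carrier ?F = ?H" using H.sub_subset by blast
  then show ?thesis
    unfolding fg_over_def using S by (intro exI[of _ ?S]) simp
qed

lemma fg_image_of_free:
  assumes X: "module R X" and fg: "fg_over R X {\<zero>\<^bsub>X\<^esub>} A"
  shows "\<exists>k f. lin R (free_module R k) X f \<and> f ` carrier (free_module R k) = A"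
proof -
  interpret X: module R X by fact
  have cr: "cring R" by (rule X.R.is_cring)
  show ?thesis
    using X.zero_submodule fg
  proof (induction rule: X.fg_over_induct)
    case base
    have "(\<lambda>_. \<zero>\<^bsub>X\<^esub>) ` carrier (free_module R 0) = {\<zero>\<^bsub>X\<^esub>}"
      by (auto simp: free_carrier)
    then show ?case
      using lin_const_zero[OF X] by (intro exI[of _ 0] exI[of _ "\<lambda>_. \<zero>\<^bsub>X\<^esub>"]) simp
  next
    case (adjoin D x)
    then obtain k f where f: "lin R (free_module R k) X f" "f ` carrier (free_module R k) = D"
      by blast
    let ?F = "free_module R k"
    let ?F' = "free_module R (Suc k)"
    let ?r = "\<lambda>v. restrict v {..<k}"
    have r: "lin R ?F' ?F ?r"
      unfolding lin_def by (auto simp: free_carrier free_add free_smult PiE_iff fun_eq_iff)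
    have p: "lin R ?F' (regular_module R) (\<lambda>v. v k)"
      unfolding lin_def by (auto simp: free_carrier free_add free_smult)
    let ?f = "\<lambda>v. f (?r v) \<oplus>\<^bsub>X\<^esub> v k \<odot>\<^bsub>X\<^esub> x"
    have lin: "lin R ?F' X ?f"
      by (intro lin_pointwise_add lin_comp[OF r f(1)] lin_comp[OF p lin_scalars[OF X adjoin.hyps(5)]]
          free_module_module cr X)
    have "?f ` carrier ?F' = adjoin R X D x"
    proof
      show "?f ` carrier ?F' \<subseteq> adjoin R X D x"
      proof
        fix y assume "y \<in> ?f ` carrier ?F'"
        then obtain v where v: "v \<in> carrier ?F'" "y = ?f v" by blast
        have "f (?r v) \<in> D" using lin_closed[OF r v(1)] f(2) by blast
        moreover have "v k \<in> carrier R" using lin_closed[OF p v(1)] by simp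
        ultimately show "y \<in> adjoin R X D x" unfolding adjoin_def using v(2) by blast
      qed
      show "adjoin R X D x \<subseteq> ?f ` carrier ?F'"
      proof
        fix y assume "y \<in> adjoin R X D x"
        then obtain u s where us: "y = u \<oplus>\<^bsub>X\<^esub> s \<odot>\<^bsub>X\<^esub> x" "u \<in> D" "s \<in> carrier R"
          unfolding adjoin_def by blast
        then obtain v where v: "v \<in> carrier ?F" "f v = u" using f(2) by blast
        let ?v = "v(k := s)"
        have "?v \<in> carrier ?F'"
          using v(1) us(3) by (auto simp: free_carrier PiE_iff extensional_def less_Suc_eq)
        moreover have "?r ?v = v"
          using v(1) by (auto simp: free_carrier PiE_iff extensional_def fun_eq_iff)
        then have "?f ?v = y" using v(2) us(1) by simp
        ultimately show "y \<in> ?f ` carrier ?F'" by blast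
      qed
    qed
    then show ?case using lin by blast
  qed
qed

context noetherian_cring
begin

text \<open>
  Over a Noetherian ring every kernel in a free module of finite rank is again an image of one, so that a resolution can be
  continued forever.
\<close>

lemma submodule_of_free_image:
  assumes "submodule S R (free_module R k)"
  shows "\<exists>m f. f \<in> linear_maps R (free_module R m) (free_module R k) \<and> f ` carrier (free_module R m) = S"
proof -
  have F: "module R (free_module R j)" for j by (rule free_module_module[OF is_cring])
  interpret F: module R "free_module R k" by (rule F)
  interpret S: submod R "free_module R k" S using F assms by (rule submodI_locale)
  have "fg_over R (free_module R k) {\<zero>\<^bsub>free_module R k\<^esub>} S"
    using submodule_fg_over[OF F free_fg_over[OF is_cring] assms S.sub_subset] S.sub_zero by simp
  then obtain m f where f: "lin R (free_module R m) (free_module R k) f" "f ` carrier (free_module R m) = S"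
    using fg_image_of_free[OF F] by blast
  then show ?thesis
    using restrict_linear_maps[OF f(1) F] by (intro exI[of _ m] exI[of _ "restrict f (carrier (free_module R m))"]) simp
qed

lemma kernel_submodule:
  assumes "module R A" "module R M" "lin R A M f"
  shows "submodule (a_kernel A M f) R A"
proof -
  interpret M: module R M by fact
  show ?thesis
    using preimage_submodule[OF assms M.zero_submodule] by (simp add: a_kernel_eq)
qed

lemma free_resolution_exists:
  assumes A: "module R A" and fg: "fg_over R A {\<zero>\<^bsub>A\<^esub>} (carrier A)"
  shows "\<exists>P. is_free_resolution R A P"
proof -
  have F: "module R (free_module R j)" for j by (rule free_module_module[OF is_cring])
  obtain k0 e0 where e0: "lin R (free_module R k0) A e0" "e0 ` carrier (free_module R k0) = carrier A"
    using fg_image_of_free[OF A fg] by blast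
  define e where "e = restrict e0 (carrier (free_module R k0))"
  have e: "e \<in> linear_maps R (free_module R k0) A" "e ` carrier (free_module R k0) = carrier A"
    using restrict_linear_maps[OF e0(1) F] e0(2) by (simp_all add: e_def)
  define adm where "adm n ks \<longleftrightarrow> submodule (snd ks) R (free_module R (fst ks)) \<and>
    (n = (0::nat) \<longrightarrow> ks = (k0, a_kernel (free_module R k0) A e))" for n ks
  define step where "step ks ks' f \<longleftrightarrow> f \<in> linear_maps R (free_module R (fst ks')) (free_module R (fst ks)) \<and>
    f ` carrier (free_module R (fst ks')) = snd ks \<and>
    snd ks' = a_kernel (free_module R (fst ks')) (free_module R (fst ks)) f"
    for ks ks' :: "nat \<times> (nat \<Rightarrow> 'a) set" and f
  have "\<exists>s. \<forall>n. adm n (s n) \<and> (\<exists>f. step (s n) (s (Suc n)) f)"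
  proof (rule dependent_nat_choice)
    show "\<exists>x. adm 0 x"
    proof -
      have "submodule (a_kernel (free_module R k0) A e) R (free_module R k0)"
        by (rule kernel_submodule[OF F A]) (use e(1) in \<open>simp add: linear_maps_iff\<close>)
      then show ?thesis
        unfolding adm_def by (intro exI[of _ "(k0, a_kernel (free_module R k0) A e)"]) simp
    qed
    fix ks n assume "adm n ks"
    then obtain m f where f: "f \<in> linear_maps R (free_module R m) (free_module R (fst ks))"
      "f ` carrier (free_module R m) = snd ks"
      using submodule_of_free_image[of "snd ks" "fst ks"] unfolding adm_def by blast
    let ?ks' = "(m, a_kernel (free_module R m) (free_module R (fst ks)) f)"
    have "submodule (a_kernel (free_module R m) (free_module R (fst ks)) f) R (free_module R m)"
      by (rule kernel_submodule[OF F F]) (use f(1) in \<open>simp add: linear_maps_iff\<close>)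
    then have "adm (Suc n) ?ks'"
      unfolding adm_def by simp
    moreover have "step ks ?ks' f"
      unfolding step_def using f by simp
    ultimately show "\<exists>ks'. adm (Suc n) ks' \<and> (\<exists>f. step ks ks' f)" by blast
  qed
  then obtain s where s: "\<And>n. adm n (s n)" and "\<And>n. \<exists>f. step (s n) (s (Suc n)) f" by blast
  then obtain f where "\<And>n. step (s n) (s (Suc n)) (f n)" by metis
  then have f: "f n \<in> linear_maps R (free_module R (fst (s (Suc n)))) (free_module R (fst (s n)))"
    "f n ` carrier (free_module R (fst (s (Suc n)))) = snd (s n)"
    "a_kernel (free_module R (fst (s (Suc n)))) (free_module R (fst (s n))) (f n) = snd (s (Suc n))" for n
    unfolding step_def by simp_all
  let ?R = "\<lparr>res_rank = fst \<circ> s, res_diff = f, res_aug = e\<rparr>"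
  have s0: "s 0 = (k0, a_kernel (free_module R k0) A e)" using s[of 0] unfolding adm_def by simp
  have "a_kernel (free_module R (fst (s 0))) A e = f 0 ` carrier (free_module R (fst (s (Suc 0))))"
    using f(2)[of 0] s0 by simp
  then have "is_free_resolution R A ?R"
    unfolding is_free_resolution_def res_module_def using e f(1) f(2,3) s0 by simp
  then show ?thesis by blast
qed

lemma chain_lift_exists:
  assumes A: "module R A" and A': "module R A'" and f: "lin R A A' f"
    and P: "is_free_resolution R A P" and Q: "is_free_resolution R A' Q"
  shows "\<exists>\<phi>. is_chain_lift R P Q f \<phi>"
proof -
  let ?P = "res_module R P" and ?Q = "res_module R Q"
  have PM: "module R (?P i)" and QM: "module R (?Q i)" for i
    unfolding res_module_def by (rule free_module_module[OF is_cring])+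
  note Pd = P[unfolded is_free_resolution_def] and Qd = Q[unfolded is_free_resolution_def]
  have Pdl: "lin R (?P (Suc i)) (?P i) (res_diff P i)" and Qdl: "lin R (?Q (Suc i)) (?Q i) (res_diff Q i)" for i
    using Pd Qd by (simp_all add: linear_maps_iff)
  have Pal: "lin R (?P 0) A (res_aug P)" and Qal: "lin R (?Q 0) A' (res_aug Q)"
    using Pd Qd by (simp_all add: linear_maps_iff)
  have Pexact: "res_diff P i (res_diff P (Suc i) x) = \<zero>\<^bsub>?P i\<^esub>" if "x \<in> carrier (?P (Suc (Suc i)))" for i x
  proof -
    have "res_diff P (Suc i) x \<in> a_kernel (?P (Suc i)) (?P i) (res_diff P i)" using Pd that by simp
    then show ?thesis by (simp add: a_kernel_eq)
  qed
  have Paug: "res_aug P (res_diff P 0 x) = \<zero>\<^bsub>A\<^esub>" if "x \<in> carrier (?P (Suc 0))" for x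
  proof -
    have "res_diff P 0 x \<in> a_kernel (?P 0) A (res_aug P)" using Pd that by simp
    then show ?thesis by (simp add: a_kernel_eq)
  qed
  have Qexact: "\<exists>w\<in>carrier (?Q (Suc (Suc i))). res_diff Q (Suc i) w = y"
    if "y \<in> carrier (?Q (Suc i))" "res_diff Q i y = \<zero>\<^bsub>?Q i\<^esub>" for i y
  proof -
    have "y \<in> a_kernel (?Q (Suc i)) (?Q i) (res_diff Q i)" using that by (simp add: a_kernel_eq)
    then have "y \<in> res_diff Q (Suc i) ` carrier (?Q (Suc (Suc i)))" using Qd by simp
    then show ?thesis by blast
  qed
  have Qaug: "\<exists>w\<in>carrier (?Q (Suc 0)). res_diff Q 0 w = y"
    if "y \<in> carrier (?Q 0)" "res_aug Q y = \<zero>\<^bsub>A'\<^esub>" for y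
  proof -
    have "y \<in> a_kernel (?Q 0) A' (res_aug Q)" using that by (simp add: a_kernel_eq)
    then have "y \<in> res_diff Q 0 ` carrier (?Q (Suc 0))" using Qd by simp
    then show ?thesis by blast
  qed
  \<comment> \<open>The condition on boundaries is what allows the next component to be chosen.\<close>
  define adm where "adm i \<phi> \<longleftrightarrow> \<phi> \<in> linear_maps R (?P i) (?Q i) \<and>
    (\<forall>x\<in>carrier (?P (Suc i)). \<exists>w\<in>carrier (?Q (Suc i)). res_diff Q i w = \<phi> (res_diff P i x)) \<and>
    (i = 0 \<longrightarrow> (\<forall>x\<in>carrier (?P 0). res_aug Q (\<phi> x) = f (res_aug P x)))" for i \<phi>
  define step where "step i \<phi> \<psi> \<longleftrightarrow> (\<forall>x\<in>carrier (?P (Suc i)). res_diff Q i (\<psi> x) = \<phi> (res_diff P i x))"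
    for i and \<phi> \<psi> :: "(nat \<Rightarrow> 'a) \<Rightarrow> (nat \<Rightarrow> 'a)"
  have "\<exists>\<phi>. \<forall>i. adm i (\<phi> i) \<and> step i (\<phi> i) (\<phi> (Suc i))"
  proof (rule dependent_nat_choice)
    have "\<exists>h. lin R (free_module R (res_rank P 0)) (?Q 0) h \<and>
      (\<forall>v\<in>carrier (free_module R (res_rank P 0)). res_aug Q (h v) = f (res_aug P v))"
    proof (rule free_lift_onto[OF QM A' Qal])
      show "lin R (free_module R (res_rank P 0)) A' (\<lambda>v. f (res_aug P v))"
        using lin_comp[OF Pal f] unfolding res_module_def .
      fix v assume "v \<in> carrier (free_module R (res_rank P 0))"
      then have "f (res_aug P v) \<in> carrier A'"
        using lin_closed[OF lin_comp[OF Pal f]] unfolding res_module_def by blast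
      then have "f (res_aug P v) \<in> res_aug Q ` carrier (?Q 0)" using Qd by simp
      then show "\<exists>x\<in>carrier (?Q 0). res_aug Q x = f (res_aug P v)" by force
    qed
    then obtain h where h: "lin R (?P 0) (?Q 0) h" "\<And>v. v \<in> carrier (?P 0) \<Longrightarrow> res_aug Q (h v) = f (res_aug P v)"
      unfolding res_module_def by blast
    let ?h = "restrict h (carrier (?P 0))"
    have "\<exists>w\<in>carrier (?Q (Suc 0)). res_diff Q 0 w = ?h (res_diff P 0 x)" if x: "x \<in> carrier (?P (Suc 0))" for x
    proof -
      have dx: "res_diff P 0 x \<in> carrier (?P 0)" by (rule lin_closed[OF Pdl x])
      show ?thesis
        using Qaug[OF lin_closed[OF h(1) dx]] h(2)[OF dx] Paug[OF x] lin_zero[OF f A A'] dx by simp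
    qed
    then have "adm 0 ?h"
      unfolding adm_def using restrict_linear_maps[OF h(1) PM] h(2) by simp
    then show "\<exists>\<phi>. adm 0 \<phi>" by blast
  next
    fix \<phi> i assume adm: "adm i \<phi>"
    have \<phi>: "lin R (?P i) (?Q i) \<phi>" using adm by (simp add: adm_def linear_maps_iff)
    have "\<exists>h. lin R (free_module R (res_rank P (Suc i))) (?Q (Suc i)) h \<and>
      (\<forall>v\<in>carrier (free_module R (res_rank P (Suc i))). res_diff Q i (h v) = \<phi> (res_diff P i v))"
    proof (rule free_lift_onto[OF QM QM Qdl])
      show "lin R (free_module R (res_rank P (Suc i))) (?Q i) (\<lambda>v. \<phi> (res_diff P i v))"
        using lin_comp[OF Pdl \<phi>] unfolding res_module_def .
      fix v assume "v \<in> carrier (free_module R (res_rank P (Suc i)))"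
      then show "\<exists>x\<in>carrier (?Q (Suc i)). res_diff Q i x = \<phi> (res_diff P i v)"
        using adm unfolding adm_def res_module_def by blast
    qed
    then obtain h where h: "lin R (?P (Suc i)) (?Q (Suc i)) h"
      "\<And>v. v \<in> carrier (?P (Suc i)) \<Longrightarrow> res_diff Q i (h v) = \<phi> (res_diff P i v)"
      unfolding res_module_def by blast
    let ?h = "restrict h (carrier (?P (Suc i)))"
    have "\<exists>w\<in>carrier (?Q (Suc (Suc i))). res_diff Q (Suc i) w = ?h (res_diff P (Suc i) x)"
      if x: "x \<in> carrier (?P (Suc (Suc i)))" for x
    proof -
      have dx: "res_diff P (Suc i) x \<in> carrier (?P (Suc i))" by (rule lin_closed[OF Pdl x])
      show ?thesis
        using Qexact[OF lin_closed[OF h(1) dx]] h(2)[OF dx] Pexact[OF x] lin_zero[OF \<phi> PM QM] dx by simp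
    qed
    then have "adm (Suc i) ?h"
      unfolding adm_def using restrict_linear_maps[OF h(1) PM] by simp
    moreover have "step i \<phi> ?h"
      unfolding step_def using h(2) by simp
    ultimately show "\<exists>\<psi>. adm (Suc i) \<psi> \<and> step i \<phi> \<psi>" by blast
  qed
  then obtain \<phi> where "\<And>i. adm i (\<phi> i)" "\<And>i. step i (\<phi> i) (\<phi> (Suc i))" by blast
  then have "is_chain_lift R P Q f \<phi>"
    unfolding is_chain_lift_def adm_def step_def by blast
  then show ?thesis by blast
qed

end


section \<open>The tower of the chosen resolutions\<close>

text \<open>
  The term \<open>n\<close> of the tower belongs to the exponent \<open>n + 1\<close>, as in the direct system that defines local cohomology.
\<close>

locale ideal_in_noetherian_cring = noetherian_cring R for R (structure) +
  fixes \<aa> :: "'a set"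
  assumes ideal_\<aa>: "ideal \<aa> R"
begin

definition I :: "nat \<Rightarrow> 'a set" where
  "I n = \<aa> [^]\<^bsub>ideals_set R\<^esub> Suc n"

definition P :: "nat \<Rightarrow> ('a, 'a set) free_resolution" where
  "P n = resolution_of R (power_quot R \<aa> (Suc n))"

definition \<Phi> :: "nat \<Rightarrow> nat \<Rightarrow> (nat \<Rightarrow> 'a) \<Rightarrow> (nat \<Rightarrow> 'a)" where
  "\<Phi> n = (SOME \<phi>. is_chain_lift R (P (Suc n)) (P n) (power_quot_proj R \<aa> (Suc n)) \<phi>)"

lemma pow_ideals_Suc: "\<aa> [^]\<^bsub>ideals_set R\<^esub> Suc n = ideal_prod R (\<aa> [^]\<^bsub>ideals_set R\<^esub> n) \<aa>"
  by (simp add: nat_pow_def ideals_set_def)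

lemma I_Suc: "I (Suc n) = ideal_prod R (I n) \<aa>"
  unfolding I_def by (rule pow_ideals_Suc)

lemma I_0: "I 0 = \<aa>"
proof -
  have "ideal_prod R (carrier R) \<aa> = \<aa>"
  proof
    show "ideal_prod R (carrier R) \<aa> \<subseteq> \<aa>" using ideal_prod_inter[OF oneideal ideal_\<aa>] by blast
    show "\<aa> \<subseteq> ideal_prod R (carrier R) \<aa>"
    proof
      fix x assume x: "x \<in> \<aa>"
      have "\<one> \<otimes> x \<in> ideal_prod R (carrier R) \<aa>" by (rule ideal_prod.prod[OF one_closed x])
      then show "x \<in> ideal_prod R (carrier R) \<aa>" using ideal.Icarr[OF ideal_\<aa> x] by simp
    qed
  qed
  then show ?thesis
    unfolding I_def pow_ideals_Suc by (simp add: nat_pow_def ideals_set_def)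
qed

lemma I_ideal: "ideal (I n) R"
  by (induction n) (auto simp: I_0 I_Suc ideal_\<aa> ideal_prod_is_ideal)

lemma I_submod: "submod R (regular_module R) (I n)"
  using regular_module_module I_ideal by (simp add: submodI_locale ideal_submodule_iff)

lemma power_quot_eq: "power_quot R \<aa> (Suc n) = quot_module (regular_module R) (I n)"
  by (simp add: power_quot_def I_def)

lemma power_quot_proj_eq: "power_quot_proj R \<aa> (Suc n) X = (\<Union>x\<in>X. I n +>\<^bsub>R\<^esub> x)"
  by (simp add: power_quot_proj_def I_def)

lemma regular_coset: "J +>\<^bsub>regular_module R\<^esub> x = J +>\<^bsub>R\<^esub> x"
  by (simp add: a_r_coset_def')

lemma proj_coset:
  assumes "r \<in> carrier R"
  shows "power_quot_proj R \<aa> (Suc n) (I (Suc n) +>\<^bsub>R\<^esub> r) = I n +>\<^bsub>R\<^esub> r"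
proof -
  interpret S: submod R "regular_module R" "I n" by (rule I_submod)
  interpret S': submod R "regular_module R" "I (Suc n)" by (rule I_submod)
  have sub: "I (Suc n) \<subseteq> I n" unfolding I_Suc using ideal_prod_inter[OF I_ideal ideal_\<aa>] by blast
  have "I n +>\<^bsub>R\<^esub> x = I n +>\<^bsub>R\<^esub> r" if "x \<in> I (Suc n) +>\<^bsub>R\<^esub> r" for x
    using S'.coset_elem[of r x] S.coset_eq_iff[of x r] that assms sub by (auto simp: regular_coset)
  moreover have "I (Suc n) +>\<^bsub>R\<^esub> r \<noteq> {}"
    using S'.coset_mem[of r] assms by (auto simp: regular_coset)
  ultimately show ?thesis
    unfolding power_quot_proj_eq by (intro UN_const_on)
qed

lemma power_quot_module: "module R (power_quot R \<aa> (Suc n))"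
  unfolding power_quot_eq by (rule submod.quot_module_module[OF I_submod])

lemma power_quot_fg: "fg_over R (power_quot R \<aa> (Suc n)) {\<zero>\<^bsub>power_quot R \<aa> (Suc n)\<^esub>} (carrier (power_quot R \<aa> (Suc n)))"
proof -
  let ?Q = "power_quot R \<aa> (Suc n)"
  interpret S: submod R "regular_module R" "I n" by (rule I_submod)
  interpret Q: module R ?Q by (rule power_quot_module)
  let ?one = "I n +>\<^bsub>R\<^esub> \<one>"
  have c: "carrier ?Q = (\<lambda>x. I n +>\<^bsub>R\<^esub> x) ` carrier R"
    unfolding power_quot_eq S.quot_carrier by (simp add: regular_coset)
  have one: "{\<zero>\<^bsub>?Q\<^esub>} \<union> {?one} \<subseteq> carrier ?Q" using c by auto
  let ?H = "lin_span R ?Q ({\<zero>\<^bsub>?Q\<^esub>} \<union> {?one})"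
  interpret H: submod R ?Q ?H using Q.module_axioms Q.span_submodule[OF one] by (rule submodI_locale)
  have "x \<in> ?H" if x: "x \<in> carrier ?Q" for x
  proof -
    obtain r where r: "r \<in> carrier R" "x = I n +>\<^bsub>R\<^esub> r" using x c by blast
    have "x = r \<odot>\<^bsub>?Q\<^esub> ?one"
      using S.quot_smult[of r \<one>] r unfolding power_quot_eq by (simp add: regular_coset)
    moreover have "?one \<in> ?H" using Q.span_superset[of "{\<zero>\<^bsub>?Q\<^esub>} \<union> {?one}"] by blast
    ultimately show ?thesis using H.sub_smult[OF r(1)] by simp
  qed
  then have "carrier ?Q = ?H" using H.sub_subset by blast
  then show ?thesis unfolding fg_over_def using one by (intro exI[of _ "{?one}"]) simp
qed

lemma proj_lin: "lin R (power_quot R \<aa> (Suc (Suc n))) (power_quot R \<aa> (Suc n)) (power_quot_proj R \<aa> (Suc n))"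
proof -
  interpret S: submod R "regular_module R" "I n" by (rule I_submod)
  interpret S': submod R "regular_module R" "I (Suc n)" by (rule I_submod)
  note rc = regular_coset
  show ?thesis
    unfolding lin_def power_quot_eq S.quot_carrier S'.quot_carrier
    using S.quot_add S'.quot_add S.quot_smult S'.quot_smult by (auto simp: rc proj_coset)
qed

lemma P_resolution: "is_free_resolution R (power_quot R \<aa> (Suc n)) (P n)"
  unfolding P_def resolution_of_def by (rule someI_ex[OF free_resolution_exists[OF power_quot_module power_quot_fg]])

lemma \<Phi>_lift: "is_chain_lift R (P (Suc n)) (P n) (power_quot_proj R \<aa> (Suc n)) (\<Phi> n)"
  unfolding \<Phi>_def
  by (rule someI_ex[OF chain_lift_exists[OF power_quot_module power_quot_module proj_lin P_resolution P_resolution]])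

definition rk :: "nat \<Rightarrow> nat \<Rightarrow> nat" where
  "rk n i = (case i of 0 \<Rightarrow> 0 | Suc j \<Rightarrow> res_rank (P n) j)"

definition d :: "nat \<Rightarrow> nat \<Rightarrow> (nat \<Rightarrow> 'a) \<Rightarrow> (nat \<Rightarrow> 'a)" where
  "d n i = (case i of 0 \<Rightarrow> (\<lambda>_. \<zero>\<^bsub>free_module R 0\<^esub>) | Suc j \<Rightarrow> res_diff (P n) j)"

definition \<phi> :: "nat \<Rightarrow> nat \<Rightarrow> (nat \<Rightarrow> 'a) \<Rightarrow> (nat \<Rightarrow> 'a)" where
  "\<phi> n i = (case i of 0 \<Rightarrow> (\<lambda>_. \<zero>\<^bsub>free_module R 0\<^esub>) | Suc j \<Rightarrow> \<Phi> n j)"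

lemma rk_d_\<phi>_simps [simp]:
  "rk n 0 = 0" "rk n (Suc j) = res_rank (P n) j"
  "d n 0 z = \<zero>\<^bsub>free_module R 0\<^esub>" "d n (Suc j) = res_diff (P n) j"
  "\<phi> n 0 z = \<zero>\<^bsub>free_module R 0\<^esub>" "\<phi> n (Suc j) = \<Phi> n j"
  by (simp_all add: rk_def d_def \<phi>_def)

lemma \<rho>_exists:
  "\<exists>\<rho>. lin R (free_module R (res_rank (P n) 0)) (regular_module R) \<rho> \<and>
    (\<forall>z\<in>carrier (free_module R (res_rank (P n) 0)). I n +>\<^bsub>R\<^esub> \<rho> z = res_aug (P n) z)"
proof -
  interpret S: submod R "regular_module R" "I n" by (rule I_submod)
  have a: "lin R (free_module R (res_rank (P n) 0)) (quot_module (regular_module R) (I n)) (res_aug (P n))"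
    using P_resolution[of n] unfolding is_free_resolution_def power_quot_eq res_module_def
    by (simp add: linear_maps_iff)
  have "\<exists>x\<in>carrier (regular_module R). I n +>\<^bsub>regular_module R\<^esub> x = res_aug (P n) v"
    if "v \<in> carrier (free_module R (res_rank (P n) 0))" for v
    using lin_closed[OF a that] unfolding S.quot_carrier by force
  from free_lift_onto[OF regular_module_module S.quot_module_module S.quot_lin a this]
  show ?thesis unfolding regular_coset .
qed

definition \<rho> :: "nat \<Rightarrow> (nat \<Rightarrow> 'a) \<Rightarrow> 'a" where
  "\<rho> n = (SOME \<rho>. lin R (free_module R (res_rank (P n) 0)) (regular_module R) \<rho> \<and>
    (\<forall>z\<in>carrier (free_module R (res_rank (P n) 0)). I n +>\<^bsub>R\<^esub> \<rho> z = res_aug (P n) z))"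

lemma \<rho>_props:
  "lin R (free_module R (res_rank (P n) 0)) (regular_module R) (\<rho> n)"
  "z \<in> carrier (free_module R (res_rank (P n) 0)) \<Longrightarrow> I n +>\<^bsub>R\<^esub> \<rho> n z = res_aug (P n) z"
  using someI_ex[OF \<rho>_exists[of n]] unfolding \<rho>_def by blast+

text \<open>
  The indices are shifted by one: degree \<open>j + 1\<close> of the tower is degree \<open>j\<close> of the resolution. Exactness of the
  resolution at degree \<open>0\<close> is expressed by \<open>\<rho>\<close>.
\<close>

lemma tower: "resolution_tower R \<aa> I rk d \<phi> \<rho>"
proof -
  have F: "module R (free_module R j)" for j by (rule free_module_module[OF is_cring])
  have F0: "z = \<zero>\<^bsub>free_module R 0\<^esub>" if "z \<in> carrier (free_module R 0)" for z
    using that by (simp add: free_carrier free_zero fun_eq_iff)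
  have Z0: "lin R X (free_module R 0) (\<lambda>_. \<zero>\<^bsub>free_module R 0\<^esub>)" for X :: "('a, nat \<Rightarrow> 'a) module"
    by (rule lin_const_zero[OF F])
  have Pn: "lin R (free_module R (res_rank (P n) (Suc i))) (free_module R (res_rank (P n) i)) (res_diff (P n) i)"
    and Pa: "res_aug (P n) ` carrier (free_module R (res_rank (P n) 0)) = carrier (power_quot R \<aa> (Suc n))"
    and Pk0: "a_kernel (free_module R (res_rank (P n) 0)) (power_quot R \<aa> (Suc n)) (res_aug (P n)) =
      res_diff (P n) 0 ` carrier (free_module R (res_rank (P n) (Suc 0)))"
    and Pk: "a_kernel (free_module R (res_rank (P n) (Suc i))) (free_module R (res_rank (P n) i)) (res_diff (P n) i) =
      res_diff (P n) (Suc i) ` carrier (free_module R (res_rank (P n) (Suc (Suc i))))" for n i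
    using P_resolution[of n] unfolding is_free_resolution_def res_module_def linear_maps_iff by blast+
  have Phi: "lin R (free_module R (res_rank (P (Suc n)) i)) (free_module R (res_rank (P n) i)) (\<Phi> n i)"
    and Phia: "\<And>x. x \<in> carrier (free_module R (res_rank (P (Suc n)) 0)) \<Longrightarrow>
      res_aug (P n) (\<Phi> n 0 x) = power_quot_proj R \<aa> (Suc n) (res_aug (P (Suc n)) x)"
    and Phid: "\<And>x. x \<in> carrier (free_module R (res_rank (P (Suc n)) (Suc i))) \<Longrightarrow>
      res_diff (P n) i (\<Phi> n (Suc i) x) = \<Phi> n i (res_diff (P (Suc n)) i x)" for n i
    using \<Phi>_lift[of n] unfolding is_chain_lift_def res_module_def linear_maps_iff by blast+
  have zero: "\<zero>\<^bsub>power_quot R \<aa> (Suc n)\<^esub> = I n" for n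
    unfolding power_quot_eq by (rule submod.quot_zero[OF I_submod])
  have coset: "I n +>\<^bsub>R\<^esub> x = I n +>\<^bsub>R\<^esub> y \<longleftrightarrow> x \<ominus> y \<in> I n" if "x \<in> carrier R" "y \<in> carrier R" for n x y
    using submod.coset_eq_iff[OF I_submod, of x y n] that by (simp add: regular_coset)
  have coset0: "I n +>\<^bsub>R\<^esub> x = I n \<longleftrightarrow> x \<in> I n" if "x \<in> carrier R" for n x
    using submod.coset_eq_B_iff[OF I_submod, of x n] that by (simp add: regular_coset)
  have \<rho>R: "\<rho> n z \<in> carrier R" if "z \<in> carrier (free_module R (res_rank (P n) 0))" for n z
    using lin_closed[OF \<rho>_props(1) that] by simp
  have ker: "\<rho> n z \<in> I n \<longleftrightarrow> z \<in> res_diff (P n) 0 ` carrier (free_module R (res_rank (P n) (Suc 0)))"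
    if z: "z \<in> carrier (free_module R (res_rank (P n) 0))" for n z
    unfolding Pk0[symmetric] a_kernel_eq zero using coset0[OF \<rho>R[OF z], of n] \<rho>_props(2)[OF z] z by simp
  show ?thesis
  proof (intro resolution_tower.intro noetherian_cring_axioms resolution_tower_axioms.intro, goal_cases)
    case 1
    show ?case by (rule ideal_\<aa>)
  next
    case 2
    show ?case by (rule I_0)
  next
    case (3 n)
    show ?case by (rule I_Suc)
  next
    case (4 n)
    show ?case by simp
  next
    case (5 n i)
    show ?case
    proof (cases i)
      case 0
      then show ?thesis using lin_cong[OF Z0 F, where g = "d n 0"] by simp
    qed (use Pn in simp)
  next
    case (6 n i)
    show ?case
    proof (cases i)
      case 0
      then show ?thesis using lin_cong[OF Z0 F, where g = "\<phi> n 0"] by simp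
    qed (use Phi in simp)
  next
    case (7 z n i)
    then show ?case
      by (cases i) (use Phid in simp_all)
  next
    case (8 z n i)
    show ?case
    proof (cases i)
      case (Suc j)
      have "res_diff (P n) (Suc j) z \<in> a_kernel (free_module R (res_rank (P n) (Suc j))) (free_module R (res_rank (P n) j)) (res_diff (P n) j)"
        unfolding Pk using 8 Suc by simp
      then show ?thesis using Suc by (simp add: a_kernel_eq)
    qed simp
  next
    case (9 z n i)
    have "z \<in> a_kernel (free_module R (res_rank (P n) (Suc i))) (free_module R (res_rank (P n) i)) (res_diff (P n) i)"
      using 9 by (simp add: a_kernel_eq)
    then show ?case unfolding Pk by auto
  next
    case (10 n)
    show ?case using \<rho>_props(1) by simp
  next
    case (11 z n)
    then show ?case using ker[of "res_diff (P n) 0 z" n] lin_closed[OF Pn, of z n 0] by simp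
  next
    case (12 z n)
    then show ?case using ker[of z n] by auto
  next
    case (13 n)
    have "I n +>\<^bsub>R\<^esub> \<one> \<in> carrier (power_quot R \<aa> (Suc n))"
      unfolding power_quot_eq submod.quot_carrier[OF I_submod] by (simp add: regular_coset)
    then obtain z where z: "z \<in> carrier (free_module R (res_rank (P n) 0))" "res_aug (P n) z = I n +>\<^bsub>R\<^esub> \<one>"
      unfolding Pa[symmetric] by force
    then show ?case using \<rho>_props(2)[OF z(1)] coset[OF \<rho>R[OF z(1)] one_closed] by auto
  next
    case (14 z n)
    then have z: "z \<in> carrier (free_module R (res_rank (P (Suc n)) 0))" by simp
    have w: "\<Phi> n 0 z \<in> carrier (free_module R (res_rank (P n) 0))" by (rule lin_closed[OF Phi z])
    have "I n +>\<^bsub>R\<^esub> \<rho> n (\<Phi> n 0 z) = I n +>\<^bsub>R\<^esub> \<rho> (Suc n) z"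
      using \<rho>_props(2)[OF w] Phia[OF z] proj_coset[OF \<rho>R[OF z], of n] unfolding \<rho>_props(2)[OF z] by simp
    then show ?case using coset[OF \<rho>R[OF w] \<rho>R[OF z]] by simp
  qed
qed

end

section \<open>Direct limits of modules\<close>

lemma Union_const: "A \<noteq> {} \<Longrightarrow> (\<And>S. S \<in> A \<Longrightarrow> S = c) \<Longrightarrow> \<Union>A = c"
  by auto

locale module_sequence =
  fixes R :: "('a, 'r) ring_scheme" and E :: "nat \<Rightarrow> ('a, 'x, 'm) module_scheme" and t :: "nat \<Rightarrow> 'x \<Rightarrow> 'x"
  assumes E_module: "module R (E n)" and t_lin: "lin R (E n) (E (Suc n)) (t n)"
begin

definition cl :: "nat \<Rightarrow> 'x \<Rightarrow> (nat \<times> 'x) set" where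
  "cl n x = dirlim_rel E t `` {(n, x)}"

lemma trans_lin: "lin R (E n) (E (n + k)) (transition t n k)"
proof (induction k)
  case 0
  show ?case by (simp add: lin_def)
next
  case (Suc k)
  show ?case using lin_comp[OF Suc t_lin] by simp
qed

lemma trans_trans: "transition t n (k + l) x = transition t (n + k) l (transition t n k x)"
  by (induction l) (simp_all add: add.assoc)

lemma trans_eq_mono:
  assumes "m + k = n + l" "transition t m k x = transition t n l y"
  shows "transition t m (k + j) x = transition t n (l + j) y"
  using assms by (simp add: trans_trans)

lemma rel_iff: "((m, x), (n, y)) \<in> dirlim_rel E t \<longleftrightarrow> x \<in> carrier (E m) \<and> y \<in> carrier (E n) \<and>
     (\<exists>k l. m + k = n + l \<and> transition t m k x = transition t n l y)"
  by (simp add: dirlim_rel_def)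

lemma rel_equiv: "equiv (SIGMA n:UNIV. carrier (E n)) (dirlim_rel E t)"
proof (rule equivI)
  show "dirlim_rel E t \<subseteq> (SIGMA n:UNIV. carrier (E n)) \<times> (SIGMA n:UNIV. carrier (E n))"
    by (auto simp: dirlim_rel_def)
  show "refl_on (SIGMA n:UNIV. carrier (E n)) (dirlim_rel E t)"
    by (auto simp: refl_on_def rel_iff)
  show "sym (dirlim_rel E t)"
    by (rule symI) (clarsimp simp: rel_iff, metis)
  show "trans (dirlim_rel E t)"
  proof (rule transI, clarsimp simp: rel_iff)
    fix m x n y p z k l k' l'
    assume *: "m + k = n + l" "transition t m k x = transition t n l y"
      "n + k' = p + l'" "transition t n k' y = transition t p l' z"
    have "transition t m (k + k') x = transition t n (l + k') y"
      by (rule trans_eq_mono[OF *(1,2)])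
    also have "\<dots> = transition t p (l' + l) z"
      using trans_eq_mono[OF *(3,4), of l] by (simp add: add.commute)
    finally show "\<exists>k l. m + k = p + l \<and> transition t m k x = transition t p l z"
      using * by (intro exI[of _ "k + k'"] exI[of _ "l' + l"]) simp
  qed
qed

lemma cl_eq_iff:
  assumes "x \<in> carrier (E m)" "y \<in> carrier (E n)"
  shows "cl m x = cl n y \<longleftrightarrow> (\<exists>k l. m + k = n + l \<and> transition t m k x = transition t n l y)"
  unfolding cl_def using eq_equiv_class_iff[OF rel_equiv, of "(m, x)" "(n, y)"] assms by (simp add: rel_iff)

lemma cl_eqI:
  assumes "x \<in> carrier (E m)" "y \<in> carrier (E n)" "m + k = n + l" "transition t m k x = transition t n l y"
  shows "cl m x = cl n y"
  unfolding cl_eq_iff[OF assms(1,2)] using assms(3,4) by blast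

lemma cl_trans:
  assumes "x \<in> carrier (E n)"
  shows "cl (n + k) (transition t n k x) = cl n x"
  unfolding cl_eq_iff[OF lin_closed[OF trans_lin assms] assms]
  by (intro exI[of _ 0] exI[of _ k]) simp

lemma mem_cl: "(n, y) \<in> cl m x \<Longrightarrow> y \<in> carrier (E n) \<and> x \<in> carrier (E m) \<and> cl n y = cl m x"
  unfolding cl_def using equiv_class_eq[OF rel_equiv, of "(m, x)" "(n, y)"] by (auto simp: rel_iff)

lemma cl_self: "x \<in> carrier (E n) \<Longrightarrow> (n, x) \<in> cl n x"
  unfolding cl_def by (auto simp: rel_iff)

lemma dirlim_carrier: "carrier (dirlim E t) = {cl n x | n x. x \<in> carrier (E n)}"
  unfolding dirlim_def quotient_def cl_def by auto

lemma dirlim_add: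
  assumes x: "x \<in> carrier (E n)" and y: "y \<in> carrier (E n)"
  shows "cl n x \<oplus>\<^bsub>dirlim E t\<^esub> cl n y = cl n (x \<oplus>\<^bsub>E n\<^esub> y)"
proof -
  interpret En: module R "E n" by (rule E_module)
  let ?A = "{cl m (u \<oplus>\<^bsub>E m\<^esub> v) | m u v. (m, u) \<in> cl n x \<and> (m, v) \<in> cl n y}"
  have "cl m (u \<oplus>\<^bsub>E m\<^esub> v) = cl n (x \<oplus>\<^bsub>E n\<^esub> y)" if u: "(m, u) \<in> cl n x" and v: "(m, v) \<in> cl n y" for m u v
  proof -
    interpret Em: module R "E m" by (rule E_module)
    have uc: "u \<in> carrier (E m)" and vc: "v \<in> carrier (E m)" using mem_cl[OF u] mem_cl[OF v] by auto
    obtain k l where 1: "m + k = n + l" "transition t m k u = transition t n l x"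
      using mem_cl[OF u] cl_eq_iff[OF uc x] by blast
    obtain k' l' where 2: "m + k' = n + l'" "transition t m k' v = transition t n l' y"
      using mem_cl[OF v] cl_eq_iff[OF vc y] by blast
    have kk: "k' + k = k + k'" "l' + k = l + k'" using 1(1) 2(1) by simp_all
    have u': "transition t m (k + k') u = transition t n (l + k') x"
      by (rule trans_eq_mono[OF 1])
    have v': "transition t m (k + k') v = transition t n (l + k') y"
      using trans_eq_mono[OF 2, of k] unfolding kk .
    have e: "m + (k + k') = n + (l + k')" using 1(1) by simp
    have "transition t m (k + k') (u \<oplus>\<^bsub>E m\<^esub> v) = transition t n (l + k') (x \<oplus>\<^bsub>E n\<^esub> y)"
      unfolding lin_add[OF trans_lin uc vc] lin_add[OF trans_lin x y] u' v' e ..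
    then show ?thesis
      using uc vc x y by (intro cl_eqI[OF _ _ e]) simp_all
  qed
  moreover have "?A \<noteq> {}" using cl_self[OF x] cl_self[OF y] by blast
  ultimately have "\<Union>?A = cl n (x \<oplus>\<^bsub>E n\<^esub> y)" by (intro Union_const) auto
  then show ?thesis by (simp add: dirlim_def cl_def)
qed

lemma dirlim_smult:
  assumes r: "r \<in> carrier R" and x: "x \<in> carrier (E n)"
  shows "r \<odot>\<^bsub>dirlim E t\<^esub> cl n x = cl n (r \<odot>\<^bsub>E n\<^esub> x)"
proof -
  interpret En: module R "E n" by (rule E_module)
  let ?A = "{cl m (r \<odot>\<^bsub>E m\<^esub> u) | m u. (m, u) \<in> cl n x}"
  have "cl m (r \<odot>\<^bsub>E m\<^esub> u) = cl n (r \<odot>\<^bsub>E n\<^esub> x)" if u: "(m, u) \<in> cl n x" for m u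
  proof -
    interpret Em: module R "E m" by (rule E_module)
    have uc: "u \<in> carrier (E m)" using mem_cl[OF u] by auto
    obtain k l where 1: "m + k = n + l" "transition t m k u = transition t n l x"
      using mem_cl[OF u] cl_eq_iff[OF uc x] by blast
    have "transition t m k (r \<odot>\<^bsub>E m\<^esub> u) = transition t n l (r \<odot>\<^bsub>E n\<^esub> x)"
      unfolding lin_smult[OF trans_lin r uc] lin_smult[OF trans_lin r x] 1 ..
    then show ?thesis
      using r uc x by (intro cl_eqI[OF _ _ 1(1)]) simp_all
  qed
  moreover have "?A \<noteq> {}" using cl_self[OF x] by blast
  ultimately have "\<Union>?A = cl n (r \<odot>\<^bsub>E n\<^esub> x)" by (intro Union_const) auto
  then show ?thesis by (simp add: dirlim_def cl_def)
qed

lemma dirlim_zero: "\<zero>\<^bsub>dirlim E t\<^esub> = cl n \<zero>\<^bsub>E n\<^esub>"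
proof -
  interpret E0: module R "E 0" by (rule E_module)
  have "cl (0 + n) (transition t 0 n \<zero>\<^bsub>E 0\<^esub>) = cl 0 \<zero>\<^bsub>E 0\<^esub>" by (rule cl_trans) simp
  moreover have "transition t 0 n \<zero>\<^bsub>E 0\<^esub> = \<zero>\<^bsub>E (0 + n)\<^esub>"
    by (rule lin_zero[OF trans_lin E_module E_module])
  ultimately show ?thesis by (simp add: dirlim_def cl_def)
qed

lemma dirlim_rep:
  assumes "X \<in> carrier (dirlim E t)"
  shows "\<exists>n0. \<forall>n\<ge>n0. \<exists>x\<in>carrier (E n). X = cl n x"
proof -
  obtain n0 x where x: "X = cl n0 x" "x \<in> carrier (E n0)" using assms unfolding dirlim_carrier by blast
  have "\<exists>y\<in>carrier (E n). X = cl n y" if "n0 \<le> n" for n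
    using cl_trans[OF x(2), of "n - n0"] lin_closed[OF trans_lin x(2), of "n - n0"] x(1) that
    by (intro bexI[of _ "transition t n0 (n - n0) x"]) auto
  then show ?thesis by blast
qed

lemma dirlim_rep3:
  assumes "X \<in> carrier (dirlim E t)" "Y \<in> carrier (dirlim E t)" "W \<in> carrier (dirlim E t)"
  obtains n x y w where "x \<in> carrier (E n)" "X = cl n x" "y \<in> carrier (E n)" "Y = cl n y"
    "w \<in> carrier (E n)" "W = cl n w"
proof -
  obtain n1 n2 n3 where n: "\<And>n. n \<ge> n1 \<Longrightarrow> \<exists>x\<in>carrier (E n). X = cl n x"
    "\<And>n. n \<ge> n2 \<Longrightarrow> \<exists>x\<in>carrier (E n). Y = cl n x" "\<And>n. n \<ge> n3 \<Longrightarrow> \<exists>x\<in>carrier (E n). W = cl n x"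
    using dirlim_rep[OF assms(1)] dirlim_rep[OF assms(2)] dirlim_rep[OF assms(3)] by blast
  show ?thesis
    using n(1)[of "n1 + n2 + n3"] n(2)[of "n1 + n2 + n3"] n(3)[of "n1 + n2 + n3"] that[of _ "n1 + n2 + n3"] by auto
qed

lemma dirlim_module: "module R (dirlim E t)"
proof (rule moduleI)
  let ?D = "dirlim E t"
  interpret E0: module R "E 0" by (rule E_module)
  show "cring R" by (rule E0.R.is_cring)
  have clD: "cl n x \<in> carrier ?D" if "x \<in> carrier (E n)" for n x
    unfolding dirlim_carrier using that by blast
  show "abelian_group ?D"
  proof (rule abelian_groupI)
    show "\<zero>\<^bsub>?D\<^esub> \<in> carrier ?D" unfolding dirlim_zero[of 0] by (rule clD) simp
  next
    fix X Y assume "X \<in> carrier ?D" "Y \<in> carrier ?D"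
    then obtain n x y where xy: "x \<in> carrier (E n)" "X = cl n x" "y \<in> carrier (E n)" "Y = cl n y"
      using dirlim_rep3 by metis
    interpret En: module R "E n" by (rule E_module)
    show "X \<oplus>\<^bsub>?D\<^esub> Y \<in> carrier ?D" using xy by (simp add: dirlim_add clD)
    show "X \<oplus>\<^bsub>?D\<^esub> Y = Y \<oplus>\<^bsub>?D\<^esub> X" using xy by (simp add: dirlim_add En.M.a_comm)
  next
    fix X Y W assume "X \<in> carrier ?D" "Y \<in> carrier ?D" "W \<in> carrier ?D"
    then obtain n x y w where xy: "x \<in> carrier (E n)" "X = cl n x" "y \<in> carrier (E n)" "Y = cl n y"
      "w \<in> carrier (E n)" "W = cl n w"
      by (rule dirlim_rep3)
    interpret En: module R "E n" by (rule E_module)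
    show "X \<oplus>\<^bsub>?D\<^esub> Y \<oplus>\<^bsub>?D\<^esub> W = X \<oplus>\<^bsub>?D\<^esub> (Y \<oplus>\<^bsub>?D\<^esub> W)" using xy by (simp add: dirlim_add En.M.a_assoc)
  next
    fix X assume "X \<in> carrier ?D"
    then obtain n x where x: "X = cl n x" "x \<in> carrier (E n)" unfolding dirlim_carrier by blast
    interpret En: module R "E n" by (rule E_module)
    show "\<zero>\<^bsub>?D\<^esub> \<oplus>\<^bsub>?D\<^esub> X = X" unfolding dirlim_zero[of n] using x by (simp add: dirlim_add)
    have "cl n (\<ominus>\<^bsub>E n\<^esub> x) \<oplus>\<^bsub>?D\<^esub> X = \<zero>\<^bsub>?D\<^esub>"
      unfolding dirlim_zero[of n] using x by (simp add: dirlim_add En.M.l_neg)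
    moreover have "cl n (\<ominus>\<^bsub>E n\<^esub> x) \<in> carrier ?D" using x by (intro clD) simp
    ultimately show "\<exists>Y\<in>carrier ?D. Y \<oplus>\<^bsub>?D\<^esub> X = \<zero>\<^bsub>?D\<^esub>" by blast
  qed
  fix r X assume r: "r \<in> carrier R" and X: "X \<in> carrier ?D"
  obtain n x where x: "X = cl n x" "x \<in> carrier (E n)" using X unfolding dirlim_carrier by blast
  interpret En: module R "E n" by (rule E_module)
  show "r \<odot>\<^bsub>?D\<^esub> X \<in> carrier ?D" using r x by (simp add: dirlim_smult clD)
  show "(r \<oplus>\<^bsub>R\<^esub> s) \<odot>\<^bsub>?D\<^esub> X = r \<odot>\<^bsub>?D\<^esub> X \<oplus>\<^bsub>?D\<^esub> s \<odot>\<^bsub>?D\<^esub> X" if "s \<in> carrier R" for s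
    using r x that by (simp add: dirlim_smult dirlim_add En.smult_l_distr)
  show "r \<otimes>\<^bsub>R\<^esub> s \<odot>\<^bsub>?D\<^esub> X = r \<odot>\<^bsub>?D\<^esub> (s \<odot>\<^bsub>?D\<^esub> X)" if "s \<in> carrier R" for s
    using r x that by (simp add: dirlim_smult En.smult_assoc1)
  show "r \<odot>\<^bsub>?D\<^esub> (X \<oplus>\<^bsub>?D\<^esub> Y) = r \<odot>\<^bsub>?D\<^esub> X \<oplus>\<^bsub>?D\<^esub> r \<odot>\<^bsub>?D\<^esub> Y" if Y: "Y \<in> carrier ?D" for Y
  proof -
    obtain m u v where uv: "u \<in> carrier (E m)" "X = cl m u" "v \<in> carrier (E m)" "Y = cl m v"
      using dirlim_rep3[OF X Y Y] by metis
    interpret Em: module R "E m" by (rule E_module)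
    show ?thesis using r uv by (simp add: dirlim_smult dirlim_add Em.smult_r_distr)
  qed
next
  fix X assume "X \<in> carrier (dirlim E t)"
  then obtain n x where x: "X = cl n x" "x \<in> carrier (E n)" unfolding dirlim_carrier by blast
  interpret En: module R "E n" by (rule E_module)
  show "\<one>\<^bsub>R\<^esub> \<odot>\<^bsub>dirlim E t\<^esub> X = X" using x by (simp add: dirlim_smult)
qed

end


section \<open>Local cohomology classes as cocycles of the tower\<close>

lemma restrict_eq_iff_extensional:
  "g \<in> extensional A \<Longrightarrow> g = restrict f A \<longleftrightarrow> (\<forall>z\<in>A. g z = f z)"
  by (auto simp: restrict_def extensional_def fun_eq_iff)

lemma hom_simps:
  "carrier (hom_module R A M) = linear_maps R A M"
  "\<zero>\<^bsub>hom_module R A M\<^esub> = (\<lambda>x\<in>carrier A. \<zero>\<^bsub>M\<^esub>)"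
  "f \<oplus>\<^bsub>hom_module R A M\<^esub> g = (\<lambda>x\<in>carrier A. f x \<oplus>\<^bsub>M\<^esub> g x)"
  "r \<odot>\<^bsub>hom_module R A M\<^esub> f = (\<lambda>x\<in>carrier A. r \<odot>\<^bsub>M\<^esub> f x)"
  by (simp_all add: hom_module_def)

lemma linear_maps_closed: "f \<in> linear_maps R A M \<Longrightarrow> x \<in> carrier A \<Longrightarrow> f x \<in> carrier M"
  by (auto simp: linear_maps_iff lin_closed)

lemma linear_maps_restrict: "f \<in> linear_maps R A M \<Longrightarrow> (\<lambda>x\<in>carrier A. f x) = f"
  by (auto simp: linear_maps_iff extensional_def)

lemma hom_module_module:
  assumes A: "module R A" and M: "module R M"
  shows "module R (hom_module R A M)"
proof (rule moduleI)
  interpret M: module R M by fact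
  let ?H = "hom_module R A M"
  show "cring R" by (rule M.R.is_cring)
  have lm: "lin R A M f" if "f \<in> linear_maps R A M" for f using that by (simp add: linear_maps_iff)
  show "abelian_group ?H"
  proof (rule abelian_groupI)
    show "\<zero>\<^bsub>?H\<^esub> \<in> carrier ?H"
      unfolding hom_simps by (rule restrict_linear_maps[OF lin_const_zero[OF M] A])
    fix f g assume f: "f \<in> carrier ?H" and g: "g \<in> carrier ?H"
    show "f \<oplus>\<^bsub>?H\<^esub> g \<in> carrier ?H"
      unfolding hom_simps using f g lm
      by (intro restrict_linear_maps lin_pointwise_add A M) (simp_all add: hom_simps)
    show "f \<oplus>\<^bsub>?H\<^esub> g = g \<oplus>\<^bsub>?H\<^esub> f"
      unfolding hom_simps using f g by (intro restrict_ext M.M.a_comm) (auto simp: hom_simps linear_maps_closed)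
    show "f \<oplus>\<^bsub>?H\<^esub> g \<oplus>\<^bsub>?H\<^esub> h = f \<oplus>\<^bsub>?H\<^esub> (g \<oplus>\<^bsub>?H\<^esub> h)" if h: "h \<in> carrier ?H" for h
      using f g h by (auto simp: hom_simps linear_maps_closed M.M.a_assoc intro!: restrict_ext)
    have "\<zero>\<^bsub>?H\<^esub> \<oplus>\<^bsub>?H\<^esub> f = (\<lambda>x\<in>carrier A. f x)"
      using f by (auto simp: hom_simps linear_maps_closed intro!: restrict_ext)
    then show "\<zero>\<^bsub>?H\<^esub> \<oplus>\<^bsub>?H\<^esub> f = f" using f linear_maps_restrict by (metis hom_simps(1))
    let ?n = "\<lambda>x\<in>carrier A. \<zero>\<^bsub>M\<^esub> \<ominus>\<^bsub>M\<^esub> f x"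
    have "?n \<in> carrier ?H"
      unfolding hom_simps using f lm
      by (intro restrict_linear_maps lin_pointwise_diff lin_const_zero A M) (simp_all add: hom_simps)
    moreover have "?n \<oplus>\<^bsub>?H\<^esub> f = \<zero>\<^bsub>?H\<^esub>"
      using f by (auto simp: hom_simps linear_maps_closed M.M.minus_eq M.M.l_neg intro!: restrict_ext)
    ultimately show "\<exists>g\<in>carrier ?H. g \<oplus>\<^bsub>?H\<^esub> f = \<zero>\<^bsub>?H\<^esub>" by blast
  qed
  fix r f assume r: "r \<in> carrier R" and f: "f \<in> carrier ?H"
  show "r \<odot>\<^bsub>?H\<^esub> f \<in> carrier ?H"
    unfolding hom_simps using f r lm
    by (intro restrict_linear_maps lin_pointwise_smult A M) (simp_all add: hom_simps)
  show "(r \<oplus>\<^bsub>R\<^esub> s) \<odot>\<^bsub>?H\<^esub> f = r \<odot>\<^bsub>?H\<^esub> f \<oplus>\<^bsub>?H\<^esub> s \<odot>\<^bsub>?H\<^esub> f" if "s \<in> carrier R" for s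
    using r f that by (auto simp: hom_simps linear_maps_closed M.smult_l_distr intro!: restrict_ext)
  show "r \<otimes>\<^bsub>R\<^esub> s \<odot>\<^bsub>?H\<^esub> f = r \<odot>\<^bsub>?H\<^esub> (s \<odot>\<^bsub>?H\<^esub> f)" if "s \<in> carrier R" for s
    using r f that by (auto simp: hom_simps linear_maps_closed M.smult_assoc1 intro!: restrict_ext)
  show "r \<odot>\<^bsub>?H\<^esub> (f \<oplus>\<^bsub>?H\<^esub> g) = r \<odot>\<^bsub>?H\<^esub> f \<oplus>\<^bsub>?H\<^esub> r \<odot>\<^bsub>?H\<^esub> g" if "g \<in> carrier ?H" for g
    using r f that by (auto simp: hom_simps linear_maps_closed M.smult_r_distr intro!: restrict_ext)
next
  interpret M: module R M by fact
  fix f assume f: "f \<in> carrier (hom_module R A M)"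
  have "\<one>\<^bsub>R\<^esub> \<odot>\<^bsub>hom_module R A M\<^esub> f = (\<lambda>x\<in>carrier A. f x)"
    using f by (auto simp: hom_simps linear_maps_closed intro!: restrict_ext)
  then show "\<one>\<^bsub>R\<^esub> \<odot>\<^bsub>hom_module R A M\<^esub> f = f" using f linear_maps_restrict by (metis hom_simps(1))
qed

sublocale ideal_in_noetherian_cring \<subseteq> T: resolution_tower R \<aa> I rk d \<phi> \<rho>
  by (rule tower)

text \<open>
  The \<open>Ext\<close> modules consist of cosets of extensional cocycles, and local cohomology of classes of such cosets. The
  purpose of this part is to label these classes by the cocycles of the tower, which need not be extensional:
  \<open>ext_class n g\<close> is the class of \<open>g\<close> in the term \<open>n\<close> of the direct system, and \<open>lim_class n g\<close> the class in the limit.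
\<close>

locale local_cohomology_classes = ideal_in_noetherian_cring R \<aa>
  for R (structure) and \<aa> +
  fixes M :: "('a, 'x, 'm) module_scheme" and i :: nat
  assumes M_module: "module R M"
begin

abbreviation (input) Zc where "Zc \<equiv> \<lambda>n. T.cocyc M (carrier M) {\<zero>\<^bsub>M\<^esub>} n i"
abbreviation (input) Bc where "Bc \<equiv> \<lambda>n. T.cobnd M (carrier M) {\<zero>\<^bsub>M\<^esub>} n i"

abbreviation Fi where "Fi n \<equiv> free_module R (res_rank (P n) i)"

definition C where "C n = hom_module R (Fi n) M"
definition cocycle_set where "cocycle_set n = {g. Zc n g \<and> g \<in> extensional (carrier (Fi n))}"
definition coboundary_set where "coboundary_set n = {g. Zc n g \<and> Bc n g \<and> g \<in> extensional (carrier (Fi n))}"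
definition cocycle_module where "cocycle_module n = (C n)\<lparr>carrier := cocycle_set n\<rparr>"
definition E where "E n = ext_module R i (power_quot R \<aa> (Suc n)) M"
definition t where "t n = ext_map R i (power_quot R \<aa> (Suc (Suc n))) (power_quot R \<aa> (Suc n)) (power_quot_proj R \<aa> (Suc n)) M"
definition restr where "restr n g = restrict g (carrier (Fi n))" for g :: "(nat \<Rightarrow> 'a) \<Rightarrow> 'x"
definition ext_class where "ext_class n g = coboundary_set n +>\<^bsub>cocycle_module n\<^esub> restr n g"

lemma F_mod: "module R (free_module R k)"
  by (rule free_module_module[OF is_cring])

lemma MS: "submodule (carrier M) R M" and M0: "submodule {\<zero>\<^bsub>M\<^esub>} R M"
  using module.carrier_is_submodule[OF M_module] module.zero_submodule[OF M_module] by simp_all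

lemma coch_iff: "T.coch M (carrier M) n j g \<longleftrightarrow> lin R (T.F n j) M g"
  unfolding T.coch_def by (auto simp: lin_def)

lemma cocyc_iff: "Zc n g \<longleftrightarrow> lin R (Fi n) M g \<and>
    (\<forall>z\<in>carrier (free_module R (res_rank (P n) (Suc i))). g (res_diff (P n) i z) = \<zero>\<^bsub>M\<^esub>)"
  unfolding T.cocyc_def coch_iff by simp

lemma cocyc_cong:
  assumes "Zc n g" "\<And>z. z \<in> carrier (Fi n) \<Longrightarrow> h z = g z"
  shows "Zc n h"
proof -
  have "lin R (Fi n) M h" using assms lin_cong[OF _ F_mod] unfolding cocyc_iff by blast
  moreover have "res_diff (P n) i z \<in> carrier (Fi n)" if "z \<in> carrier (free_module R (res_rank (P n) (Suc i)))" for z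
    using T.d_carrier[of z n "Suc i"] that by simp
  ultimately show ?thesis using assms unfolding cocyc_iff by simp
qed

lemma cobnd_cong:
  assumes "Bc n g" "\<And>z. z \<in> carrier (Fi n) \<Longrightarrow> h z = g z"
  shows "Bc n h"
  using assms unfolding T.cobnd_def by simp

lemma cocyc_carrier: "Zc n g \<Longrightarrow> z \<in> carrier (Fi n) \<Longrightarrow> g z \<in> carrier M"
  unfolding cocyc_iff by (auto simp: lin_def)

lemma cocyc_add:
  assumes "Zc n g" "Zc n h"
  shows "Zc n (\<lambda>z. g z \<oplus>\<^bsub>M\<^esub> h z)"
proof -
  interpret M: module R M by (rule M_module)
  show ?thesis
    using assms lin_pointwise_add[OF _ _ F_mod M_module] unfolding cocyc_iff by simp
qed

lemma cocyc_diff: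
  assumes "Zc n g" "Zc n h"
  shows "Zc n (\<lambda>z. g z \<ominus>\<^bsub>M\<^esub> h z)"
proof -
  interpret M: module R M by (rule M_module)
  show ?thesis
    using assms lin_pointwise_diff[OF _ _ F_mod M_module] unfolding cocyc_iff by simp
qed

lemma cocyc_smult:
  assumes "Zc n g" "r \<in> carrier R"
  shows "Zc n (\<lambda>z. r \<odot>\<^bsub>M\<^esub> g z)"
proof -
  interpret M: module R M by (rule M_module)
  show ?thesis
    using assms lin_pointwise_smult[OF _ F_mod M_module] unfolding cocyc_iff by simp
qed

lemma cobnd_iff: "Bc n g \<longleftrightarrow> (\<exists>h. lin R (T.F n i) M h \<and> (\<forall>z\<in>carrier (Fi n). g z \<ominus>\<^bsub>M\<^esub> h (d n i z) = \<zero>\<^bsub>M\<^esub>))"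
  unfolding T.cobnd_def coch_iff by simp

lemma cobnd_iff': "Zc n g \<Longrightarrow> Bc n g \<longleftrightarrow> (\<exists>h. lin R (T.F n i) M h \<and> (\<forall>z\<in>carrier (Fi n). g z = h (d n i z)))"
proof -
  assume g: "Zc n g"
  interpret M: module R M by (rule M_module)
  have "g z \<ominus>\<^bsub>M\<^esub> h (d n i z) = \<zero>\<^bsub>M\<^esub> \<longleftrightarrow> g z = h (d n i z)" if h: "lin R (T.F n i) M h" and z: "z \<in> carrier (Fi n)" for h z
    using M.minus_eq_zero_iff[OF cocyc_carrier[OF g z] lin_closed[OF h T.d_carrier]] z by simp
  then show ?thesis unfolding cobnd_iff by blast
qed

lemma cobnd_zero: "Bc n (\<lambda>_. \<zero>\<^bsub>M\<^esub>)"
  by (rule T.cobnd_of_values[OF M_module MS lin_const_zero[OF M_module]]) simp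

lemma cobnd_add:
  assumes "Zc n g" "Zc n h" "Bc n g" "Bc n h"
  shows "Bc n (\<lambda>z. g z \<oplus>\<^bsub>M\<^esub> h z)"
proof -
  obtain u v where "lin R (T.F n i) M u" "\<forall>z\<in>carrier (Fi n). g z = u (d n i z)"
    "lin R (T.F n i) M v" "\<forall>z\<in>carrier (Fi n). h z = v (d n i z)"
    using assms by (auto simp: cobnd_iff')
  then show ?thesis
    unfolding cobnd_iff'[OF cocyc_add[OF assms(1,2)]]
    using lin_pointwise_add[of R "T.F n i" M u v, OF _ _ F_mod M_module]
    by (intro exI[of _ "\<lambda>z. u z \<oplus>\<^bsub>M\<^esub> v z"]) simp
qed

lemma cobnd_smult:
  assumes "Zc n g" "Bc n g" "r \<in> carrier R"
  shows "Bc n (\<lambda>z. r \<odot>\<^bsub>M\<^esub> g z)"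
proof -
  obtain u where "lin R (T.F n i) M u" "\<forall>z\<in>carrier (Fi n). g z = u (d n i z)"
    using assms by (auto simp: cobnd_iff')
  then show ?thesis
    unfolding cobnd_iff'[OF cocyc_smult[OF assms(1,3)]]
    using lin_pointwise_smult[of R "T.F n i" M u, OF _ F_mod M_module assms(3)]
    by (intro exI[of _ "\<lambda>z. r \<odot>\<^bsub>M\<^esub> u z"]) simp
qed

lemma cochain_eq: "cochain_module R (P n) M i = C n"
  by (simp add: cochain_module_def res_module_def C_def)

lemma cocycles_eq: "cocycles R (P n) M i = cocycle_set n"
proof -
  interpret M: module R M by (rule M_module)
  have "cochain_diff R (P n) i g = (\<lambda>x\<in>carrier (free_module R (res_rank (P n) (Suc i))). \<zero>\<^bsub>M\<^esub>) \<longleftrightarrow>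
    (\<forall>z\<in>carrier (free_module R (res_rank (P n) (Suc i))). g (res_diff (P n) i z) = \<zero>\<^bsub>M\<^esub>)" for g :: "(nat \<Rightarrow> 'a) \<Rightarrow> 'x"
    by (auto simp: cochain_diff_def compose_def res_module_def restrict_def fun_eq_iff)
  then show ?thesis
    unfolding cocycles_def a_kernel_eq cochain_module_def hom_simps res_module_def cocycle_set_def cocyc_iff
    by (auto simp: linear_maps_iff)
qed

lemma coboundaries_eq: "coboundaries R (P n) M i = coboundary_set n"
proof (cases i)
  case 0
  have "g = (\<lambda>z\<in>carrier (Fi n). \<zero>\<^bsub>M\<^esub>) \<longleftrightarrow> g \<in> coboundary_set n" for g
  proof
    assume g: "g = (\<lambda>z\<in>carrier (Fi n). \<zero>\<^bsub>M\<^esub>)"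
    have "Zc n (\<lambda>_. \<zero>\<^bsub>M\<^esub>)" unfolding cocyc_iff using lin_const_zero[OF M_module] by simp
    then have "Zc n g" by (rule cocyc_cong) (simp add: g)
    moreover have "Bc n g" using cobnd_zero by (rule cobnd_cong) (simp add: g)
    ultimately show "g \<in> coboundary_set n" unfolding coboundary_set_def using g by simp
  next
    assume g: "g \<in> coboundary_set n"
    then obtain h where h: "lin R (T.F n i) M h" "\<forall>z\<in>carrier (Fi n). g z = h (d n i z)"
      unfolding coboundary_set_def by (auto simp: cobnd_iff')
    have "h (d n i z) = \<zero>\<^bsub>M\<^esub>" for z
      using lin_zero[OF h(1) F_mod M_module] 0 by simp
    then show "g = (\<lambda>z\<in>carrier (Fi n). \<zero>\<^bsub>M\<^esub>)"
      using g h(2) unfolding coboundary_set_def by (simp add: restrict_eq_iff_extensional)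
  qed
  moreover have "coboundaries R (P n) M i = {\<lambda>z\<in>carrier (Fi n). \<zero>\<^bsub>M\<^esub>}"
    by (simp add: coboundaries_def cochain_module_def hom_simps res_module_def 0)
  ultimately show ?thesis by blast
next
  case (Suc j)
  have F: "T.F n i = free_module R (res_rank (P n) j)" and dj: "d n i = res_diff (P n) j" using Suc by simp_all
  have "g \<in> cochain_diff R (P n) j ` linear_maps R (free_module R (res_rank (P n) j)) M \<longleftrightarrow> g \<in> coboundary_set n" for g
  proof
    assume "g \<in> cochain_diff R (P n) j ` linear_maps R (free_module R (res_rank (P n) j)) M"
    then obtain h where "h \<in> linear_maps R (free_module R (res_rank (P n) j)) M" "g = cochain_diff R (P n) j h"
      by blast
    then have h: "lin R (free_module R (res_rank (P n) j)) M h"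
      "g = (\<lambda>z\<in>carrier (Fi n). h (res_diff (P n) j z))"
      by (simp_all add: linear_maps_iff cochain_diff_def compose_def res_module_def Suc)
    have c: "T.coch M (carrier M) n (Suc i) (\<lambda>z. h (d n i z))"
      by (rule T.coch_d) (use h(1) F in \<open>simp add: coch_iff\<close>)
    have "h (d n i (d n (Suc i) z)) = \<zero>\<^bsub>M\<^esub>" if "z \<in> carrier (T.F n (Suc (Suc i)))" for z
      using T.d_d[OF that] lin_zero[OF h(1) F_mod M_module] F by simp
    then have Z: "Zc n (\<lambda>z. h (d n i z))" using c unfolding T.cocyc_def by simp
    have "Bc n (\<lambda>z. h (d n i z))"
      unfolding cobnd_iff'[OF Z] using h(1) F by auto
    then have "Bc n g" by (rule cobnd_cong) (use h(2) dj in simp)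
    moreover have "Zc n g" using Z by (rule cocyc_cong) (use h(2) dj in simp)
    ultimately show "g \<in> coboundary_set n" unfolding coboundary_set_def using h(2) by simp
  next
    assume g: "g \<in> coboundary_set n"
    then obtain h where h: "lin R (T.F n i) M h" "\<forall>z\<in>carrier (Fi n). g z = h (d n i z)"
      unfolding coboundary_set_def by (auto simp: cobnd_iff')
    let ?h = "restrict h (carrier (free_module R (res_rank (P n) j)))"
    have "?h \<in> linear_maps R (free_module R (res_rank (P n) j)) M"
      using restrict_linear_maps[OF h(1) F_mod] F by simp
    moreover have "res_diff (P n) j z \<in> carrier (free_module R (res_rank (P n) j))" if "z \<in> carrier (Fi n)" for z
      using T.d_carrier[of z n i] that F dj by simp
    then have "g = cochain_diff R (P n) j ?h"
      unfolding cochain_diff_def compose_def res_module_def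
      using g h(2) dj Suc unfolding coboundary_set_def by (simp add: restrict_eq_iff_extensional)
    ultimately show "g \<in> cochain_diff R (P n) j ` linear_maps R (free_module R (res_rank (P n) j)) M" by blast
  qed
  then show ?thesis
    unfolding coboundaries_def Suc by (auto simp: cochain_module_def hom_simps res_module_def Suc)
qed

lemma E_eq: "E n = quot_module (cocycle_module n) (coboundary_set n)"
  unfolding E_def ext_module_def Let_def P_def[symmetric] cocycle_module_def cochain_eq cocycles_eq coboundaries_eq ..

lemma C_module: "module R (C n)"
  unfolding C_def by (rule hom_module_module[OF F_mod M_module])

lemma restr_cocycle_set: "Zc n g \<Longrightarrow> restr n g \<in> cocycle_set n"
  unfolding cocycle_set_def restr_def using cocyc_cong[of n g "restrict g (carrier (Fi n))"] by simp

lemma restr_coboundary_set: "Zc n g \<Longrightarrow> restr n g \<in> coboundary_set n \<longleftrightarrow> Bc n g"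
  unfolding coboundary_set_def restr_def using cocyc_cong[of n g "restrict g (carrier (Fi n))"]
    cobnd_cong[of n g "restrict g (carrier (Fi n))"] cobnd_cong[of n "restrict g (carrier (Fi n))" g] by auto

lemma restr_self: "g \<in> cocycle_set n \<Longrightarrow> restr n g = g"
  unfolding cocycle_set_def restr_def by (auto simp: extensional_def)

lemma C_add: "restr n g \<oplus>\<^bsub>C n\<^esub> restr n h = restr n (\<lambda>z. g z \<oplus>\<^bsub>M\<^esub> h z)"
  by (auto simp: C_def hom_simps restr_def intro!: restrict_ext)

lemma C_smult: "r \<odot>\<^bsub>C n\<^esub> restr n g = restr n (\<lambda>z. r \<odot>\<^bsub>M\<^esub> g z)"
  by (auto simp: C_def hom_simps restr_def intro!: restrict_ext)

lemma C_zero: "\<zero>\<^bsub>C n\<^esub> = restr n (\<lambda>_. \<zero>\<^bsub>M\<^esub>)"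
  by (auto simp: C_def hom_simps restr_def)

lemma zero_cocyc: "Zc n (\<lambda>_. \<zero>\<^bsub>M\<^esub>)"
  unfolding cocyc_iff using lin_const_zero[OF M_module] by simp

lemma cocycle_set_Zc: "g \<in> cocycle_set n \<Longrightarrow> Zc n g"
  by (simp add: cocycle_set_def)

lemma coboundary_set_cocycle_set: "coboundary_set n \<subseteq> cocycle_set n"
  by (auto simp: cocycle_set_def coboundary_set_def)

lemma coboundary_set_Bc: "g \<in> coboundary_set n \<Longrightarrow> Bc n g"
  by (simp add: coboundary_set_def)

lemma cocycle_set_submodule: "submodule (cocycle_set n) R (C n)"
proof (rule module.submodI[OF C_module])
  show "cocycle_set n \<subseteq> carrier (C n)"
    by (auto simp: cocycle_set_def C_def hom_simps cocyc_iff linear_maps_iff)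
  show "\<zero>\<^bsub>C n\<^esub> \<in> cocycle_set n" unfolding C_zero by (rule restr_cocycle_set[OF zero_cocyc])
  show "g \<oplus>\<^bsub>C n\<^esub> h \<in> cocycle_set n" if "g \<in> cocycle_set n" "h \<in> cocycle_set n" for g h
    using restr_cocycle_set[OF cocyc_add[OF cocycle_set_Zc[OF that(1)] cocycle_set_Zc[OF that(2)]]] C_add[of n g h] restr_self that by simp
  show "r \<odot>\<^bsub>C n\<^esub> g \<in> cocycle_set n" if "r \<in> carrier R" "g \<in> cocycle_set n" for r g
    using restr_cocycle_set[OF cocyc_smult[OF cocycle_set_Zc[OF that(2)] that(1)]] C_smult[of n r g] restr_self that by simp
qed

lemma cocycle_module_simps: "carrier (cocycle_module n) = cocycle_set n" "x \<oplus>\<^bsub>cocycle_module n\<^esub> y = x \<oplus>\<^bsub>C n\<^esub> y" "r \<odot>\<^bsub>cocycle_module n\<^esub> x = r \<odot>\<^bsub>C n\<^esub> x" "\<zero>\<^bsub>cocycle_module n\<^esub> = \<zero>\<^bsub>C n\<^esub>"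
  by (simp_all add: cocycle_module_def)

lemma cocycle_module_module: "module R (cocycle_module n)"
  unfolding cocycle_module_def by (rule submodule.submodule_is_module[OF cocycle_set_submodule C_module])

lemma coboundary_set_submod: "submod R (cocycle_module n) (coboundary_set n)"
proof (rule submodI_locale[OF cocycle_module_module module.submodI[OF cocycle_module_module]])
  show "coboundary_set n \<subseteq> carrier (cocycle_module n)" using coboundary_set_cocycle_set by (simp add: cocycle_module_simps)
  show "\<zero>\<^bsub>cocycle_module n\<^esub> \<in> coboundary_set n" unfolding cocycle_module_simps C_zero using restr_coboundary_set[OF zero_cocyc] cobnd_zero by simp
  show "g \<oplus>\<^bsub>cocycle_module n\<^esub> h \<in> coboundary_set n" if gh: "g \<in> coboundary_set n" "h \<in> coboundary_set n" for g h
  proof -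
    have Z: "g \<in> cocycle_set n" "h \<in> cocycle_set n" using gh coboundary_set_cocycle_set by auto
    have "restr n (\<lambda>z. g z \<oplus>\<^bsub>M\<^esub> h z) \<in> coboundary_set n"
      using restr_coboundary_set[OF cocyc_add] cobnd_add cocycle_set_Zc Z coboundary_set_Bc gh by blast
    then show ?thesis using C_add[of n g h] restr_self Z by (simp add: cocycle_module_simps)
  qed
  show "r \<odot>\<^bsub>cocycle_module n\<^esub> g \<in> coboundary_set n" if r: "r \<in> carrier R" and g: "g \<in> coboundary_set n" for r g
  proof -
    have Z: "g \<in> cocycle_set n" using g coboundary_set_cocycle_set by auto
    have "restr n (\<lambda>z. r \<odot>\<^bsub>M\<^esub> g z) \<in> coboundary_set n"
      using restr_coboundary_set[OF cocyc_smult] cobnd_smult cocycle_set_Zc Z coboundary_set_Bc g r by blast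
    then show ?thesis using C_smult[of n r g] restr_self Z by (simp add: cocycle_module_simps)
  qed
qed

lemma E_module: "module R (E n)"
  unfolding E_eq by (rule submod.quot_module_module[OF coboundary_set_submod])

lemma E_carrier: "carrier (E n) = ext_class n ` {g. Zc n g}"
proof -
  have "carrier (E n) = (\<lambda>x. coboundary_set n +>\<^bsub>cocycle_module n\<^esub> x) ` cocycle_set n"
    unfolding E_eq submod.quot_carrier[OF coboundary_set_submod] cocycle_module_simps ..
  also have "cocycle_set n = restr n ` {g. Zc n g}"
    using restr_cocycle_set restr_self cocycle_set_Zc by (auto simp: image_iff) metis
  finally show ?thesis unfolding ext_class_def by (simp add: image_image)
qed

lemma ext_class_carrier: "Zc n g \<Longrightarrow> ext_class n g \<in> carrier (E n)"
  unfolding E_carrier by blast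

lemma cocycle_module_add: "Zc n g \<Longrightarrow> Zc n h \<Longrightarrow> restr n g \<oplus>\<^bsub>cocycle_module n\<^esub> restr n h = restr n (\<lambda>z. g z \<oplus>\<^bsub>M\<^esub> h z)"
  by (simp add: cocycle_module_simps C_add)

lemma cocycle_module_diff:
  assumes "Zc n g" "Zc n h"
  shows "restr n g \<ominus>\<^bsub>cocycle_module n\<^esub> restr n h = restr n (\<lambda>z. g z \<ominus>\<^bsub>M\<^esub> h z)"
proof -
  interpret Z: module R "cocycle_module n" by (rule cocycle_module_module)
  interpret M: module R M by (rule M_module)
  let ?u = "\<lambda>z. g z \<ominus>\<^bsub>M\<^esub> h z"
  have "restr n ?u \<oplus>\<^bsub>cocycle_module n\<^esub> restr n h = restr n (\<lambda>z. ?u z \<oplus>\<^bsub>M\<^esub> h z)"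
    by (rule cocycle_module_add[OF cocyc_diff[OF assms] assms(2)])
  also have "\<dots> = restr n g"
    unfolding restr_def using cocyc_carrier[OF assms(1)] cocyc_carrier[OF assms(2)]
    by (intro restrict_ext) (simp add: M.M.a_comm[of "g _ \<ominus>\<^bsub>M\<^esub> h _"] M.add_minus_cancel)
  finally show ?thesis
    using Z.add_diff_cancel[of "restr n ?u" "restr n h"] restr_cocycle_set cocyc_diff[OF assms] assms by (simp add: cocycle_module_simps(1))
qed

lemma ext_class_eq_iff:
  assumes "Zc n g" "Zc n h"
  shows "ext_class n g = ext_class n h \<longleftrightarrow> Bc n (\<lambda>z. g z \<ominus>\<^bsub>M\<^esub> h z)"
  unfolding ext_class_def
  using submod.coset_eq_iff[OF coboundary_set_submod, of "restr n g" n "restr n h"] restr_cocycle_set assms cocycle_module_diff[OF assms]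
    restr_coboundary_set[OF cocyc_diff[OF assms]] by (simp add: cocycle_module_simps(1))

lemma ext_class_add: "Zc n g \<Longrightarrow> Zc n h \<Longrightarrow> ext_class n g \<oplus>\<^bsub>E n\<^esub> ext_class n h = ext_class n (\<lambda>z. g z \<oplus>\<^bsub>M\<^esub> h z)"
  unfolding ext_class_def E_eq using submod.quot_add[OF coboundary_set_submod] restr_cocycle_set by (simp add: cocycle_module_simps C_add)

lemma ext_class_smult: "r \<in> carrier R \<Longrightarrow> Zc n g \<Longrightarrow> r \<odot>\<^bsub>E n\<^esub> ext_class n g = ext_class n (\<lambda>z. r \<odot>\<^bsub>M\<^esub> g z)"
  unfolding ext_class_def E_eq using submod.quot_smult[OF coboundary_set_submod] restr_cocycle_set by (simp add: cocycle_module_simps C_smult)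

lemma ext_class_zero: "\<zero>\<^bsub>E n\<^esub> = ext_class n (\<lambda>_. \<zero>\<^bsub>M\<^esub>)"
  unfolding ext_class_def E_eq submod.quot_zero[OF coboundary_set_submod] C_zero[symmetric]
  using submod.quot_zero_coset[OF coboundary_set_submod] by (simp add: cocycle_module_simps)

lemma cocyc_\<Phi>: "Zc n g \<Longrightarrow> Zc (Suc n) (\<lambda>z. g (\<Phi> n i z))"
  using T.cocyc_tr[of M "carrier M" "{\<zero>\<^bsub>M\<^esub>}" n i g "Suc 0"] by simp

lemma cobnd_\<Phi>: "Bc n g \<Longrightarrow> Bc (Suc n) (\<lambda>z. g (\<Phi> n i z))"
  using T.cobnd_tr[of M "carrier M" "{\<zero>\<^bsub>M\<^esub>}" n i g "Suc 0"] by simp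

lemma t_ext_class:
  assumes g: "Zc n g"
  shows "t n (ext_class n g) = ext_class (Suc n) (\<lambda>z. g (\<Phi> n i z))"
proof -
  interpret M: module R M by (rule M_module)
  interpret S: submod R "cocycle_module n" "coboundary_set n" by (rule coboundary_set_submod)
  have coset: "coboundary_set (Suc n) +>\<^bsub>C (Suc n)\<^esub> x = coboundary_set (Suc n) +>\<^bsub>cocycle_module (Suc n)\<^esub> x" for x
    by (simp add: a_r_coset_def' cocycle_module_simps)
  have t: "t n X = (\<Union>h\<in>X. ext_class (Suc n) (\<lambda>z. h (\<Phi> n i z)))" for X
    unfolding t_def ext_map_def Let_def P_def[symmetric] \<Phi>_def[symmetric] coboundaries_eq cochain_eq coset ext_class_def restr_def
      compose_def res_module_def ..
  have rg: "restr n g \<in> carrier (cocycle_module n)" using restr_cocycle_set[OF g] by (simp add: cocycle_module_simps)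
  have "ext_class (Suc n) (\<lambda>z. h (\<Phi> n i z)) = ext_class (Suc n) (\<lambda>z. g (\<Phi> n i z))" if h: "h \<in> ext_class n g" for h
  proof -
    have hZ: "h \<in> cocycle_set n" and hB: "h \<ominus>\<^bsub>cocycle_module n\<^esub> restr n g \<in> coboundary_set n"
      using S.coset_elem[OF rg, of h] h unfolding ext_class_def by (simp_all add: cocycle_module_simps)
    have Zh: "Zc n h" using cocycle_set_Zc[OF hZ] .
    have "restr n (\<lambda>z. h z \<ominus>\<^bsub>M\<^esub> g z) \<in> coboundary_set n"
      using hB cocycle_module_diff[OF Zh g] restr_self[OF hZ] by simp
    then have "Bc n (\<lambda>z. h z \<ominus>\<^bsub>M\<^esub> g z)" using restr_coboundary_set[OF cocyc_diff[OF Zh g]] by simp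
    then show ?thesis
      using ext_class_eq_iff[OF cocyc_\<Phi>[OF Zh] cocyc_\<Phi>[OF g]] cobnd_\<Phi> by blast
  qed
  moreover have "ext_class n g \<noteq> {}" unfolding ext_class_def using S.coset_mem[OF rg] by blast
  ultimately show ?thesis unfolding t by (intro UN_const_on)
qed

lemma t_lin: "lin R (E n) (E (Suc n)) (t n)"
  unfolding lin_def E_carrier
  by (auto simp: t_ext_class cocyc_\<Phi> ext_class_add ext_class_smult cocyc_add cocyc_smult)

sublocale D: module_sequence R E t
  by (rule module_sequence.intro) (rule E_module, rule t_lin)

lemma local_cohomology_eq: "local_cohomology R \<aa> (int i) M = dirlim E t"
  unfolding local_cohomology_def E_def t_def by simp

definition lim_class where "lim_class n g = D.cl n (ext_class n g)"

lemma cocyc_tr: "Zc n g \<Longrightarrow> Zc (n + k) (\<lambda>z. g (T.tr n k (Suc i) z))"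
  by (rule T.cocyc_tr)

lemma transition_ext_class: "Zc n g \<Longrightarrow> transition t n k (ext_class n g) = ext_class (n + k) (\<lambda>z. g (T.tr n k (Suc i) z))"
  by (induction k) (simp_all add: t_ext_class cocyc_tr)

lemma lim_class_eq_iff:
  assumes "Zc n g" "Zc m h"
  shows "lim_class n g = lim_class m h \<longleftrightarrow> (\<exists>k l. n + k = m + l \<and>
    Bc (n + k) (\<lambda>z. g (T.tr n k (Suc i) z) \<ominus>\<^bsub>M\<^esub> h (T.tr m l (Suc i) z)))"
proof -
  have "ext_class (n + k) (\<lambda>z. g (T.tr n k (Suc i) z)) = ext_class (m + l) (\<lambda>z. h (T.tr m l (Suc i) z)) \<longleftrightarrow>
      Bc (n + k) (\<lambda>z. g (T.tr n k (Suc i) z) \<ominus>\<^bsub>M\<^esub> h (T.tr m l (Suc i) z))" if "n + k = m + l" for k l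
    using ext_class_eq_iff[OF cocyc_tr[OF assms(1), of k], of "\<lambda>z. h (T.tr m l (Suc i) z)"] cocyc_tr[OF assms(2), of l] that
    by simp
  then show ?thesis
    unfolding lim_class_def D.cl_eq_iff[OF ext_class_carrier[OF assms(1)] ext_class_carrier[OF assms(2)]]
      transition_ext_class[OF assms(1)] transition_ext_class[OF assms(2)] by blast
qed

lemma lim_class_carrier: "carrier (dirlim E t) = {lim_class n g | n g. Zc n g}"
  unfolding D.dirlim_carrier E_carrier lim_class_def by blast

lemma lim_class_add: "Zc n g \<Longrightarrow> Zc n h \<Longrightarrow> lim_class n g \<oplus>\<^bsub>dirlim E t\<^esub> lim_class n h = lim_class n (\<lambda>z. g z \<oplus>\<^bsub>M\<^esub> h z)"
  unfolding lim_class_def by (simp add: D.dirlim_add ext_class_carrier ext_class_add)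

lemma lim_class_smult: "r \<in> carrier R \<Longrightarrow> Zc n g \<Longrightarrow> r \<odot>\<^bsub>dirlim E t\<^esub> lim_class n g = lim_class n (\<lambda>z. r \<odot>\<^bsub>M\<^esub> g z)"
  unfolding lim_class_def by (simp add: D.dirlim_smult ext_class_carrier ext_class_smult)

lemma lim_class_zero: "\<zero>\<^bsub>dirlim E t\<^esub> = lim_class n (\<lambda>_. \<zero>\<^bsub>M\<^esub>)"
  unfolding lim_class_def D.dirlim_zero[of n] ext_class_zero ..

lemma lim_class_tr: "Zc n g \<Longrightarrow> lim_class (n + k) (\<lambda>z. g (T.tr n k (Suc i) z)) = lim_class n g"
  unfolding lim_class_def transition_ext_class[symmetric] by (rule D.cl_trans[OF ext_class_carrier])

lemma lim_class_cobnd: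
  assumes "Zc n g" "Bc n g"
  shows "lim_class n g = \<zero>\<^bsub>dirlim E t\<^esub>"
proof -
  interpret M: module R M by (rule M_module)
  have "Bc n (\<lambda>z. g z \<ominus>\<^bsub>M\<^esub> \<zero>\<^bsub>M\<^esub>)"
    by (rule cobnd_cong[OF assms(2)]) (simp add: cocyc_carrier[OF assms(1)])
  then have "ext_class n g = ext_class n (\<lambda>_. \<zero>\<^bsub>M\<^esub>)" using ext_class_eq_iff[OF assms(1) zero_cocyc] by simp
  then show ?thesis unfolding lim_class_zero[of n] lim_class_def by simp
qed

lemma lim_class_cong:
  assumes "Zc n g" "Zc n h" "\<And>z. z \<in> carrier (Fi n) \<Longrightarrow> g z = h z"
  shows "lim_class n g = lim_class n h"
  unfolding lim_class_def ext_class_def restr_def using assms(3) by (metis restrict_ext)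

lemma vanishing_of_zero_module:
  assumes "is_zero_module (local_cohomology R \<aa> (int i) M)"
  shows "T.H_vanishes M (carrier M) {\<zero>\<^bsub>M\<^esub>} i"
  unfolding T.H_vanishes_def
proof (intro allI impI)
  fix n g assume g: "Zc n g"
  interpret M: module R M by (rule M_module)
  have "lim_class n g \<in> carrier (dirlim E t)" unfolding lim_class_carrier using g by blast
  then have "lim_class n g = lim_class n (\<lambda>_. \<zero>\<^bsub>M\<^esub>)"
    using assms unfolding is_zero_module_def local_cohomology_eq lim_class_zero[of n] by simp
  then obtain k where "Bc (n + k) (\<lambda>z. g (T.tr n k (Suc i) z) \<ominus>\<^bsub>M\<^esub> \<zero>\<^bsub>M\<^esub>)"
    unfolding lim_class_eq_iff[OF g zero_cocyc] by auto
  then have "Bc (n + k) (\<lambda>z. g (T.tr n k (Suc i) z))"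
    by (rule cobnd_cong) (simp add: cocyc_carrier[OF cocyc_tr[OF g]])
  then show "T.lim_zero M (carrier M) {\<zero>\<^bsub>M\<^esub>} n i g"
    unfolding T.lim_zero_def by blast
qed

text \<open>
  A submodule of the limit corresponds to the set of cocycles whose classes it contains; conversely, membership of a class
  in a given \<open>limit_submodule\<close> is independent of the representing cocycle.
\<close>

lemma attached_primes_iff:
  "p \<in> attached_primes R (local_cohomology R \<aa> (int i) M) \<longleftrightarrow> T.attached_to_H M i p"
proof -
  interpret M: module R M by (rule M_module)
  let ?D = "dirlim E t"
  interpret D: module R ?D by (rule D.dirlim_module)
  have ann: "annihilator R (quot_module ?D B) = {r \<in> carrier R. \<forall>n g. Zc n g \<longrightarrow> lim_class n (\<lambda>z. r \<odot>\<^bsub>M\<^esub> g z) \<in> B}"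
    if "submodule B R ?D" for B
    unfolding submod.annihilator_quot[OF submodI_locale[OF D.module_axioms that]] lim_class_carrier
    by (auto simp: lim_class_smult) (metis lim_class_smult)
  show ?thesis
  proof
    assume "p \<in> attached_primes R (local_cohomology R \<aa> (int i) M)"
    then obtain B where p: "primeideal p R" and B: "submodule B R ?D" and pB: "p = annihilator R (quot_module ?D B)"
      unfolding attached_primes_def local_cohomology_eq by blast
    interpret B: submod R ?D B using D.module_axioms B by (rule submodI_locale)
    define Q where "Q n g \<longleftrightarrow> lim_class n g \<in> B" for n g
    have "T.limit_submodule M i Q"
      unfolding T.limit_submodule_def
    proof (intro conjI allI impI)
      fix n g h assume g: "Zc n g" and h: "Zc n h"
      show "Q n (\<lambda>z. g z \<oplus>\<^bsub>M\<^esub> h z)" if "Q n g" "Q n h"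
        using B.sub_add that lim_class_add[OF g h] unfolding Q_def by metis
      show "Q n h" if "\<forall>z\<in>carrier (T.F n (Suc i)). g z = h z" "Q n g"
        using lim_class_cong[OF g h] that unfolding Q_def by simp
    next
      fix n g r assume "Zc n g" "r \<in> carrier R" "Q n g"
      then show "Q n (\<lambda>z. r \<odot>\<^bsub>M\<^esub> g z)"
        unfolding Q_def using B.sub_smult[of r "lim_class n g"] lim_class_smult[of r n g] by simp
    next
      fix n g assume g: "Zc n g"
      show "Q (Suc n) (\<lambda>z. g (\<phi> n (Suc i) z)) \<longleftrightarrow> Q n g"
        using lim_class_tr[OF g, of "Suc 0"] unfolding Q_def by simp
      show "Q n g" if "Bc n g"
        using lim_class_cobnd[OF g that] unfolding Q_def by simp
    qed
    then show "T.attached_to_H M i p"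
      unfolding T.attached_to_H_def using p pB ann[OF B] unfolding Q_def by blast
  next
    assume "T.attached_to_H M i p"
    then obtain Q where p: "primeideal p R" and Q: "T.limit_submodule M i Q"
      and pQ: "p = {r \<in> carrier R. \<forall>n g. Zc n g \<longrightarrow> Q n (\<lambda>z. r \<odot>\<^bsub>M\<^esub> g z)}"
      unfolding T.attached_to_H_def by blast
    note QD = T.limit_submoduleD[OF Q]
    note Qtr = T.limit_submodule_tr[OF Q]
    have Qwd: "Q n g" if g: "Zc n g" and h: "Zc m h" and e: "lim_class n g = lim_class m h" and Qh: "Q m h" for n g m h
    proof -
      obtain k l where kl: "n + k = m + l"
        "Bc (n + k) (\<lambda>z. g (T.tr n k (Suc i) z) \<ominus>\<^bsub>M\<^esub> h (T.tr m l (Suc i) z))"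
        using e unfolding lim_class_eq_iff[OF g h] by blast
      let ?g = "\<lambda>z. g (T.tr n k (Suc i) z)" and ?h = "\<lambda>z. h (T.tr m l (Suc i) z)"
      have Zg: "Zc (n + k) ?g" by (rule cocyc_tr[OF g])
      have Zh: "Zc (n + k) ?h" using cocyc_tr[OF h, of l] kl(1) by simp
      have Qh': "Q (n + k) ?h" using Qtr[OF h, of l] Qh kl(1) by simp
      have s: "Q (n + k) (\<lambda>z. ?h z \<oplus>\<^bsub>M\<^esub> (?g z \<ominus>\<^bsub>M\<^esub> ?h z))"
        by (rule QD(1)[OF Zh cocyc_diff[OF Zg Zh] Qh' QD(4)[OF cocyc_diff[OF Zg Zh] kl(2)]])
      have "Q (n + k) ?g"
      proof (rule QD(5)[OF cocyc_add[OF Zh cocyc_diff[OF Zg Zh]] Zg _ s])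
        fix z assume z: "z \<in> carrier (T.F (n + k) (Suc i))"
        show "?h z \<oplus>\<^bsub>M\<^esub> (?g z \<ominus>\<^bsub>M\<^esub> ?h z) = ?g z"
          using M.add_minus_cancel cocyc_carrier[OF Zg] cocyc_carrier[OF Zh] z by simp
      qed
      then show ?thesis using Qtr[OF g, of k] by simp
    qed
    define B where "B = {lim_class n g | n g. Zc n g \<and> Q n g}"
    have mem: "lim_class n g \<in> B \<longleftrightarrow> Q n g" if "Zc n g" for n g
      unfolding B_def using Qwd[OF that] that by blast
    have B: "submodule B R ?D"
    proof (rule D.submodI)
      show "B \<subseteq> carrier ?D" unfolding B_def lim_class_carrier by blast
      show "\<zero>\<^bsub>?D\<^esub> \<in> B"
        unfolding lim_class_zero[of 0] mem[OF zero_cocyc] by (rule QD(4)[OF zero_cocyc cobnd_zero])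
    next
      fix X Y assume "X \<in> B" "Y \<in> B"
      then obtain n g m h where *: "X = lim_class n g" "Zc n g" "Q n g" "Y = lim_class m h" "Zc m h" "Q m h"
        unfolding B_def by blast
      let ?g = "\<lambda>z. g (T.tr n m (Suc i) z)" and ?h = "\<lambda>z. h (T.tr m n (Suc i) z)"
      have Z: "Zc (n + m) ?g" "Zc (n + m) ?h"
        using cocyc_tr[OF *(2), of m] cocyc_tr[OF *(5), of n] by (simp_all add: add.commute)
      have QQ: "Q (n + m) ?g" "Q (n + m) ?h"
        using Qtr[OF *(2), of m] Qtr[OF *(5), of n] *(3,6) by (simp_all add: add.commute)
      have "X = lim_class (n + m) ?g" "Y = lim_class (n + m) ?h"
        using lim_class_tr[OF *(2), of m] lim_class_tr[OF *(5), of n] *(1,4) by (simp_all add: add.commute)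
      then have "X \<oplus>\<^bsub>?D\<^esub> Y = lim_class (n + m) (\<lambda>z. ?g z \<oplus>\<^bsub>M\<^esub> ?h z)" using lim_class_add[OF Z] by simp
      then show "X \<oplus>\<^bsub>?D\<^esub> Y \<in> B"
        using mem[OF cocyc_add[OF Z]] QD(1)[OF Z QQ] by simp
    next
      fix r X assume r: "r \<in> carrier R" and "X \<in> B"
      then obtain n g where *: "X = lim_class n g" "Zc n g" "Q n g" unfolding B_def by blast
      show "r \<odot>\<^bsub>?D\<^esub> X \<in> B"
        using lim_class_smult[OF r *(2)] mem[OF cocyc_smult[OF *(2) r]] QD(2)[OF *(2) r *(3)] *(1) by simp
    qed
    have "p = annihilator R (quot_module ?D B)"
      unfolding ann[OF B] pQ using mem[OF cocyc_smult] by blast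
    then show "p \<in> attached_primes R (local_cohomology R \<aa> (int i) M)"
      unfolding attached_primes_def local_cohomology_eq using p B by blast
  qed
qed

end

section \<open>Support and annihilator\<close>

lemma annihilator_ideal:
  assumes "module R M"
  shows "ideal (annihilator R M) R"
proof -
  interpret M: module R M by fact
  interpret Reg: module R "regular_module R" by (rule M.R.regular_module_module)
  have "submodule (annihilator R M) R (regular_module R)"
    by (rule Reg.submodI) (auto simp: annihilator_def M.smult_l_distr M.smult_assoc1)
  then show ?thesis by (simp add: M.R.ideal_submodule_iff)
qed

lemma annihilator_smult: "r \<in> annihilator R M \<Longrightarrow> x \<in> carrier M \<Longrightarrow> r \<odot>\<^bsub>M\<^esub> x = \<zero>\<^bsub>M\<^esub>"
  by (simp add: annihilator_def)

text \<open>
  An element of \<open>Ann M\<close> outside \<open>p\<close> identifies all fractions.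
\<close>

lemma annihilator_subset_of_support:
  assumes M: "module R M" and p: "p \<in> module_supp R M"
  shows "annihilator R M \<subseteq> p"
proof (rule ccontr)
  interpret M: module R M by fact
  have pp: "primeideal p R" using p by (simp add: module_supp_def)
  interpret p: primeideal p R by fact
  assume "\<not> annihilator R M \<subseteq> p"
  then obtain u where u: "u \<in> carrier R - p" "\<And>x. x \<in> carrier M \<Longrightarrow> u \<odot>\<^bsub>M\<^esub> x = \<zero>\<^bsub>M\<^esub>"
    by (auto simp: annihilator_def)
  let ?S = "carrier M \<times> (carrier R - p)"
  have one: "\<one>\<^bsub>R\<^esub> \<in> carrier R - p" using p.one_imp_carrier p.I_notcarr by auto
  have rel: "localization_rel R M p `` {ys} = ?S" if "ys \<in> ?S" for ys
    using that u by (auto simp: localization_rel_def intro!: bexI[of _ u])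
  then have "localization_carrier R M p = {?S}"
    unfolding localization_carrier_def quotient_def using one by auto
  moreover have "localization_zero R M p = ?S"
    unfolding localization_zero_def by (rule rel) (use one in simp)
  ultimately show False using p by (simp add: module_supp_def)
qed

text \<open>
  If every element of \<open>M\<close> were killed by an element outside \<open>p\<close>, then a product of such elements for finitely many
  generators would kill \<open>M\<close> and lie outside \<open>p\<close>.
\<close>

lemma support_of_annihilator_subset:
  assumes M: "module R M" and fg: "fg_over R M {\<zero>\<^bsub>M\<^esub>} (carrier M)"
    and p: "primeideal p R" and ann: "annihilator R M \<subseteq> p"
  shows "p \<in> module_supp R M"
proof -
  interpret M: module R M by fact
  interpret p: primeideal p R by fact
  have one: "\<one>\<^bsub>R\<^esub> \<in> carrier R - p" using p.one_imp_carrier p.I_notcarr by auto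
  have "\<exists>x\<in>carrier M. \<forall>u\<in>carrier R - p. u \<odot>\<^bsub>M\<^esub> x \<noteq> \<zero>\<^bsub>M\<^esub>"
  proof (rule ccontr)
    assume no: "\<not> (\<exists>x\<in>carrier M. \<forall>u\<in>carrier R - p. u \<odot>\<^bsub>M\<^esub> x \<noteq> \<zero>\<^bsub>M\<^esub>)"
    have "\<exists>u\<in>carrier R - p. \<forall>x\<in>carrier M. u \<odot>\<^bsub>M\<^esub> x = \<zero>\<^bsub>M\<^esub>"
    proof (rule M.fg_over_induct[OF M.zero_submodule fg, where P = "\<lambda>D. \<exists>u\<in>carrier R - p. \<forall>x\<in>D. u \<odot>\<^bsub>M\<^esub> x = \<zero>\<^bsub>M\<^esub>"])
      show "\<exists>u\<in>carrier R - p. \<forall>x\<in>{\<zero>\<^bsub>M\<^esub>}. u \<odot>\<^bsub>M\<^esub> x = \<zero>\<^bsub>M\<^esub>"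
        using one by auto
      fix D x assume D: "submodule D R M" and x: "x \<in> carrier M"
        and "\<exists>u\<in>carrier R - p. \<forall>x\<in>D. u \<odot>\<^bsub>M\<^esub> x = \<zero>\<^bsub>M\<^esub>"
      then obtain u where u: "u \<in> carrier R" "u \<notin> p" "\<forall>x\<in>D. u \<odot>\<^bsub>M\<^esub> x = \<zero>\<^bsub>M\<^esub>" by blast
      obtain v where v: "v \<in> carrier R" "v \<notin> p" "v \<odot>\<^bsub>M\<^esub> x = \<zero>\<^bsub>M\<^esub>" using no x by blast
      have "(u \<otimes>\<^bsub>R\<^esub> v) \<odot>\<^bsub>M\<^esub> y = \<zero>\<^bsub>M\<^esub>" if y: "y \<in> adjoin R M D x" for y
      proof -
        obtain w r where w: "y = w \<oplus>\<^bsub>M\<^esub> r \<odot>\<^bsub>M\<^esub> x" "w \<in> D" "r \<in> carrier R"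
          using y unfolding adjoin_def by blast
        have wM: "w \<in> carrier M" using M.submoduleE(1)[OF D] w(2) by blast
        have "(u \<otimes>\<^bsub>R\<^esub> v) \<odot>\<^bsub>M\<^esub> w = v \<odot>\<^bsub>M\<^esub> (u \<odot>\<^bsub>M\<^esub> w)"
          using u(1) v(1) wM by (simp add: M.smult_assoc1 M.smult_comm)
        moreover have "(u \<otimes>\<^bsub>R\<^esub> v) \<odot>\<^bsub>M\<^esub> (r \<odot>\<^bsub>M\<^esub> x) = u \<odot>\<^bsub>M\<^esub> (r \<odot>\<^bsub>M\<^esub> (v \<odot>\<^bsub>M\<^esub> x))"
          using u(1) v(1) w(3) x by (simp add: M.smult_assoc1 M.smult_comm)
        ultimately show ?thesis
          using w u v x wM by (simp add: M.smult_r_distr)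
      qed
      moreover have "u \<otimes>\<^bsub>R\<^esub> v \<in> carrier R - p"
        using p.I_prime[OF u(1) v(1)] u v by auto
      ultimately show "\<exists>u\<in>carrier R - p. \<forall>x\<in>adjoin R M D x. u \<odot>\<^bsub>M\<^esub> x = \<zero>\<^bsub>M\<^esub>" by blast
    qed
    then show False using ann by (auto simp: annihilator_def)
  qed
  then obtain x where x: "x \<in> carrier M" "\<And>u. u \<in> carrier R - p \<Longrightarrow> u \<odot>\<^bsub>M\<^esub> x \<noteq> \<zero>\<^bsub>M\<^esub>" by blast
  let ?c = "localization_rel R M p `` {(x, \<one>\<^bsub>R\<^esub>)}"
  have "?c \<in> localization_carrier R M p"
    unfolding localization_carrier_def by (rule quotientI) (use x one in simp)
  moreover have "?c \<noteq> localization_zero R M p"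
  proof
    assume e: "?c = localization_zero R M p"
    have "(x, \<one>\<^bsub>R\<^esub>) \<in> ?c"
      using x(1) one by (auto simp: localization_rel_def intro!: bexI[of _ "\<one>\<^bsub>R\<^esub>"])
    then have "((\<zero>\<^bsub>M\<^esub>, \<one>\<^bsub>R\<^esub>), (x, \<one>\<^bsub>R\<^esub>)) \<in> localization_rel R M p"
      unfolding e localization_zero_def by simp
    then obtain u where u: "u \<in> carrier R - p" "u \<odot>\<^bsub>M\<^esub> (\<zero>\<^bsub>M\<^esub> \<ominus>\<^bsub>M\<^esub> x) = \<zero>\<^bsub>M\<^esub>"
      using x(1) one by (auto simp: localization_rel_def)
    have "u \<odot>\<^bsub>M\<^esub> x = \<ominus>\<^bsub>M\<^esub> (u \<odot>\<^bsub>M\<^esub> (\<zero>\<^bsub>M\<^esub> \<ominus>\<^bsub>M\<^esub> x))"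
      using u(1) x(1) by (simp add: M.M.minus_eq M.smult_r_minus)
    then show False using u x(2)[OF u(1)] by simp
  qed
  ultimately have "localization_carrier R M p \<noteq> {localization_zero R M p}"
    by (metis singletonD)
  then show ?thesis
    using p by (simp add: module_supp_def)
qed

lemma attached_primes_zero_module: "attached_primes R (zero_module z) = {}"
proof -
  have "annihilator R (quot_module (zero_module z) B) = carrier R" if B: "submodule B R (zero_module z)" for B
  proof -
    have "B = {z}"
      using B unfolding submodule_def subgroup_def zero_module_def by auto
    then show ?thesis
      by (auto simp: annihilator_def quot_module_def A_RCOSETS_def' a_r_coset_def' zero_module_def)
  qed
  then show ?thesis
    unfolding attached_primes_def by (auto dest: primeideal.I_notcarr)
qed

theorem corollary1p6:
  fixes R :: "('a, 'r) ring_scheme"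
    and \<aa> :: "'a set"
    and M :: "('a, 'b, 'm) module_scheme"
    and N :: "('a, 'c, 'n) module_scheme"
    and d :: nat
  assumes "cring R" and "noetherian_ring R" and "\<one>\<^bsub>R\<^esub> \<noteq> \<zero>\<^bsub>R\<^esub>"
    and "ideal \<aa> R"
    and "module R M" and "fin_gen_module R M" and "\<not> is_zero_module M"
    and "module R N" and "fin_gen_module R N" and "\<not> is_zero_module N"
    and "module_dim R M = enat d"
    and "is_zero_module (local_cohomology R \<aa> (int d) M)"
    and "module_supp R M = module_supp R N"
  shows "attached_primes R (local_cohomology R \<aa> (int d - 1) N) =
         attached_primes R (local_cohomology R \<aa> (int d - 1) M)"
proof (cases d)
  case 0
  \<comment> \<open>The cohomology in degree \<open>-1\<close> is zero, and the zero module has no attached primes.\<close>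
  then show ?thesis
    by (simp add: local_cohomology_def attached_primes_zero_module)
next
  case (Suc i)
  interpret ideal_in_noetherian_cring R \<aa>
    using assms(1,2,4)
    by (simp add: ideal_in_noetherian_cring_def ideal_in_noetherian_cring_axioms_def noetherian_cring_def)
  note M = assms(5) and N = assms(8) and supp = assms(13)
  have fgM: "fg_over R M {\<zero>\<^bsub>M\<^esub>} (carrier M)" and fgN: "fg_over R N {\<zero>\<^bsub>N\<^esub>} (carrier N)"
    by (rule fin_gen_imp_fg_over[OF assms(5,6)], rule fin_gen_imp_fg_over[OF assms(8,9)])
  interpret LM: local_cohomology_classes R \<aa> M "Suc i"
    by (intro local_cohomology_classes.intro ideal_in_noetherian_cring_axioms local_cohomology_classes_axioms.intro M)
  have annM: "p \<in> module_supp R M \<longleftrightarrow> primeideal p R \<and> annihilator R M \<subseteq> p" for p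
    using annihilator_subset_of_support[OF M] support_of_annihilator_subset[OF M fgM]
    by (auto simp: module_supp_def)
  have annN: "p \<in> module_supp R M \<longleftrightarrow> primeideal p R \<and> annihilator R N \<subseteq> p" for p
    unfolding supp using annihilator_subset_of_support[OF N] support_of_annihilator_subset[OF N fgN]
    by (auto simp: module_supp_def)
  \<comment> \<open>The ideals \<open>J\<close> with \<open>Supp (R/J) \<subseteq> Supp M\<close>.\<close>
  define \<G> where "\<G> J \<longleftrightarrow> (\<forall>p. primeideal p R \<longrightarrow> J \<subseteq> p \<longrightarrow> p \<in> module_supp R M)" for J
  have GM: "\<G> J" if "annihilator R M \<subseteq> J" for J
    unfolding \<G>_def annM using that by blast
  have GN: "\<G> J" if "annihilator R N \<subseteq> J" for J
    unfolding \<G>_def annN using that by blast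
  have no_chain: "\<not> T.prime_chain J (Suc d)" if G: "\<G> J" for J
  proof
    assume "T.prime_chain J (Suc d)"
    then obtain c where c: "\<forall>j\<le>Suc d. primeideal (c j) R \<and> J \<subseteq> c j" "\<forall>j<Suc d. c j \<subset> c (Suc j)"
      unfolding T.prime_chain_def by blast
    then have "\<forall>j\<le>Suc d. c j \<in> module_supp R M"
      using G unfolding \<G>_def by blast
    then have "enat (Suc d) \<le> module_dim R M"
      unfolding module_dim_def using c(2) by (intro Sup_upper) blast
    then show False using assms(11) by simp
  qed
  have v1: "T.H_quot_vanishes J (Suc d)" if "ideal J R" "\<G> J" for J
    by (rule T.H_quot_vanishes_above_dimension[OF that(1) no_chain[OF that(2)]])
  have zero: "T.H_vanishes M (carrier M) {\<zero>\<^bsub>M\<^esub>} d"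
    using LM.vanishing_of_zero_module assms(12) Suc by simp
  have ann_in: "r \<in> p" if "primeideal p R" "\<G> p" "r \<in> carrier R" "\<And>x. x \<in> carrier M \<Longrightarrow> r \<odot>\<^bsub>M\<^esub> x = \<zero>\<^bsub>M\<^esub>" for p r
    using that(2) annM[of p] that(1,3,4) unfolding \<G>_def annihilator_def by blast
  have ann_in': "r \<in> p" if "primeideal p R" "\<G> p" "r \<in> carrier R" "\<And>x. x \<in> carrier N \<Longrightarrow> r \<odot>\<^bsub>N\<^esub> x = \<zero>\<^bsub>N\<^esub>" for p r
    using that(2) annN[of p] that(1,3,4) unfolding \<G>_def annihilator_def by blast
  have vd: "T.H_quot_vanishes J (Suc i)" if J: "ideal J R" "\<G> J" for J
  proof -
    have "T.H_quot_vanishes J d"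
    proof (rule T.H_quot_vanishes_from_module[where \<G> = \<G> and X = M and A = "carrier M" and K = "annihilator R M"])
      show "annihilator R M \<subseteq> carrier R" by (auto simp: annihilator_def)
      show "\<G> L" if "\<G> J" "J \<subseteq> L" for J L
        using that unfolding \<G>_def by blast
    qed (use M fgM annihilator_smult GM ann_in v1 zero J in auto)
    then show ?thesis using Suc by simp
  qed
  have vM: "T.H_quot_vanishes J (Suc i)" if "ideal J R" "annihilator R M \<subseteq> J" for J
    using vd[OF that(1) GM[OF that(2)]] .
  have vN: "T.H_quot_vanishes J (Suc i)" if "ideal J R" "annihilator R N \<subseteq> J" for J
    using vd[OF that(1) GN[OF that(2)]] .
  have NM: "T.attached_to_H M i p" if "T.attached_to_H N i p" for p
    by (rule T.attached_to_H_transfer[OF M fgM N fgN annihilator_ideal[OF M] annihilator_smult annihilator_ideal[OF N]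
          annihilator_smult vM vN ann_in that]) (simp_all add: GN)
  have MN: "T.attached_to_H N i p" if "T.attached_to_H M i p" for p
    by (rule T.attached_to_H_transfer[OF N fgN M fgM annihilator_ideal[OF N] annihilator_smult annihilator_ideal[OF M]
          annihilator_smult vN vM ann_in' that]) (simp_all add: GM)
  interpret AM: local_cohomology_classes R \<aa> M i
    by (intro local_cohomology_classes.intro ideal_in_noetherian_cring_axioms local_cohomology_classes_axioms.intro M)
  interpret AN: local_cohomology_classes R \<aa> N i
    by (intro local_cohomology_classes.intro ideal_in_noetherian_cring_axioms local_cohomology_classes_axioms.intro N)
  have "p \<in> attached_primes R (local_cohomology R \<aa> (int i) N) \<longleftrightarrow>
      p \<in> attached_primes R (local_cohomology R \<aa> (int i) M)" for p
    unfolding AM.attached_primes_iff AN.attached_primes_iff using NM MN by blast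
  then show ?thesis using Suc by auto
qed

end
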